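(* Let $R$ be a commutative noetherian ring and let $A$ be an $R$-algebra with property $\mathbf{P_\ell}$. Then the Laurent polynomial algebra $A[x_1,x_1^{-1},\dots,x_n,x_n^{-1}]$ has property $\mathbf{P_\ell}$. In particular, $R[x_1,x_1^{-1},\dots,x_n,x_n^{-1}]^\circ$ is a Hopf algebra.
   Context: Algebras are associative with unit. Property $\mathbf{P_\ell}$ for an $R$-algebra $A$: for every left ideal $I$ of $A$ with $A/I$ finitely generated as an $R$-module, there is a left ideal $I_0\subseteq I$ of $A$ with $A/I_0$ finitely generated and projective as an $R$-module. $A[x_1,x_1^{-1},\dots,x_n,x_n^{-1}]=A\otimes_R R[x_1,x_1^{-1},\dots,x_n,x_n^{-1}]$. $H=R[x_1,x_1^{-1},\dots,x_n,x_n^{-1}]$ is regarded as a Hopf $R$-algebra as the group algebra $R[\mathbb{Z}^n]$ (each $x_i$ group-like). For an $R$-algebra $H$, $H^\circ=\{f\in\mathrm{Hom}_R(H,R): Hf\text{ is a finitely generated }R\text{-module}\}$, where $(hf)(k)=f(kh)$. The Hopf algebra structure on $H^\circ$ is the canonical one: multiplication is convolution $(fg)(h)=\sum f(h_1)g(h_2)$ with unit $\epsilon$; comultiplication $\Delta(f)=\sum f_1\otimes f_2\in H^\circ\otimes_R H^\circ$ is determined by $f(hk)=\sum f_1(h)f_2(k)$; counit $f\mapsto f(1)$; antipode $f\mapsto f\circ S$. *)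

theory Defs
  imports "HOL-Algebra.Module" "HOL-Algebra.Ring_Divisibility" "HOL-Algebra.Free_Abelian_Groups"
begin

section \<open>Modules and algebras over a commutative ring\<close>

text \<open>The library locale \<^locale>\<open>algebra\<close> requires the algebra to be commutative; here it need not be.\<close>

locale assoc_algebra = module + ring M +
  assumes smult_assoc2:
      "\<lbrakk>a \<in> carrier R; x \<in> carrier M; y \<in> carrier M\<rbrakk> \<Longrightarrow>
      (a \<odot>\<^bsub>M\<^esub> x) \<otimes>\<^bsub>M\<^esub> y = a \<odot>\<^bsub>M\<^esub> (x \<otimes>\<^bsub>M\<^esub> y)"
    and smult_assoc3:
      "\<lbrakk>a \<in> carrier R; x \<in> carrier M; y \<in> carrier M\<rbrakk> \<Longrightarrow>
      x \<otimes>\<^bsub>M\<^esub> (a \<odot>\<^bsub>M\<^esub> y) = a \<odot>\<^bsub>M\<^esub> (x \<otimes>\<^bsub>M\<^esub> y)"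

text \<open>Modules are records of type \<^typ>\<open>('a, 'b) module\<close>, which also have a multiplication and a unit.
  Where a structure is only meant as a module, those two fields are left \<^const>\<open>undefined\<close>.\<close>

definition linear_maps ::
    "('a, 'r) ring_scheme \<Rightarrow> ('a, 'b, 'm) module_scheme \<Rightarrow> ('a, 'c, 'n) module_scheme \<Rightarrow> ('b \<Rightarrow> 'c) set"
  where "linear_maps R M N = {f \<in> carrier M \<rightarrow> carrier N.
    (\<forall>x\<in>carrier M. \<forall>y\<in>carrier M. f (x \<oplus>\<^bsub>M\<^esub> y) = f x \<oplus>\<^bsub>N\<^esub> f y) \<and>
    (\<forall>r\<in>carrier R. \<forall>x\<in>carrier M. f (r \<odot>\<^bsub>M\<^esub> x) = r \<odot>\<^bsub>N\<^esub> f x)}"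

definition regular_module :: "('a, 'r) ring_scheme \<Rightarrow> ('a, 'a) module"
  where "regular_module R =
    \<lparr>carrier = carrier R, monoid.mult = monoid.mult R, one = one R,
     ring.zero = ring.zero R, add = add R, smult = monoid.mult R\<rparr>"

definition quotient_module :: "('a, 'b, 'm) module_scheme \<Rightarrow> 'b set \<Rightarrow> ('a, 'b set) module"
  where "quotient_module M N =
    \<lparr>carrier = a_rcosets\<^bsub>M\<^esub> N, monoid.mult = undefined, one = undefined, ring.zero = N, add = set_add M,
     smult = (\<lambda>r B. \<Union>x\<in>B. N +>\<^bsub>M\<^esub> (r \<odot>\<^bsub>M\<^esub> x))\<rparr>"

definition fg_module :: "('a, 'r) ring_scheme \<Rightarrow> ('a, 'b, 'm) module_scheme \<Rightarrow> bool"
  where "fg_module R M \<longleftrightarrow> (\<exists>B. finite B \<and> B \<subseteq> carrier M \<and>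
    (\<forall>m\<in>carrier M. \<exists>c\<in>B \<rightarrow> carrier R. m = (\<Oplus>\<^bsub>M\<^esub>x\<in>B. c x \<odot>\<^bsub>M\<^esub> x)))"

definition free_module :: "('a, 'r) ring_scheme \<Rightarrow> 'x set \<Rightarrow> ('a, 'x \<Rightarrow> 'a) module"
  where "free_module R B =
    \<lparr>carrier = {f \<in> B \<rightarrow>\<^sub>E carrier R. finite {x \<in> B. f x \<noteq> \<zero>\<^bsub>R\<^esub>}},
     monoid.mult = undefined, one = undefined,
     ring.zero = (\<lambda>x\<in>B. \<zero>\<^bsub>R\<^esub>),
     add = (\<lambda>f g. \<lambda>x\<in>B. f x \<oplus>\<^bsub>R\<^esub> g x),
     smult = (\<lambda>r f. \<lambda>x\<in>B. r \<otimes>\<^bsub>R\<^esub> f x)\<rparr>"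

text \<open>Projective: a direct summand of a free module, i.e. \<open>P\<close> is a retract of some \<open>R\<^sup>(\<^sup>B\<^sup>)\<close>.
  Index sets \<open>B\<close> of elements of the type of \<open>P\<close> suffice, since a retract of any free module
  is a quotient of, hence (being projective) a retract of, the free module on \<^term>\<open>carrier P\<close>.\<close>

definition projective_module :: "('a, 'r) ring_scheme \<Rightarrow> ('a, 'b, 'm) module_scheme \<Rightarrow> bool"
  where "projective_module R P \<longleftrightarrow> (\<exists>B :: 'b set.
    \<exists>i\<in>linear_maps R P (free_module R B). \<exists>p\<in>linear_maps R (free_module R B) P.
      \<forall>x\<in>carrier P. p (i x) = x)"

definition left_ideal :: "'b set \<Rightarrow> ('b, 'm) ring_scheme \<Rightarrow> bool"
  where "left_ideal I A \<longleftrightarrow> additive_subgroup I A \<and> (\<forall>a\<in>carrier A. \<forall>x\<in>I. a \<otimes>\<^bsub>A\<^esub> x \<in> I)"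

locale algebra_with_P_left = assoc_algebra R A for R (structure) and A (structure) +
  assumes P_left: "\<lbrakk>left_ideal I A; fg_module R (quotient_module A I)\<rbrakk> \<Longrightarrow>
    \<exists>I\<^sub>0. left_ideal I\<^sub>0 A \<and> I\<^sub>0 \<subseteq> I \<and>
      fg_module R (quotient_module A I\<^sub>0) \<and> projective_module R (quotient_module A I\<^sub>0)"


section \<open>Tensor products\<close>

text \<open>\<open>M \<otimes>\<^sub>R N\<close> is the free abelian group on \<^term>\<open>carrier M \<times> carrier N\<close> modulo the usual relations;
  its elements are cosets.\<close>

type_synonym ('b, 'c) tensor = "(('b \<times> 'c) \<Rightarrow>\<^sub>0 int) set"

definition tensor_relators ::
    "('a, 'r) ring_scheme \<Rightarrow> ('a, 'b, 'm) module_scheme \<Rightarrow> ('a, 'c, 'n) module_scheme \<Rightarrow>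
     (('b \<times> 'c) \<Rightarrow>\<^sub>0 int) set"
  where "tensor_relators R M N =
    {frag_of (m \<oplus>\<^bsub>M\<^esub> m', n) - frag_of (m, n) - frag_of (m', n) | m m' n.
       m \<in> carrier M \<and> m' \<in> carrier M \<and> n \<in> carrier N} \<union>
    {frag_of (m, n \<oplus>\<^bsub>N\<^esub> n') - frag_of (m, n) - frag_of (m, n') | m n n'.
       m \<in> carrier M \<and> n \<in> carrier N \<and> n' \<in> carrier N} \<union>
    {frag_of (r \<odot>\<^bsub>M\<^esub> m, n) - frag_of (m, r \<odot>\<^bsub>N\<^esub> n) | r m n.
       r \<in> carrier R \<and> m \<in> carrier M \<and> n \<in> carrier N}"

abbreviation tensor_free ::
    "('a, 'b, 'm) module_scheme \<Rightarrow> ('a, 'c, 'n) module_scheme \<Rightarrow> (('b \<times> 'c) \<Rightarrow>\<^sub>0 int) monoid"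
  where "tensor_free M N \<equiv> free_Abelian_group (carrier M \<times> carrier N)"

definition tensor_coset ::
    "('a, 'r) ring_scheme \<Rightarrow> ('a, 'b, 'm) module_scheme \<Rightarrow> ('a, 'c, 'n) module_scheme \<Rightarrow>
     (('b \<times> 'c) \<Rightarrow>\<^sub>0 int) \<Rightarrow> ('b, 'c) tensor"
  where "tensor_coset R M N x =
    generate (tensor_free M N) (tensor_relators R M N) #>\<^bsub>tensor_free M N\<^esub> x"

definition pure_tensor ::
    "('a, 'r) ring_scheme \<Rightarrow> ('a, 'b, 'm) module_scheme \<Rightarrow> ('a, 'c, 'n) module_scheme \<Rightarrow>
     'b \<Rightarrow> 'c \<Rightarrow> ('b, 'c) tensor"
  where "pure_tensor R M N m n = tensor_coset R M N (frag_of (m, n))"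

text \<open>Scalars and products act on representatives, \<open>r(m \<otimes> n) = rm \<otimes> n\<close> and
  \<open>(m \<otimes> n)(m' \<otimes> n') = mm' \<otimes> nn'\<close>; as for \<^const>\<open>rcoset_mult\<close>, the unions are over equal cosets.
  The multiplication and the unit are meaningful only if \<open>M\<close> and \<open>N\<close> are algebras.\<close>

definition tensor ::
    "('a, 'r) ring_scheme \<Rightarrow> ('a, 'b, 'm) module_scheme \<Rightarrow> ('a, 'c, 'n) module_scheme \<Rightarrow>
     ('a, ('b, 'c) tensor) module"
  where "tensor R M N =
    (let Q = tensor_free M N Mod generate (tensor_free M N) (tensor_relators R M N) in
    \<lparr>carrier = carrier Q,
     monoid.mult = (\<lambda>s t. \<Union>x\<in>s. \<Union>y\<in>t. tensor_coset R M N
       (frag_extend (\<lambda>(m, n). frag_extend (\<lambda>(m', n'). frag_of (m \<otimes>\<^bsub>M\<^esub> m', n \<otimes>\<^bsub>N\<^esub> n')) y) x)),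
     one = pure_tensor R M N \<one>\<^bsub>M\<^esub> \<one>\<^bsub>N\<^esub>,
     ring.zero = \<one>\<^bsub>Q\<^esub>,
     add = monoid.mult Q,
     smult = (\<lambda>r t. \<Union>x\<in>t. tensor_coset R M N (frag_extend (\<lambda>(m, n). frag_of (r \<odot>\<^bsub>M\<^esub> m, n)) x))\<rparr>)"

text \<open>The additive map \<open>M \<otimes>\<^sub>R N \<rightarrow> P\<close> with \<open>m \<otimes> n \<mapsto> \<beta> m n\<close>, for a balanced biadditive \<open>\<beta>\<close>.
  In Sweedler notation, \<^term>\<open>tensor_lift P \<beta> (\<Delta> h)\<close> is \<open>\<Sum> \<beta> h\<^sub>1 h\<^sub>2\<close>.\<close>

definition tensor_lift :: "('p, 'z) ring_scheme \<Rightarrow> ('b \<Rightarrow> 'c \<Rightarrow> 'p) \<Rightarrow> ('b, 'c) tensor \<Rightarrow> 'p"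
  where "tensor_lift P \<beta> t = (let x = (SOME x. x \<in> t) in
    \<Oplus>\<^bsub>P\<^esub>k\<in>Poly_Mapping.keys x. [Poly_Mapping.lookup x k] \<cdot>\<^bsub>P\<^esub> \<beta> (fst k) (snd k))"

definition tensor_map ::
    "('a, 'r) ring_scheme \<Rightarrow> ('a, 'd, 'm) module_scheme \<Rightarrow> ('a, 'e, 'n) module_scheme \<Rightarrow>
     ('b \<Rightarrow> 'd) \<Rightarrow> ('c \<Rightarrow> 'e) \<Rightarrow> ('b, 'c) tensor \<Rightarrow> ('d, 'e) tensor"
  where "tensor_map R M' N' f g =
    tensor_lift (tensor R M' N') (\<lambda>m n. pure_tensor R M' N' (f m) (g n))"

text \<open>The canonical map \<open>(L \<otimes> M) \<otimes> N \<rightarrow> L \<otimes> (M \<otimes> N)\<close>.\<close>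

definition tensor_assoc ::
    "('a, 'r) ring_scheme \<Rightarrow> ('a, 'b, 'l) module_scheme \<Rightarrow> ('a, 'c, 'm) module_scheme \<Rightarrow>
     ('a, 'd, 'n) module_scheme \<Rightarrow> (('b, 'c) tensor, 'd) tensor \<Rightarrow> ('b, ('c, 'd) tensor) tensor"
  where "tensor_assoc R L M N =
    tensor_lift (tensor R L (tensor R M N)) (\<lambda>t n.
      tensor_lift (tensor R L (tensor R M N)) (\<lambda>l m.
        pure_tensor R L (tensor R M N) l (pure_tensor R M N m n)) t)"


section \<open>Hopf algebras\<close>

record ('a, 'b) hopf = "('a, 'b) module" +
  comult :: "'b \<Rightarrow> ('b, 'b) tensor"
  counit :: "'b \<Rightarrow> 'a"
  antipode :: "'b \<Rightarrow> 'b"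

locale coalgebra = module R C
  for R (structure) and C :: "('a, 'b, 'h) hopf_scheme" (structure) +
  assumes comult_linear: "comult C \<in> linear_maps R C (tensor R C C)"
    and counit_linear: "counit C \<in> linear_maps R C (regular_module R)"
    and coassoc: "c \<in> carrier C \<Longrightarrow>
      tensor_assoc R C C C (tensor_map R (tensor R C C) C (comult C) id (comult C c)) =
      tensor_map R C (tensor R C C) id (comult C) (comult C c)"
    and counit_l: "c \<in> carrier C \<Longrightarrow>
      tensor_lift C (\<lambda>a b. counit C a \<odot>\<^bsub>C\<^esub> b) (comult C c) = c"
    and counit_r: "c \<in> carrier C \<Longrightarrow>
      tensor_lift C (\<lambda>a b. counit C b \<odot>\<^bsub>C\<^esub> a) (comult C c) = c"

locale bialgebra = assoc_algebra R H + coalgebra R H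
  for R (structure) and H :: "('a, 'b, 'h) hopf_scheme" (structure) +
  assumes comult_ring_hom: "comult H \<in> ring_hom H (tensor R H H)"
    and counit_ring_hom: "counit H \<in> ring_hom H R"

locale hopf_algebra = bialgebra R H
  for R (structure) and H :: "('a, 'b, 'h) hopf_scheme" (structure) +
  assumes antipode_linear: "antipode H \<in> linear_maps R H H"
    and antipode_l: "h \<in> carrier H \<Longrightarrow>
      tensor_lift H (\<lambda>a b. antipode H a \<otimes>\<^bsub>H\<^esub> b) (comult H h) = counit H h \<odot>\<^bsub>H\<^esub> \<one>\<^bsub>H\<^esub>"
    and antipode_r: "h \<in> carrier H \<Longrightarrow>
      tensor_lift H (\<lambda>a b. a \<otimes>\<^bsub>H\<^esub> antipode H b) (comult H h) = counit H h \<odot>\<^bsub>H\<^esub> \<one>\<^bsub>H\<^esub>"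


section \<open>Group algebras and Laurent polynomials\<close>

definition group_basis :: "('a, 'r) ring_scheme \<Rightarrow> ('g, 'k) monoid_scheme \<Rightarrow> 'g \<Rightarrow> 'g \<Rightarrow> 'a"
  where "group_basis R G x = (\<lambda>y\<in>carrier G. if y = x then \<one>\<^bsub>R\<^esub> else \<zero>\<^bsub>R\<^esub>)"

abbreviation group_support :: "('a, 'r) ring_scheme \<Rightarrow> ('g, 'k) monoid_scheme \<Rightarrow> ('g \<Rightarrow> 'a) \<Rightarrow> 'g set"
  where "group_support R G f \<equiv> {x \<in> carrier G. f x \<noteq> \<zero>\<^bsub>R\<^esub>}"

definition group_algebra :: "('a, 'r) ring_scheme \<Rightarrow> ('g, 'k) monoid_scheme \<Rightarrow> ('a, 'g \<Rightarrow> 'a) module"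
  where "group_algebra R G = (free_module R (carrier G))
    \<lparr>monoid.mult := (\<lambda>f g. \<lambda>z\<in>carrier G.
       \<Oplus>\<^bsub>R\<^esub>x\<in>group_support R G f. f x \<otimes>\<^bsub>R\<^esub> g (inv\<^bsub>G\<^esub> x \<otimes>\<^bsub>G\<^esub> z)),
     one := group_basis R G \<one>\<^bsub>G\<^esub>\<rparr>"

text \<open>Every group element is group-like: \<open>\<Delta> x = x \<otimes> x\<close>, \<open>\<epsilon> x = 1\<close>, \<open>S x = x\<^sup>-\<^sup>1\<close>.\<close>

definition group_hopf_algebra ::
    "('a, 'r) ring_scheme \<Rightarrow> ('g, 'k) monoid_scheme \<Rightarrow> ('a, 'g \<Rightarrow> 'a) hopf"
  where "group_hopf_algebra R G = (let A = group_algebra R G in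
    module.extend A (hopf.fields
      (\<lambda>f. \<Oplus>\<^bsub>tensor R A A\<^esub>x\<in>group_support R G f.
         f x \<odot>\<^bsub>tensor R A A\<^esub> pure_tensor R A A (group_basis R G x) (group_basis R G x))
      (\<lambda>f. \<Oplus>\<^bsub>R\<^esub>x\<in>group_support R G f. f x)
      (\<lambda>f. \<lambda>x\<in>carrier G. f (inv\<^bsub>G\<^esub> x))))"

definition free_abelian_rank :: "nat \<Rightarrow> (nat \<Rightarrow> int) monoid"
  where "free_abelian_rank n = product_group {..<n} (\<lambda>_. integer_group)"

text \<open>\<open>R[x\<^sub>1, x\<^sub>1\<^sup>-\<^sup>1, \<dots>, x\<^sub>n, x\<^sub>n\<^sup>-\<^sup>1] = R[\<int>\<^sup>n]\<close>; the variables are numbered from 0.\<close>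

definition laurent :: "('a, 'r) ring_scheme \<Rightarrow> nat \<Rightarrow> ('a, (nat \<Rightarrow> int) \<Rightarrow> 'a) hopf"
  where "laurent R n = group_hopf_algebra R (free_abelian_rank n)"

definition laurent_over ::
    "('a, 'r) ring_scheme \<Rightarrow> ('a, 'b, 'm) module_scheme \<Rightarrow> nat \<Rightarrow>
     ('a, ('b, (nat \<Rightarrow> int) \<Rightarrow> 'a) tensor) module"
  where "laurent_over R A n = tensor R A (laurent R n)"


section \<open>The finite dual\<close>

text \<open>Functions on \<open>H\<close> are made \<^const>\<open>extensional\<close>, so that equality of elements of
  \<open>Hom\<^sub>R(H, R)\<close> is equality of maps on \<^term>\<open>carrier H\<close>.\<close>

definition dual_module ::
    "('a, 'r) ring_scheme \<Rightarrow> ('a, 'b, 'm) module_scheme \<Rightarrow> ('a, 'b \<Rightarrow> 'a) module"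
  where "dual_module R H =
    \<lparr>carrier = linear_maps R H (regular_module R) \<inter> extensional (carrier H),
     monoid.mult = undefined, one = undefined,
     ring.zero = (\<lambda>k\<in>carrier H. \<zero>\<^bsub>R\<^esub>),
     add = (\<lambda>f g. \<lambda>k\<in>carrier H. f k \<oplus>\<^bsub>R\<^esub> g k),
     smult = (\<lambda>r f. \<lambda>k\<in>carrier H. r \<otimes>\<^bsub>R\<^esub> f k)\<rparr>"

definition dual_action :: "('b, 'm) ring_scheme \<Rightarrow> 'b \<Rightarrow> ('b \<Rightarrow> 'a) \<Rightarrow> 'b \<Rightarrow> 'a"
  where "dual_action H h f = (\<lambda>k\<in>carrier H. f (k \<otimes>\<^bsub>H\<^esub> h))"

definition finite_dual_module ::
    "('a, 'r) ring_scheme \<Rightarrow> ('a, 'b, 'm) module_scheme \<Rightarrow> ('a, 'b \<Rightarrow> 'a) module"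
  where "finite_dual_module R H = (dual_module R H)
    \<lparr>carrier := {f \<in> carrier (dual_module R H).
       fg_module R ((dual_module R H)\<lparr>carrier := (\<lambda>h. dual_action H h f) ` carrier H\<rparr>)}\<rparr>"

text \<open>\<open>t = \<Sum> f\<^sub>1 \<otimes> f\<^sub>2\<close> in \<open>H\<degree> \<otimes> H\<degree>\<close> satisfies \<open>f(hk) = \<Sum> f\<^sub>1(h) f\<^sub>2(k)\<close>.\<close>

definition is_dual_comult ::
    "('a, 'r) ring_scheme \<Rightarrow> ('a, 'b, 'm) module_scheme \<Rightarrow> ('b \<Rightarrow> 'a) \<Rightarrow>
     ('b \<Rightarrow> 'a, 'b \<Rightarrow> 'a) tensor \<Rightarrow> bool"
  where "is_dual_comult R H f t \<longleftrightarrow>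
    t \<in> carrier (tensor R (finite_dual_module R H) (finite_dual_module R H)) \<and>
    (\<forall>h\<in>carrier H. \<forall>k\<in>carrier H.
       f (h \<otimes>\<^bsub>H\<^esub> k) = tensor_lift R (\<lambda>f\<^sub>1 f\<^sub>2. f\<^sub>1 h \<otimes>\<^bsub>R\<^esub> f\<^sub>2 k) t)"

definition finite_dual ::
    "('a, 'r) ring_scheme \<Rightarrow> ('a, 'b, 'h) hopf_scheme \<Rightarrow> ('a, 'b \<Rightarrow> 'a) hopf"
  where "finite_dual R H = module.extend
    ((finite_dual_module R H)
      \<lparr>monoid.mult := (\<lambda>f g. \<lambda>h\<in>carrier H. tensor_lift R (\<lambda>a b. f a \<otimes>\<^bsub>R\<^esub> g b) (comult H h)),
       one := (\<lambda>h\<in>carrier H. counit H h)\<rparr>)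
    (hopf.fields
      (\<lambda>f. THE t. is_dual_comult R H f t)
      (\<lambda>f. f \<one>\<^bsub>H\<^esub>)
      (\<lambda>f. \<lambda>h\<in>carrier H. f (antipode H h)))"

end

theory Submission
  imports Defs
begin

text \<open>Let \<open>\<int>\<^sup>n\<close> act linearly on a finitely generated module \<open>M\<close> over the Noetherian ring \<open>R\<close>. Each
  variable satisfies a monic relation on \<open>M\<close> whose constant term is a unit, so there are a finite
  \<open>E \<subseteq> \<int>\<^sup>n\<close> and functions \<open>c\<^sub>e : \<int>\<^sup>n \<rightarrow> R\<close> with \<open>g m = \<Sum> c\<^sub>e(g) e m\<close> for all \<open>g\<close> and \<open>m\<close>. The \<open>c\<^sub>e\<close> are
  coordinates on a finite free quotient of \<open>R[\<int>\<^sup>n]\<close>, whence \<open>c\<^sub>e(gh) = \<Sum> c\<^sub>f(g) c\<^sub>e(fh)\<close>.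

  Let \<open>I\<close> be a left ideal of \<open>A[x\<^sub>1, x\<^sub>1\<^sup>-\<^sup>1, \<dots>]\<close> with finitely generated quotient \<open>M\<close>. Since \<open>A/(A \<inter> I)\<close>
  embeds into \<open>M\<close>, property \<open>P\<^sub>\<ell>\<close> gives \<open>I\<^sub>0 \<subseteq> A \<inter> I\<close>, and the elements \<open>\<Sum> a\<^sub>g g\<close> all of whose
  coordinates \<open>\<Sum> c\<^sub>e(g) a\<^sub>g\<close> lie in \<open>I\<^sub>0\<close> form a left ideal inside \<open>I\<close>. A dual basis of \<open>A/I\<^sub>0\<close>,
  multiplied by the elements of \<open>E\<close>, is a dual basis of the quotient by it.

  For \<open>H = R[\<int>\<^sup>n]\<close>, the same coordinates lie in \<open>H\<degree>\<close> and satisfy \<open>f = \<Sum> f(e) c\<^sub>e\<close> for all \<open>f\<close> in a given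
  finite subset of \<open>H\<degree>\<close>. Hence \<open>\<Delta> f = \<Sum> c\<^sub>e \<otimes> e f\<close> exists, an element of a tensor power of \<open>H\<degree>\<close> is
  determined by its values at group elements, and there every Hopf identity is evident.\<close>

section \<open>Linear maps, spans and Noetherian modules\<close>

text \<open>The constant term must be a unit because coordinates are wanted for all integral powers
  of a variable: only then is \<open>t\<close> invertible in the free quotient with basis
  \<open>1, ..., t^d\<close>. Cayley-Hamilton would supply a monic relation, but its constant term
  is the determinant of a matrix over a set of generators, which need not be a unit when the module
  is not free: on \<open>\<int>/5\<close> the automorphism \<open>2\<close> has the integer matrix
  \<open>2\<close>. Noetherianity is therefore used to relate the two outer powers to the inner ones
  in a single relation.

  The second obstacle is uniqueness of the comultiplication. Over a general ring, a tensor product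
  of two modules of functions need not embed into the functions of two variables, and without such
  an embedding neither the choice of \<open>\<Delta> f\<close> nor coassociativity can be tested on
  values. A tensor involves only finitely many functionals, though, and a family of functionals that
  reproduces these from their values expresses the tensor through its own values.

  Equations between multilinear expressions are checked on generators only: on pure tensors, on
  group elements, or on both.\<close>

lemma linear_mapsI:
  assumes "\<And>x. x \<in> carrier M \<Longrightarrow> f x \<in> carrier N"
    and "\<And>x y. x \<in> carrier M \<Longrightarrow> y \<in> carrier M \<Longrightarrow> f (x \<oplus>\<^bsub>M\<^esub> y) = f x \<oplus>\<^bsub>N\<^esub> f y"
    and "\<And>r x. r \<in> carrier R \<Longrightarrow> x \<in> carrier M \<Longrightarrow> f (r \<odot>\<^bsub>M\<^esub> x) = r \<odot>\<^bsub>N\<^esub> f x"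
  shows "f \<in> linear_maps R M N"
  using assms by (auto simp: linear_maps_def)

lemma linear_mapsD:
  assumes "f \<in> linear_maps R M N"
  shows "x \<in> carrier M \<Longrightarrow> f x \<in> carrier N"
    and "x \<in> carrier M \<Longrightarrow> y \<in> carrier M \<Longrightarrow> f (x \<oplus>\<^bsub>M\<^esub> y) = f x \<oplus>\<^bsub>N\<^esub> f y"
    and "r \<in> carrier R \<Longrightarrow> x \<in> carrier M \<Longrightarrow> f (r \<odot>\<^bsub>M\<^esub> x) = r \<odot>\<^bsub>N\<^esub> f x"
  using assms by (auto simp: linear_maps_def)

lemma linear_maps_comp:
  assumes "f \<in> linear_maps R M N" and "g \<in> linear_maps R N P"
  shows "(\<lambda>x. g (f x)) \<in> linear_maps R M P"
  using assms by (auto simp: linear_maps_def Pi_iff)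

lemma linear_maps_zero:
  assumes "module R M" and "module R N" and f: "f \<in> linear_maps R M N"
  shows "f \<zero>\<^bsub>M\<^esub> = \<zero>\<^bsub>N\<^esub>"
proof -
  interpret M: module R M by fact
  interpret N: module R N by fact
  have "f \<zero>\<^bsub>M\<^esub> = f (\<zero>\<^bsub>R\<^esub> \<odot>\<^bsub>M\<^esub> \<zero>\<^bsub>M\<^esub>)" by simp
  also have "\<dots> = \<zero>\<^bsub>R\<^esub> \<odot>\<^bsub>N\<^esub> f \<zero>\<^bsub>M\<^esub>" by (rule linear_mapsD(3)[OF f]) auto
  also have "\<dots> = \<zero>\<^bsub>N\<^esub>" using linear_mapsD(1)[OF f] by simp
  finally show ?thesis .
qed

lemma (in module) smult_neg_one: "x \<in> carrier M \<Longrightarrow> (\<ominus> \<one>) \<odot>\<^bsub>M\<^esub> x = \<ominus>\<^bsub>M\<^esub> x"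
  by (simp add: smult_l_minus)

lemma linear_maps_neg:
  assumes "module R M" and "module R N" and f: "f \<in> linear_maps R M N" and x: "x \<in> carrier M"
  shows "f (\<ominus>\<^bsub>M\<^esub> x) = \<ominus>\<^bsub>N\<^esub> f x"
proof -
  interpret M: module R M by fact
  interpret N: module R N by fact
  have "f (\<ominus>\<^bsub>M\<^esub> x) = f ((\<ominus>\<^bsub>R\<^esub> \<one>\<^bsub>R\<^esub>) \<odot>\<^bsub>M\<^esub> x)" using x by (simp add: M.smult_neg_one)
  also have "\<dots> = (\<ominus>\<^bsub>R\<^esub> \<one>\<^bsub>R\<^esub>) \<odot>\<^bsub>N\<^esub> f x" using x by (intro linear_mapsD(3)[OF f]) auto
  also have "\<dots> = \<ominus>\<^bsub>N\<^esub> f x" using linear_mapsD(1)[OF f x] by (simp add: N.smult_neg_one)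
  finally show ?thesis .
qed

lemma linear_maps_diff:
  assumes "module R M" and "module R N" and f: "f \<in> linear_maps R M N"
    and x: "x \<in> carrier M" and y: "y \<in> carrier M"
  shows "f (x \<ominus>\<^bsub>M\<^esub> y) = f x \<ominus>\<^bsub>N\<^esub> f y"
proof -
  interpret M: module R M by fact
  show ?thesis
    using x y by (simp add: a_minus_def linear_mapsD(2)[OF f] linear_maps_neg[OF assms(1,2) f])
qed

lemma linear_maps_finsum:
  assumes "module R M" and "module R N" and f: "f \<in> linear_maps R M N"
    and h: "h \<in> I \<rightarrow> carrier M"
  shows "f (\<Oplus>\<^bsub>M\<^esub>i\<in>I. h i) = (\<Oplus>\<^bsub>N\<^esub>i\<in>I. f (h i))"
proof -
  interpret M: module R M by fact
  interpret N: module R N by fact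
  show ?thesis
  proof (cases "finite I")
    case True
    then show ?thesis using h
    proof (induction I)
      case empty
      then show ?case by (simp add: linear_maps_zero[OF assms(1,2) f])
    next
      case (insert i I)
      then have "h \<in> I \<rightarrow> carrier M" "h i \<in> carrier M" by auto
      moreover then have "(\<lambda>i. f (h i)) \<in> I \<rightarrow> carrier N" "f (h i) \<in> carrier N"
        using linear_mapsD(1)[OF f] by auto
      ultimately show ?case using insert by (simp add: linear_mapsD(2)[OF f])
    qed
  next
    case False
    then show ?thesis by (simp add: linear_maps_zero[OF assms(1,2) f])
  qed
qed

context module
begin

lemma linear_maps_add:
  assumes f: "f \<in> linear_maps R N M" and g: "g \<in> linear_maps R N M"
  shows "(\<lambda>x. f x \<oplus>\<^bsub>M\<^esub> g x) \<in> linear_maps R N M"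
  by (rule linear_mapsI)
    (auto simp: linear_mapsD[OF f] linear_mapsD[OF g] smult_r_distr M.a_ac)

lemma linear_maps_smult:
  assumes f: "f \<in> linear_maps R N M" and r: "r \<in> carrier R"
  shows "(\<lambda>x. r \<odot>\<^bsub>M\<^esub> f x) \<in> linear_maps R N M"
proof (rule linear_mapsI)
  fix s x assume "s \<in> carrier R" "x \<in> carrier N"
  then show "r \<odot>\<^bsub>M\<^esub> f (s \<odot>\<^bsub>N\<^esub> x) = s \<odot>\<^bsub>M\<^esub> (r \<odot>\<^bsub>M\<^esub> f x)"
    using r by (simp add: linear_mapsD[OF f] smult_assoc1[symmetric] R.m_comm)
qed (use r in \<open>auto simp: linear_mapsD[OF f] smult_r_distr\<close>)

lemma linear_maps_const_zero: "(\<lambda>x. \<zero>\<^bsub>M\<^esub>) \<in> linear_maps R N M"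
  by (rule linear_mapsI) auto

lemma linear_maps_sum:
  assumes "finite I" "\<And>i. i \<in> I \<Longrightarrow> f i \<in> linear_maps R N M"
  shows "(\<lambda>x. \<Oplus>\<^bsub>M\<^esub>i\<in>I. f i x) \<in> linear_maps R N M"
proof (rule linear_mapsI)
  note f = linear_mapsD[OF assms(2)]
  show "(\<Oplus>\<^bsub>M\<^esub>i\<in>I. f i x) \<in> carrier M" if "x \<in> carrier N" for x
    using that by (intro M.finsum_closed) (auto simp: f)
  show "(\<Oplus>\<^bsub>M\<^esub>i\<in>I. f i (x \<oplus>\<^bsub>N\<^esub> y)) = (\<Oplus>\<^bsub>M\<^esub>i\<in>I. f i x) \<oplus>\<^bsub>M\<^esub> (\<Oplus>\<^bsub>M\<^esub>i\<in>I. f i y)"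
    if "x \<in> carrier N" "y \<in> carrier N" for x y
    using that
    by (subst M.finsum_addf[symmetric])
      (auto intro!: M.finsum_cong' simp: f simp del: M.finsum_addf M.add.finprod_multf)
  show "(\<Oplus>\<^bsub>M\<^esub>i\<in>I. f i (r \<odot>\<^bsub>N\<^esub> x)) = r \<odot>\<^bsub>M\<^esub> (\<Oplus>\<^bsub>M\<^esub>i\<in>I. f i x)"
    if "r \<in> carrier R" "x \<in> carrier N" for r x
    using that assms(1)
    by (subst finsum_smult_ldistr) (auto intro!: M.finsum_cong' simp: f)
qed

text \<open>A functional and a vector give a map of rank one. Sums of such maps are the sections
  built from a dual basis and the right-hand sides of the reproducing formulas.\<close>

lemma linear_maps_smult_point:
  assumes f: "f \<in> linear_maps R N (regular_module R)" and x: "x \<in> carrier M"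
  shows "(\<lambda>y. f y \<odot>\<^bsub>M\<^esub> x) \<in> linear_maps R N M"
  using linear_mapsD[OF f] x
  by (intro linear_mapsI) (auto simp: regular_module_def smult_l_distr smult_assoc1)

end

section \<open>Linear spans, built up one summand at a time\<close>

inductive_set lspan ::
    "('a, 'r) ring_scheme \<Rightarrow> ('a, 'b, 'm) module_scheme \<Rightarrow> 'b set \<Rightarrow> 'b set"
  for R M S where
  zero: "\<zero>\<^bsub>M\<^esub> \<in> lspan R M S"
| step: "\<lbrakk>r \<in> carrier R; s \<in> S; y \<in> lspan R M S\<rbrakk> \<Longrightarrow> (r \<odot>\<^bsub>M\<^esub> s) \<oplus>\<^bsub>M\<^esub> y \<in> lspan R M S"

text \<open>Only zero, addition and scalars enter into a span, so that a span computed in a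
  submodule is the span computed in the ambient module.\<close>

lemma lspan_carrier_update [simp]: "lspan R (M\<lparr>carrier := N\<rparr>) S = lspan R M S"
proof (intro equalityI subsetI)
  fix x assume "x \<in> lspan R (M\<lparr>carrier := N\<rparr>) S"
  then show "x \<in> lspan R M S"
    by induction (simp_all add: lspan.zero lspan.step)
next
  fix x assume "x \<in> lspan R M S"
  then show "x \<in> lspan R (M\<lparr>carrier := N\<rparr>) S"
  proof induction
    case zero
    show ?case using lspan.zero[of "M\<lparr>carrier := N\<rparr>"] by simp
  next
    case (step r s y)
    then show ?case using lspan.step[of r R s S y "M\<lparr>carrier := N\<rparr>"] by simp
  qed
qed

lemma lspan_mono: "S \<subseteq> S' \<Longrightarrow> lspan R M S \<subseteq> lspan R M S'"
proof
  fix x assume "S \<subseteq> S'" and "x \<in> lspan R M S"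
  from this(2,1) show "x \<in> lspan R M S'" by induction (auto intro: lspan.intros)
qed

text \<open>An element uses finitely many summands only. This serves to pick finitely many powers
  out of the infinite family of all powers of an automorphism.\<close>

lemma lspan_finite_subset:
  "x \<in> lspan R M S \<Longrightarrow> \<exists>F. finite F \<and> F \<subseteq> S \<and> x \<in> lspan R M F"
proof (induction rule: lspan.induct)
  case zero
  then show ?case by (auto intro: lspan.zero)
next
  case (step r s y)
  then obtain F where "finite F" "F \<subseteq> S" "y \<in> lspan R M F" by auto
  with step show ?case
    by (intro exI[of _ "insert s F"]) (auto intro!: lspan.step intro: subsetD[OF lspan_mono])
qed

context module
begin

lemma lspan_closed: 
  assumes S: "S \<subseteq> carrier M" and "x \<in> lspan R M S"
  shows "x \<in> carrier M"
  using assms(2) by induction (use S in auto)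

lemma lspan_base: "S \<subseteq> carrier M \<Longrightarrow> s \<in> S \<Longrightarrow> s \<in> lspan R M S"
  using lspan.step[OF R.one_closed _ lspan.zero[of M R S], of s] by auto

lemma lspan_add:
  assumes S: "S \<subseteq> carrier M" and "x \<in> lspan R M S" and y: "y \<in> lspan R M S"
  shows "x \<oplus>\<^bsub>M\<^esub> y \<in> lspan R M S"
  using assms(2)
proof induction
  case zero
  then show ?case using y lspan_closed[OF S y] by simp
next
  case (step r s z)
  moreover from this have "s \<in> carrier M" "z \<in> carrier M" using S lspan_closed[OF S] by auto
  ultimately show ?case
    using lspan_closed[OF S y] by (auto simp: M.a_assoc intro: lspan.step)
qed

lemma lspan_smult:
  assumes S: "S \<subseteq> carrier M" and r: "r \<in> carrier R" and "x \<in> lspan R M S"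
  shows "r \<odot>\<^bsub>M\<^esub> x \<in> lspan R M S"
  using assms(3)
proof induction
  case zero
  then show ?case using r by (auto intro: lspan.zero)
next
  case (step r' s z)
  moreover from this have "s \<in> carrier M" "z \<in> carrier M" using S lspan_closed[OF S] by auto
  ultimately show ?case
    using r by (auto simp: smult_r_distr smult_assoc1[symmetric] intro: lspan.step)
qed

lemma lspan_submodule: "S \<subseteq> carrier M \<Longrightarrow> submodule (lspan R M S) R M"
proof (rule submoduleI)
  assume S: "S \<subseteq> carrier M"
  then show "lspan R M S \<subseteq> carrier M" using lspan_closed by blast
  fix a assume a: "a \<in> lspan R M S"
  then show "\<ominus>\<^bsub>M\<^esub> a \<in> lspan R M S"
    using lspan_smult[OF S, of "\<ominus> \<one>" a] lspan_closed[OF S a] by (simp add: smult_neg_one)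
qed (auto intro: lspan.zero lspan_add lspan_smult)

lemma submodule_zero: "submodule N R M \<Longrightarrow> \<zero>\<^bsub>M\<^esub> \<in> N"
  using submoduleE(2,4)[of N] submoduleE(1)[of N]
  by (metis R.zero_closed all_not_in_conv smult_l_null subsetD)

lemma submodule_finsum:
  assumes N: "submodule N R M" and "f \<in> I \<rightarrow> N"
  shows "(\<Oplus>\<^bsub>M\<^esub>i\<in>I. f i) \<in> N"
proof (cases "finite I")
  case True
  then show ?thesis using assms(2)
  proof (induction I)
    case empty
    then show ?case by (simp add: submodule_zero[OF N])
  next
    case (insert i I)
    then have "f \<in> I \<rightarrow> carrier M" "f i \<in> carrier M" using submoduleE(1)[OF N] by auto
    then show ?case using insert by (auto intro: submoduleE(5)[OF N])
  qed
qed (simp add: submodule_zero[OF N])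

lemma lspan_minimal:
  assumes N: "submodule N R M" and "S \<subseteq> N"
  shows "lspan R M S \<subseteq> N"
proof
  fix x assume "x \<in> lspan R M S"
  then show "x \<in> N"
    by induction (use assms(2) in \<open>auto intro: submodule_zero[OF N] submoduleE(4,5)[OF N]\<close>)
qed

lemma lspan_finsum_closed:
  "S \<subseteq> carrier M \<Longrightarrow> f \<in> I \<rightarrow> lspan R M S \<Longrightarrow> (\<Oplus>\<^bsub>M\<^esub>i\<in>I. f i) \<in> lspan R M S"
  by (rule submodule_finsum[OF lspan_submodule])

text \<open>The coefficients are indexed by \<open>I\<close> and not by the values of
  \<open>f\<close>, so that \<open>f\<close> may repeat values: each new summand is charged to one
  chosen index.\<close>

lemma lspan_image_finsum:
  assumes I: "finite I" and f: "f \<in> I \<rightarrow> carrier M" and "x \<in> lspan R M (f ` I)"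
  shows "\<exists>c \<in> I \<rightarrow> carrier R. x = (\<Oplus>\<^bsub>M\<^esub>i\<in>I. c i \<odot>\<^bsub>M\<^esub> f i)"
  using assms(3)
proof induction
  case zero
  have "(\<Oplus>\<^bsub>M\<^esub>i\<in>I. \<zero> \<odot>\<^bsub>M\<^esub> f i) = \<zero>\<^bsub>M\<^esub>" using f by (intro M.add.finprod_one_eqI) (simp add: Pi_iff)
  then show ?case by (intro bexI[of _ "\<lambda>_. \<zero>"]) auto
next
  case (step r s y)
  then obtain c j where c: "c \<in> I \<rightarrow> carrier R" and y: "y = (\<Oplus>\<^bsub>M\<^esub>i\<in>I. c i \<odot>\<^bsub>M\<^esub> f i)"
    and j: "j \<in> I" "s = f j" by auto
  have cf: "c i \<in> carrier R" "f i \<in> carrier M" if "i \<in> I" for i using c f that by auto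
  \<comment> \<open>A single summand is written as a sum over all of \<open>I\<close> supported at
    \<open>j\<close>, so that it can be added to the coefficients already found.\<close>
  have "r \<odot>\<^bsub>M\<^esub> s = (\<Oplus>\<^bsub>M\<^esub>i\<in>I. if j = i then r \<odot>\<^bsub>M\<^esub> f i else \<zero>\<^bsub>M\<^esub>)"
    using j I cf step.hyps by (subst M.add.finprod_singleton) auto
  also have "\<dots> = (\<Oplus>\<^bsub>M\<^esub>i\<in>I. (if i = j then r else \<zero>) \<odot>\<^bsub>M\<^esub> f i)"
    using cf step.hyps by (intro M.finsum_cong') auto
  finally have "r \<odot>\<^bsub>M\<^esub> s \<oplus>\<^bsub>M\<^esub> y = (\<Oplus>\<^bsub>M\<^esub>i\<in>I. ((if i = j then r else \<zero>) \<oplus> c i) \<odot>\<^bsub>M\<^esub> f i)"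
    using cf step.hyps unfolding y
    by (simp only:) (subst M.finsum_addf[symmetric], auto intro!: M.finsum_cong' simp: smult_l_distr simp del: M.finsum_addf M.add.finprod_multf)
  then show ?case
    using cf step.hyps by (intro bexI[of _ "\<lambda>i. (if i = j then r else \<zero>) \<oplus> c i"]) auto
qed

text \<open>Applied to the whole carrier it shows that the image of a linear map is its own span,
  hence a submodule; this is how orbits and images of \<open>A\<close> are recognised as
  submodules.\<close>

lemma lspan_linear_image:
  assumes "module R N" and f: "f \<in> linear_maps R M N" and S: "S \<subseteq> carrier M"
  shows "f ` lspan R M S = lspan R N (f ` S)"
proof (intro equalityI subsetI)
  fix y assume "y \<in> f ` lspan R M S"
  then obtain x where "x \<in> lspan R M S" "y = f x" by auto
  then show "y \<in> lspan R N (f ` S)"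
  proof (induction arbitrary: y)
    case zero
    then show ?case by (simp add: linear_maps_zero[OF module_axioms assms(1) f] lspan.zero)
  next
    case (step r s z)
    then have "s \<in> carrier M" "z \<in> carrier M" using S lspan_closed[OF S] by auto
    then have "y = r \<odot>\<^bsub>N\<^esub> f s \<oplus>\<^bsub>N\<^esub> f z" using step by (simp add: linear_mapsD[OF f])
    with step show ?case using lspan.step[of r R "f s" "f ` S" "f z" N] by auto
  qed
next
  fix y assume "y \<in> lspan R N (f ` S)"
  then show "y \<in> f ` lspan R M S"
  proof induction
    case zero
    show ?case using linear_maps_zero[OF module_axioms assms(1) f] lspan.zero by (metis imageI)
  next
    case (step r s z)
    then obtain s' z' where *: "s' \<in> S" "s = f s'" "z' \<in> lspan R M S" "z = f z'" by auto
    then have "s' \<in> carrier M" "z' \<in> carrier M" using S lspan_closed[OF S] by auto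
    then have "r \<odot>\<^bsub>N\<^esub> s \<oplus>\<^bsub>N\<^esub> z = f (r \<odot>\<^bsub>M\<^esub> s' \<oplus>\<^bsub>M\<^esub> z')"
      using step * by (simp add: linear_mapsD[OF f])
    with * step show ?case by (auto intro!: lspan.step)
  qed
qed

section \<open>Finite generation and submodules over a Noetherian ring\<close>

lemma fg_module_iff:
  "fg_module R M \<longleftrightarrow> (\<exists>B. finite B \<and> B \<subseteq> carrier M \<and> carrier M \<subseteq> lspan R M B)"
proof -
  have *: "x \<in> lspan R M B \<longleftrightarrow> (\<exists>c\<in>B \<rightarrow> carrier R. x = (\<Oplus>\<^bsub>M\<^esub>b\<in>B. c b \<odot>\<^bsub>M\<^esub> b))"
    if "finite B" "B \<subseteq> carrier M" for x B
  proof
    show "\<exists>c\<in>B \<rightarrow> carrier R. x = (\<Oplus>\<^bsub>M\<^esub>b\<in>B. c b \<odot>\<^bsub>M\<^esub> b)" if "x \<in> lspan R M B"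
      using lspan_image_finsum[of B "\<lambda>x. x" x] that \<open>finite B\<close> \<open>B \<subseteq> carrier M\<close> by auto
    show "x \<in> lspan R M B" if ex: "\<exists>c\<in>B \<rightarrow> carrier R. x = (\<Oplus>\<^bsub>M\<^esub>b\<in>B. c b \<odot>\<^bsub>M\<^esub> b)"
    proof -
      note B = \<open>B \<subseteq> carrier M\<close>
      obtain c where c: "c \<in> B \<rightarrow> carrier R" and x: "x = (\<Oplus>\<^bsub>M\<^esub>b\<in>B. c b \<odot>\<^bsub>M\<^esub> b)" using ex by auto
      have "c b \<odot>\<^bsub>M\<^esub> b \<in> lspan R M B" if "b \<in> B" for b
        using c that by (intro lspan_smult[OF B] lspan_base[OF B]) auto
      then show ?thesis unfolding x by (intro lspan_finsum_closed[OF B]) auto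
    qed
  qed
  show ?thesis
    unfolding fg_module_def
  proof (intro iff_exI conj_cong refl)
    fix B assume "finite B" "B \<subseteq> carrier M"
    from *[OF this]
    show "(\<forall>m\<in>carrier M. \<exists>c\<in>B \<rightarrow> carrier R. m = (\<Oplus>\<^bsub>M\<^esub>x\<in>B. c x \<odot>\<^bsub>M\<^esub> x)) \<longleftrightarrow>
      carrier M \<subseteq> lspan R M B" by blast
  qed
qed

lemma fg_submodule_iff:
  assumes N: "submodule N R M"
  shows "fg_module R (M\<lparr>carrier := N\<rparr>) \<longleftrightarrow> (\<exists>B. finite B \<and> B \<subseteq> N \<and> N \<subseteq> lspan R M B)"
  using module.fg_module_iff[OF submodule.submodule_is_module[OF N module_axioms]] by simp

text \<open>The analogue of the ideal of leading coefficients in Hilbert's basis theorem: the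
  possible coefficients at \<open>b\<close> of elements of \<open>N\<close>, the remainder being
  taken from the span of \<open>B\<close>.\<close>

lemma leading_ideal:
  assumes N: "submodule N R M" and b: "b \<in> carrier M" and B: "B \<subseteq> carrier M"
  shows "ideal {r \<in> carrier R. \<exists>y\<in>lspan R M B. r \<odot>\<^bsub>M\<^esub> b \<oplus>\<^bsub>M\<^esub> y \<in> N} R" (is "ideal ?J R")
proof -
  note E = submoduleE[OF N] and L = submoduleE[OF lspan_submodule[OF B]]
  have closed: "y \<in> carrier M" if "y \<in> lspan R M B" for y using that lspan_closed[OF B] by auto
  have smult: "s \<otimes> r \<in> ?J" if r: "r \<in> ?J" and s: "s \<in> carrier R" for r s
  proof -
    from r obtain y where y: "y \<in> lspan R M B" "r \<odot>\<^bsub>M\<^esub> b \<oplus>\<^bsub>M\<^esub> y \<in> N" "r \<in> carrier R" by auto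
    then have "s \<odot>\<^bsub>M\<^esub> (r \<odot>\<^bsub>M\<^esub> b \<oplus>\<^bsub>M\<^esub> y) \<in> N" using E s by auto
    moreover have "s \<odot>\<^bsub>M\<^esub> (r \<odot>\<^bsub>M\<^esub> b \<oplus>\<^bsub>M\<^esub> y) = (s \<otimes> r) \<odot>\<^bsub>M\<^esub> b \<oplus>\<^bsub>M\<^esub> s \<odot>\<^bsub>M\<^esub> y"
      using y s b closed by (simp add: smult_r_distr smult_assoc1)
    ultimately show ?thesis using y s L by auto
  qed
  have add: "r \<oplus> s \<in> ?J" if r: "r \<in> ?J" and s: "s \<in> ?J" for r s
  proof -
    from r obtain y where y: "y \<in> lspan R M B" "r \<odot>\<^bsub>M\<^esub> b \<oplus>\<^bsub>M\<^esub> y \<in> N" "r \<in> carrier R" by auto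
    from s obtain z where z: "z \<in> lspan R M B" "s \<odot>\<^bsub>M\<^esub> b \<oplus>\<^bsub>M\<^esub> z \<in> N" "s \<in> carrier R" by auto
    have "(r \<odot>\<^bsub>M\<^esub> b \<oplus>\<^bsub>M\<^esub> y) \<oplus>\<^bsub>M\<^esub> (s \<odot>\<^bsub>M\<^esub> b \<oplus>\<^bsub>M\<^esub> z) = (r \<oplus> s) \<odot>\<^bsub>M\<^esub> b \<oplus>\<^bsub>M\<^esub> (y \<oplus>\<^bsub>M\<^esub> z)"
      using y z b closed by (simp add: smult_l_distr M.a_ac)
    then show ?thesis using E(5)[OF y(2) z(2)] y z L by auto
  qed
  have "subgroup ?J (add_monoid R)"
  proof (rule R.add.subgroupI)
    have "\<zero> \<odot>\<^bsub>M\<^esub> b \<oplus>\<^bsub>M\<^esub> \<zero>\<^bsub>M\<^esub> \<in> N" using b submodule_zero[OF N] by simp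
    then have "\<zero> \<in> ?J" using lspan.zero by blast
    then show "?J \<noteq> {}" by blast
    show "\<ominus> r \<in> ?J" if "r \<in> ?J" for r
      using smult[OF that, of "\<ominus> \<one>"] that by (auto simp: R.l_minus)
  qed (use add in auto)
  then show ?thesis
    using smult R.m_comm by (intro idealI R.ring_axioms) auto
qed

text \<open>Induction on the generators: the coefficients at the last one form an ideal.\<close>

lemma noetherian_submodule:
  assumes noeth: "noetherian_ring R" and "finite B" and "B \<subseteq> carrier M"
    and "submodule N R M" and "N \<subseteq> lspan R M B"
  shows "\<exists>C. finite C \<and> C \<subseteq> N \<and> N \<subseteq> lspan R M C"
  using assms(2-)
proof (induction B arbitrary: N)
  case empty
  have "lspan R M {} \<subseteq> {\<zero>\<^bsub>M\<^esub>}"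
    by (auto elim: lspan.cases)
  with empty show ?case by (intro exI[of _ "{}"]) (auto intro: lspan.zero)
next
  case (insert b B)
  note N = \<open>submodule N R M\<close>
  have b: "b \<in> carrier M" and B: "B \<subseteq> carrier M" using insert by auto
  note E = submoduleE[OF N] and L = submoduleE[OF lspan_submodule[OF B]]
  let ?J = "\<lambda>N. {r \<in> carrier R. \<exists>y\<in>lspan R M B. r \<odot>\<^bsub>M\<^esub> b \<oplus>\<^bsub>M\<^esub> y \<in> N}"
  obtain A where A: "A \<subseteq> carrier R" "finite A" "?J N = Idl A"
    using noetherian_ring.finetely_gen[OF noeth leading_ideal[OF N b B]] by blast
  have "A \<subseteq> ?J N" unfolding A(3) using R.genideal_self[OF A(1)] .
  then have "\<forall>r\<in>A. \<exists>y. y \<in> lspan R M B \<and> r \<odot>\<^bsub>M\<^esub> b \<oplus>\<^bsub>M\<^esub> y \<in> N" by auto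
  then obtain y where y: "\<And>r. r \<in> A \<Longrightarrow> y r \<in> lspan R M B \<and> r \<odot>\<^bsub>M\<^esub> b \<oplus>\<^bsub>M\<^esub> y r \<in> N" by metis
  \<comment> \<open>For each generator of the ideal, one element of \<open>N\<close> that has it as
    coefficient at \<open>b\<close>.\<close>
  define D where "D = (\<lambda>r. r \<odot>\<^bsub>M\<^esub> b \<oplus>\<^bsub>M\<^esub> y r) ` A"
  have D: "finite D" "D \<subseteq> N" "D \<subseteq> carrier M" using y A E(1) by (auto simp: D_def)
  have "A \<subseteq> ?J (lspan R M D)"
  proof
    fix r assume r: "r \<in> A"
    then have "r \<odot>\<^bsub>M\<^esub> b \<oplus>\<^bsub>M\<^esub> y r \<in> lspan R M D"
      by (intro lspan_base[OF D(3)]) (auto simp: D_def)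
    with r A y show "r \<in> ?J (lspan R M D)" by blast
  qed
  \<comment> \<open>The coefficients realised by the span of \<open>D\<close> form an ideal too, and
    it contains the generators \<open>A\<close>; hence every coefficient that occurs in
    \<open>N\<close> already occurs in the span of \<open>D\<close>.\<close>
  then have J: "?J N \<subseteq> ?J (lspan R M D)"
    unfolding A(3) by (intro R.genideal_minimal leading_ideal lspan_submodule D b B)
  have "submodule (N \<inter> lspan R M B) R M"
    using E L submodule_zero[OF N] lspan.zero[of M R B] by (intro submoduleI) auto
  with insert.IH B obtain C where C: "finite C" "C \<subseteq> N \<inter> lspan R M B" "N \<inter> lspan R M B \<subseteq> lspan R M C"
    by (metis inf_le2)
  have CD: "C \<union> D \<subseteq> carrier M" using C D E(1) by auto
  have "x \<in> lspan R M (C \<union> D)" if x: "x \<in> N" for x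
  proof -
    have "\<exists>r\<in>carrier R. \<exists>z\<in>lspan R M B. x = r \<odot>\<^bsub>M\<^esub> b \<oplus>\<^bsub>M\<^esub> z"
    proof -
      have "x \<in> lspan R M (insert b B)" using x insert by auto
      then show ?thesis
      proof induction
        case zero
        then show ?case using b by (intro bexI[of _ \<zero>] bexI[of _ "\<zero>\<^bsub>M\<^esub>"]) (auto intro: lspan.zero)
      next
        case (step r s u)
        then obtain r' z where *: "r' \<in> carrier R" "z \<in> lspan R M B" "u = r' \<odot>\<^bsub>M\<^esub> b \<oplus>\<^bsub>M\<^esub> z" by auto
        have z: "z \<in> carrier M" using * lspan_closed[OF B] by auto
        show ?case
        proof (cases "s = b")
          case True
          have "r \<odot>\<^bsub>M\<^esub> s \<oplus>\<^bsub>M\<^esub> u = (r \<oplus> r') \<odot>\<^bsub>M\<^esub> b \<oplus>\<^bsub>M\<^esub> z"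
            using * step b True z by (simp add: smult_l_distr M.a_assoc)
          then show ?thesis using * step.hyps(1) R.a_closed by blast
        next
          case False
          with step have s: "s \<in> B" "s \<in> carrier M" using B by auto
          then have "r \<odot>\<^bsub>M\<^esub> s \<oplus>\<^bsub>M\<^esub> u = r' \<odot>\<^bsub>M\<^esub> b \<oplus>\<^bsub>M\<^esub> (r \<odot>\<^bsub>M\<^esub> s \<oplus>\<^bsub>M\<^esub> z)"
            using * step b z by (simp add: M.a_ac)
          moreover have "r \<odot>\<^bsub>M\<^esub> s \<oplus>\<^bsub>M\<^esub> z \<in> lspan R M B" using s * step by (auto intro: lspan.step)
          ultimately show ?thesis using *(1) by blast
        qed
      qed
    qed
    then obtain r z where r: "r \<in> carrier R" and z: "z \<in> lspan R M B" and xe: "x = r \<odot>\<^bsub>M\<^esub> b \<oplus>\<^bsub>M\<^esub> z"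
      by auto
    then have "r \<in> ?J N" using x by auto
    then obtain z' where z': "z' \<in> lspan R M B" "r \<odot>\<^bsub>M\<^esub> b \<oplus>\<^bsub>M\<^esub> z' \<in> lspan R M D" using J by blast
    have cl: "z \<in> carrier M" "z' \<in> carrier M" using z z' lspan_closed[OF B] by auto
    \<comment> \<open>\<open>?u\<close> lies in the span of \<open>D\<close> and has the same
      coefficient at \<open>b\<close> as \<open>x\<close>. The difference is \<open>z - z'\<close>,
      which lies both in \<open>N\<close> and in the span of \<open>B\<close>, where
      \<open>C\<close> generates.\<close>
    let ?u = "r \<odot>\<^bsub>M\<^esub> b \<oplus>\<^bsub>M\<^esub> z'"
    have u: "?u \<in> N" using z' lspan_minimal[OF N D(2)] by auto
    have "x \<oplus>\<^bsub>M\<^esub> \<ominus>\<^bsub>M\<^esub> ?u = z \<oplus>\<^bsub>M\<^esub> \<ominus>\<^bsub>M\<^esub> z'"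
    proof -
      have "x \<oplus>\<^bsub>M\<^esub> \<ominus>\<^bsub>M\<^esub> ?u = (r \<odot>\<^bsub>M\<^esub> b \<oplus>\<^bsub>M\<^esub> \<ominus>\<^bsub>M\<^esub> (r \<odot>\<^bsub>M\<^esub> b)) \<oplus>\<^bsub>M\<^esub> (z \<oplus>\<^bsub>M\<^esub> \<ominus>\<^bsub>M\<^esub> z')"
        using r b cl xe by (simp add: M.minus_add M.a_ac)
      then show ?thesis using r b cl by (simp add: M.r_neg)
    qed
    moreover have "x \<oplus>\<^bsub>M\<^esub> \<ominus>\<^bsub>M\<^esub> ?u \<in> N" using x u E by auto
    moreover have "z \<oplus>\<^bsub>M\<^esub> \<ominus>\<^bsub>M\<^esub> z' \<in> lspan R M B" using z z' L by auto
    ultimately have "x \<oplus>\<^bsub>M\<^esub> \<ominus>\<^bsub>M\<^esub> ?u \<in> lspan R M C" using C by auto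
    then have "x \<oplus>\<^bsub>M\<^esub> \<ominus>\<^bsub>M\<^esub> ?u \<in> lspan R M (C \<union> D)" "?u \<in> lspan R M (C \<union> D)"
      using lspan_mono[of C "C \<union> D" R M] lspan_mono[of D "C \<union> D" R M] z' by auto
    from lspan_add[OF CD this] have "x \<oplus>\<^bsub>M\<^esub> \<ominus>\<^bsub>M\<^esub> ?u \<oplus>\<^bsub>M\<^esub> ?u \<in> lspan R M (C \<union> D)" .
    moreover have "x \<in> carrier M" "?u \<in> carrier M" using x u E(1) by blast+
    then have "x \<oplus>\<^bsub>M\<^esub> \<ominus>\<^bsub>M\<^esub> ?u \<oplus>\<^bsub>M\<^esub> ?u = x" by (metis M.a_assoc M.a_inv_closed M.l_neg M.r_zero)
    ultimately show ?thesis by simp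
  qed
  then show ?case using C D by (intro exI[of _ "C \<union> D"]) auto
qed

lemma fg_submodule_noetherian:
  assumes "noetherian_ring R" and "submodule N R M"
    and "finite B" and "B \<subseteq> carrier M" and "N \<subseteq> lspan R M B"
  shows "fg_module R (M\<lparr>carrier := N\<rparr>)"
  using noetherian_submodule[OF assms(1,3,4,2,5)] fg_submodule_iff[OF assms(2)] by auto

end

section \<open>Quotients, free modules and dual bases\<close>

lemma finsum_regular_module [simp]: "finsum (regular_module R) = finsum R"
  by (intro ext) (simp add: finsum_def finprod_def regular_module_def)

lemma regular_module_simps [simp]:
  "carrier (regular_module R) = carrier R"
  "\<zero>\<^bsub>regular_module R\<^esub> = \<zero>\<^bsub>R\<^esub>"
  "x \<oplus>\<^bsub>regular_module R\<^esub> y = x \<oplus>\<^bsub>R\<^esub> y"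
  "x \<odot>\<^bsub>regular_module R\<^esub> y = x \<otimes>\<^bsub>R\<^esub> y"
  by (simp_all add: regular_module_def)

lemma (in cring) regular_module: "module R (regular_module R)"
proof (rule moduleI[OF is_cring])
  show "abelian_group (regular_module R)"
  proof (rule abelian_groupI)
    fix x assume "x \<in> carrier (regular_module R)"
    then show "\<exists>y\<in>carrier (regular_module R). y \<oplus>\<^bsub>regular_module R\<^esub> x = \<zero>\<^bsub>regular_module R\<^esub>"
      by (intro bexI[of _ "\<ominus> x"]) (auto simp: l_neg)
  qed (simp_all add: a_ac)
qed (simp_all add: m_assoc l_distr r_distr)

section \<open>Quotient modules\<close>

context module
begin

lemma submodule_abelian_subgroup: "submodule N R M \<Longrightarrow> abelian_subgroup N M"
  by (intro abelian_subgroupI3 additive_subgroup.intro submodule.axioms(1))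
    (auto simp: M.abelian_group_axioms)

lemma coset_eq_iff:
  assumes N: "submodule N R M" and x: "x \<in> carrier M" and y: "y \<in> carrier M"
  shows "N +>\<^bsub>M\<^esub> x = N +>\<^bsub>M\<^esub> y \<longleftrightarrow> x \<ominus>\<^bsub>M\<^esub> y \<in> N"
proof -
  interpret N: abelian_subgroup N M by (rule submodule_abelian_subgroup[OF N])
  have "x \<in> N +>\<^bsub>M\<^esub> y \<longleftrightarrow> x \<ominus>\<^bsub>M\<^esub> y \<in> N" using N.a_rcos_module x y by (simp add: a_minus_def)
  then show ?thesis
    using N.a_rcos_self[OF x] M.a_repr_independence[OF _ y N.a_subgroup] by metis
qed

lemma coset_eq_zero_iff:
  assumes N: "submodule N R M" and x: "x \<in> carrier M"
  shows "N +>\<^bsub>M\<^esub> x = N \<longleftrightarrow> x \<in> N"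
  using coset_eq_iff[OF N x M.zero_closed] M.a_coset_add_zero[OF submoduleE(1)[OF N]] x
    M.minus_equality[of "\<zero>\<^bsub>M\<^esub>" "\<zero>\<^bsub>M\<^esub>"]
  by (simp add: a_minus_def)

lemma quotient_module_carrier: "carrier (quotient_module M N) = (\<lambda>x. N +>\<^bsub>M\<^esub> x) ` carrier M"
  by (auto simp: quotient_module_def A_RCOSETS_def RCOSETS_def a_r_coset_def)

lemma quotient_module_add:
  assumes N: "submodule N R M" and "x \<in> carrier M" and "y \<in> carrier M"
  shows "(N +>\<^bsub>M\<^esub> x) \<oplus>\<^bsub>quotient_module M N\<^esub> (N +>\<^bsub>M\<^esub> y) = N +>\<^bsub>M\<^esub> (x \<oplus>\<^bsub>M\<^esub> y)"
  using abelian_subgroup.a_rcos_sum[OF submodule_abelian_subgroup[OF N] assms(2,3)]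
  by (simp add: quotient_module_def)

lemma quotient_module_smult:
  assumes N: "submodule N R M" and r: "r \<in> carrier R" and x: "x \<in> carrier M"
  shows "r \<odot>\<^bsub>quotient_module M N\<^esub> (N +>\<^bsub>M\<^esub> x) = N +>\<^bsub>M\<^esub> (r \<odot>\<^bsub>M\<^esub> x)"
proof -
  interpret N: abelian_subgroup N M by (rule submodule_abelian_subgroup[OF N])
  have "N +>\<^bsub>M\<^esub> (r \<odot>\<^bsub>M\<^esub> y) = N +>\<^bsub>M\<^esub> (r \<odot>\<^bsub>M\<^esub> x)" if y: "y \<in> N +>\<^bsub>M\<^esub> x" for y
  proof -
    have yM: "y \<in> carrier M" using y M.a_r_coset_subset_G[OF N.a_subset x] by auto
    have "y \<ominus>\<^bsub>M\<^esub> x \<in> N" using N.a_rcos_module x y yM by (simp add: a_minus_def)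
    then have "r \<odot>\<^bsub>M\<^esub> (y \<ominus>\<^bsub>M\<^esub> x) \<in> N" using submoduleE(4)[OF N] r by auto
    then show ?thesis
      using coset_eq_iff[OF N] r x yM by (simp add: a_minus_def smult_r_distr smult_r_minus)
  qed
  \<comment> \<open>The union in the definition of the scalar action ranges over a nonempty family
    of equal cosets.\<close>
  then have "(\<Union>y\<in>N +>\<^bsub>M\<^esub> x. N +>\<^bsub>M\<^esub> (r \<odot>\<^bsub>M\<^esub> y)) = (\<Union>y\<in>N +>\<^bsub>M\<^esub> x. N +>\<^bsub>M\<^esub> (r \<odot>\<^bsub>M\<^esub> x))"
    by simp
  also have "\<dots> = N +>\<^bsub>M\<^esub> (r \<odot>\<^bsub>M\<^esub> x)" using N.a_rcos_self[OF x] by blast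
  finally show ?thesis by (simp add: quotient_module_def)
qed

lemma quotient_module_module:
  assumes N: "submodule N R M"
  shows "module R (quotient_module M N)"
proof -
  let ?Q = "quotient_module M N"
  note s = quotient_module_carrier quotient_module_add[OF N] quotient_module_smult[OF N]
  have zero: "\<zero>\<^bsub>?Q\<^esub> = N +>\<^bsub>M\<^esub> \<zero>\<^bsub>M\<^esub>"
    using M.a_coset_add_zero[OF submoduleE(1)[OF N]] by (simp add: quotient_module_def)
  have "abelian_group ?Q"
  proof (rule abelian_groupI)
    fix x assume "x \<in> carrier ?Q"
    then obtain u where "u \<in> carrier M" "x = N +>\<^bsub>M\<^esub> u" by (auto simp: s)
    then show "\<exists>y\<in>carrier ?Q. y \<oplus>\<^bsub>?Q\<^esub> x = \<zero>\<^bsub>?Q\<^esub>"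
      by (intro bexI[of _ "N +>\<^bsub>M\<^esub> (\<ominus>\<^bsub>M\<^esub> u)"]) (auto simp: s zero M.l_neg)
  qed (auto simp: s zero M.a_ac)
  then show ?thesis
    by (rule moduleI[OF R.is_cring]) (auto simp: s smult_l_distr smult_r_distr smult_assoc1)
qed

lemma quotient_proj_linear:
  "submodule N R M \<Longrightarrow> (\<lambda>x. N +>\<^bsub>M\<^esub> x) \<in> linear_maps R M (quotient_module M N)"
  by (rule linear_mapsI) (auto simp: quotient_module_carrier quotient_module_add quotient_module_smult)

text \<open>The span of the images is the image of the span, so finitely many generators of the
  quotient can be lifted. Afterwards finite generation is a statement about representatives modulo
  \<open>N\<close>.\<close>

lemma quotient_fg_iff:
  assumes N: "submodule N R M"
  shows "fg_module R (quotient_module M N) \<longleftrightarrow>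
    (\<exists>B. finite B \<and> B \<subseteq> carrier M \<and> (\<forall>x\<in>carrier M. \<exists>y\<in>lspan R M B. x \<ominus>\<^bsub>M\<^esub> y \<in> N))"
    (is "?L \<longleftrightarrow> ?R")
proof -
  let ?Q = "quotient_module M N"
  let ?\<pi> = "\<lambda>x. N +>\<^bsub>M\<^esub> x"
  interpret Q: module R ?Q by (rule quotient_module_module[OF N])
  note im = lspan_linear_image[OF Q.module_axioms quotient_proj_linear[OF N]]
  have *: "carrier ?Q \<subseteq> lspan R ?Q (?\<pi> ` B) \<longleftrightarrow> (\<forall>x\<in>carrier M. \<exists>y\<in>lspan R M B. x \<ominus>\<^bsub>M\<^esub> y \<in> N)"
    if B: "B \<subseteq> carrier M" for B
  proof -
    have "?\<pi> x \<in> ?\<pi> ` lspan R M B \<longleftrightarrow> (\<exists>y\<in>lspan R M B. x \<ominus>\<^bsub>M\<^esub> y \<in> N)" if "x \<in> carrier M" for x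
      using coset_eq_iff[OF N that] lspan_closed[OF B] by (auto simp: image_iff)
    then show ?thesis by (auto simp: im[OF B, symmetric] quotient_module_carrier subset_iff)
  qed
  show ?thesis
  proof
    assume ?L
    then obtain B where B: "finite B" "B \<subseteq> ?\<pi> ` carrier M" "carrier ?Q \<subseteq> lspan R ?Q B"
      by (auto simp: Q.fg_module_iff quotient_module_carrier)
    then obtain C where "C \<subseteq> carrier M" "finite C" "B = ?\<pi> ` C"
      by (meson finite_subset_image)
    with B * show ?R by metis
  next
    assume ?R
    then obtain B where B: "finite B" "B \<subseteq> carrier M" "carrier ?Q \<subseteq> lspan R ?Q (?\<pi> ` B)"
      using * by metis
    then show ?L
      unfolding Q.fg_module_iff
      by (intro exI[of _ "?\<pi> ` B"]) (auto simp: quotient_module_carrier)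
  qed
qed

end

section \<open>Free modules and linear extension from a basis\<close>

definition unit_vec :: "('a, 'r) ring_scheme \<Rightarrow> 'x set \<Rightarrow> 'x \<Rightarrow> 'x \<Rightarrow> 'a"
  where "unit_vec R B x = (\<lambda>y\<in>B. if y = x then \<one>\<^bsub>R\<^esub> else \<zero>\<^bsub>R\<^esub>)"

text \<open>The linear extension of \<open>u\<close> from the basis. The sum runs over the support
  because \<open>B\<close> may be infinite, and a \<open>finsum\<close> over an infinite set is zero
  by convention.\<close>

definition free_lift ::
    "('a, 'r) ring_scheme \<Rightarrow> 'x set \<Rightarrow> ('a, 'b, 'm) module_scheme \<Rightarrow> ('x \<Rightarrow> 'b) \<Rightarrow> ('x \<Rightarrow> 'a) \<Rightarrow> 'b"
  where "free_lift R B N u f = (\<Oplus>\<^bsub>N\<^esub>x\<in>{x \<in> B. f x \<noteq> \<zero>\<^bsub>R\<^esub>}. f x \<odot>\<^bsub>N\<^esub> u x)"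

lemma free_module_simps:
  "carrier (free_module R B) = {f \<in> B \<rightarrow>\<^sub>E carrier R. finite {x \<in> B. f x \<noteq> \<zero>\<^bsub>R\<^esub>}}"
  "\<zero>\<^bsub>free_module R B\<^esub> = (\<lambda>x\<in>B. \<zero>\<^bsub>R\<^esub>)"
  "f \<oplus>\<^bsub>free_module R B\<^esub> g = (\<lambda>x\<in>B. f x \<oplus>\<^bsub>R\<^esub> g x)"
  "r \<odot>\<^bsub>free_module R B\<^esub> f = (\<lambda>x\<in>B. r \<otimes>\<^bsub>R\<^esub> f x)"
  by (simp_all add: free_module_def)

lemma free_module_mem: "f \<in> carrier (free_module R B) \<Longrightarrow> x \<in> B \<Longrightarrow> f x \<in> carrier R"
  by (auto simp: free_module_simps)

context cring
begin

lemma free_module_module: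
  fixes B :: "'x set"
  shows "module R (free_module R B)"
proof -
  have add: "finite {x \<in> B. f x \<oplus> g x \<noteq> \<zero>}"
    if "finite {x \<in> B. f x \<noteq> \<zero>}" "finite {x \<in> B. g x \<noteq> \<zero>}" for f g :: "'x \<Rightarrow> 'a"
    by (rule finite_subset[of _ "{x \<in> B. f x \<noteq> \<zero>} \<union> {x \<in> B. g x \<noteq> \<zero>}"]) (use that in auto)
  have smult: "finite {x \<in> B. r \<otimes> f x \<noteq> \<zero>}"
    if "finite {x \<in> B. f x \<noteq> \<zero>}" "r \<in> carrier R" for f :: "'x \<Rightarrow> 'a" and r
    by (rule finite_subset[OF _ that(1)]) (use that in auto)
  have neg: "finite {x \<in> B. \<ominus> f x \<noteq> \<zero>}"
    if "finite {x \<in> B. f x \<noteq> \<zero>}" for f :: "'x \<Rightarrow> 'a"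
    by (rule finite_subset[OF _ that(1)]) auto
  let ?F = "free_module R B"
  have mem: "f x \<in> carrier R" if "f \<in> carrier ?F" "x \<in> B" for f x
    using that by (auto simp: free_module_simps)
  \<comment> \<open>Elements are extensional on \<open>B\<close>, so every module law can be checked
    coordinate by coordinate.\<close>
  have eqI: "f = g" if "f \<in> carrier ?F" "g \<in> carrier ?F" "\<And>x. x \<in> B \<Longrightarrow> f x = g x" for f g
    using that by (auto simp: free_module_simps intro: PiE_ext)
  have carI: "(\<lambda>x\<in>B. h x) \<in> carrier ?F"
    if "\<And>x. x \<in> B \<Longrightarrow> h x \<in> carrier R" "finite {x \<in> B. h x \<noteq> \<zero>}" for h
  proof -
    have "{x \<in> B. (\<lambda>x\<in>B. h x) x \<noteq> \<zero>} = {x \<in> B. h x \<noteq> \<zero>}" by auto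
    then show ?thesis using that by (auto simp: free_module_simps)
  qed
  have fin: "finite {x \<in> B. f x \<noteq> \<zero>}" if "f \<in> carrier ?F" for f
    using that by (simp add: free_module_simps)
  have add_cl: "f \<oplus>\<^bsub>?F\<^esub> g \<in> carrier ?F" if "f \<in> carrier ?F" "g \<in> carrier ?F" for f g
    unfolding free_module_simps(3) using that by (intro carI add fin a_closed mem)
  have smult_cl: "r \<odot>\<^bsub>?F\<^esub> f \<in> carrier ?F" if "r \<in> carrier R" "f \<in> carrier ?F" for r f
    unfolding free_module_simps(4)
    using that by (intro carI smult m_closed) (auto intro: fin mem)
  have zero_cl: "\<zero>\<^bsub>?F\<^esub> \<in> carrier ?F"
    unfolding free_module_simps(2) by (intro carI) auto
  have neg_cl: "(\<lambda>x\<in>B. \<ominus> f x) \<in> carrier ?F" if "f \<in> carrier ?F" for f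
    using that by (intro carI neg fin a_inv_closed mem)
  note cl = add_cl smult_cl zero_cl
  have ab: "abelian_group ?F"
  proof (rule abelian_groupI)
    fix f assume f: "f \<in> carrier ?F"
    show "\<exists>g\<in>carrier ?F. g \<oplus>\<^bsub>?F\<^esub> f = \<zero>\<^bsub>?F\<^esub>"
    proof (rule bexI[of _ "\<lambda>x\<in>B. \<ominus> f x"])
      show "(\<lambda>x\<in>B. \<ominus> f x) \<oplus>\<^bsub>?F\<^esub> f = \<zero>\<^bsub>?F\<^esub>"
        by (rule eqI[OF add_cl[OF neg_cl[OF f] f] zero_cl]) (simp add: free_module_simps mem[OF f] l_neg)
    qed (rule neg_cl[OF f])
    show "\<zero>\<^bsub>?F\<^esub> \<oplus>\<^bsub>?F\<^esub> f = f"
      by (rule eqI, intro cl f, rule f, simp add: free_module_simps mem[OF f])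
    fix g assume g: "g \<in> carrier ?F"
    show "f \<oplus>\<^bsub>?F\<^esub> g = g \<oplus>\<^bsub>?F\<^esub> f"
      by (rule eqI, intro cl f g, intro cl f g, simp add: free_module_simps mem[OF f] mem[OF g] a_comm)
    fix h assume h: "h \<in> carrier ?F"
    show "f \<oplus>\<^bsub>?F\<^esub> g \<oplus>\<^bsub>?F\<^esub> h = f \<oplus>\<^bsub>?F\<^esub> (g \<oplus>\<^bsub>?F\<^esub> h)"
      by (rule eqI, intro cl f g h, intro cl f g h, simp add: free_module_simps mem[OF f] mem[OF g] mem[OF h] a_assoc)
  qed (intro cl; assumption)+
  show ?thesis
  proof (rule moduleI[OF is_cring ab])
    fix r f assume r: "r \<in> carrier R" and f: "f \<in> carrier ?F"
    show "r \<odot>\<^bsub>?F\<^esub> f \<in> carrier ?F" by (intro cl r f)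
    fix s assume s: "s \<in> carrier R"
    show "(r \<oplus> s) \<odot>\<^bsub>?F\<^esub> f = r \<odot>\<^bsub>?F\<^esub> f \<oplus>\<^bsub>?F\<^esub> s \<odot>\<^bsub>?F\<^esub> f"
      by (rule eqI, intro cl f a_closed r s, intro cl f r s, simp add: free_module_simps mem[OF f] r s l_distr)
    show "(r \<otimes> s) \<odot>\<^bsub>?F\<^esub> f = r \<odot>\<^bsub>?F\<^esub> (s \<odot>\<^bsub>?F\<^esub> f)"
      by (rule eqI, intro cl f m_closed r s, intro cl f r s, simp add: free_module_simps mem[OF f] r s m_assoc)
  next
    fix r f g assume r: "r \<in> carrier R" and f: "f \<in> carrier ?F" and g: "g \<in> carrier ?F"
    show "r \<odot>\<^bsub>?F\<^esub> (f \<oplus>\<^bsub>?F\<^esub> g) = r \<odot>\<^bsub>?F\<^esub> f \<oplus>\<^bsub>?F\<^esub> r \<odot>\<^bsub>?F\<^esub> g"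
      by (rule eqI, intro cl f g r, intro cl f g r, simp add: free_module_simps mem[OF f] mem[OF g] r r_distr)
  next
    fix f assume f: "f \<in> carrier ?F"
    show "\<one> \<odot>\<^bsub>?F\<^esub> f = f"
      by (rule eqI, intro cl f one_closed, rule f, simp add: free_module_simps mem[OF f])
  qed
qed

lemma unit_vec_closed: "x \<in> B \<Longrightarrow> unit_vec R B x \<in> carrier (free_module R B)"
proof -
  assume "x \<in> B"
  have "finite {y \<in> B. unit_vec R B x y \<noteq> \<zero>}"
    by (rule finite_subset[of _ "{x}"]) (auto simp: unit_vec_def)
  then show ?thesis by (auto simp: free_module_simps unit_vec_def)
qed

lemma free_module_coord_linear:
  "x \<in> B \<Longrightarrow> (\<lambda>f. f x) \<in> linear_maps R (free_module R B) (regular_module R)"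
  by (rule linear_mapsI) (auto simp: free_module_simps)

lemma free_module_finsum_apply:
  assumes "x \<in> B" and "h \<in> I \<rightarrow> carrier (free_module R B)"
  shows "(\<Oplus>\<^bsub>free_module R B\<^esub>i\<in>I. h i) x = (\<Oplus>i\<in>I. h i x)"
  using linear_maps_finsum[OF free_module_module regular_module free_module_coord_linear[OF assms(1)] assms(2)]
  by simp

text \<open>\<open>S\<close> may exceed the support, so that a single index set can serve many
  elements at once, as in \<open>free_module_span\<close> and
  \<open>dual_basis_exists\<close>.\<close>

lemma free_module_expansion:
  assumes f: "f \<in> carrier (free_module R B)" and S: "finite S" "S \<subseteq> B" "{x \<in> B. f x \<noteq> \<zero>} \<subseteq> S"
  shows "f = (\<Oplus>\<^bsub>free_module R B\<^esub>x\<in>S. f x \<odot>\<^bsub>free_module R B\<^esub> unit_vec R B x)"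
    (is "_ = ?r")
proof -
  interpret F: module R "free_module R B" by (rule free_module_module)
  have fx: "f x \<in> carrier R" if "x \<in> B" for x using f that by (auto simp: free_module_simps)
  have cl: "(\<lambda>x. f x \<odot>\<^bsub>free_module R B\<^esub> unit_vec R B x) \<in> S \<rightarrow> carrier (free_module R B)"
    using fx S(2) by (intro Pi_I F.smult_closed unit_vec_closed) auto
  have r: "?r \<in> carrier (free_module R B)" using cl by (rule F.finsum_closed)
  show ?thesis
  proof (rule PiE_ext)
    show "f \<in> B \<rightarrow>\<^sub>E carrier R" "?r \<in> B \<rightarrow>\<^sub>E carrier R" using f r by (auto simp: free_module_simps)
    fix y assume y: "y \<in> B"
    have "?r y = (\<Oplus>x\<in>S. f x \<otimes> unit_vec R B x y)"
      using y by (subst free_module_finsum_apply[OF y cl]) (simp add: free_module_simps)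
    also have "\<dots> = (\<Oplus>x\<in>S. if y = x then f x else \<zero>)"
      using S fx y by (intro finsum_cong') (auto simp: unit_vec_def subset_iff)
    also have "\<dots> = f y"
    proof (cases "y \<in> S")
      case True
      then show ?thesis using S fx by (subst add.finprod_singleton) auto
    next
      case False
      then have "f y = \<zero>" using S y by auto
      moreover have "(\<Oplus>x\<in>S. if y = x then f x else \<zero>) = \<zero>"
        using False by (intro add.finprod_one_eqI) auto
      ultimately show ?thesis by simp
    qed
    finally show "f y = ?r y" by simp
  qed
qed

lemma free_module_induct [consumes 1, case_names zero unit add]:
  assumes f: "f \<in> carrier (free_module R B)"
    and zero: "P \<zero>\<^bsub>free_module R B\<^esub>"
    and unit: "\<And>r x. r \<in> carrier R \<Longrightarrow> x \<in> B \<Longrightarrow> P (r \<odot>\<^bsub>free_module R B\<^esub> unit_vec R B x)"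
    and add: "\<And>f g. f \<in> carrier (free_module R B) \<Longrightarrow> g \<in> carrier (free_module R B) \<Longrightarrow> P f \<Longrightarrow> P g
      \<Longrightarrow> P (f \<oplus>\<^bsub>free_module R B\<^esub> g)"
  shows "P f"
proof -
  interpret F: module R "free_module R B" by (rule free_module_module)
  have "P (\<Oplus>\<^bsub>free_module R B\<^esub>x\<in>S. f x \<odot>\<^bsub>free_module R B\<^esub> unit_vec R B x)"
    if "finite S" "S \<subseteq> B" for S
    using that
  proof (induction S)
    case empty
    then show ?case using zero by simp
  next
    case (insert x S)
    have cl: "f y \<odot>\<^bsub>free_module R B\<^esub> unit_vec R B y \<in> carrier (free_module R B)" if "y \<in> B" for y
      using that f by (intro F.smult_closed unit_vec_closed) (auto simp: free_module_simps)
    have fx: "f x \<in> carrier R" using f insert by (auto simp: free_module_simps)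
    have "(\<lambda>y. f y \<odot>\<^bsub>free_module R B\<^esub> unit_vec R B y) \<in> S \<rightarrow> carrier (free_module R B)"
      using insert cl by blast
    with insert cl show ?case
      by (subst F.finsum_insert) (auto intro!: add unit fx F.finsum_closed)
  qed
  from this[of "{x \<in> B. f x \<noteq> \<zero>}"] free_module_expansion[OF f] f
  show ?thesis by (auto simp: free_module_simps)
qed

end

context module
begin

text \<open>The supports of two functions and of their sum differ, so additivity can only be seen
  after all sums have been extended to one finite set; the additional terms vanish.\<close>

lemma free_lift_superset:
  assumes f: "f \<in> carrier (free_module R B)" and u: "u \<in> B \<rightarrow> carrier M"
    and S: "finite S" "S \<subseteq> B" "{x \<in> B. f x \<noteq> \<zero>} \<subseteq> S"
  shows "free_lift R B M u f = (\<Oplus>\<^bsub>M\<^esub>x\<in>S. f x \<odot>\<^bsub>M\<^esub> u x)"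
proof -
  have c: "f x \<in> carrier R" "u x \<in> carrier M" if "x \<in> B" for x
    using u that free_module_mem[OF f] by auto
  have "f x \<odot>\<^bsub>M\<^esub> u x = \<zero>\<^bsub>M\<^esub>" if "x \<in> S - {x \<in> B. f x \<noteq> \<zero>}" for x
  proof -
    have "f x = \<zero>" "u x \<in> carrier M" using that S(2) c by auto
    then show ?thesis by simp
  qed
  moreover have "(\<lambda>x. f x \<odot>\<^bsub>M\<^esub> u x) \<in> S \<rightarrow> carrier M" using c S(2) by (intro Pi_I smult_closed) auto
  ultimately show ?thesis
    unfolding free_lift_def by (intro M.add.finprod_mono_neutral_cong_left S(1,3)) simp_all
qed

lemma free_lift_linear:
  assumes u: "u \<in> B \<rightarrow> carrier M"
  shows "free_lift R B M u \<in> linear_maps R (free_module R B) M"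
proof (rule linear_mapsI)
  interpret F: module R "free_module R B" by (rule R.free_module_module)
  let ?F = "free_module R B"
  fix f assume f: "f \<in> carrier ?F"
  then have fS: "finite {x \<in> B. f x \<noteq> \<zero>}" by (simp add: free_module_simps)
  show "free_lift R B M u f \<in> carrier M"
    unfolding free_lift_def
  proof (intro M.finsum_closed Pi_I smult_closed)
    fix x assume "x \<in> {x \<in> B. f x \<noteq> \<zero>}"
    then show "f x \<in> carrier R" "u x \<in> carrier M" using f u by (auto simp: free_module_simps)
  qed
  {
    fix g assume g: "g \<in> carrier ?F"
    then have gS: "finite {x \<in> B. g x \<noteq> \<zero>}" by (simp add: free_module_simps)
    let ?S = "{x \<in> B. f x \<noteq> \<zero>} \<union> {x \<in> B. g x \<noteq> \<zero>}"
    have fg: "f \<oplus>\<^bsub>?F\<^esub> g \<in> carrier ?F" using f g by (rule F.add.m_closed)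
    have c: "f x \<in> carrier R" "g x \<in> carrier R" "u x \<in> carrier M" if "x \<in> B" for x
      using f g u that by (auto simp: free_module_simps)
    have "free_lift R B M u (f \<oplus>\<^bsub>?F\<^esub> g) = (\<Oplus>\<^bsub>M\<^esub>x\<in>?S. (f \<oplus>\<^bsub>?F\<^esub> g) x \<odot>\<^bsub>M\<^esub> u x)"
      using fS gS by (intro free_lift_superset fg u) (auto simp: free_module_simps)
    also have "\<dots> = (\<Oplus>\<^bsub>M\<^esub>x\<in>?S. f x \<odot>\<^bsub>M\<^esub> u x \<oplus>\<^bsub>M\<^esub> g x \<odot>\<^bsub>M\<^esub> u x)"
      using c by (intro M.finsum_cong') (auto simp: smult_l_distr free_module_simps)
    also have "\<dots> = (\<Oplus>\<^bsub>M\<^esub>x\<in>?S. f x \<odot>\<^bsub>M\<^esub> u x) \<oplus>\<^bsub>M\<^esub> (\<Oplus>\<^bsub>M\<^esub>x\<in>?S. g x \<odot>\<^bsub>M\<^esub> u x)"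
      using c by (intro M.finsum_addf) auto
    also have "(\<Oplus>\<^bsub>M\<^esub>x\<in>?S. f x \<odot>\<^bsub>M\<^esub> u x) = free_lift R B M u f"
      using fS gS by (intro free_lift_superset[symmetric] f u) auto
    also have "(\<Oplus>\<^bsub>M\<^esub>x\<in>?S. g x \<odot>\<^bsub>M\<^esub> u x) = free_lift R B M u g"
      using fS gS by (intro free_lift_superset[symmetric] g u) auto
    finally show "free_lift R B M u (f \<oplus>\<^bsub>?F\<^esub> g) = free_lift R B M u f \<oplus>\<^bsub>M\<^esub> free_lift R B M u g" .
  }
  fix r assume r: "r \<in> carrier R"
  let ?S = "{x \<in> B. f x \<noteq> \<zero>}"
  have c: "f x \<in> carrier R" "u x \<in> carrier M" if "x \<in> B" for x
    using u that free_module_mem[OF f] by auto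
  have "free_lift R B M u (r \<odot>\<^bsub>?F\<^esub> f) = (\<Oplus>\<^bsub>M\<^esub>x\<in>?S. (r \<odot>\<^bsub>?F\<^esub> f) x \<odot>\<^bsub>M\<^esub> u x)"
    using fS r by (intro free_lift_superset F.smult_closed f u) (auto simp: free_module_simps)
  also have "\<dots> = (\<Oplus>\<^bsub>M\<^esub>x\<in>?S. r \<odot>\<^bsub>M\<^esub> (f x \<odot>\<^bsub>M\<^esub> u x))"
    using c r by (intro M.finsum_cong' refl Pi_I) (auto simp: smult_assoc1 free_module_simps)
  also have "\<dots> = r \<odot>\<^bsub>M\<^esub> free_lift R B M u f"
    unfolding free_lift_def using c r fS by (intro finsum_smult_ldistr[symmetric]) auto
  finally show "free_lift R B M u (r \<odot>\<^bsub>?F\<^esub> f) = r \<odot>\<^bsub>M\<^esub> free_lift R B M u f" .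
qed

lemma free_lift_unit:
  assumes u: "u \<in> B \<rightarrow> carrier M" and x: "x \<in> B"
  shows "free_lift R B M u (unit_vec R B x) = u x"
proof -
  have "free_lift R B M u (unit_vec R B x) = (\<Oplus>\<^bsub>M\<^esub>y\<in>{x}. unit_vec R B x y \<odot>\<^bsub>M\<^esub> u y)"
    using x by (intro free_lift_superset R.unit_vec_closed u) (auto simp: unit_vec_def)
  also have "\<dots> = u x" using u x by (simp add: unit_vec_def Pi_iff)
  finally show ?thesis .
qed

lemma free_module_linear_eq:
  assumes f: "f \<in> linear_maps R (free_module R B) M" and g: "g \<in> linear_maps R (free_module R B) M"
    and eq: "\<And>x. x \<in> B \<Longrightarrow> f (unit_vec R B x) = g (unit_vec R B x)"
    and v: "v \<in> carrier (free_module R B)"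
  shows "f v = g v"
  using v
proof (induction rule: R.free_module_induct)
  case zero
  show ?case
    using linear_maps_zero[OF R.free_module_module module_axioms f]
      linear_maps_zero[OF R.free_module_module module_axioms g] by simp
next
  case (unit r x)
  then show ?case
    using linear_mapsD(3)[OF f] linear_mapsD(3)[OF g] eq R.unit_vec_closed by metis
next
  case (add v w)
  then show ?case using linear_mapsD(2)[OF f] linear_mapsD(2)[OF g] by metis
qed

text \<open>Let \<open>M\<close> be a retract of a free module. The section sends the finitely many
  generators of \<open>M\<close> to vectors with finite support, so it meets finitely many
  coordinates only. These coordinates, with the images of the corresponding unit vectors under the
  retraction, are a finite dual basis.\<close>

lemma dual_basis_exists:
  assumes "fg_module R M" and "projective_module R M"
  obtains I :: "'c set" and b \<phi> where "finite I" and "b \<in> I \<rightarrow> carrier M"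
    and "\<And>i. i \<in> I \<Longrightarrow> \<phi> i \<in> linear_maps R M (regular_module R)"
    and "\<And>x. x \<in> carrier M \<Longrightarrow> x = (\<Oplus>\<^bsub>M\<^esub>i\<in>I. \<phi> i x \<odot>\<^bsub>M\<^esub> b i)"
proof -
  obtain B :: "'c set" and \<iota> p where \<iota>: "\<iota> \<in> linear_maps R M (free_module R B)"
    and p: "p \<in> linear_maps R (free_module R B) M" and p\<iota>: "\<And>x. x \<in> carrier M \<Longrightarrow> p (\<iota> x) = x"
    using assms(2) by (auto simp: projective_module_def)
  obtain C where C: "finite C" "C \<subseteq> carrier M" "carrier M \<subseteq> lspan R M C"
    using assms(1) by (auto simp: fg_module_iff)
  let ?F = "free_module R B"
  interpret F: module R ?F by (rule R.free_module_module)
  \<comment> \<open>The coordinates met by the generators. A coordinate outside \<open>I\<close> is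
    a functional that vanishes on generators, hence on all of \<open>M\<close>.\<close>
  define I where "I = (\<Union>c\<in>C. {y \<in> B. \<iota> c y \<noteq> \<zero>})"
  have \<iota>F: "\<iota> x \<in> carrier ?F" if "x \<in> carrier M" for x using that linear_mapsD(1)[OF \<iota>] by blast
  have I: "finite I" "I \<subseteq> B" using C \<iota>F by (auto simp: I_def free_module_simps)
  have coord: "(\<lambda>x. \<iota> x y) \<in> linear_maps R M (regular_module R)" if "y \<in> B" for y
    by (rule linear_maps_comp[OF \<iota> R.free_module_coord_linear[OF that]])
  have supp: "\<iota> x y = \<zero>" if "x \<in> carrier M" "y \<in> B" "y \<notin> I" for x y
  proof -
    have "x \<in> lspan R M C" using C that by auto
    then show ?thesis
    proof induction
      case zero
      show ?case using linear_maps_zero[OF module_axioms R.regular_module coord[OF that(2)]]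
        by simp
    next
      case (step r s z)
      then have "s \<in> carrier M" "z \<in> carrier M" "\<iota> s y = \<zero>"
        using C lspan_closed[OF C(2)] that by (auto simp: I_def)
      with step show ?case
        using linear_mapsD(2,3)[OF coord[OF that(2)]] by simp
    qed
  qed
  have exp: "x = (\<Oplus>\<^bsub>M\<^esub>i\<in>I. \<iota> x i \<odot>\<^bsub>M\<^esub> p (unit_vec R B i))" if x: "x \<in> carrier M" for x
  proof -
    have c: "\<iota> x i \<in> carrier R" if "i \<in> I" for i
      using linear_mapsD(1)[OF coord x] that I by auto
    have cl: "(\<lambda>i. \<iota> x i \<odot>\<^bsub>?F\<^esub> unit_vec R B i) \<in> I \<rightarrow> carrier ?F"
      using c I by (intro Pi_I F.smult_closed R.unit_vec_closed) auto
    have "x = p (\<iota> x)" using p\<iota> x by simp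
    also have "\<iota> x = (\<Oplus>\<^bsub>?F\<^esub>i\<in>I. \<iota> x i \<odot>\<^bsub>?F\<^esub> unit_vec R B i)"
      using supp x by (intro R.free_module_expansion \<iota>F I) auto
    also have "p \<dots> = (\<Oplus>\<^bsub>M\<^esub>i\<in>I. p (\<iota> x i \<odot>\<^bsub>?F\<^esub> unit_vec R B i))"
      by (rule linear_maps_finsum[OF F.module_axioms module_axioms p cl])
    also have "\<dots> = (\<Oplus>\<^bsub>M\<^esub>i\<in>I. \<iota> x i \<odot>\<^bsub>M\<^esub> p (unit_vec R B i))"
    proof (intro M.finsum_cong' refl)
      show "(\<lambda>i. \<iota> x i \<odot>\<^bsub>M\<^esub> p (unit_vec R B i)) \<in> I \<rightarrow> carrier M"
        using c I linear_mapsD(1)[OF p R.unit_vec_closed] by auto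
      show "p (\<iota> x i \<odot>\<^bsub>?F\<^esub> unit_vec R B i) = \<iota> x i \<odot>\<^bsub>M\<^esub> p (unit_vec R B i)" if "i \<in> I" for i
        using that I c by (intro linear_mapsD(3)[OF p] R.unit_vec_closed) auto
    qed
    finally show ?thesis .
  qed
  show ?thesis
  proof (rule that[OF I(1)])
    show "(\<lambda>i. p (unit_vec R B i)) \<in> I \<rightarrow> carrier M"
      using I(2) linear_mapsD(1)[OF p R.unit_vec_closed] by auto
    show "(\<lambda>x. \<iota> x i) \<in> linear_maps R M (regular_module R)" if "i \<in> I" for i
      using coord I(2) that by auto
  qed (rule exp)
qed

text \<open>The section sends \<open>x\<close> to the combination of unit vectors with coefficients
  \<open>\<phi> i x\<close>. The free module is taken over the set of vectors \<open>b i\<close>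
  itself, as \<open>projective_module\<close> demands index sets of elements of \<open>M\<close>; if
  \<open>b\<close> repeats a vector, the contributions of its indices simply add up.\<close>

lemma dual_basis_fg_projective:
  assumes I: "finite I" and b: "b \<in> I \<rightarrow> carrier M"
    and \<phi>: "\<And>i. i \<in> I \<Longrightarrow> \<phi> i \<in> linear_maps R M (regular_module R)"
    and expand: "\<And>x. x \<in> carrier M \<Longrightarrow> x = (\<Oplus>\<^bsub>M\<^esub>i\<in>I. \<phi> i x \<odot>\<^bsub>M\<^esub> b i)"
  shows "fg_module R M" and "projective_module R M"
proof -
  let ?B = "b ` I"
  let ?F = "free_module R ?B"
  have B: "finite ?B" "?B \<subseteq> carrier M" using I b by auto
  have \<phi>c: "\<phi> i x \<in> carrier R" if "i \<in> I" "x \<in> carrier M" for i x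
    using linear_mapsD(1)[OF \<phi>] that by auto
  have bc: "b i \<in> carrier M" if "i \<in> I" for i using b that by auto
  show "fg_module R M"
    unfolding fg_module_iff
  proof (intro exI[of _ ?B] conjI B subsetI)
    fix x assume x: "x \<in> carrier M"
    have "\<phi> i x \<odot>\<^bsub>M\<^esub> b i \<in> lspan R M ?B" if "i \<in> I" for i
      using \<phi>c[OF that x] that by (intro lspan_smult[OF B(2)] lspan_base[OF B(2)]) auto
    then show "x \<in> lspan R M ?B"
      by (subst expand[OF x]) (intro lspan_finsum_closed[OF B(2)], auto)
  qed
  define \<iota> where "\<iota> x = (\<Oplus>\<^bsub>?F\<^esub>i\<in>I. \<phi> i x \<odot>\<^bsub>?F\<^esub> unit_vec R ?B (b i))" for x
  interpret F: module R ?F by (rule R.free_module_module)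
  have u: "unit_vec R ?B (b i) \<in> carrier ?F" if "i \<in> I" for i
    using that by (intro R.unit_vec_closed) auto
  have \<iota>: "\<iota> \<in> linear_maps R M ?F"
    unfolding \<iota>_def by (intro F.linear_maps_sum I F.linear_maps_smult_point \<phi> u)
  have p: "free_lift R ?B M (\<lambda>x. x) \<in> linear_maps R ?F M"
    using B by (intro free_lift_linear) auto
  have "free_lift R ?B M (\<lambda>x. x) (\<iota> x) = x" if x: "x \<in> carrier M" for x
  proof -
    have "free_lift R ?B M (\<lambda>x. x) (\<iota> x) =
        (\<Oplus>\<^bsub>M\<^esub>i\<in>I. free_lift R ?B M (\<lambda>x. x) (\<phi> i x \<odot>\<^bsub>?F\<^esub> unit_vec R ?B (b i)))"
      unfolding \<iota>_def
      by (rule linear_maps_finsum[OF F.module_axioms module_axioms p]) (intro Pi_I F.smult_closed \<phi>c x u)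
    also have "\<dots> = (\<Oplus>\<^bsub>M\<^esub>i\<in>I. \<phi> i x \<odot>\<^bsub>M\<^esub> b i)"
    proof (intro M.finsum_cong' refl)
      show "(\<lambda>i. \<phi> i x \<odot>\<^bsub>M\<^esub> b i) \<in> I \<rightarrow> carrier M" using \<phi>c bc x by auto
      fix i assume i: "i \<in> I"
      have "free_lift R ?B M (\<lambda>x. x) (unit_vec R ?B (b i)) = b i"
        using B i by (intro free_lift_unit) auto
      then show "free_lift R ?B M (\<lambda>x. x) (\<phi> i x \<odot>\<^bsub>?F\<^esub> unit_vec R ?B (b i)) = \<phi> i x \<odot>\<^bsub>M\<^esub> b i"
        using linear_mapsD(3)[OF p \<phi>c[OF i x] u[OF i]] by simp
    qed
    also have "\<dots> = x" using expand[OF x] by simp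
    finally show ?thesis .
  qed
  with \<iota> p show "projective_module R M"
    unfolding projective_module_def by blast
qed

end

section \<open>Tensor products\<close>

definition frag_sum :: "('p, 'z) ring_scheme \<Rightarrow> ('k \<Rightarrow> 'p) \<Rightarrow> ('k \<Rightarrow>\<^sub>0 int) \<Rightarrow> 'p"
  where "frag_sum P h x = (\<Oplus>\<^bsub>P\<^esub>k\<in>Poly_Mapping.keys x. [Poly_Mapping.lookup x k] \<cdot>\<^bsub>P\<^esub> h k)"

context abelian_group
begin

text \<open>Cancellation may shrink the support of a sum of formal sums, so additivity is proved
  over a common finite index set.\<close>

lemma frag_sum_superset:
  assumes "finite U" and "Poly_Mapping.keys x \<subseteq> U" and "h \<in> U \<rightarrow> carrier G"
  shows "frag_sum G h x = (\<Oplus>k\<in>U. [Poly_Mapping.lookup x k] \<cdot> h k)"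
  unfolding frag_sum_def
proof (intro add.finprod_mono_neutral_cong_left assms Pi_I)
  show "[Poly_Mapping.lookup x k] \<cdot> h k \<in> carrier G" if "k \<in> U" for k
    using that assms by (intro add.int_pow_closed) auto
  show "[Poly_Mapping.lookup x k] \<cdot> h k = \<zero>" if "k \<in> U - Poly_Mapping.keys x" for k
    using that by (auto simp: in_keys_iff add_pow_def)
qed simp

lemma frag_sum_closed:
  "Poly_Mapping.keys x \<subseteq> S \<Longrightarrow> h \<in> S \<rightarrow> carrier G \<Longrightarrow> frag_sum G h x \<in> carrier G"
  unfolding frag_sum_def by (intro finsum_closed Pi_I add.int_pow_closed) auto

lemma frag_sum_add:
  assumes x: "Poly_Mapping.keys x \<subseteq> S" and y: "Poly_Mapping.keys y \<subseteq> S" and h: "h \<in> S \<rightarrow> carrier G"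
  shows "frag_sum G h (x + y) = frag_sum G h x \<oplus> frag_sum G h y"
proof -
  let ?U = "Poly_Mapping.keys x \<union> Poly_Mapping.keys y"
  have U: "h k \<in> carrier G" if "k \<in> ?U" for k using that x y h by auto
  have "frag_sum G h (x + y) = (\<Oplus>k\<in>?U. [Poly_Mapping.lookup (x + y) k] \<cdot> h k)"
    using U keys_add[of x y] by (intro frag_sum_superset) auto
  also have "\<dots> = (\<Oplus>k\<in>?U. [Poly_Mapping.lookup x k] \<cdot> h k \<oplus> [Poly_Mapping.lookup y k] \<cdot> h k)"
    using U by (intro finsum_cong' refl Pi_I) (simp_all add: lookup_add add.int_pow_mult)
  also have "\<dots> = (\<Oplus>k\<in>?U. [Poly_Mapping.lookup x k] \<cdot> h k) \<oplus> (\<Oplus>k\<in>?U. [Poly_Mapping.lookup y k] \<cdot> h k)"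
    using U by (intro finsum_addf Pi_I) simp_all
  also have "\<dots> = frag_sum G h x \<oplus> frag_sum G h y"
    using U by (simp add: frag_sum_superset[of ?U])
  finally show ?thesis .
qed

lemma frag_sum_zero [simp]: "frag_sum G h 0 = \<zero>"
  by (simp add: frag_sum_def)

lemma frag_sum_neg:
  assumes "Poly_Mapping.keys x \<subseteq> S" and "h \<in> S \<rightarrow> carrier G"
  shows "frag_sum G h (- x) = \<ominus> frag_sum G h x"
proof -
  have "frag_sum G h (- x) \<oplus> frag_sum G h x = \<zero>"
    using frag_sum_add[of "- x" S x h] assms by simp
  then show ?thesis
    using frag_sum_closed[of "- x" S h] frag_sum_closed[of x S h] assms
    by (metis keys_minus minus_equality)
qed

lemma frag_sum_diff:
  assumes "Poly_Mapping.keys x \<subseteq> S" and "Poly_Mapping.keys y \<subseteq> S" and "h \<in> S \<rightarrow> carrier G"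
  shows "frag_sum G h (x - y) = frag_sum G h x \<ominus> frag_sum G h y"
  using frag_sum_add[of x S "- y" h] frag_sum_neg[of y S h] assms by (simp add: a_minus_def)

lemma frag_sum_of: "h k \<in> carrier G \<Longrightarrow> frag_sum G h (frag_of k) = h k"
  by (simp add: frag_sum_def)

end

lemma add_pow_regular_module [simp]:
  fixes k :: int
  shows "[k] \<cdot>\<^bsub>regular_module R\<^esub> x = [k] \<cdot>\<^bsub>R\<^esub> x"
  by (simp add: add_pow_def int_pow_def nat_pow_def m_inv_def regular_module_def Let_def)

text \<open>With this, maps from a tensor product to \<open>R\<close> fall under the lemmas about
  linear maps between modules.\<close>

lemma tensor_lift_regular_module [simp]: "tensor_lift (regular_module R) \<beta> = tensor_lift R \<beta>"
  by (intro ext) (simp add: tensor_lift_def)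

text \<open>Exactly what makes an additive extension vanish on the relators. The target is a mere
  abelian group, because the scalar action on the tensor product is itself built from such a map,
  before the tensor product is known to be a module.\<close>

definition balanced ::
    "('a, 'r) ring_scheme \<Rightarrow> ('a, 'b, 'm) module_scheme \<Rightarrow> ('a, 'c, 'n) module_scheme \<Rightarrow>
     ('p, 'z) ring_scheme \<Rightarrow> ('b \<Rightarrow> 'c \<Rightarrow> 'p) \<Rightarrow> bool"
  where "balanced R M N P \<beta> \<longleftrightarrow>
    (\<forall>m\<in>carrier M. \<forall>n\<in>carrier N. \<beta> m n \<in> carrier P) \<and>
    (\<forall>m\<in>carrier M. \<forall>m'\<in>carrier M. \<forall>n\<in>carrier N. \<beta> (m \<oplus>\<^bsub>M\<^esub> m') n = \<beta> m n \<oplus>\<^bsub>P\<^esub> \<beta> m' n) \<and>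
    (\<forall>m\<in>carrier M. \<forall>n\<in>carrier N. \<forall>n'\<in>carrier N. \<beta> m (n \<oplus>\<^bsub>N\<^esub> n') = \<beta> m n \<oplus>\<^bsub>P\<^esub> \<beta> m n') \<and>
    (\<forall>r\<in>carrier R. \<forall>m\<in>carrier M. \<forall>n\<in>carrier N. \<beta> (r \<odot>\<^bsub>M\<^esub> m) n = \<beta> m (r \<odot>\<^bsub>N\<^esub> n))"

definition bilinear_maps ::
    "('a, 'r) ring_scheme \<Rightarrow> ('a, 'b, 'm) module_scheme \<Rightarrow> ('a, 'c, 'n) module_scheme \<Rightarrow>
     ('a, 'p, 'z) module_scheme \<Rightarrow> ('b \<Rightarrow> 'c \<Rightarrow> 'p) set"
  where "bilinear_maps R M N P = {\<beta>.
    (\<forall>m\<in>carrier M. \<beta> m \<in> linear_maps R N P) \<and>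
    (\<forall>n\<in>carrier N. (\<lambda>m. \<beta> m n) \<in> linear_maps R M P)}"

lemma bilinear_mapsI:
  assumes "\<And>m. m \<in> carrier M \<Longrightarrow> \<beta> m \<in> linear_maps R N P"
    and "\<And>n. n \<in> carrier N \<Longrightarrow> (\<lambda>m. \<beta> m n) \<in> linear_maps R M P"
  shows "\<beta> \<in> bilinear_maps R M N P"
  using assms by (simp add: bilinear_maps_def)

lemma bilinear_mapsD:
  assumes "\<beta> \<in> bilinear_maps R M N P"
  shows "m \<in> carrier M \<Longrightarrow> \<beta> m \<in> linear_maps R N P"
    and "n \<in> carrier N \<Longrightarrow> (\<lambda>m. \<beta> m n) \<in> linear_maps R M P"
  using assms by (auto simp: bilinear_maps_def)

lemma bilinear_maps_closed:
  "\<beta> \<in> bilinear_maps R M N P \<Longrightarrow> m \<in> carrier M \<Longrightarrow> n \<in> carrier N \<Longrightarrow> \<beta> m n \<in> carrier P"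
  by (auto dest!: bilinear_mapsD(1) linear_mapsD(1))

lemma bilinear_maps_precomp:
  assumes "\<beta> \<in> bilinear_maps R M N P" and f: "f \<in> linear_maps R M' M" and g: "g \<in> linear_maps R N' N"
  shows "(\<lambda>m n. \<beta> (f m) (g n)) \<in> bilinear_maps R M' N' P"
  using bilinear_mapsD[OF assms(1)] linear_mapsD(1)[OF f] linear_mapsD(1)[OF g]
  by (intro bilinear_mapsI linear_maps_comp[OF f] linear_maps_comp[OF g]) auto

lemma linear_maps_id: "(\<lambda>x. x) \<in> linear_maps R M M"
  by (rule linear_mapsI) auto

lemma bilinear_balanced: "\<beta> \<in> bilinear_maps R M N P \<Longrightarrow> balanced R M N P \<beta>"
  using bilinear_mapsD[of \<beta> R M N P]
  by (simp add: balanced_def linear_maps_def Pi_iff)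

lemma (in module) bilinear_smult: "(\<lambda>r x. r \<odot>\<^bsub>M\<^esub> x) \<in> bilinear_maps R (regular_module R) M M"
  by (intro bilinear_mapsI linear_mapsI)
    (auto simp: smult_r_distr smult_l_distr smult_assoc1[symmetric] R.m_comm)

section \<open>The tensor product as a module and its universal property\<close>

locale tensor_product = L: module R M + N: module R N for R (structure) and M N
begin

abbreviation "F \<equiv> tensor_free M N"
abbreviation "K \<equiv> generate F (tensor_relators R M N)"
abbreviation "T \<equiv> tensor R M N"
abbreviation "coset \<equiv> tensor_coset R M N"
abbreviation "pure \<equiv> pure_tensor R M N"

lemma relator_cases:
  assumes "y \<in> tensor_relators R M N"
  obtains
    (left) m m' n where "m \<in> carrier M" "m' \<in> carrier M" "n \<in> carrier N"
      "y = frag_of (m \<oplus>\<^bsub>M\<^esub> m', n) - frag_of (m, n) - frag_of (m', n)"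
  | (right) m n n' where "m \<in> carrier M" "n \<in> carrier N" "n' \<in> carrier N"
      "y = frag_of (m, n \<oplus>\<^bsub>N\<^esub> n') - frag_of (m, n) - frag_of (m, n')"
  | (scalar) r m n where "r \<in> carrier R" "m \<in> carrier M" "n \<in> carrier N"
      "y = frag_of (r \<odot>\<^bsub>M\<^esub> m, n) - frag_of (m, r \<odot>\<^bsub>N\<^esub> n)"
  using assms unfolding tensor_relators_def
  by (elim UnE CollectE exE conjE; (erule (3) that)?)

lemma free_add_closed: "x \<in> carrier F \<Longrightarrow> y \<in> carrier F \<Longrightarrow> x + y \<in> carrier F"
  using keys_add[of x y] by auto

lemma free_diff_closed: "x \<in> carrier F \<Longrightarrow> y \<in> carrier F \<Longrightarrow> x - y \<in> carrier F"
  using keys_diff[of x y] by auto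

lemma frag_of_closed: "m \<in> carrier M \<Longrightarrow> n \<in> carrier N \<Longrightarrow> frag_of (m, n) \<in> carrier F"
  by simp

lemma relators_subset: "tensor_relators R M N \<subseteq> carrier F"
proof
  fix y assume "y \<in> tensor_relators R M N"
  then show "y \<in> carrier F"
    by (cases rule: relator_cases)
      (simp_all only: free_diff_closed frag_of_closed L.M.a_closed N.M.a_closed L.smult_closed N.smult_closed)
qed

lemma K_subgroup: "subgroup K F"
  by (rule group.generate_is_subgroup[OF group_free_Abelian_group relators_subset])

lemma K_subset: "K \<subseteq> carrier F"
  by (rule subgroup.subset[OF K_subgroup])

lemma K_zero: "0 \<in> K"
  using subgroup.one_closed[OF K_subgroup] by simp

lemma K_add: "x \<in> K \<Longrightarrow> y \<in> K \<Longrightarrow> x + y \<in> K"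
  using subgroup.m_closed[OF K_subgroup] by simp

lemma K_neg: "x \<in> K \<Longrightarrow> - x \<in> K"
  using subgroup.m_inv_closed[OF K_subgroup, of x] K_subset by auto

lemma K_diff: "x \<in> K \<Longrightarrow> y \<in> K \<Longrightarrow> x - y \<in> K"
  using K_add[of x "- y"] K_neg by simp

lemma coset_alt: "coset x = (\<lambda>k. k + x) ` K"
  by (auto simp: tensor_coset_def r_coset_def)

text \<open>This turns the calculus of cosets into arithmetic with formal sums.\<close>

lemma coset_mem: "y \<in> coset x \<longleftrightarrow> y - x \<in> K"
proof
  show "y - x \<in> K" if "y \<in> coset x" using that by (auto simp: coset_alt)
  show "y \<in> coset x" if "y - x \<in> K"
    using imageI[OF that, of "\<lambda>k. k + x"] by (simp add: coset_alt)
qed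

lemma coset_self: "x \<in> coset x"
  by (simp add: coset_mem K_zero)

lemma coset_eq_iff: "coset x = coset y \<longleftrightarrow> x - y \<in> K"
proof
  assume "coset x = coset y"
  then show "x - y \<in> K" using coset_self[of x] by (simp add: coset_mem)
next
  assume xy: "x - y \<in> K"
  show "coset x = coset y"
  proof (rule Set.set_eqI)
    fix z
    show "z \<in> coset x \<longleftrightarrow> z \<in> coset y"
      unfolding coset_mem
      using K_add[OF _ xy, of "z - x"] K_diff[OF _ xy, of "z - y"] by (auto simp: algebra_simps)
  qed
qed

lemma mem_coset_eq: "y \<in> coset x \<Longrightarrow> coset y = coset x"
  by (simp add: coset_mem coset_eq_iff)

lemma coset_subset: "x \<in> carrier F \<Longrightarrow> coset x \<subseteq> carrier F"
  using K_subset free_add_closed by (auto simp: coset_alt simp del: carrier_free_Abelian_group_iff)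

lemma tensor_carrier: "carrier T = coset ` carrier F"
  by (auto simp: tensor_def Let_def FactGroup_def RCOSETS_def tensor_coset_def)

lemma tensor_mem:
  assumes "t \<in> carrier T" and "x \<in> t"
  shows "x \<in> carrier F" and "t = coset x"
proof -
  obtain y where y: "y \<in> carrier F" "t = coset y" using assms by (auto simp: tensor_carrier)
  show "x \<in> carrier F" using subsetD[OF coset_subset[OF y(1)]] y(2) assms(2) by metis
  show "t = coset x" using mem_coset_eq assms(2) y(2) by simp
qed

lemma coset_closed: "x \<in> carrier F \<Longrightarrow> coset x \<in> carrier T"
  by (simp add: tensor_carrier)

lemma tensor_zero: "\<zero>\<^bsub>T\<^esub> = coset 0"
  by (simp add: tensor_def Let_def FactGroup_def coset_alt)

lemma coset_add: "coset x \<oplus>\<^bsub>T\<^esub> coset y = coset (x + y)"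
proof -
  have "coset x \<oplus>\<^bsub>T\<^esub> coset y = (\<Union>a\<in>coset x. \<Union>b\<in>coset y. {a + b})"
    by (simp add: tensor_def Let_def FactGroup_def set_mult_def)
  also have "\<dots> = coset (x + y)"
  proof (intro equalityI subsetI)
    fix z assume "z \<in> (\<Union>a\<in>coset x. \<Union>b\<in>coset y. {a + b})"
    then obtain a b where "a - x \<in> K" "b - y \<in> K" "z = a + b" by (auto simp: coset_mem)
    then show "z \<in> coset (x + y)" using K_add[of "a - x" "b - y"] by (simp add: coset_mem algebra_simps)
  next
    fix z assume "z \<in> coset (x + y)"
    then have "z - y \<in> coset x" by (simp add: coset_mem algebra_simps)
    then show "z \<in> (\<Union>a\<in>coset x. \<Union>b\<in>coset y. {a + b})" using coset_self[of y] by force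
  qed
  finally show ?thesis .
qed

lemma tensor_abelian_group: "abelian_group T"
proof (rule abelian_groupI)
  show "\<zero>\<^bsub>T\<^esub> \<in> carrier T" by (simp add: tensor_zero coset_closed)
  fix s assume "s \<in> carrier T"
  then obtain x where x: "s = coset x" "x \<in> carrier F" by (auto simp: tensor_carrier)
  show "\<zero>\<^bsub>T\<^esub> \<oplus>\<^bsub>T\<^esub> s = s" by (simp add: x tensor_zero coset_add)
  show "\<exists>y\<in>carrier T. y \<oplus>\<^bsub>T\<^esub> s = \<zero>\<^bsub>T\<^esub>"
    by (rule bexI[of _ "coset (- x)"]) (use x in \<open>simp_all add: coset_add tensor_zero coset_closed\<close>)
  fix t assume "t \<in> carrier T"
  then obtain y where y: "t = coset y" "y \<in> carrier F" by (auto simp: tensor_carrier)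
  show "s \<oplus>\<^bsub>T\<^esub> t \<in> carrier T"
    unfolding x(1) y(1) coset_add using x y by (intro coset_closed free_add_closed)
  show "s \<oplus>\<^bsub>T\<^esub> t = t \<oplus>\<^bsub>T\<^esub> s" by (simp add: x y coset_add add.commute)
  fix u assume "u \<in> carrier T"
  then obtain z where "u = coset z" by (auto simp: tensor_carrier)
  then show "s \<oplus>\<^bsub>T\<^esub> t \<oplus>\<^bsub>T\<^esub> u = s \<oplus>\<^bsub>T\<^esub> (t \<oplus>\<^bsub>T\<^esub> u)" by (simp add: x y coset_add add.assoc)
qed

sublocale T: abelian_group T
  by (rule tensor_abelian_group)

lemma pure_closed: "m \<in> carrier M \<Longrightarrow> n \<in> carrier N \<Longrightarrow> pure m n \<in> carrier T"
  unfolding pure_tensor_def by (rule coset_closed) simp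

lemma relator_mem: "x \<in> tensor_relators R M N \<Longrightarrow> x \<in> K"
  by (rule generate.incl)

lemma pure_add_left:
  assumes "m \<in> carrier M" "m' \<in> carrier M" "n \<in> carrier N"
  shows "pure (m \<oplus>\<^bsub>M\<^esub> m') n = pure m n \<oplus>\<^bsub>T\<^esub> pure m' n"
  unfolding pure_tensor_def coset_add coset_eq_iff
  by (rule relator_mem) (use assms in \<open>auto simp: tensor_relators_def diff_diff_eq\<close>)

lemma pure_add_right:
  assumes "m \<in> carrier M" "n \<in> carrier N" "n' \<in> carrier N"
  shows "pure m (n \<oplus>\<^bsub>N\<^esub> n') = pure m n \<oplus>\<^bsub>T\<^esub> pure m n'"
  unfolding pure_tensor_def coset_add coset_eq_iff
  by (rule relator_mem) (use assms in \<open>auto simp: tensor_relators_def diff_diff_eq\<close>)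

lemma pure_balanced:
  assumes "r \<in> carrier R" "m \<in> carrier M" "n \<in> carrier N"
  shows "pure (r \<odot>\<^bsub>M\<^esub> m) n = pure m (r \<odot>\<^bsub>N\<^esub> n)"
  unfolding pure_tensor_def coset_add coset_eq_iff
  by (rule relator_mem) (use assms in \<open>auto simp: tensor_relators_def diff_diff_eq\<close>)

text \<open>The negative of a generator is again a pure tensor, so an induction over tensors needs
  no case for differences.\<close>

lemma pure_neg:
  assumes m: "m \<in> carrier M" and n: "n \<in> carrier N"
  shows "coset (- frag_of (m, n)) = pure (\<ominus>\<^bsub>M\<^esub> m) n"
proof -
  have 0: "pure \<zero>\<^bsub>M\<^esub> n = \<zero>\<^bsub>T\<^esub>"
    using pure_add_left[of "\<zero>\<^bsub>M\<^esub>" "\<zero>\<^bsub>M\<^esub>" n] pure_closed[of "\<zero>\<^bsub>M\<^esub>" n] n by simp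
  have "pure (\<ominus>\<^bsub>M\<^esub> m) n \<oplus>\<^bsub>T\<^esub> pure m n = \<zero>\<^bsub>T\<^esub>"
    using pure_add_left[of "\<ominus>\<^bsub>M\<^esub> m" m n] m n by (simp add: L.M.l_neg 0)
  moreover have "coset (- frag_of (m, n)) \<oplus>\<^bsub>T\<^esub> pure m n = \<zero>\<^bsub>T\<^esub>"
    by (simp add: pure_tensor_def coset_add tensor_zero)
  moreover have "coset (- frag_of (m, n)) \<in> carrier T" using m n by (intro coset_closed) simp
  moreover have "pure m n \<in> carrier T" "pure (\<ominus>\<^bsub>M\<^esub> m) n \<in> carrier T" using m n by (simp_all add: pure_closed)
  ultimately show ?thesis by (metis T.minus_equality T.minus_minus)
qed

lemma tensor_induct [consumes 1, case_names zero pure add]: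
  assumes t: "t \<in> carrier T"
    and zero: "P \<zero>\<^bsub>T\<^esub>"
    and pure: "\<And>m n. m \<in> carrier M \<Longrightarrow> n \<in> carrier N \<Longrightarrow> P (pure m n)"
    and add: "\<And>s t. s \<in> carrier T \<Longrightarrow> t \<in> carrier T \<Longrightarrow> P s \<Longrightarrow> P t \<Longrightarrow> P (s \<oplus>\<^bsub>T\<^esub> t)"
  shows "P t"
proof -
  obtain x where x: "t = coset x" "Poly_Mapping.keys x \<subseteq> carrier M \<times> carrier N"
    using t by (auto simp: tensor_carrier)
  \<comment> \<open>The induction rule for free abelian groups builds formal sums by differences,
    whereas \<open>P\<close> is only known to be preserved by sums; carrying \<open>- x\<close>
    along turns a difference into a sum.\<close>
  have "P (coset x) \<and> P (coset (- x))"
    using x(2)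
  proof (induction x rule: free_Abelian_group_induct[consumes 1, case_names 1 2 3])
    case 1
    then show ?case using zero by (simp add: tensor_zero)
  next
    case (2 x y)
    have "P (coset x \<oplus>\<^bsub>T\<^esub> coset (- y))" "P (coset (- x) \<oplus>\<^bsub>T\<^esub> coset y)"
      using 2 by (auto intro!: add coset_closed)
    then show ?case by (simp add: coset_add)
  next
    case (3 a)
    then show ?case
      using pure[of "fst a" "snd a"] pure[of "\<ominus>\<^bsub>M\<^esub> fst a" "snd a"] pure_neg[of "fst a" "snd a"]
      by (auto simp: pure_tensor_def)
  qed
  then show ?thesis by (simp add: x)
qed

lemma balanced_Pi:
  "balanced R M N P \<beta> \<Longrightarrow> (\<lambda>k. \<beta> (fst k) (snd k)) \<in> carrier M \<times> carrier N \<rightarrow> carrier P"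
  by (auto simp: balanced_def)

text \<open>Well-definedness of \<open>tensor_lift\<close>. The additive extension of a balanced map
  vanishes on the relators, hence on the subgroup that they generate, so every representative of a
  coset has the same value, in particular the one picked by \<open>SOME\<close>.\<close>

lemma tensor_lift_coset:
  assumes P: "abelian_group P" and \<beta>: "balanced R M N P \<beta>" and x: "x \<in> carrier F"
  shows "tensor_lift P \<beta> (coset x) = frag_sum P (\<lambda>k. \<beta> (fst k) (snd k)) x"
proof -
  interpret P: abelian_group P by fact
  let ?h = "\<lambda>k. \<beta> (fst k) (snd k)"
  note h = balanced_Pi[OF \<beta>]
  have c: "frag_sum P ?h y \<in> carrier P" if "y \<in> carrier F" for y
    using that h P.frag_sum_closed by simp
  have d: "frag_sum P ?h (y - z) = frag_sum P ?h y \<ominus>\<^bsub>P\<^esub> frag_sum P ?h z"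
    if "y \<in> carrier F" "z \<in> carrier F" for y z
    using that P.frag_sum_diff[OF _ _ h] by simp
  have of: "frag_sum P ?h (frag_of (m, n)) = \<beta> m n" if "m \<in> carrier M" "n \<in> carrier N" for m n
    using that \<beta> P.frag_sum_of[of ?h "(m, n)"] by (simp add: balanced_def)
  have dF: "y - z \<in> carrier F" if "y \<in> carrier F" "z \<in> carrier F" for y z
    using that keys_diff[of y z] by auto
  have rel: "frag_sum P ?h y = \<zero>\<^bsub>P\<^esub>" if y: "y \<in> tensor_relators R M N" for y
  proof -
    have oF: "frag_of (m, n) \<in> carrier F" if "m \<in> carrier M" "n \<in> carrier N" for m n
      using that by simp
    have z: "(p \<oplus>\<^bsub>P\<^esub> q) \<ominus>\<^bsub>P\<^esub> p \<ominus>\<^bsub>P\<^esub> q = \<zero>\<^bsub>P\<^esub>" if "p \<in> carrier P" "q \<in> carrier P" for p q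
    proof -
      have "(p \<oplus>\<^bsub>P\<^esub> q) \<ominus>\<^bsub>P\<^esub> p \<ominus>\<^bsub>P\<^esub> q = (p \<oplus>\<^bsub>P\<^esub> \<ominus>\<^bsub>P\<^esub> p) \<oplus>\<^bsub>P\<^esub> (q \<oplus>\<^bsub>P\<^esub> \<ominus>\<^bsub>P\<^esub> q)"
        unfolding a_minus_def using that by (simp add: P.a_ac)
      then show ?thesis using that by (simp add: P.r_neg)
    qed
    from y show ?thesis
    proof (cases rule: relator_cases)
      case (left m m' n)
      then have "frag_sum P ?h y = \<beta> (m \<oplus>\<^bsub>M\<^esub> m') n \<ominus>\<^bsub>P\<^esub> \<beta> m n \<ominus>\<^bsub>P\<^esub> \<beta> m' n"
        using oF dF by (simp only: d of L.M.a_closed)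
      then show ?thesis using left \<beta> z by (simp add: balanced_def)
    next
      case (right m n n')
      then have "frag_sum P ?h y = \<beta> m (n \<oplus>\<^bsub>N\<^esub> n') \<ominus>\<^bsub>P\<^esub> \<beta> m n \<ominus>\<^bsub>P\<^esub> \<beta> m n'"
        using oF dF by (simp only: d of N.M.a_closed)
      then show ?thesis using right \<beta> z by (simp add: balanced_def)
    next
      case (scalar r m n)
      then have "frag_sum P ?h y = \<beta> (r \<odot>\<^bsub>M\<^esub> m) n \<ominus>\<^bsub>P\<^esub> \<beta> m (r \<odot>\<^bsub>N\<^esub> n)"
        using oF dF by (simp only: d of L.smult_closed N.smult_closed)
      then show ?thesis using scalar \<beta> by (simp add: balanced_def P.r_neg a_minus_def)
    qed
  qed
  have K: "frag_sum P ?h y = \<zero>\<^bsub>P\<^esub>" if "y \<in> K" for y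
    using that
  proof (induction rule: generate.induct)
    case one
    then show ?case by simp
  next
    case (incl y)
    then show ?case by (rule rel)
  next
    case (inv y)
    then have "y \<in> carrier F" using relators_subset by (rule_tac subsetD)
    then have "inv\<^bsub>F\<^esub> y = 0 - y" "y \<in> carrier F" by simp_all
    then show ?case using d[of 0 y] rel[OF inv] by (simp add: a_minus_def P.minus_equality)
  next
    case (eng y z)
    then have "y \<in> carrier F" "z \<in> carrier F" using K_subset by (auto simp only: subsetD)
    then show ?case using eng P.frag_sum_add[OF _ _ h] by simp
  qed
  \<comment> \<open>The representative on which \<open>tensor_lift\<close> is evaluated; it differs
    from \<open>x\<close> by an element of \<open>K\<close>.\<close>
  define y where "y = (SOME y. y \<in> coset x)"
  have y: "y \<in> coset x" unfolding y_def by (rule someI[of "\<lambda>y. y \<in> coset x", OF coset_self])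
  then have yF: "y \<in> carrier F" by (rule subsetD[OF coset_subset[OF x]])
  have "frag_sum P ?h y \<ominus>\<^bsub>P\<^esub> frag_sum P ?h x = \<zero>\<^bsub>P\<^esub>"
    using K y d[OF yF x] by (simp add: coset_mem)
  then have "frag_sum P ?h y = frag_sum P ?h x"
    using P.add.inv_solve_right[OF P.zero_closed c[OF yF] c[OF x]] c[OF x] by (simp add: a_minus_def)
  then show ?thesis by (simp add: tensor_lift_def y_def frag_sum_def)
qed

lemma tensor_lift_closed:
  assumes P: "abelian_group P" and \<beta>: "balanced R M N P \<beta>" and t: "t \<in> carrier T"
  shows "tensor_lift P \<beta> t \<in> carrier P"
proof -
  obtain x where "t = coset x" "x \<in> carrier F" using t by (auto simp: tensor_carrier)
  then show ?thesis
    using abelian_group.frag_sum_closed[OF P _ balanced_Pi[OF \<beta>]] by (simp add: tensor_lift_coset[OF P \<beta>])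
qed

lemma tensor_lift_add:
  assumes P: "abelian_group P" and \<beta>: "balanced R M N P \<beta>" and s: "s \<in> carrier T" and t: "t \<in> carrier T"
  shows "tensor_lift P \<beta> (s \<oplus>\<^bsub>T\<^esub> t) = tensor_lift P \<beta> s \<oplus>\<^bsub>P\<^esub> tensor_lift P \<beta> t"
proof -
  obtain x where x: "s = coset x" "x \<in> carrier F" using s by (auto simp: tensor_carrier)
  obtain y where y: "t = coset y" "y \<in> carrier F" using t by (auto simp: tensor_carrier)
  have "tensor_lift P \<beta> (s \<oplus>\<^bsub>T\<^esub> t) = frag_sum P (\<lambda>k. \<beta> (fst k) (snd k)) (x + y)"
    unfolding x(1) y(1) coset_add by (rule tensor_lift_coset[OF P \<beta> free_add_closed[OF x(2) y(2)]])
  also have "\<dots> = tensor_lift P \<beta> s \<oplus>\<^bsub>P\<^esub> tensor_lift P \<beta> t"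
    using abelian_group.frag_sum_add[OF P _ _ balanced_Pi[OF \<beta>]] x y
    by (simp add: tensor_lift_coset[OF P \<beta>])
  finally show ?thesis .
qed

lemma tensor_lift_pure:
  assumes P: "abelian_group P" and \<beta>: "balanced R M N P \<beta>" and m: "m \<in> carrier M" and n: "n \<in> carrier N"
  shows "tensor_lift P \<beta> (pure m n) = \<beta> m n"
proof -
  have "\<beta> m n \<in> carrier P" using \<beta> m n by (simp add: balanced_def)
  then show ?thesis
    unfolding pure_tensor_def using m n abelian_group.frag_sum_of[OF P, of "\<lambda>k. \<beta> (fst k) (snd k)" "(m, n)"]
    by (subst tensor_lift_coset[OF P \<beta>]) auto
qed

lemma tensor_lift_zero:
  assumes P: "abelian_group P" and \<beta>: "balanced R M N P \<beta>"
  shows "tensor_lift P \<beta> \<zero>\<^bsub>T\<^esub> = \<zero>\<^bsub>P\<^esub>"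
  using abelian_group.frag_sum_zero[OF P] by (simp add: tensor_zero tensor_lift_coset[OF P \<beta>])

text \<open>The operations of \<open>tensor\<close> act on representatives by
  \<open>frag_extend\<close>. Modulo relators such an extension becomes a sum in the tensor product,
  and this identifies the operations with values of \<open>tensor_lift\<close>.\<close>

lemma coset_frag_extend:
  assumes "\<And>k. k \<in> carrier M \<times> carrier N \<Longrightarrow> b k \<in> carrier F" and "x \<in> carrier F"
  shows "frag_extend b x \<in> carrier F \<and> coset (frag_extend b x) = frag_sum T (\<lambda>k. coset (b k)) x"
proof -
  have h: "(\<lambda>k. coset (b k)) \<in> carrier M \<times> carrier N \<rightarrow> carrier T"
    using assms(1) coset_closed by auto
  have "Poly_Mapping.keys x \<subseteq> carrier M \<times> carrier N" using assms(2) by simp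
  then show ?thesis
  proof (induction x rule: free_Abelian_group_induct[consumes 1, case_names 1 2 3])
    case 1
    then show ?case by (simp add: tensor_zero)
  next
    case (2 x y)
    let ?x = "frag_extend b x" and ?y = "frag_extend b y"
    have xy: "?x - ?y \<in> carrier F" using 2 by (intro free_diff_closed) auto
    have cl: "coset ?y \<in> carrier T" "coset (?x - ?y) \<in> carrier T" "coset ?x \<in> carrier T"
      by (rule coset_closed, rule 2(4)[THEN conjunct1], rule coset_closed[OF xy],
          rule coset_closed, rule 2(3)[THEN conjunct1])
    have "coset ?x = coset (?x - ?y) \<oplus>\<^bsub>T\<^esub> coset ?y" by (simp add: coset_add)
    then have "coset (?x - ?y) = coset ?x \<ominus>\<^bsub>T\<^esub> coset ?y"
      using T.add.inv_solve_right[OF cl(2,3,1)] by (simp add: a_minus_def)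
    also have "\<dots> = frag_sum T (\<lambda>k. coset (b k)) (x - y)"
      using 2 T.frag_sum_diff[OF 2(1,2) h] by (simp only: conjunct2)
    finally show ?case using xy by (simp add: frag_extend_diff)
  next
    case (3 k)
    then have "coset (b k) \<in> carrier T" "b k \<in> carrier F" using h assms(1) by auto
    then show ?case using T.frag_sum_of[of "\<lambda>k. coset (b k)" k] by simp
  qed
qed

lemma balanced_smult: "r \<in> carrier R \<Longrightarrow> balanced R M N T (\<lambda>m n. pure (r \<odot>\<^bsub>M\<^esub> m) n)"
proof -
  assume r: "r \<in> carrier R"
  have "pure (r \<odot>\<^bsub>M\<^esub> (s \<odot>\<^bsub>M\<^esub> m)) n = pure (r \<odot>\<^bsub>M\<^esub> m) (s \<odot>\<^bsub>N\<^esub> n)"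
    if "s \<in> carrier R" "m \<in> carrier M" "n \<in> carrier N" for s m n
  proof -
    have "r \<odot>\<^bsub>M\<^esub> (s \<odot>\<^bsub>M\<^esub> m) = s \<odot>\<^bsub>M\<^esub> (r \<odot>\<^bsub>M\<^esub> m)"
      using r that by (simp add: L.smult_assoc1[symmetric] L.R.m_comm)
    then show ?thesis using r that by (simp add: pure_balanced)
  qed
  then show ?thesis
    using r by (simp add: balanced_def pure_closed L.smult_r_distr pure_add_left pure_add_right)
qed

text \<open>All the cosets united in the definition of the scalar action are the value of one lift,
  and a coset has at least one representative. The action thus inherits additivity from the
  lift.\<close>

lemma tensor_smult_lift:
  assumes r: "r \<in> carrier R" and t: "t \<in> carrier T"
  shows "r \<odot>\<^bsub>T\<^esub> t = tensor_lift T (\<lambda>m n. pure (r \<odot>\<^bsub>M\<^esub> m) n) t"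
proof -
  let ?b = "\<lambda>(m, n). frag_of (r \<odot>\<^bsub>M\<^esub> m, n)"
  have *: "coset (frag_extend ?b x) = tensor_lift T (\<lambda>m n. pure (r \<odot>\<^bsub>M\<^esub> m) n) t" if x: "x \<in> t" for x
  proof -
    note xF = tensor_mem(1)[OF t x] and tx = tensor_mem(2)[OF t x]
    have "coset (frag_extend ?b x) = frag_sum T (\<lambda>k. coset (?b k)) x"
      using r by (intro conjunct2[OF coset_frag_extend[OF _ xF]]) (auto simp: case_prod_beta)
    also have "\<dots> = tensor_lift T (\<lambda>m n. pure (r \<odot>\<^bsub>M\<^esub> m) n) t"
      unfolding tx tensor_lift_coset[OF tensor_abelian_group balanced_smult[OF r] xF]
      by (simp add: case_prod_beta pure_tensor_def)
    finally show ?thesis .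
  qed
  have "t \<noteq> {}" using t coset_self by (auto simp: tensor_carrier)
  then show ?thesis using * by (simp add: tensor_def Let_def)
qed

lemmas smult_props =
  tensor_lift_add[OF tensor_abelian_group balanced_smult]
  tensor_lift_pure[OF tensor_abelian_group balanced_smult]
  tensor_lift_zero[OF tensor_abelian_group balanced_smult]
  tensor_lift_closed[OF tensor_abelian_group balanced_smult]

lemma tensor_smult_pure:
  "r \<in> carrier R \<Longrightarrow> m \<in> carrier M \<Longrightarrow> n \<in> carrier N \<Longrightarrow> r \<odot>\<^bsub>T\<^esub> pure m n = pure (r \<odot>\<^bsub>M\<^esub> m) n"
  by (simp add: tensor_smult_lift pure_closed smult_props)

lemma tensor_module: "module R T"
proof -
  have cl: "r \<odot>\<^bsub>T\<^esub> t \<in> carrier T" if "r \<in> carrier R" "t \<in> carrier T" for r t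
    using that by (simp add: tensor_smult_lift smult_props)
  have distr: "r \<odot>\<^bsub>T\<^esub> (s \<oplus>\<^bsub>T\<^esub> t) = r \<odot>\<^bsub>T\<^esub> s \<oplus>\<^bsub>T\<^esub> r \<odot>\<^bsub>T\<^esub> t"
    if "r \<in> carrier R" "s \<in> carrier T" "t \<in> carrier T" for r s t
    using that by (simp add: tensor_smult_lift smult_props)
  have zero: "r \<odot>\<^bsub>T\<^esub> \<zero>\<^bsub>T\<^esub> = \<zero>\<^bsub>T\<^esub>" if "r \<in> carrier R" for r
    using that by (simp add: tensor_smult_lift smult_props)
  show ?thesis
  proof (rule moduleI[OF L.R.is_cring tensor_abelian_group cl])
    fix a b t assume a: "a \<in> carrier R" and b: "b \<in> carrier R" and t: "t \<in> carrier T"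
    show "(a \<oplus> b) \<odot>\<^bsub>T\<^esub> t = a \<odot>\<^bsub>T\<^esub> t \<oplus>\<^bsub>T\<^esub> b \<odot>\<^bsub>T\<^esub> t"
      using t
    proof (induction rule: tensor_induct)
      case (pure m n)
      then show ?case using a b by (simp add: tensor_smult_pure L.smult_l_distr pure_add_left)
    next
      case (add s t)
      then show ?case using a b
        by (simp add: distr cl T.a_ac)
    qed (use a b in \<open>simp add: zero\<close>)
    show "(a \<otimes> b) \<odot>\<^bsub>T\<^esub> t = a \<odot>\<^bsub>T\<^esub> (b \<odot>\<^bsub>T\<^esub> t)"
      using t
    proof (induction rule: tensor_induct)
      case (pure m n)
      then show ?case using a b by (simp add: tensor_smult_pure L.smult_assoc1)
    next
      case (add s t)
      then show ?case using a b
        by (simp add: distr cl)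
    qed (use a b in \<open>simp add: zero\<close>)
  next
    fix t assume "t \<in> carrier T"
    then show "\<one> \<odot>\<^bsub>T\<^esub> t = t"
    proof (induction rule: tensor_induct)
      case (pure m n)
      then show ?case by (simp add: tensor_smult_pure)
    next
      case (add s t)
      then show ?case
        by (simp add: distr)
    qed (simp add: zero)
  qed (use distr in auto)
qed

sublocale T: module R T
  by (rule tensor_module)

lemma pure_bilinear: "pure \<in> bilinear_maps R M N T"
  by (intro bilinear_mapsI linear_mapsI)
    (simp_all add: pure_closed pure_add_left pure_add_right tensor_smult_pure pure_balanced[symmetric])

lemma tensor_lift_linear:
  assumes "module R P" and \<beta>: "\<beta> \<in> bilinear_maps R M N P"
  shows "tensor_lift P \<beta> \<in> linear_maps R T P"
proof -
  interpret P: module R P by fact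
  note b = bilinear_balanced[OF \<beta>]
  note P = P.M.abelian_group_axioms
  show ?thesis
  proof (intro linear_mapsI)
    fix t assume t: "t \<in> carrier T"
    show "tensor_lift P \<beta> t \<in> carrier P" by (rule tensor_lift_closed[OF P b t])
    show "tensor_lift P \<beta> (s \<oplus>\<^bsub>T\<^esub> t') = tensor_lift P \<beta> s \<oplus>\<^bsub>P\<^esub> tensor_lift P \<beta> t'"
      if "s \<in> carrier T" "t' \<in> carrier T" for s t' by (rule tensor_lift_add[OF P b that])
    show "tensor_lift P \<beta> (r \<odot>\<^bsub>T\<^esub> t) = r \<odot>\<^bsub>P\<^esub> tensor_lift P \<beta> t" if r: "r \<in> carrier R" for r
      using t
    proof (induction rule: tensor_induct)
      case zero
      then show ?case using r by (simp add: tensor_lift_zero[OF P b])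
    next
      case (pure m n)
      then show ?case using r linear_mapsD(3)[OF bilinear_mapsD(2)[OF \<beta> pure(2)] r pure(1)]
        by (simp add: tensor_smult_pure tensor_lift_pure[OF P b])
    next
      case (add s t)
      then show ?case using r
        by (simp add: T.smult_r_distr tensor_lift_add[OF P b] tensor_lift_closed[OF P b] P.smult_r_distr)
    qed
  qed
qed

lemma tensor_lift_pure':
  "module R P \<Longrightarrow> \<beta> \<in> bilinear_maps R M N P \<Longrightarrow> m \<in> carrier M \<Longrightarrow> n \<in> carrier N \<Longrightarrow>
    tensor_lift P \<beta> (pure m n) = \<beta> m n"
  by (intro tensor_lift_pure bilinear_balanced) (auto simp: module_def)

lemma tensor_linear_eq:
  assumes "module R P" and f: "f \<in> linear_maps R T P" and g: "g \<in> linear_maps R T P"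
    and eq: "\<And>m n. m \<in> carrier M \<Longrightarrow> n \<in> carrier N \<Longrightarrow> f (pure m n) = g (pure m n)"
    and t: "t \<in> carrier T"
  shows "f t = g t"
  using t
proof (induction rule: tensor_induct)
  case zero
  show ?case using linear_maps_zero[OF tensor_module assms(1)] f g by metis
next
  case (add s t)
  then show ?case using linear_mapsD(2)[OF f] linear_mapsD(2)[OF g] by metis
qed (rule eq)

end

lemma linear_maps_cong:
  assumes "module R M" and f: "f \<in> linear_maps R M N" and eq: "\<And>x. x \<in> carrier M \<Longrightarrow> g x = f x"
  shows "g \<in> linear_maps R M N"
proof -
  interpret M: module R M by fact
  show ?thesis by (rule linear_mapsI) (simp_all add: eq linear_mapsD[OF f])
qed

context assoc_algebra
begin

lemma mult_left_linear: "x \<in> carrier M \<Longrightarrow> (\<lambda>y. x \<otimes>\<^bsub>M\<^esub> y) \<in> linear_maps R M M"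
  by (rule linear_mapsI) (simp_all add: r_distr smult_assoc3)

lemma mult_right_linear: "y \<in> carrier M \<Longrightarrow> (\<lambda>x. x \<otimes>\<^bsub>M\<^esub> y) \<in> linear_maps R M M"
  by (rule linear_mapsI) (simp_all add: l_distr smult_assoc2)

lemma mult_bilinear: "(\<otimes>\<^bsub>M\<^esub>) \<in> bilinear_maps R M M M"
  by (intro bilinear_mapsI mult_left_linear mult_right_linear)

end

section \<open>The tensor product of two algebras\<close>

locale tensor_algebra = L: assoc_algebra R M + N: assoc_algebra R N for R (structure) and M N

sublocale tensor_algebra \<subseteq> tensor_product
  by unfold_locales

context tensor_algebra
begin

text \<open>Multiplication from the left by the pure tensor of \<open>m\<close> and
  \<open>n\<close>. The product arises by two lifts: \<open>pm m n\<close> in the right factor, then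
  in \<open>m\<close> and \<open>n\<close>.\<close>

definition pm where "pm m n m' n' = pure (m \<otimes>\<^bsub>M\<^esub> m') (n \<otimes>\<^bsub>N\<^esub> n')"

lemma pm_bilinear:
  assumes "m \<in> carrier M" and "n \<in> carrier N"
  shows "pm m n \<in> bilinear_maps R M N T"
  unfolding pm_def
  by (rule bilinear_maps_precomp[OF pure_bilinear L.mult_left_linear[OF assms(1)] N.mult_left_linear[OF assms(2)]])

lemma pm_lift_linear:
  "m \<in> carrier M \<Longrightarrow> n \<in> carrier N \<Longrightarrow> tensor_lift T (pm m n) \<in> linear_maps R T T"
  by (rule tensor_lift_linear[OF tensor_module pm_bilinear])

lemma pm_lift_pure:
  assumes "m \<in> carrier M" "n \<in> carrier N" "m' \<in> carrier M" "n' \<in> carrier N"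
  shows "tensor_lift T (pm m n) (pure m' n') = pure (m \<otimes>\<^bsub>M\<^esub> m') (n \<otimes>\<^bsub>N\<^esub> n')"
  using tensor_lift_pure'[OF tensor_module pm_bilinear] assms by (simp add: pm_def)

text \<open>What the second lift requires. For fixed \<open>m\<close> and \<open>n\<close> both
  sides of each law are linear in \<open>t\<close>, so they are compared on pure tensors, where the
  laws of the two algebras apply.\<close>

lemma pm_lift_bilinear:
  assumes t: "t \<in> carrier T"
  shows "(\<lambda>m n. tensor_lift T (pm m n) t) \<in> bilinear_maps R M N T"
proof (intro bilinear_mapsI linear_mapsI)
  note cl = linear_mapsD(1)[OF pm_lift_linear]
  note eq = tensor_linear_eq[OF tensor_module pm_lift_linear _ _ t]
  fix m n assume m: "m \<in> carrier M" and n: "n \<in> carrier N"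
  show "tensor_lift T (pm m n) t \<in> carrier T" "tensor_lift T (pm m n) t \<in> carrier T"
    using m n t by (auto intro: cl)
  show "tensor_lift T (pm m (n \<oplus>\<^bsub>N\<^esub> n')) t = tensor_lift T (pm m n) t \<oplus>\<^bsub>T\<^esub> tensor_lift T (pm m n') t"
    if n': "n' \<in> carrier N" for n'
    by (rule eq[OF _ _ T.linear_maps_add[OF pm_lift_linear pm_lift_linear]])
      (simp_all add: m n n' pm_lift_pure N.l_distr pure_add_right)
  show "tensor_lift T (pm (m \<oplus>\<^bsub>M\<^esub> m') n) t = tensor_lift T (pm m n) t \<oplus>\<^bsub>T\<^esub> tensor_lift T (pm m' n) t"
    if m': "m' \<in> carrier M" for m'
    by (rule eq[OF _ _ T.linear_maps_add[OF pm_lift_linear pm_lift_linear]])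
      (simp_all add: m n m' pm_lift_pure L.l_distr pure_add_left)
  show "tensor_lift T (pm m (r \<odot>\<^bsub>N\<^esub> n)) t = r \<odot>\<^bsub>T\<^esub> tensor_lift T (pm m n) t" if r: "r \<in> carrier R" for r
    by (rule eq[OF _ _ T.linear_maps_smult[OF pm_lift_linear]])
      (simp_all add: m n r pm_lift_pure N.smult_assoc2 tensor_smult_pure pure_balanced)
  show "tensor_lift T (pm (r \<odot>\<^bsub>M\<^esub> m) n) t = r \<odot>\<^bsub>T\<^esub> tensor_lift T (pm m n) t" if r: "r \<in> carrier R" for r
    by (rule eq[OF _ _ T.linear_maps_smult[OF pm_lift_linear]])
      (simp_all add: m n r pm_lift_pure L.smult_assoc2 tensor_smult_pure)
qed

text \<open>Whatever representatives are chosen for the two factors, the resulting coset is the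
  value of the iterated lift, so the double union in the definition is a union of one and the same
  set.\<close>

lemma tensor_mult_lift:
  assumes s: "s \<in> carrier T" and t: "t \<in> carrier T"
  shows "s \<otimes>\<^bsub>T\<^esub> t = tensor_lift T (\<lambda>m n. tensor_lift T (pm m n) t) s"
proof -
  let ?b = "\<lambda>m n. \<lambda>(m', n'). frag_of (m \<otimes>\<^bsub>M\<^esub> m', n \<otimes>\<^bsub>N\<^esub> n')"
  let ?c = "\<lambda>y. \<lambda>(m, n). frag_extend (?b m n) y"
  have 1: "frag_extend (?b m n) y \<in> carrier F \<and> coset (frag_extend (?b m n) y) = tensor_lift T (pm m n) t"
    if y: "y \<in> t" and m: "m \<in> carrier M" and n: "n \<in> carrier N" for y m n
  proof -
    note yF = tensor_mem(1)[OF t y] and ty = tensor_mem(2)[OF t y]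
    have "frag_extend (?b m n) y \<in> carrier F \<and>
        coset (frag_extend (?b m n) y) = frag_sum T (\<lambda>k. coset (?b m n k)) y"
      using m n by (intro coset_frag_extend[OF _ yF]) (auto simp: case_prod_beta)
    moreover have "tensor_lift T (pm m n) t = frag_sum T (\<lambda>k. coset (?b m n k)) y"
      unfolding ty tensor_lift_coset[OF tensor_abelian_group bilinear_balanced[OF pm_bilinear[OF m n]] yF]
      by (simp add: case_prod_beta pure_tensor_def pm_def)
    ultimately show ?thesis by simp
  qed
  have 2: "coset (frag_extend (?c y) x) = tensor_lift T (\<lambda>m n. tensor_lift T (pm m n) t) s"
    if x: "x \<in> s" and y: "y \<in> t" for x y
  proof -
    note xF = tensor_mem(1)[OF s x] and sx = tensor_mem(2)[OF s x]
    have "coset (frag_extend (?c y) x) = frag_sum T (\<lambda>k. coset (?c y k)) x"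
    proof (intro conjunct2[OF coset_frag_extend[OF _ xF]])
      fix k assume "k \<in> carrier M \<times> carrier N"
      then show "?c y k \<in> carrier F" using 1[OF y] by (cases k) (simp del: carrier_free_Abelian_group_iff)
    qed
    also have "\<dots> = frag_sum T (\<lambda>k. tensor_lift T (pm (fst k) (snd k)) t) x"
      unfolding frag_sum_def
    proof (intro T.finsum_cong' refl Pi_I)
      fix k assume "k \<in> Poly_Mapping.keys x"
      then have k: "fst k \<in> carrier M" "snd k \<in> carrier N" using xF by auto
      then show "[Poly_Mapping.lookup x k] \<cdot>\<^bsub>T\<^esub> coset (?c y k) =
          [Poly_Mapping.lookup x k] \<cdot>\<^bsub>T\<^esub> tensor_lift T (pm (fst k) (snd k)) t"
        using 1[OF y k] by (simp add: case_prod_beta)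
      show "[Poly_Mapping.lookup x k] \<cdot>\<^bsub>T\<^esub> tensor_lift T (pm (fst k) (snd k)) t \<in> carrier T"
        using k t by (intro T.add.int_pow_closed linear_mapsD(1)[OF pm_lift_linear])
    qed
    also have "\<dots> = tensor_lift T (\<lambda>m n. tensor_lift T (pm m n) t) s"
      unfolding sx
      by (rule tensor_lift_coset[OF tensor_abelian_group bilinear_balanced[OF pm_lift_bilinear[OF t]] xF, symmetric])
    finally show ?thesis .
  qed
  have ne: "s \<noteq> {}" "t \<noteq> {}" using s t coset_self by (auto simp: tensor_carrier)
  have "s \<otimes>\<^bsub>T\<^esub> t = (\<Union>x\<in>s. \<Union>y\<in>t. coset (frag_extend (?c y) x))"
    by (simp add: tensor_def Let_def)
  also have "\<dots> = (\<Union>x\<in>s. \<Union>y\<in>t. tensor_lift T (\<lambda>m n. tensor_lift T (pm m n) t) s)"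
    by (intro SUP_cong refl 2)
  also have "\<dots> = tensor_lift T (\<lambda>m n. tensor_lift T (pm m n) t) s"
    using ne by simp
  finally show ?thesis .
qed

lemma tensor_mult_pure:
  assumes "m \<in> carrier M" "n \<in> carrier N" "m' \<in> carrier M" "n' \<in> carrier N"
  shows "pure m n \<otimes>\<^bsub>T\<^esub> pure m' n' = pure (m \<otimes>\<^bsub>M\<^esub> m') (n \<otimes>\<^bsub>N\<^esub> n')"
  using assms tensor_lift_pure'[OF tensor_module pm_lift_bilinear]
  by (simp add: tensor_mult_lift pure_closed pm_lift_pure)

lemma tensor_mult_right_linear:
  assumes t: "t \<in> carrier T"
  shows "(\<lambda>s. s \<otimes>\<^bsub>T\<^esub> t) \<in> linear_maps R T T"
  by (rule linear_maps_cong[OF tensor_module tensor_lift_linear[OF tensor_module pm_lift_bilinear[OF t]]])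
    (rule tensor_mult_lift[OF _ t])

text \<open>In the lifted form the left factor is the outer variable, so linearity in the right
  factor is not immediate. For a pure left factor the product is a single lift, and a sum of linear
  maps is linear.\<close>

lemma tensor_mult_left_linear:
  assumes s: "s \<in> carrier T"
  shows "(\<lambda>t. s \<otimes>\<^bsub>T\<^esub> t) \<in> linear_maps R T T"
  using s
proof (induction rule: tensor_induct)
  case zero
  show ?case
    by (rule linear_maps_cong[OF tensor_module T.linear_maps_const_zero])
      (rule linear_maps_zero[OF tensor_module tensor_module tensor_mult_right_linear])
next
  case (pure m n)
  have "pure m n \<otimes>\<^bsub>T\<^esub> t = tensor_lift T (pm m n) t" if "t \<in> carrier T" for t
    using pure that tensor_lift_pure'[OF tensor_module pm_lift_bilinear[OF that]]
    by (simp add: tensor_mult_lift pure_closed)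
  then show ?case
    by (rule linear_maps_cong[OF tensor_module pm_lift_linear[OF pure]])
next
  case (add s s')
  show ?case
    by (rule linear_maps_cong[OF tensor_module T.linear_maps_add[OF add(3,4)]])
      (rule linear_mapsD(2)[OF tensor_mult_right_linear add(1,2)])
qed

lemma tensor_mult_closed: "s \<in> carrier T \<Longrightarrow> t \<in> carrier T \<Longrightarrow> s \<otimes>\<^bsub>T\<^esub> t \<in> carrier T"
  using linear_mapsD(1)[OF tensor_mult_left_linear] by blast

lemma tensor_one: "\<one>\<^bsub>T\<^esub> = pure \<one>\<^bsub>M\<^esub> \<one>\<^bsub>N\<^esub>"
  by (simp add: tensor_def Let_def)

lemma tensor_mult_assoc:
  assumes s: "s \<in> carrier T" and t: "t \<in> carrier T" and u: "u \<in> carrier T"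
  shows "s \<otimes>\<^bsub>T\<^esub> t \<otimes>\<^bsub>T\<^esub> u = s \<otimes>\<^bsub>T\<^esub> (t \<otimes>\<^bsub>T\<^esub> u)"
proof (rule tensor_linear_eq[OF tensor_module _ _ _ s])
  note R = tensor_mult_right_linear and L = tensor_mult_left_linear
  show "(\<lambda>s. s \<otimes>\<^bsub>T\<^esub> t \<otimes>\<^bsub>T\<^esub> u) \<in> linear_maps R T T"
    by (rule linear_maps_comp[OF R[OF t] R[OF u]])
  show "(\<lambda>s. s \<otimes>\<^bsub>T\<^esub> (t \<otimes>\<^bsub>T\<^esub> u)) \<in> linear_maps R T T"
    by (rule R[OF tensor_mult_closed[OF t u]])
  fix m n assume mn: "m \<in> carrier M" "n \<in> carrier N"
  show "pure m n \<otimes>\<^bsub>T\<^esub> t \<otimes>\<^bsub>T\<^esub> u = pure m n \<otimes>\<^bsub>T\<^esub> (t \<otimes>\<^bsub>T\<^esub> u)"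
  proof (rule tensor_linear_eq[OF tensor_module _ _ _ t])
    show "(\<lambda>t. pure m n \<otimes>\<^bsub>T\<^esub> t \<otimes>\<^bsub>T\<^esub> u) \<in> linear_maps R T T"
      by (rule linear_maps_comp[OF L[OF pure_closed[OF mn]] R[OF u]])
    show "(\<lambda>t. pure m n \<otimes>\<^bsub>T\<^esub> (t \<otimes>\<^bsub>T\<^esub> u)) \<in> linear_maps R T T"
      by (rule linear_maps_comp[OF R[OF u] L[OF pure_closed[OF mn]]])
    fix m' n' assume mn': "m' \<in> carrier M" "n' \<in> carrier N"
    show "pure m n \<otimes>\<^bsub>T\<^esub> pure m' n' \<otimes>\<^bsub>T\<^esub> u = pure m n \<otimes>\<^bsub>T\<^esub> (pure m' n' \<otimes>\<^bsub>T\<^esub> u)"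
    proof (rule tensor_linear_eq[OF tensor_module _ _ _ u])
      show "(\<lambda>u. pure m n \<otimes>\<^bsub>T\<^esub> pure m' n' \<otimes>\<^bsub>T\<^esub> u) \<in> linear_maps R T T"
        by (rule L[OF tensor_mult_closed[OF pure_closed[OF mn] pure_closed[OF mn']]])
      show "(\<lambda>u. pure m n \<otimes>\<^bsub>T\<^esub> (pure m' n' \<otimes>\<^bsub>T\<^esub> u)) \<in> linear_maps R T T"
        by (rule linear_maps_comp[OF L[OF pure_closed[OF mn']] L[OF pure_closed[OF mn]]])
    qed (simp add: mn mn' tensor_mult_pure L.m_assoc N.m_assoc)
  qed
qed

lemma tensor_one_mult:
  assumes t: "t \<in> carrier T"
  shows "\<one>\<^bsub>T\<^esub> \<otimes>\<^bsub>T\<^esub> t = t" and "t \<otimes>\<^bsub>T\<^esub> \<one>\<^bsub>T\<^esub> = t"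
proof -
  have one: "pure \<one>\<^bsub>M\<^esub> \<one>\<^bsub>N\<^esub> \<in> carrier T" by (simp add: pure_closed)
  show "\<one>\<^bsub>T\<^esub> \<otimes>\<^bsub>T\<^esub> t = t"
    unfolding tensor_one
    by (rule tensor_linear_eq[OF tensor_module tensor_mult_left_linear[OF one] linear_maps_id _ t])
      (simp add: tensor_mult_pure)
  show "t \<otimes>\<^bsub>T\<^esub> \<one>\<^bsub>T\<^esub> = t"
    unfolding tensor_one
    by (rule tensor_linear_eq[OF tensor_module tensor_mult_right_linear[OF one] linear_maps_id _ t])
      (simp add: tensor_mult_pure)
qed

lemma tensor_assoc_algebra: "assoc_algebra R T"
proof -
  note R = tensor_mult_right_linear and L = tensor_mult_left_linear
  have "ring T"
  proof (rule ringI[OF tensor_abelian_group])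
    show "monoid T"
      by (rule monoidI)
        (simp_all add: tensor_mult_closed tensor_mult_assoc tensor_one_mult, simp add: tensor_one pure_closed)
  qed (simp_all add: linear_mapsD(2)[OF R] linear_mapsD(2)[OF L])
  then show ?thesis
    by (intro assoc_algebra.intro tensor_module assoc_algebra_axioms.intro)
      (simp_all add: linear_mapsD(3)[OF R] linear_mapsD(3)[OF L])
qed

end

section \<open>Group algebras\<close>

lemma module_cong:
  assumes "module R M" and c: "carrier N = carrier M" "add N = add M" "ring.zero N = ring.zero M" "smult N = smult M"
  shows "module R N"
proof -
  interpret M: module R M by fact
  have "abelian_group N"
  proof (rule abelian_groupI)
    fix x assume "x \<in> carrier N"
    then show "\<exists>y\<in>carrier N. y \<oplus>\<^bsub>N\<^esub> x = \<zero>\<^bsub>N\<^esub>"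
      by (intro bexI[of _ "\<ominus>\<^bsub>M\<^esub> x"]) (simp_all add: c M.l_neg)
  qed (simp_all add: c M.a_ac)
  then show ?thesis
    by (rule moduleI[OF M.is_cring]) (simp_all add: c M.smult_l_distr M.smult_r_distr M.smult_assoc1)
qed

lemma finsum_cong_fields:
  assumes "carrier N = carrier M" "add N = add M" "ring.zero N = ring.zero M"
  shows "finsum N = finsum M"
  using assms by (intro ext) (simp add: finsum_def finprod_def)

text \<open>Needed because one module occurs in several records: \<open>group_algebra\<close> and
  \<open>group_hopf_algebra\<close> on one side, \<open>finite_dual_module\<close> and
  \<open>finite_dual\<close> on the other.\<close>

lemma tensor_cong:
  assumes "carrier M' = carrier M" "add M' = add M" "smult M' = smult M"
    and "carrier N' = carrier N" "add N' = add N" "smult N' = smult N"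
  shows "tensor_coset R M' N' = tensor_coset R M N" "pure_tensor R M' N' = pure_tensor R M N"
proof -
  have "tensor_relators R M' N' = tensor_relators R M N" using assms by (simp add: tensor_relators_def)
  then show "tensor_coset R M' N' = tensor_coset R M N"
    using assms by (intro ext) (simp add: tensor_coset_def)
  then show "pure_tensor R M' N' = pure_tensor R M N"
    by (intro ext) (simp add: pure_tensor_def)
qed

lemma tensor_cong_fields:
  assumes "carrier M' = carrier M" "add M' = add M" "smult M' = smult M"
    and "carrier N' = carrier N" "add N' = add N" "smult N' = smult N"
  shows "carrier (tensor R M' N') = carrier (tensor R M N)"
    and "add (tensor R M' N') = add (tensor R M N)"
    and "ring.zero (tensor R M' N') = ring.zero (tensor R M N)"
    and "smult (tensor R M' N') = smult (tensor R M N)"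
proof -
  have 1: "tensor_relators R M' N' = tensor_relators R M N" using assms by (simp add: tensor_relators_def)
  note 2 = tensor_cong(1)[OF assms]
  show "carrier (tensor R M' N') = carrier (tensor R M N)"
    "add (tensor R M' N') = add (tensor R M N)"
    "ring.zero (tensor R M' N') = ring.zero (tensor R M N)"
    "smult (tensor R M' N') = smult (tensor R M N)"
    using assms by (simp_all add: tensor_def Let_def 1 2)
qed

section \<open>The group algebra of an abelian group\<close>

locale group_ring = R: cring R + G: comm_group G for R (structure) and G
begin

abbreviation "FM \<equiv> free_module R (carrier G)"
abbreviation "H \<equiv> group_hopf_algebra R G"
abbreviation "\<delta> \<equiv> unit_vec R (carrier G)"

lemma group_basis_eq: "group_basis R G = \<delta>"
  by (intro ext) (simp add: group_basis_def unit_vec_def)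

lemma H_fields:
  "carrier H = carrier FM" "add H = add FM" "ring.zero H = ring.zero FM" "smult H = smult FM"
  "monoid.mult H = monoid.mult (group_algebra R G)" "one H = one (group_algebra R G)"
  by (simp_all add: group_hopf_algebra_def Let_def module.extend_def hopf.fields_def group_algebra_def)

lemma GA_fields:
  "carrier (group_algebra R G) = carrier FM" "add (group_algebra R G) = add FM"
  "ring.zero (group_algebra R G) = ring.zero FM" "smult (group_algebra R G) = smult FM"
  by (simp_all add: group_algebra_def)

lemma H_module: "module R H"
  by (rule module_cong[OF R.free_module_module]) (simp_all add: H_fields)

lemma H_linear: "linear_maps R H P = linear_maps R FM P" "linear_maps R P H = linear_maps R P FM"
  by (simp_all add: linear_maps_def H_fields)

lemma \<delta>_closed: "g \<in> carrier G \<Longrightarrow> \<delta> g \<in> carrier H"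
  unfolding H_fields by (rule R.unit_vec_closed)

lemma H_linear_eq:
  assumes "module R P" and "f \<in> linear_maps R H P" and "g \<in> linear_maps R H P"
    and "\<And>x. x \<in> carrier G \<Longrightarrow> f (\<delta> x) = g (\<delta> x)" and "v \<in> carrier H"
  shows "f v = g v"
  using module.free_module_linear_eq[OF assms(1), of f "carrier G" g v] assms(2-)
  by (simp add: H_linear H_fields(1))

text \<open>Multiplication by the group element \<open>x\<close>, in terms of coefficient functions;
  see \<open>\<delta>_mult\<close>.\<close>

definition shift :: "'c \<Rightarrow> ('c \<Rightarrow> 'a) \<Rightarrow> 'c \<Rightarrow> 'a"
  where "shift x g = (\<lambda>z\<in>carrier G. g (inv\<^bsub>G\<^esub> x \<otimes>\<^bsub>G\<^esub> z))"

lemma H_mem: "f \<in> carrier H \<Longrightarrow> x \<in> carrier G \<Longrightarrow> f x \<in> carrier R"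
  using free_module_mem[of f R "carrier G" x] by (simp add: H_fields)

lemma H_memI:
  assumes "\<And>x. x \<in> carrier G \<Longrightarrow> h x \<in> carrier R" and "finite {x \<in> carrier G. h x \<noteq> \<zero>}"
  shows "(\<lambda>x\<in>carrier G. h x) \<in> carrier H"
proof -
  have "{x \<in> carrier G. (\<lambda>x\<in>carrier G. h x) x \<noteq> \<zero>} = {x \<in> carrier G. h x \<noteq> \<zero>}" by auto
  then show ?thesis using assms by (auto simp: H_fields free_module_simps)
qed

lemma H_finite: "f \<in> carrier H \<Longrightarrow> finite {x \<in> carrier G. f x \<noteq> \<zero>}"
  by (simp add: H_fields free_module_simps)

lemma H_ops:
  "f \<oplus>\<^bsub>H\<^esub> g = (\<lambda>x\<in>carrier G. f x \<oplus> g x)" "r \<odot>\<^bsub>H\<^esub> f = (\<lambda>x\<in>carrier G. r \<otimes> f x)"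
  by (simp_all add: H_fields free_module_simps)

text \<open>Injectivity of \<open>\<tau>\<close> keeps the support finite. The instances are the
  translations of the group and its inversion.\<close>

lemma precomp_bij_linear:
  assumes \<tau>: "\<And>z. z \<in> carrier G \<Longrightarrow> \<tau> z \<in> carrier G" and inj: "inj_on \<tau> (carrier G)"
  shows "(\<lambda>g. \<lambda>z\<in>carrier G. g (\<tau> z)) \<in> linear_maps R H H"
proof (rule linear_mapsI)
  fix g assume g: "g \<in> carrier H"
  have "finite (\<tau> ` {z \<in> carrier G. g (\<tau> z) \<noteq> \<zero>})"
    by (rule finite_subset[OF _ H_finite[OF g]]) (use \<tau> in auto)
  then have "finite {z \<in> carrier G. g (\<tau> z) \<noteq> \<zero>}"
    by (rule finite_imageD) (rule inj_on_subset[OF inj], auto)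
  then show "(\<lambda>z\<in>carrier G. g (\<tau> z)) \<in> carrier H"
    by (intro H_memI H_mem[OF g] \<tau>)
qed (auto simp: H_ops \<tau> intro!: restrict_ext)

lemma shift_linear: "x \<in> carrier G \<Longrightarrow> shift x \<in> linear_maps R H H"
  unfolding shift_def
  by (rule precomp_bij_linear) (auto intro!: inj_onI)

lemma shift_\<delta>:
  assumes "x \<in> carrier G" and "y \<in> carrier G"
  shows "shift x (\<delta> y) = \<delta> (x \<otimes>\<^bsub>G\<^esub> y)"
proof -
  have "inv\<^bsub>G\<^esub> x \<otimes>\<^bsub>G\<^esub> z = y \<longleftrightarrow> z = x \<otimes>\<^bsub>G\<^esub> y" if "z \<in> carrier G" for z
    using that assms by (metis G.inv_closed G.inv_solve_left)
  then show ?thesis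
    using assms by (auto simp: shift_def unit_vec_def intro!: restrict_ext)
qed

text \<open>The convolution product is the linear extension of translation in its left factor. Hence
  it is bilinear, and the laws of the algebra need only be checked on group elements.\<close>

lemma mult_free_lift:
  assumes f: "f \<in> carrier H" and g: "g \<in> carrier H"
  shows "f \<otimes>\<^bsub>H\<^esub> g = free_lift R (carrier G) FM (\<lambda>x. shift x g) f"
proof -
  let ?S = "{x \<in> carrier G. f x \<noteq> \<zero>}"
  let ?r = "\<Oplus>\<^bsub>FM\<^esub>x\<in>?S. f x \<odot>\<^bsub>FM\<^esub> shift x g"
  interpret FM: module R FM by (rule R.free_module_module)
  have sh: "shift x g \<in> carrier FM" if "x \<in> carrier G" for x
    using linear_mapsD(1)[OF shift_linear[OF that] g] by (simp add: H_fields)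
  have cl: "(\<lambda>x. f x \<odot>\<^bsub>FM\<^esub> shift x g) \<in> ?S \<rightarrow> carrier FM"
    using sh H_mem[OF f] by (intro Pi_I FM.smult_closed) auto
  have r: "?r \<in> carrier FM" by (rule FM.finsum_closed[OF cl])
  have "?r z = (\<Oplus>x\<in>?S. f x \<otimes> g (inv\<^bsub>G\<^esub> x \<otimes>\<^bsub>G\<^esub> z))" if z: "z \<in> carrier G" for z
    unfolding R.free_module_finsum_apply[OF z cl]
    using z H_mem[OF f] H_mem[OF g] by (intro R.finsum_cong' refl) (auto simp: free_module_simps shift_def)
  then have "?r = (\<lambda>z\<in>carrier G. \<Oplus>x\<in>?S. f x \<otimes> g (inv\<^bsub>G\<^esub> x \<otimes>\<^bsub>G\<^esub> z))"
    using r by (auto simp: free_module_simps PiE_iff extensional_def fun_eq_iff)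
  then show ?thesis by (simp add: H_fields group_algebra_def free_lift_def)
qed

lemma mult_right_linear: 
  assumes g: "g \<in> carrier H"
  shows "(\<lambda>f. f \<otimes>\<^bsub>H\<^esub> g) \<in> linear_maps R H H"
proof -
  have "(\<lambda>x. shift x g) \<in> carrier G \<rightarrow> carrier FM"
    using linear_mapsD(1)[OF shift_linear g] by (simp add: H_fields)
  then have "free_lift R (carrier G) FM (\<lambda>x. shift x g) \<in> linear_maps R H H"
    using module.free_lift_linear[OF R.free_module_module] by (simp add: H_linear)
  then show ?thesis
    by (rule linear_maps_cong[OF H_module]) (rule mult_free_lift[OF _ g])
qed

lemma \<delta>_mult:
  assumes x: "x \<in> carrier G" and g: "g \<in> carrier H"
  shows "\<delta> x \<otimes>\<^bsub>H\<^esub> g = shift x g"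
proof -
  have "(\<lambda>x. shift x g) \<in> carrier G \<rightarrow> carrier FM"
    using linear_mapsD(1)[OF shift_linear g] by (simp add: H_fields)
  then show ?thesis
    using module.free_lift_unit[OF R.free_module_module _ x] by (simp add: mult_free_lift \<delta>_closed x g)
qed

lemma mult_left_linear: 
  assumes f: "f \<in> carrier H"
  shows "(\<lambda>g. f \<otimes>\<^bsub>H\<^esub> g) \<in> linear_maps R H H"
proof -
  interpret FM: module R FM by (rule R.free_module_module)
  have "(\<lambda>g. free_lift R (carrier G) FM (\<lambda>x. shift x g) f) \<in> linear_maps R H FM"
    unfolding free_lift_def
  proof (intro FM.linear_maps_sum FM.linear_maps_smult)
    show "finite {x \<in> carrier G. f x \<noteq> \<zero>}" by (rule H_finite[OF f])
    fix x assume x: "x \<in> {x \<in> carrier G. f x \<noteq> \<zero>}"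
    then show "f x \<in> carrier R" using H_mem[OF f] by auto
    show "shift x \<in> linear_maps R H FM" using shift_linear x by (simp add: H_linear)
  qed
  then have "(\<lambda>g. free_lift R (carrier G) FM (\<lambda>x. shift x g) f) \<in> linear_maps R H H"
    by (simp add: H_linear)
  then show ?thesis
    by (rule linear_maps_cong[OF H_module]) (rule mult_free_lift[OF f])
qed

lemma \<delta>_mult_\<delta>: "x \<in> carrier G \<Longrightarrow> y \<in> carrier G \<Longrightarrow> \<delta> x \<otimes>\<^bsub>H\<^esub> \<delta> y = \<delta> (x \<otimes>\<^bsub>G\<^esub> y)"
  by (simp add: \<delta>_mult \<delta>_closed shift_\<delta>)

lemma H_one: "\<one>\<^bsub>H\<^esub> = \<delta> \<one>\<^bsub>G\<^esub>"
  by (simp add: H_fields group_algebra_def group_basis_eq)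

lemma H_mult_closed: "f \<in> carrier H \<Longrightarrow> g \<in> carrier H \<Longrightarrow> f \<otimes>\<^bsub>H\<^esub> g \<in> carrier H"
  using linear_mapsD(1)[OF mult_left_linear] by blast

text \<open>Both sides are linear in each of the three arguments, so the identity reduces in three
  rounds to associativity in the group.\<close>

lemma H_mult_assoc:
  assumes f: "f \<in> carrier H" and g: "g \<in> carrier H" and h: "h \<in> carrier H"
  shows "f \<otimes>\<^bsub>H\<^esub> g \<otimes>\<^bsub>H\<^esub> h = f \<otimes>\<^bsub>H\<^esub> (g \<otimes>\<^bsub>H\<^esub> h)"
proof (rule H_linear_eq[OF H_module _ _ _ f])
  note R = mult_right_linear and L = mult_left_linear
  show "(\<lambda>f. f \<otimes>\<^bsub>H\<^esub> g \<otimes>\<^bsub>H\<^esub> h) \<in> linear_maps R H H"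
    by (rule linear_maps_comp[OF R[OF g] R[OF h]])
  show "(\<lambda>f. f \<otimes>\<^bsub>H\<^esub> (g \<otimes>\<^bsub>H\<^esub> h)) \<in> linear_maps R H H"
    by (rule R[OF H_mult_closed[OF g h]])
  fix x assume x: "x \<in> carrier G"
  show "\<delta> x \<otimes>\<^bsub>H\<^esub> g \<otimes>\<^bsub>H\<^esub> h = \<delta> x \<otimes>\<^bsub>H\<^esub> (g \<otimes>\<^bsub>H\<^esub> h)"
  proof (rule H_linear_eq[OF H_module _ _ _ g])
    show "(\<lambda>g. \<delta> x \<otimes>\<^bsub>H\<^esub> g \<otimes>\<^bsub>H\<^esub> h) \<in> linear_maps R H H"
      by (rule linear_maps_comp[OF L[OF \<delta>_closed[OF x]] R[OF h]])
    show "(\<lambda>g. \<delta> x \<otimes>\<^bsub>H\<^esub> (g \<otimes>\<^bsub>H\<^esub> h)) \<in> linear_maps R H H"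
      by (rule linear_maps_comp[OF R[OF h] L[OF \<delta>_closed[OF x]]])
    fix y assume y: "y \<in> carrier G"
    show "\<delta> x \<otimes>\<^bsub>H\<^esub> \<delta> y \<otimes>\<^bsub>H\<^esub> h = \<delta> x \<otimes>\<^bsub>H\<^esub> (\<delta> y \<otimes>\<^bsub>H\<^esub> h)"
    proof (rule H_linear_eq[OF H_module _ _ _ h])
      show "(\<lambda>h. \<delta> x \<otimes>\<^bsub>H\<^esub> \<delta> y \<otimes>\<^bsub>H\<^esub> h) \<in> linear_maps R H H"
        by (rule L[OF H_mult_closed[OF \<delta>_closed[OF x] \<delta>_closed[OF y]]])
      show "(\<lambda>h. \<delta> x \<otimes>\<^bsub>H\<^esub> (\<delta> y \<otimes>\<^bsub>H\<^esub> h)) \<in> linear_maps R H H"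
        by (rule linear_maps_comp[OF L[OF \<delta>_closed[OF y]] L[OF \<delta>_closed[OF x]]])
    qed (simp add: x y \<delta>_mult_\<delta> G.m_assoc)
  qed
qed

lemma H_mult_comm:
  assumes f: "f \<in> carrier H" and g: "g \<in> carrier H"
  shows "f \<otimes>\<^bsub>H\<^esub> g = g \<otimes>\<^bsub>H\<^esub> f"
proof (rule H_linear_eq[OF H_module mult_right_linear[OF g] mult_left_linear[OF g] _ f])
  fix x assume x: "x \<in> carrier G"
  note \<delta> = \<delta>_closed[OF x]
  show "\<delta> x \<otimes>\<^bsub>H\<^esub> g = g \<otimes>\<^bsub>H\<^esub> \<delta> x"
    by (rule H_linear_eq[OF H_module mult_left_linear[OF \<delta>] mult_right_linear[OF \<delta>] _ g])
      (simp add: x \<delta>_mult_\<delta> G.m_comm)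
qed

lemma H_one_mult: "f \<in> carrier H \<Longrightarrow> \<one>\<^bsub>H\<^esub> \<otimes>\<^bsub>H\<^esub> f = f"
  unfolding H_one
  by (rule H_linear_eq[OF H_module mult_left_linear[OF \<delta>_closed] linear_maps_id]) (simp_all add: \<delta>_mult_\<delta>)

lemma H_algebra: "assoc_algebra R H"
proof -
  interpret H: module R H by (rule H_module)
  have one: "\<one>\<^bsub>H\<^esub> \<in> carrier H" by (simp add: H_one \<delta>_closed)
  note L = linear_mapsD[OF mult_left_linear] and R = linear_mapsD[OF mult_right_linear]
  have "ring H"
    by (rule ringI[OF H.M.abelian_group_axioms monoidI])
      (simp_all add: H_mult_closed H_mult_assoc H_one_mult one H_mult_comm[OF _ one] R L)
  then show ?thesis
    by (intro assoc_algebra.intro H_module assoc_algebra_axioms.intro) (simp_all add: L R)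
qed

sublocale H: assoc_algebra R H
  by (rule H_algebra)

sublocale HH: tensor_algebra R H H
  by (intro tensor_algebra.intro H_algebra)

section \<open>Comultiplication, counit and antipode on group elements\<close>

lemma H_comult:
  "comult H f = free_lift R (carrier G) (tensor R H H) (\<lambda>x. pure_tensor R H H (\<delta> x) (\<delta> x)) f"
proof -
  let ?A = "group_algebra R G"
  \<comment> \<open>The comultiplication is defined with the tensor square of
    \<open>group_algebra\<close>, while the Hopf axioms refer to the tensor square of
    \<open>H\<close>; the two records share the fields on which tensors depend.\<close>
  have f: "carrier H = carrier ?A" "add H = add ?A" "smult H = smult ?A"
    by (simp_all add: H_fields GA_fields)
  have "comult H f = (\<Oplus>\<^bsub>tensor R ?A ?A\<^esub>x\<in>{x \<in> carrier G. f x \<noteq> \<zero>}.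
      f x \<odot>\<^bsub>tensor R ?A ?A\<^esub> pure_tensor R ?A ?A (group_basis R G x) (group_basis R G x))"
    by (simp add: group_hopf_algebra_def Let_def module.extend_def hopf.fields_def)
  then show ?thesis
    by (simp add: free_lift_def group_basis_eq tensor_cong(2)[OF f f] tensor_cong_fields(4)[OF f f]
        finsum_cong_fields[OF tensor_cong_fields(1-3)[OF f f]])
qed

lemma comult_linear: "comult H \<in> linear_maps R H (tensor R H H)"
proof -
  have "(\<lambda>x. pure_tensor R H H (\<delta> x) (\<delta> x)) \<in> carrier G \<rightarrow> carrier (tensor R H H)"
    by (intro Pi_I HH.pure_closed \<delta>_closed)
  from module.free_lift_linear[OF HH.tensor_module this]
  show ?thesis
    by (rule_tac linear_maps_cong[OF H_module]) (simp_all add: H_linear H_comult)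
qed

lemma comult_\<delta>: "x \<in> carrier G \<Longrightarrow> comult H (\<delta> x) = pure_tensor R H H (\<delta> x) (\<delta> x)"
  unfolding H_comult
  by (rule module.free_lift_unit[OF HH.tensor_module]) (auto intro: HH.pure_closed \<delta>_closed)

lemma H_counit: "counit H f = free_lift R (carrier G) (regular_module R) (\<lambda>x. \<one>) f" if "f \<in> carrier H"
proof -
  have "counit H f = (\<Oplus>x\<in>{x \<in> carrier G. f x \<noteq> \<zero>}. f x)"
    by (simp add: group_hopf_algebra_def Let_def module.extend_def hopf.fields_def)
  also have "\<dots> = (\<Oplus>x\<in>{x \<in> carrier G. f x \<noteq> \<zero>}. f x \<otimes> \<one>)"
    using H_mem[OF that] by (intro R.finsum_cong') auto
  finally show ?thesis by (simp add: free_lift_def)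
qed

lemma counit_linear: "counit H \<in> linear_maps R H (regular_module R)"
proof -
  have "(\<lambda>x. \<one>) \<in> carrier G \<rightarrow> carrier (regular_module R)" by simp
  from module.free_lift_linear[OF R.regular_module this]
  have "free_lift R (carrier G) (regular_module R) (\<lambda>x. \<one>) \<in> linear_maps R H (regular_module R)"
    by (simp add: H_linear)
  then show ?thesis by (rule linear_maps_cong[OF H_module]) (rule H_counit)
qed

lemma counit_\<delta>: "x \<in> carrier G \<Longrightarrow> counit H (\<delta> x) = \<one>"
  using module.free_lift_unit[OF R.regular_module, of "\<lambda>x. \<one>" "carrier G" x]
  by (simp add: H_counit \<delta>_closed)

lemma H_antipode: "antipode H f = (\<lambda>x\<in>carrier G. f (inv\<^bsub>G\<^esub> x))"
  by (simp add: group_hopf_algebra_def Let_def module.extend_def hopf.fields_def)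

lemma antipode_linear: "antipode H \<in> linear_maps R H H"
proof -
  have "(\<lambda>f. \<lambda>x\<in>carrier G. f (inv\<^bsub>G\<^esub> x)) \<in> linear_maps R H H"
    by (rule precomp_bij_linear) (auto intro!: inj_onI)
  then show ?thesis by (rule linear_maps_cong[OF H_module]) (rule H_antipode)
qed

lemma antipode_\<delta>:
  assumes x: "x \<in> carrier G"
  shows "antipode H (\<delta> x) = \<delta> (inv\<^bsub>G\<^esub> x)"
proof -
  have "inv\<^bsub>G\<^esub> z = x \<longleftrightarrow> z = inv\<^bsub>G\<^esub> x" if "z \<in> carrier G" for z
    using that x G.inv_inv by metis
  then show ?thesis
    by (auto simp: H_antipode unit_vec_def intro!: restrict_ext)
qed

end

section \<open>Actions of free abelian groups on finitely generated modules\<close>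

definition lin_action ::
    "('a, 'r) ring_scheme \<Rightarrow> ('g, 'k) monoid_scheme \<Rightarrow> ('a, 'b, 'm) module_scheme \<Rightarrow> ('g \<Rightarrow> 'b \<Rightarrow> 'b) \<Rightarrow> bool"
  where "lin_action R G M \<alpha> \<longleftrightarrow>
    (\<forall>g\<in>carrier G. \<alpha> g \<in> linear_maps R M M) \<and>
    (\<forall>g\<in>carrier G. \<forall>h\<in>carrier G. \<forall>x\<in>carrier M. \<alpha> (g \<otimes>\<^bsub>G\<^esub> h) x = \<alpha> g (\<alpha> h x)) \<and>
    (\<forall>x\<in>carrier M. \<alpha> \<one>\<^bsub>G\<^esub> x = x)"

lemma lin_actionD:
  assumes "lin_action R G M \<alpha>"
  shows "g \<in> carrier G \<Longrightarrow> \<alpha> g \<in> linear_maps R M M"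
    and "g \<in> carrier G \<Longrightarrow> h \<in> carrier G \<Longrightarrow> x \<in> carrier M \<Longrightarrow> \<alpha> (g \<otimes>\<^bsub>G\<^esub> h) x = \<alpha> g (\<alpha> h x)"
    and "x \<in> carrier M \<Longrightarrow> \<alpha> \<one>\<^bsub>G\<^esub> x = x"
  using assms by (auto simp: lin_action_def)

lemma (in module) lspan_linear_eq:
  assumes "module R N" and f: "f \<in> linear_maps R M N" and g: "g \<in> linear_maps R M N"
    and B: "B \<subseteq> carrier M" and eq: "\<And>b. b \<in> B \<Longrightarrow> f b = g b" and x: "x \<in> lspan R M B"
  shows "f x = g x"
  using x
proof induction
  case zero
  show ?case
    using linear_maps_zero[OF module_axioms assms(1) f] linear_maps_zero[OF module_axioms assms(1) g] by simp
next
  case (step r s y)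
  have "s \<in> carrier M" "y \<in> carrier M" using step B lspan_closed[OF B] by auto
  then show ?case using step eq by (simp add: linear_mapsD[OF f] linear_mapsD[OF g])
qed

lemma (in cring) free_module_span:
  assumes "finite B"
  shows "carrier (free_module R B) \<subseteq> lspan R (free_module R B) (unit_vec R B ` B)"
proof
  interpret F: module R "free_module R B" by (rule free_module_module)
  have S: "unit_vec R B ` B \<subseteq> carrier (free_module R B)" using unit_vec_closed by auto
  fix f assume f: "f \<in> carrier (free_module R B)"
  then have "f = (\<Oplus>\<^bsub>free_module R B\<^esub>x\<in>B. f x \<odot>\<^bsub>free_module R B\<^esub> unit_vec R B x)"
    by (rule free_module_expansion) (use assms in auto)
  moreover have "(\<Oplus>\<^bsub>free_module R B\<^esub>x\<in>B. f x \<odot>\<^bsub>free_module R B\<^esub> unit_vec R B x)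
      \<in> lspan R (free_module R B) (unit_vec R B ` B)"
    using free_module_mem[OF f]
    by (intro F.lspan_finsum_closed[OF S] Pi_I F.lspan_smult[OF S] F.lspan_base[OF S]) auto
  ultimately show "f \<in> lspan R (free_module R B) (unit_vec R B ` B)" by simp
qed

text \<open>The coefficient matrices of the powers of an automorphism span a finitely generated module;
  adding the relations for the first power beyond each end makes both outer coefficients \<open>1\<close>.\<close>

lemma (in module) integer_action_relation:
  assumes noeth: "noetherian_ring R" and fg: "fg_module R M" and act: "lin_action R integer_group M \<sigma>"
  shows "\<exists>d \<rho>. (\<forall>j. \<rho> j \<in> carrier R) \<and> \<rho> 0 = \<ominus> \<one> \<and>
    (\<forall>x\<in>carrier M. \<sigma> (int (Suc d)) x = (\<Oplus>\<^bsub>M\<^esub>j\<in>{..d}. \<rho> j \<odot>\<^bsub>M\<^esub> \<sigma> (int j) x))"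
proof -
  note lin = lin_actionD(1)[OF act, simplified]
  have \<sigma>M: "\<sigma> k x \<in> carrier M" if "x \<in> carrier M" for k x using linear_mapsD(1)[OF lin that] .
  have \<sigma>\<sigma>: "\<sigma> k (\<sigma> l x) = \<sigma> (k + l) x" if "x \<in> carrier M" for k l x
    using lin_actionD(2)[OF act _ _ that, of k l] by simp
  have \<sigma>0: "\<sigma> 0 x = x" if "x \<in> carrier M" for x using lin_actionD(3)[OF act that] by simp
  obtain B where B: "finite B" "B \<subseteq> carrier M" "carrier M \<subseteq> lspan R M B"
    using fg by (auto simp: fg_module_iff)
  have C_ex: "\<exists>c\<in>B \<rightarrow> carrier R. \<sigma> i b = (\<Oplus>\<^bsub>M\<^esub>b'\<in>B. c b' \<odot>\<^bsub>M\<^esub> b')" if "b \<in> B" for i b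
  proof -
    have "\<sigma> i b \<in> lspan R M B" using B(2,3) \<sigma>M that by blast
    moreover have "(\<lambda>x. x) \<in> B \<rightarrow> carrier M" using B(2) by auto
    ultimately show ?thesis using lspan_image_finsum[OF B(1), of "\<lambda>x. x" "\<sigma> i b"] by simp
  qed
  \<comment> \<open>Row \<open>b\<close> of a matrix for \<open>\<sigma> i\<close>. As
    \<open>B\<close> need not be linearly independent, this is a choice, and the matrices need not
    multiply like the powers; only linear relations among them are used.\<close>
  define C where "C i b = (SOME c. c \<in> B \<rightarrow> carrier R \<and> \<sigma> i b = (\<Oplus>\<^bsub>M\<^esub>b'\<in>B. c b' \<odot>\<^bsub>M\<^esub> b'))" for i b
  have C: "C i b \<in> B \<rightarrow> carrier R" "\<sigma> i b = (\<Oplus>\<^bsub>M\<^esub>b'\<in>B. C i b b' \<odot>\<^bsub>M\<^esub> b')" if "b \<in> B" for i b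
    using someI_ex[OF C_ex[OF that, of i, unfolded Bex_def]] by (simp_all add: C_def)
  let ?BB = "B \<times> B"
  let ?W = "free_module R ?BB"
  interpret W: module R ?W by (rule R.free_module_module)
  have BB: "finite ?BB" using B by simp
  define w where "w i = (\<lambda>(b, b')\<in>?BB. C i b b')" for i
  have w: "w i \<in> carrier ?W" for i using C(1) BB by (auto simp: w_def free_module_simps Pi_iff)
  then have rw: "range w \<subseteq> carrier ?W" by auto
  have us: "unit_vec R ?BB ` ?BB \<subseteq> carrier ?W" using R.unit_vec_closed[of _ ?BB] by auto
  have "lspan R ?W (range w) \<subseteq> lspan R ?W (unit_vec R ?BB ` ?BB)"
    using W.lspan_closed[OF rw] R.free_module_span[OF BB] by blast
  \<comment> \<open>All the matrices lie in one free module of finite rank, so their span is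
    finitely generated; the generators in turn involve finitely many powers only.\<close>
  from W.noetherian_submodule[OF noeth _ us W.lspan_submodule[OF rw] this]
  obtain D where D: "finite D" "D \<subseteq> lspan R ?W (range w)" "lspan R ?W (range w) \<subseteq> lspan R ?W D"
    using BB by auto
  have "\<forall>x\<in>D. \<exists>F. finite F \<and> F \<subseteq> range w \<and> x \<in> lspan R ?W F"
    using D(2) by (intro ballI lspan_finite_subset) (rule subsetD)
  then obtain Fx where Fx: "\<And>x. x \<in> D \<Longrightarrow> finite (Fx x) \<and> Fx x \<subseteq> range w \<and> x \<in> lspan R ?W (Fx x)"
    by metis
  have "finite (\<Union>(Fx ` D))" "\<Union>(Fx ` D) \<subseteq> range w" using Fx D(1) by auto
  then obtain I where I: "finite I" "\<Union>(Fx ` D) = w ` I"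
    using finite_subset_image[of "\<Union>(Fx ` D)" w UNIV] by auto
  \<comment> \<open>The exponents from \<open>-K\<close> to \<open>K\<close> suffice to span the
    matrices of all powers.\<close>
  obtain K where K: "\<forall>k\<in>(\<lambda>i. nat \<bar>i\<bar>) ` I. k \<le> K"
    using I(1) finite_nat_set_iff_bounded_le by (meson finite_imageI)
  \<comment> \<open>The exponents \<open>-K, ..., K\<close> raised by \<open>K + 1\<close>; the
    index 0 stays free for the constant term.\<close>
  define J where "J = {1..2 * K + 1}"
  define f where "f j = w (int j - int K - 1)" for j :: nat
  have fJ: "f \<in> J \<rightarrow> carrier ?W" using w by (auto simp: f_def)
  have fJ': "f ` J \<subseteq> carrier ?W" using w by (auto simp: f_def)
  have "w ` I \<subseteq> f ` J"
  proof
    fix v assume "v \<in> w ` I"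
    then obtain i where i: "i \<in> I" "v = w i" by auto
    then have "\<bar>i\<bar> \<le> int K" using K by force
    then have "nat (i + int K + 1) \<in> J" "v = f (nat (i + int K + 1))" by (auto simp: J_def f_def i)
    then show "v \<in> f ` J" by blast
  qed
  then have "Fx x \<subseteq> f ` J" if "x \<in> D" for x using I(2) that by blast
  then have "D \<subseteq> lspan R ?W (f ` J)" using Fx lspan_mono[of _ "f ` J" R ?W] by blast
  then have wJ: "w i \<in> lspan R ?W (f ` J)" for i
    using W.lspan_minimal[OF W.lspan_submodule[OF fJ'], of D] D(3) W.lspan_base[OF rw, of "w i"] by blast
  \<comment> \<open>The sum of the matrices one step beyond each end of the range. Its expansion in
    the inner powers is a relation with coefficient 1 at both ends.\<close>
  define x where "x = w (int K + 1) \<oplus>\<^bsub>?W\<^esub> w (- int K - 1)"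
  have "x \<in> lspan R ?W (f ` J)"
    unfolding x_def by (rule W.lspan_add[OF fJ' wJ wJ])
  from W.lspan_image_finsum[OF _ fJ this]
  obtain u where u: "u \<in> J \<rightarrow> carrier R" "x = (\<Oplus>\<^bsub>?W\<^esub>j\<in>J. u j \<odot>\<^bsub>?W\<^esub> f j)" by (auto simp: J_def)
  have uJ: "u j \<in> carrier R" if "j \<in> J" for j using u that by auto
  have finJ: "finite J" by (simp add: J_def)
  have gen: "\<sigma> (int K + 1) b \<oplus>\<^bsub>M\<^esub> \<sigma> (- int K - 1) b = (\<Oplus>\<^bsub>M\<^esub>j\<in>J. u j \<odot>\<^bsub>M\<^esub> \<sigma> (int j - int K - 1) b)"
    if b: "b \<in> B" for b
  proof -
    \<comment> \<open>Reads row \<open>b\<close> of a matrix as an element of \<open>M\<close>. It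
      sends the matrix of \<open>\<sigma> i\<close> to \<open>\<sigma> i b\<close>, and so carries
      linear relations among matrices over to the automorphisms.\<close>
    define \<Lambda> where "\<Lambda> v = (\<Oplus>\<^bsub>M\<^esub>b'\<in>B. v (b, b') \<odot>\<^bsub>M\<^esub> b')" for v
    have \<Lambda>: "\<Lambda> \<in> linear_maps R ?W M"
      unfolding \<Lambda>_def
    proof (intro linear_maps_sum B(1) linear_maps_smult_point)
      fix b' assume b': "b' \<in> B"
      show "(\<lambda>v. v (b, b')) \<in> linear_maps R ?W (regular_module R)"
        using b b' by (intro R.free_module_coord_linear) simp
      show "b' \<in> carrier M" using b' B(2) by auto
    qed
    have \<Lambda>w: "\<Lambda> (w i) = \<sigma> i b" for i
      unfolding \<Lambda>_def C(2)[OF b] using b C(1)[OF b] B(2)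
      by (intro M.finsum_cong') (auto simp: w_def)
    have "\<sigma> (int K + 1) b \<oplus>\<^bsub>M\<^esub> \<sigma> (- int K - 1) b = \<Lambda> x"
      unfolding x_def linear_mapsD(2)[OF \<Lambda> w w] \<Lambda>w ..
    also have "\<dots> = (\<Oplus>\<^bsub>M\<^esub>j\<in>J. \<Lambda> (u j \<odot>\<^bsub>?W\<^esub> f j))"
      unfolding u(2) using uJ fJ
      by (intro linear_maps_finsum[OF W.module_axioms module_axioms \<Lambda>] Pi_I W.smult_closed) auto
    also have "\<dots> = (\<Oplus>\<^bsub>M\<^esub>j\<in>J. u j \<odot>\<^bsub>M\<^esub> \<sigma> (int j - int K - 1) b)"
      using uJ \<sigma>M b B(2) linear_mapsD(3)[OF \<Lambda>] w
      by (intro M.finsum_cong' refl Pi_I) (auto simp: f_def \<Lambda>w intro!: smult_closed)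
    finally show ?thesis .
  qed
  have all: "\<sigma> (int K + 1) y \<oplus>\<^bsub>M\<^esub> \<sigma> (- int K - 1) y = (\<Oplus>\<^bsub>M\<^esub>j\<in>J. u j \<odot>\<^bsub>M\<^esub> \<sigma> (int j - int K - 1) y)"
    if y: "y \<in> carrier M" for y
  proof (rule lspan_linear_eq[OF module_axioms _ _ B(2) gen])
    show "(\<lambda>y. \<sigma> (int K + 1) y \<oplus>\<^bsub>M\<^esub> \<sigma> (- int K - 1) y) \<in> linear_maps R M M"
      by (intro linear_maps_add lin)
    show "(\<lambda>y. \<Oplus>\<^bsub>M\<^esub>j\<in>J. u j \<odot>\<^bsub>M\<^esub> \<sigma> (int j - int K - 1) y) \<in> linear_maps R M M"
      by (intro linear_maps_sum finJ linear_maps_smult lin uJ)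
    show "y \<in> lspan R M B" using y B(3) by auto
  qed
  \<comment> \<open>After the shift by \<open>K + 1\<close> the lower end becomes the identity;
    moved to the other side it contributes the coefficient \<open>\<ominus> \<one>\<close> at 0, and
    the upper end is the power \<open>d + 1\<close> with \<open>d = 2K + 1\<close>.\<close>
  define \<rho> where "\<rho> j = (if j = 0 then \<ominus> \<one> else if j \<in> J then u j else \<zero>)" for j
  have \<rho>: "\<rho> j \<in> carrier R" for j using uJ by (auto simp: \<rho>_def)
  have J0: "{..2 * K + 1} = insert 0 J" "0 \<notin> J" by (auto simp: J_def)
  have "\<sigma> (int (Suc (2 * K + 1))) y = (\<Oplus>\<^bsub>M\<^esub>j\<in>{..2 * K + 1}. \<rho> j \<odot>\<^bsub>M\<^esub> \<sigma> (int j) y)"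
    if y: "y \<in> carrier M" for y
  proof -
    \<comment> \<open>Evaluating the symmetric relation at this element raises every exponent by
      \<open>K + 1\<close>.\<close>
    let ?z = "\<sigma> (int K + 1) y"
    let ?s = "\<Oplus>\<^bsub>M\<^esub>j\<in>J. u j \<odot>\<^bsub>M\<^esub> \<sigma> (int j) y"
    have z: "?z \<in> carrier M" using \<sigma>M[OF y] .
    have s: "?s \<in> carrier M" using uJ \<sigma>M[OF y] by (intro M.finsum_closed Pi_I smult_closed) auto
    have "\<sigma> (int (Suc (2 * K + 1))) y \<oplus>\<^bsub>M\<^esub> y = ?s"
      using all[OF z] by (simp add: \<sigma>\<sigma>[OF y] \<sigma>0[OF y] algebra_simps)
    then have "\<sigma> (int (Suc (2 * K + 1))) y = ?s \<oplus>\<^bsub>M\<^esub> \<ominus>\<^bsub>M\<^esub> y"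
      using M.add.inv_solve_right[OF \<sigma>M[OF y] s y] by simp
    also have "\<dots> = (\<ominus> \<one>) \<odot>\<^bsub>M\<^esub> \<sigma> (int 0) y \<oplus>\<^bsub>M\<^esub> ?s"
      using s y by (simp add: \<sigma>0 smult_neg_one M.a_comm)
    also have "?s = (\<Oplus>\<^bsub>M\<^esub>j\<in>J. \<rho> j \<odot>\<^bsub>M\<^esub> \<sigma> (int j) y)"
      using \<rho> \<sigma>M[OF y] J0(2) by (intro M.finsum_cong' refl Pi_I smult_closed) (auto simp: \<rho>_def)
    also have "(\<ominus> \<one>) \<odot>\<^bsub>M\<^esub> \<sigma> (int 0) y \<oplus>\<^bsub>M\<^esub> \<dots> = (\<Oplus>\<^bsub>M\<^esub>j\<in>{..2 * K + 1}. \<rho> j \<odot>\<^bsub>M\<^esub> \<sigma> (int j) y)"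
      unfolding J0(1) using \<rho> \<sigma>M[OF y] J0(2) finJ
      by (subst M.finsum_insert) (auto simp: \<rho>_def[of 0])
    finally show ?thesis .
  qed
  then show ?thesis using \<rho> by (intro exI[of _ "2 * K + 1"] exI[of _ \<rho>]) (auto simp: \<rho>_def)
qed

text \<open>Multiplication by \<open>t\<close> and by \<open>t\<^sup>-\<^sup>1\<close> on coefficient vectors with respect to the basis
  \<open>1, t, \<dots>, t\<^sup>d\<close> of \<open>R[t, t\<^sup>-\<^sup>1]/(t\<^sup>d\<^sup>+\<^sup>1 - \<Sum> \<rho>\<^sub>j t\<^sup>j)\<close>, where \<open>\<rho>\<^sub>0 = -1\<close>; \<open>V k\<close> holds the coefficients of \<open>t\<^sup>k\<close>.\<close>

locale companion = cring R for R (structure) +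
  fixes d :: nat and \<rho> :: "nat \<Rightarrow> 'a"
  assumes \<rho>_closed [simp]: "\<rho> j \<in> carrier R" and \<rho>_0: "\<rho> 0 = \<ominus> \<one>"
begin

definition S :: "(nat \<Rightarrow> 'a) \<Rightarrow> nat \<Rightarrow> 'a"
  where "S v j = (if j = 0 then \<zero> else v (j - 1)) \<oplus> v d \<otimes> \<rho> j"

text \<open>As \<open>\<rho> 0\<close> is \<open>-1\<close>, the relation can be solved for
  \<open>t^-1\<close>: it equals the sum of \<open>\<rho> j t^(j-1)\<close> over \<open>j\<close>
  from 1 to \<open>d\<close>, minus \<open>t^d\<close>. The term \<open>v 0\<close> of a vector is
  multiplied by this, and the others move down by one.\<close>

definition S' :: "(nat \<Rightarrow> 'a) \<Rightarrow> nat \<Rightarrow> 'a"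
  where "S' v j = (if j = d then \<ominus> v 0 else v (Suc j) \<oplus> v 0 \<otimes> \<rho> (Suc j))"

definition V :: "int \<Rightarrow> nat \<Rightarrow> 'a"
  where "V k = (if k \<ge> 0 then (S ^^ nat k) (\<lambda>j. if j = 0 then \<one> else \<zero>)
    else (S' ^^ nat (- k)) (\<lambda>j. if j = 0 then \<one> else \<zero>))"

lemma S_closed: "(\<And>j. v j \<in> carrier R) \<Longrightarrow> S v j \<in> carrier R"
  by (simp add: S_def)

lemma S'_closed: "(\<And>j. v j \<in> carrier R) \<Longrightarrow> S' v j \<in> carrier R"
  by (simp add: S'_def)

lemma V_closed [simp]: "V k j \<in> carrier R"
proof -
  have "(S ^^ n) (\<lambda>j. if j = 0 then \<one> else \<zero>) j \<in> carrier R"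
    "(S' ^^ n) (\<lambda>j. if j = 0 then \<one> else \<zero>) j \<in> carrier R" for n j
    by (induction n arbitrary: j) (simp_all add: S_closed S'_closed)
  then show ?thesis by (simp add: V_def)
qed

text \<open>Entries beyond \<open>d\<close> have no meaning as coefficients, and \<open>S\<close>
  does produce some there. This direction therefore holds up to \<open>d\<close> only, while
  \<open>S'_S\<close> holds at every index.\<close>

lemma S_S':
  assumes v: "\<And>j. v j \<in> carrier R" and j: "j \<le> d"
  shows "S (S' v) j = v j"
proof (cases "j = 0")
  case True
  then show ?thesis using v by (simp add: S_def S'_def \<rho>_0 l_minus r_minus)
next
  case False
  then have "j - 1 \<noteq> d" using j by linarith
  with False have "S (S' v) j = (v j \<oplus> v 0 \<otimes> \<rho> j) \<oplus> (\<ominus> v 0) \<otimes> \<rho> j"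
    using j by (simp add: S_def S'_def)
  also have "\<dots> = v j" using v by (simp add: l_minus a_assoc r_neg)
  finally show ?thesis .
qed

lemma S'_S:
  assumes v: "\<And>j. v j \<in> carrier R"
  shows "S' (S v) j = v j"
proof (cases "j = d")
  case True
  then show ?thesis using v by (simp add: S_def S'_def \<rho>_0 l_minus r_minus)
next
  case False
  then have "S' (S v) j = (v j \<oplus> v d \<otimes> \<rho> (Suc j)) \<oplus> (v d \<otimes> \<ominus> \<one>) \<otimes> \<rho> (Suc j)"
    using v by (simp add: S_def S'_def \<rho>_0)
  also have "\<dots> = v j" using v by (simp add: l_minus r_minus a_assoc r_neg)
  finally show ?thesis .
qed

text \<open>For \<open>k > 0\<close> this is the cancellation \<open>S'_S\<close>, for
  \<open>k \<le> 0\<close> the definition of \<open>V\<close>. It holds at all indices, so the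
  upward step \<open>V_succ\<close> can be deduced from it, up to index \<open>d\<close>.\<close>

lemma V_pred: "V (k - 1) j = S' (V k) j"
proof (cases "k > 0")
  case True
  then have "nat k = Suc (nat (k - 1))" by simp
  then have "V k = S (V (k - 1))" using True by (simp add: V_def)
  then show ?thesis by (simp add: S'_S)
next
  case False
  then have "nat (1 - k) = Suc (nat (- k))" by simp
  then have "V (k - 1) = S' (if k = 0 then V 0 else V k)" using False by (auto simp: V_def)
  then show ?thesis by simp
qed

lemma V_succ:
  assumes "j \<le> d"
  shows "V (k + 1) j = S (V k) j"
proof -
  have "V k = S' (V (k + 1))" using V_pred[of "k + 1"] by auto
  then show ?thesis by (simp add: S_S' assms)
qed

lemma S_cong: "j \<le> d \<Longrightarrow> (\<And>i. i \<le> d \<Longrightarrow> v i = w i) \<Longrightarrow> S v j = S w j"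
  by (simp add: S_def)

lemma S'_cong: "j \<le> d \<Longrightarrow> (\<And>i. i \<le> d \<Longrightarrow> v i = w i) \<Longrightarrow> S' v j = S' w j"
  by (simp add: S'_def)

text \<open>These powers are basis elements, and no reduction takes place below
  \<open>t^d\<close>.\<close>

lemma V_nat: "i \<le> d \<Longrightarrow> j \<le> d \<Longrightarrow> V (int i) j = (if j = i then \<one> else \<zero>)"
proof (induction i arbitrary: j)
  case 0
  then show ?case by (simp add: V_def)
next
  case (Suc i)
  have "V (int (Suc i)) j = S (V (int i)) j"
    using V_succ[OF Suc.prems(2), of "int i"] by (simp add: add.commute)
  also have "\<dots> = S (\<lambda>j. if j = i then \<one> else \<zero>) j"
    using Suc by (intro S_cong) auto
  also have "\<dots> = (if j = Suc i then \<one> else \<zero>)" using Suc.prems by (auto simp: S_def)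
  finally show ?case .
qed

lemma S_lincomb:
  assumes "finite I" and a: "\<And>i. i \<in> I \<Longrightarrow> a i \<in> carrier R" and v: "\<And>i j. v i j \<in> carrier R"
  shows "S (\<lambda>j. \<Oplus>i\<in>I. a i \<otimes> v i j) j = (\<Oplus>i\<in>I. a i \<otimes> S (v i) j)"
proof -
  let ?z = "\<lambda>i. if j = 0 then \<zero> else v i (j - 1)"
  have "(\<Oplus>i\<in>I. a i \<otimes> S (v i) j) = (\<Oplus>i\<in>I. a i \<otimes> ?z i \<oplus> (a i \<otimes> v i d) \<otimes> \<rho> j)"
    using a v by (intro finsum_cong' refl Pi_I) (simp_all add: S_def r_distr m_assoc)
  also have "\<dots> = (\<Oplus>i\<in>I. a i \<otimes> ?z i) \<oplus> (\<Oplus>i\<in>I. (a i \<otimes> v i d) \<otimes> \<rho> j)"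
    using a v by (intro finsum_addf Pi_I) simp_all
  also have "(\<Oplus>i\<in>I. (a i \<otimes> v i d) \<otimes> \<rho> j) = (\<Oplus>i\<in>I. a i \<otimes> v i d) \<otimes> \<rho> j"
    using a v assms(1) by (intro finsum_ldistr[symmetric] Pi_I) simp_all
  also have "(\<Oplus>i\<in>I. a i \<otimes> ?z i) = (if j = 0 then \<zero> else (\<Oplus>i\<in>I. a i \<otimes> v i (j - 1)))"
  proof (cases "j = 0")
    case True
    have "(\<Oplus>i\<in>I. a i \<otimes> ?z i) = \<zero>" using True a by (intro add.finprod_one_eqI) simp
    then show ?thesis using True by simp
  qed simp
  finally show ?thesis by (simp add: S_def)
qed

lemma S'_lincomb:
  assumes "finite I" and a: "\<And>i. i \<in> I \<Longrightarrow> a i \<in> carrier R" and v: "\<And>i j. v i j \<in> carrier R"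
  shows "S' (\<lambda>j. \<Oplus>i\<in>I. a i \<otimes> v i j) j = (\<Oplus>i\<in>I. a i \<otimes> S' (v i) j)"
proof (cases "j = d")
  case True
  have "(\<Oplus>i\<in>I. a i \<otimes> S' (v i) j) = (\<Oplus>i\<in>I. (a i \<otimes> v i 0) \<otimes> \<ominus> \<one>)"
    using True a v by (intro finsum_cong' refl Pi_I) (simp_all add: S'_def r_minus)
  also have "\<dots> = (\<Oplus>i\<in>I. a i \<otimes> v i 0) \<otimes> \<ominus> \<one>"
    using a v assms(1) by (intro finsum_ldistr[symmetric] Pi_I) simp_all
  also have "\<dots> = \<ominus> (\<Oplus>i\<in>I. a i \<otimes> v i 0)"
    using a v by (subst r_minus) (auto intro!: finsum_closed r_one)
  finally show ?thesis using True by (simp add: S'_def)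
next
  case False
  have "(\<Oplus>i\<in>I. a i \<otimes> S' (v i) j) = (\<Oplus>i\<in>I. a i \<otimes> v i (Suc j) \<oplus> (a i \<otimes> v i 0) \<otimes> \<rho> (Suc j))"
    using False a v by (intro finsum_cong' refl Pi_I) (simp_all add: S'_def r_distr m_assoc)
  also have "\<dots> = (\<Oplus>i\<in>I. a i \<otimes> v i (Suc j)) \<oplus> (\<Oplus>i\<in>I. (a i \<otimes> v i 0) \<otimes> \<rho> (Suc j))"
    using a v by (intro finsum_addf Pi_I) simp_all
  also have "(\<Oplus>i\<in>I. (a i \<otimes> v i 0) \<otimes> \<rho> (Suc j)) = (\<Oplus>i\<in>I. a i \<otimes> v i 0) \<otimes> \<rho> (Suc j)"
    using a v assms(1) by (intro finsum_ldistr[symmetric] Pi_I) simp_all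
  finally show ?thesis using False by (simp add: S'_def)
qed

text \<open>The coefficient form of multiplying the expansion of \<open>t^k\<close> by
  \<open>t^h\<close>. As functions of \<open>h\<close> both sides agree at 0 and obey the same
  recursion in both directions, because \<open>S\<close> and \<open>S'\<close> are linear.\<close>

lemma V_add: "j \<le> d \<Longrightarrow> V (k + h) j = (\<Oplus>i\<in>{..d}. V k i \<otimes> V (int i + h) j)"
proof (induction h arbitrary: j rule: int_induct[where k = 0])
  case base
  have "(\<Oplus>i\<in>{..d}. V k i \<otimes> V (int i + 0) j) = (\<Oplus>i\<in>{..d}. if j = i then V k i else \<zero>)"
    using base by (intro finsum_cong' refl Pi_I) (auto simp: V_nat)
  also have "\<dots> = V k j"
    using base by (intro add.finprod_singleton) auto
  finally show ?case by simp
next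
  case (step1 h)
  have "V (k + (h + 1)) j = S (V (k + h)) j" using V_succ[OF step1.prems, of "k + h"] by (simp add: add.assoc)
  also have "\<dots> = S (\<lambda>j. \<Oplus>i\<in>{..d}. V k i \<otimes> V (int i + h) j) j"
    using step1 by (intro S_cong) auto
  also have "\<dots> = (\<Oplus>i\<in>{..d}. V k i \<otimes> S (V (int i + h)) j)"
    by (rule S_lincomb) simp_all
  also have "\<dots> = (\<Oplus>i\<in>{..d}. V k i \<otimes> V (int i + (h + 1)) j)"
    using V_succ[OF step1.prems] by (intro finsum_cong' refl Pi_I) (simp_all add: S_closed add.assoc[symmetric])
  finally show ?case .
next
  case (step2 h)
  have "V (k + (h - 1)) j = S' (V (k + h)) j" using V_pred[of "k + h" j] by (simp add: algebra_simps)
  also have "\<dots> = S' (\<lambda>j. \<Oplus>i\<in>{..d}. V k i \<otimes> V (int i + h) j) j"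
    using step2 by (intro S'_cong) auto
  also have "\<dots> = (\<Oplus>i\<in>{..d}. V k i \<otimes> S' (V (int i + h)) j)"
    by (rule S'_lincomb) simp_all
  also have "\<dots> = (\<Oplus>i\<in>{..d}. V k i \<otimes> V (int i + (h - 1)) j)"
  proof (intro finsum_cong' refl Pi_I)
    show "V k i \<otimes> S' (V (int i + h)) j = V k i \<otimes> V (int i + (h - 1)) j" for i
      using V_pred[of "int i + h" j] by (simp add: algebra_simps)
  qed simp
  finally show ?case .
qed

end

text \<open>Evaluating a coefficient vector at the powers of \<open>\<sigma>\<close> applied to
  \<open>x\<close> turns \<open>S\<close> into \<open>\<sigma> 1\<close>, by the monic relation. So
  the vector \<open>V k\<close> of the formal power \<open>t^k\<close> evaluates to
  \<open>\<sigma> k x\<close>.\<close>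

lemma (in module) integer_action_expansion:
  assumes \<rho>: "companion R \<rho>" and act: "lin_action R integer_group M \<sigma>"
    and rel: "\<And>x. x \<in> carrier M \<Longrightarrow> \<sigma> (int (Suc d)) x = (\<Oplus>\<^bsub>M\<^esub>j\<in>{..d}. \<rho> j \<odot>\<^bsub>M\<^esub> \<sigma> (int j) x)"
    and x: "x \<in> carrier M"
  shows "\<sigma> k x = (\<Oplus>\<^bsub>M\<^esub>i\<in>{..d}. companion.V R d \<rho> k i \<odot>\<^bsub>M\<^esub> \<sigma> (int i) x)"
proof -
  interpret companion R d \<rho> by fact
  note lin = lin_actionD(1)[OF act, simplified]
  have \<sigma>M: "\<sigma> k x \<in> carrier M" if "x \<in> carrier M" for k x using linear_mapsD(1)[OF lin that] .
  have \<sigma>\<sigma>: "\<sigma> k (\<sigma> l x) = \<sigma> (k + l) x" if "x \<in> carrier M" for k l x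
    using lin_actionD(2)[OF act _ _ that, of k l] by simp
  have \<sigma>0: "\<sigma> 0 x = x" if "x \<in> carrier M" for x using lin_actionD(3)[OF act that] by simp
  let ?e = "\<lambda>v. \<Oplus>\<^bsub>M\<^esub>i\<in>{..d}. v i \<odot>\<^bsub>M\<^esub> \<sigma> (int i) x"
  have eM: "?e v \<in> carrier M" if "\<And>i. v i \<in> carrier R" for v
    using that \<sigma>M[OF x] by (intro M.finsum_closed Pi_I smult_closed)
  \<comment> \<open>Applying \<open>\<sigma> 1\<close> moves every term up by one; the term of
    exponent \<open>d + 1\<close> is then rewritten by \<open>rel\<close>.\<close>
  have shift: "\<sigma> 1 (?e v) = ?e (S v)" if v: "\<And>i. v i \<in> carrier R" for v
  proof -
    let ?a = "\<lambda>j. (if j = 0 then \<zero> else v (j - 1)) \<odot>\<^bsub>M\<^esub> \<sigma> (int j) x"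
    have a: "?a j \<in> carrier M" for j using v \<sigma>M[OF x] by simp
    have "\<sigma> 1 (?e v) = (\<Oplus>\<^bsub>M\<^esub>i\<in>{..d}. \<sigma> 1 (v i \<odot>\<^bsub>M\<^esub> \<sigma> (int i) x))"
      using v \<sigma>M[OF x] by (intro linear_maps_finsum[OF module_axioms module_axioms lin] Pi_I smult_closed)
    also have "\<dots> = (\<Oplus>\<^bsub>M\<^esub>i\<in>{..d}. ?a (Suc i))"
      using v \<sigma>M[OF x] linear_mapsD(3)[OF lin v \<sigma>M[OF x]]
      by (intro M.finsum_cong' refl Pi_I) (simp_all add: \<sigma>\<sigma>[OF x])
    also have "\<dots> = (\<Oplus>\<^bsub>M\<^esub>j\<in>{..Suc d}. ?a j)"
      using a v \<sigma>M[OF x] by (subst M.finsum_Suc2) (auto intro!: M.r_zero[symmetric] M.finsum_closed)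
    also have "\<dots> = ?a (Suc d) \<oplus>\<^bsub>M\<^esub> (\<Oplus>\<^bsub>M\<^esub>j\<in>{..d}. ?a j)"
      using a by (intro M.finsum_Suc) auto
    also have "?a (Suc d) = (\<Oplus>\<^bsub>M\<^esub>j\<in>{..d}. (v d \<otimes> \<rho> j) \<odot>\<^bsub>M\<^esub> \<sigma> (int j) x)"
    proof -
      have "?a (Suc d) = v d \<odot>\<^bsub>M\<^esub> (\<Oplus>\<^bsub>M\<^esub>j\<in>{..d}. \<rho> j \<odot>\<^bsub>M\<^esub> \<sigma> (int j) x)" using rel[OF x] by simp
      also have "\<dots> = (\<Oplus>\<^bsub>M\<^esub>j\<in>{..d}. v d \<odot>\<^bsub>M\<^esub> (\<rho> j \<odot>\<^bsub>M\<^esub> \<sigma> (int j) x))"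
        using v \<sigma>M[OF x] by (intro finsum_smult_ldistr) auto
      also have "\<dots> = (\<Oplus>\<^bsub>M\<^esub>j\<in>{..d}. (v d \<otimes> \<rho> j) \<odot>\<^bsub>M\<^esub> \<sigma> (int j) x)"
        using v \<sigma>M[OF x] by (intro M.finsum_cong' refl Pi_I) (simp_all add: smult_assoc1)
      finally show ?thesis .
    qed
    also have "(\<Oplus>\<^bsub>M\<^esub>j\<in>{..d}. (v d \<otimes> \<rho> j) \<odot>\<^bsub>M\<^esub> \<sigma> (int j) x) \<oplus>\<^bsub>M\<^esub> (\<Oplus>\<^bsub>M\<^esub>j\<in>{..d}. ?a j)
        = (\<Oplus>\<^bsub>M\<^esub>j\<in>{..d}. (v d \<otimes> \<rho> j) \<odot>\<^bsub>M\<^esub> \<sigma> (int j) x \<oplus>\<^bsub>M\<^esub> ?a j)"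
      using a v \<sigma>M[OF x] by (intro M.finsum_addf[symmetric] Pi_I) simp_all
    also have "\<dots> = ?e (S v)"
      using a v \<sigma>M[OF x] S_closed[OF v]
      by (intro M.finsum_cong' refl Pi_I) (simp_all add: S_def smult_l_distr M.a_comm)
    finally show ?thesis .
  qed
  show ?thesis
  proof (induction k rule: int_induct[where k = 0])
    case base
    have "?e (V 0) = (\<Oplus>\<^bsub>M\<^esub>i\<in>{..d}. if 0 = i then \<sigma> (int i) x else \<zero>\<^bsub>M\<^esub>)"
      using \<sigma>M[OF x] by (intro M.finsum_cong' refl Pi_I) (auto simp: V_def)
    also have "\<dots> = \<sigma> (int 0) x"
      using \<sigma>M[OF x] by (intro M.add.finprod_singleton) auto
    finally show ?case by simp
  next
    case (step1 k)
    have "\<sigma> (k + 1) x = \<sigma> 1 (\<sigma> k x)" by (simp add: \<sigma>\<sigma>[OF x] add.commute)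
    also have "\<dots> = ?e (S (V k))" unfolding step1 by (rule shift) simp
    also have "\<dots> = ?e (V (k + 1))"
      using \<sigma>M[OF x] by (intro M.finsum_cong' refl Pi_I) (simp_all add: V_succ S_closed)
    finally show ?case .
  next
    case (step2 k)
    \<comment> \<open>The downward step evaluates no \<open>S'\<close>: it applies the upward rule
      to \<open>V (k - 1)\<close> and cancels the invertible \<open>\<sigma> 1\<close>.\<close>
    have "\<sigma> 1 (?e (V (k - 1))) = ?e (S (V (k - 1)))" by (rule shift) simp
    also have "\<dots> = ?e (V k)"
      using \<sigma>M[OF x] V_succ[of _ "k - 1"]
      by (intro M.finsum_cong' refl Pi_I) (simp_all add: S_closed)
    also have "\<dots> = \<sigma> k x" using step2 by simp
    finally have *: "\<sigma> 1 (?e (V (k - 1))) = \<sigma> k x" .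
    have "\<sigma> (k - 1) x = \<sigma> (- 1) (\<sigma> k x)" by (simp add: \<sigma>\<sigma>[OF x])
    also have "\<dots> = \<sigma> (- 1) (\<sigma> 1 (?e (V (k - 1))))" unfolding * ..
    also have "\<dots> = ?e (V (k - 1))" using eM[of "V (k - 1)"] by (simp add: \<sigma>\<sigma> \<sigma>0)
    finally show ?case .
  qed
qed


section \<open>From one variable to several\<close>

lemma (in abelian_monoid) finsum_Times:
  assumes "finite A" and "finite B" and "\<And>a b. a \<in> A \<Longrightarrow> b \<in> B \<Longrightarrow> f (a, b) \<in> carrier G"
  shows "(\<Oplus>x\<in>A \<times> B. f x) = (\<Oplus>a\<in>A. \<Oplus>b\<in>B. f (a, b))"
  using assms(1,3)
proof (induction A)
  case empty
  then show ?case by simp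
next
  case (insert a A)
  have "(\<Oplus>x\<in>Pair a ` B. f x) = (\<Oplus>b\<in>B. f (a, b))"
    using insert.prems by (intro finsum_reindex) (auto intro: inj_onI)
  moreover have "insert a A \<times> B = Pair a ` B \<union> A \<times> B" by auto
  moreover have "(\<Oplus>x\<in>Pair a ` B \<union> A \<times> B. f x) = (\<Oplus>x\<in>Pair a ` B. f x) \<oplus> (\<Oplus>x\<in>A \<times> B. f x)"
    using insert assms(2) by (intro finsum_Un_disjoint) auto
  moreover have "(\<Oplus>a\<in>insert a A. \<Oplus>b\<in>B. f (a, b)) = (\<Oplus>b\<in>B. f (a, b)) \<oplus> (\<Oplus>a\<in>A. \<Oplus>b\<in>B. f (a, b))"
    using insert by (intro finsum_insert) (auto intro!: finsum_closed)
  ultimately show ?case using insert by simp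
qed

text \<open>Read \<open>g\<close> as the combination of the \<open>e'\<close> with coefficients
  \<open>c e' g\<close>, multiply by \<open>h\<close>, and take the coordinate at \<open>e\<close>
  of both sides.\<close>

definition shift_coeffs ::
    "('a, 'r) ring_scheme \<Rightarrow> ('g, 'k) monoid_scheme \<Rightarrow> 'g set \<Rightarrow> ('g \<Rightarrow> 'g \<Rightarrow> 'a) \<Rightarrow> bool"
  where "shift_coeffs R G E c \<longleftrightarrow> finite E \<and> E \<subseteq> carrier G \<and>
    (\<forall>e\<in>E. \<forall>g\<in>carrier G. c e g \<in> carrier R) \<and>
    (\<forall>e\<in>E. \<forall>g\<in>carrier G. \<forall>h\<in>carrier G.
      c e (g \<otimes>\<^bsub>G\<^esub> h) = (\<Oplus>\<^bsub>R\<^esub>e'\<in>E. c e' g \<otimes>\<^bsub>R\<^esub> c e (e' \<otimes>\<^bsub>G\<^esub> h)))"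

lemma comm_group_free_abelian_rank: "comm_group (free_abelian_rank n)"
proof (rule group.group_comm_groupI)
  show "group (free_abelian_rank n)" by (simp add: free_abelian_rank_def)
  show "x \<otimes>\<^bsub>free_abelian_rank n\<^esub> y = y \<otimes>\<^bsub>free_abelian_rank n\<^esub> x" for x y
    by (simp add: free_abelian_rank_def add.commute)
qed

text \<open>Projection onto the first \<open>k\<close> variables, taken inside the full group, so
  that an induction over the variables stays with one group and one action.\<close>

definition trunc_vec :: "nat \<Rightarrow> nat \<Rightarrow> (nat \<Rightarrow> int) \<Rightarrow> nat \<Rightarrow> int"
  where "trunc_vec n k g = (\<lambda>i\<in>{..<n}. if i < k then g i else 0)"

definition axis_vec :: "nat \<Rightarrow> nat \<Rightarrow> int \<Rightarrow> nat \<Rightarrow> int"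
  where "axis_vec n k z = (\<lambda>i\<in>{..<n}. if i = k then z else 0)"

text \<open>Induction on the number \<open>k\<close> of variables treated so far. A new exponent
  vector is an old one times a power of variable \<open>k\<close>, and its coordinate function is
  the old one times an entry of the companion vector \<open>V\<close>. The functional equation of
  the product is the product of those of the factors.\<close>

lemma (in module) free_abelian_action_expansion:
  assumes noeth: "noetherian_ring R" and fg: "fg_module R M"
    and act: "lin_action R (free_abelian_rank n) M \<alpha>"
  shows "\<exists>E c. shift_coeffs R (free_abelian_rank n) E c \<and>
    (\<forall>x\<in>carrier M. \<forall>g\<in>carrier (free_abelian_rank n).
      \<alpha> g x = (\<Oplus>\<^bsub>M\<^esub>e\<in>E. c e g \<odot>\<^bsub>M\<^esub> \<alpha> e x))"
proof -
  let ?G = "free_abelian_rank n"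
  let ?tr = "trunc_vec n" and ?ax = "axis_vec n"
  interpret G: comm_group ?G by (rule comm_group_free_abelian_rank)
  note lin = lin_actionD(1)[OF act] and mult = lin_actionD(2)[OF act]
  have mG: "g \<otimes>\<^bsub>?G\<^esub> h = (\<lambda>i\<in>{..<n}. g i + h i)" for g h
    by (simp add: free_abelian_rank_def)
  have GI: "g \<in> carrier ?G \<longleftrightarrow> g \<in> extensional {..<n}" for g
    by (auto simp: free_abelian_rank_def PiE_def)
  have tr: "?tr k g \<in> carrier ?G" for k g by (simp add: GI trunc_vec_def)
  have ax: "?ax k z \<in> carrier ?G" for k z by (simp add: GI axis_vec_def)
  have tr0: "?tr 0 g = \<one>\<^bsub>?G\<^esub>" for g by (simp add: trunc_vec_def free_abelian_rank_def)
  have trn: "?tr n g = g" if "g \<in> carrier ?G" for g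
    using that by (auto simp: trunc_vec_def GI extensional_def)
  have ax_add: "?ax k (y + z) = ?ax k y \<otimes>\<^bsub>?G\<^esub> ?ax k z" for k y z
    by (auto simp: axis_vec_def mG intro!: restrict_ext)
  \<comment> \<open>Two invariants beyond the claim itself, \<open>?tr k e = e\<close> and
    \<open>c e (?tr k g) = c e g\<close>, say that \<open>E\<close> and \<open>c\<close> live on the
    first \<open>k\<close> variables; they keep the next variable independent of what has been
    done.\<close>
  let ?Q = "\<lambda>k E c. finite E \<and> E \<subseteq> carrier ?G \<and> (\<forall>e\<in>E. ?tr k e = e) \<and>
    (\<forall>e\<in>E. \<forall>g\<in>carrier ?G. c e g \<in> carrier R \<and> c e (?tr k g) = c e g) \<and>
    (\<forall>e\<in>E. \<forall>g\<in>carrier ?G. \<forall>h\<in>carrier ?G.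
      c e (g \<otimes>\<^bsub>?G\<^esub> h) = (\<Oplus>e'\<in>E. c e' g \<otimes> c e (e' \<otimes>\<^bsub>?G\<^esub> h))) \<and>
    (\<forall>x\<in>carrier M. \<forall>g\<in>carrier ?G. \<alpha> (?tr k g) x = (\<Oplus>\<^bsub>M\<^esub>e\<in>E. c e g \<odot>\<^bsub>M\<^esub> \<alpha> e x))"
  have "\<exists>E c. ?Q k E c"
    if "k \<le> n" for k
    using that
  proof (induction k)
    case 0
    have "\<alpha> \<one>\<^bsub>?G\<^esub> x \<in> carrier M" if "x \<in> carrier M" for x
      using linear_mapsD(1)[OF lin] that by blast
    then show ?case
      by (intro exI[of _ "{\<one>\<^bsub>?G\<^esub>}"] exI[of _ "\<lambda>_ _. \<one>"]) (simp add: tr0)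
  next
    case (Suc k)
    then have "\<exists>E c. ?Q k E c" by simp
    then obtain E where "\<exists>c. ?Q k E c" by (rule exE)
    then obtain c where Q: "?Q k E c" by (rule exE)
    then have E: "finite E" "E \<subseteq> carrier ?G" "\<And>e. e \<in> E \<Longrightarrow> ?tr k e = e" by blast+
    have c: "\<And>e g. e \<in> E \<Longrightarrow> g \<in> carrier ?G \<Longrightarrow> c e g \<in> carrier R"
      "\<And>e g. e \<in> E \<Longrightarrow> g \<in> carrier ?G \<Longrightarrow> c e (?tr k g) = c e g"
      "\<And>e g h. e \<in> E \<Longrightarrow> g \<in> carrier ?G \<Longrightarrow> h \<in> carrier ?G \<Longrightarrow>
        c e (g \<otimes>\<^bsub>?G\<^esub> h) = (\<Oplus>e'\<in>E. c e' g \<otimes> c e (e' \<otimes>\<^bsub>?G\<^esub> h))"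
      using Q by blast+
    have c\<alpha>: "\<And>x g. x \<in> carrier M \<Longrightarrow> g \<in> carrier ?G \<Longrightarrow>
        \<alpha> (?tr k g) x = (\<Oplus>\<^bsub>M\<^esub>e\<in>E. c e g \<odot>\<^bsub>M\<^esub> \<alpha> e x)"
      using Q by blast
    have kn: "k < n" using Suc.prems by simp
    define \<sigma> where "\<sigma> z = \<alpha> (?ax k z)" for z
    have act\<sigma>: "lin_action R integer_group M \<sigma>"
      unfolding lin_action_def
    proof (intro conjI ballI)
      show "\<sigma> z \<in> linear_maps R M M" for z unfolding \<sigma>_def by (rule lin[OF ax])
      show "\<sigma> (y \<otimes>\<^bsub>integer_group\<^esub> z) x = \<sigma> y (\<sigma> z x)" if "x \<in> carrier M" for y z x
        unfolding \<sigma>_def using mult[OF ax ax that] by (simp add: ax_add)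
      have "?ax k 0 = \<one>\<^bsub>?G\<^esub>" by (simp add: axis_vec_def free_abelian_rank_def)
      then show "\<sigma> \<one>\<^bsub>integer_group\<^esub> x = x" if "x \<in> carrier M" for x
        unfolding \<sigma>_def using lin_actionD(3)[OF act that] by simp
    qed
    obtain d \<rho> where \<rho>: "\<And>j. \<rho> j \<in> carrier R" "\<rho> 0 = \<ominus> \<one>"
      and rel: "\<And>x. x \<in> carrier M \<Longrightarrow> \<sigma> (int (Suc d)) x = (\<Oplus>\<^bsub>M\<^esub>j\<in>{..d}. \<rho> j \<odot>\<^bsub>M\<^esub> \<sigma> (int j) x)"
      using integer_action_relation[OF noeth fg act\<sigma>] by auto
    interpret companion R d \<rho>
      by (rule companion.intro[OF R.is_cring companion_axioms.intro]) (use \<rho> in auto)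
    note expand = integer_action_expansion[OF companion_axioms act\<sigma> rel]
    let ?J = "{..d}"
    \<comment> \<open>A pair of an old vector \<open>e\<close> and an exponent \<open>j\<close> is
      encoded as one group element, from which \<open>?tr k\<close> and the coordinate
      \<open>k\<close> recover the two parts. So \<open>c'\<close> can be a function of group
      elements.\<close>
    define m where "m = (\<lambda>(e, j). e \<otimes>\<^bsub>?G\<^esub> ?ax k (int j))"
    define c' where "c' e g = c (?tr k e) g \<otimes> V (g k) (nat (e k))" for e g
    have ek: "e k = 0" if "e \<in> E" for e using fun_cong[OF E(3)[OF that], of k] kn by (simp add: trunc_vec_def)
    have trm: "?tr k (m (e, j)) = e" "m (e, j) k = int j" if "e \<in> E" for e j
    proof -
      have "?tr k (m (e, j)) = ?tr k e" using kn
        by (auto simp: m_def mG trunc_vec_def axis_vec_def intro!: restrict_ext)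
      then show "?tr k (m (e, j)) = e" using E(3)[OF that] by simp
      show "m (e, j) k = int j" using kn ek[OF that] by (simp add: m_def mG axis_vec_def)
    qed
    have mC: "m (e, j) \<in> carrier ?G" if "e \<in> E" for e j using that E(2) ax by (auto simp: m_def)
    have inj: "inj_on m (E \<times> ?J)"
    proof (rule inj_onI, clarify)
      fix e j e' j' assume "e \<in> E" "e' \<in> E" "m (e, j) = m (e', j')"
      then show "e = e' \<and> j = j'" using trm by (metis of_nat_eq_iff)
    qed
    have c'm: "c' (m (e, j)) g = c e g \<otimes> V (g k) j" if "e \<in> E" for e j g
      by (simp add: c'_def trm[OF that])
    have EJ: "finite (m ` (E \<times> ?J))" using E(1) by simp
    have trSuc: "?tr (Suc k) g = ?tr k g \<otimes>\<^bsub>?G\<^esub> ?ax k (g k)" for g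
      using kn by (auto simp: mG trunc_vec_def axis_vec_def less_Suc_eq intro!: restrict_ext)
    show ?case
    proof (intro exI[of _ "m ` (E \<times> ?J)"] exI[of _ c'] conjI ballI EJ)
      show "m ` (E \<times> ?J) \<subseteq> carrier ?G" using mC by auto
      show "?tr (Suc k) e = e" if e: "e \<in> m ` (E \<times> ?J)" for e
      proof -
        obtain e0 j where e0: "e = m (e0, j)" "e0 \<in> E" using e by auto
        then show ?thesis unfolding trSuc e0(1) trm[OF e0(2)] by (simp add: m_def)
      qed
      fix e g assume e: "e \<in> m ` (E \<times> ?J)" and g: "g \<in> carrier ?G"
      obtain e0 j where e0: "e = m (e0, j)" "e0 \<in> E" "j \<in> ?J" using e by auto
      show "c' e g \<in> carrier R" using e0 c(1) g by (simp add: c'm)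
      have "?tr k (?tr (Suc k) g) = ?tr k g" "?tr (Suc k) g k = g k"
        using kn by (auto simp: trunc_vec_def intro!: restrict_ext)
      then show "c' e (?tr (Suc k) g) = c' e g"
        using c(2)[OF e0(2) tr[of "Suc k" g]] c(2)[OF e0(2) g] e0 by (simp add: c'm)
      fix h assume h: "h \<in> carrier ?G"
      have gh: "(g \<otimes>\<^bsub>?G\<^esub> h) k = g k + h k" using kn by (simp add: mG)
      \<comment> \<open>Each term separates into a factor that depends on \<open>e'\<close> and one
        that depends on \<open>i\<close>, so the sum over pairs is the product of the two known
        sums.\<close>
      have tm: "c' (m (e', i)) g \<otimes> c' e (m (e', i) \<otimes>\<^bsub>?G\<^esub> h) =
          (c e' g \<otimes> c e0 (e' \<otimes>\<^bsub>?G\<^esub> h)) \<otimes> (V (g k) i \<otimes> V (int i + h k) j)"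
        if e': "e' \<in> E" for e' i
      proof -
        have cl: "m (e', i) \<otimes>\<^bsub>?G\<^esub> h \<in> carrier ?G" "e' \<otimes>\<^bsub>?G\<^esub> h \<in> carrier ?G"
          using mC[OF e'] h e' E(2) by auto
        have "?tr k (m (e', i) \<otimes>\<^bsub>?G\<^esub> h) = ?tr k (e' \<otimes>\<^bsub>?G\<^esub> h)"
          using kn by (auto simp: m_def mG trunc_vec_def axis_vec_def intro!: restrict_ext)
        then have "c e0 (m (e', i) \<otimes>\<^bsub>?G\<^esub> h) = c e0 (e' \<otimes>\<^bsub>?G\<^esub> h)"
          using c(2)[OF e0(2) cl(1)] c(2)[OF e0(2) cl(2)] by simp
        moreover have "(m (e', i) \<otimes>\<^bsub>?G\<^esub> h) k = int i + h k" using kn trm[OF e'] by (simp add: mG)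
        ultimately show ?thesis
          using c(1)[OF e' g] c(1)[OF e0(2) cl(2)] by (simp add: e0 c'm e' R.m_ac)
      qed
      have cl: "c e' g \<otimes> c e0 (e' \<otimes>\<^bsub>?G\<^esub> h) \<in> carrier R" if "e' \<in> E" for e'
        using that c(1) e0(2) g h E(2) by (auto intro!: R.m_closed)
      have "c' e (g \<otimes>\<^bsub>?G\<^esub> h) = (\<Oplus>e'\<in>E. c e' g \<otimes> c e0 (e' \<otimes>\<^bsub>?G\<^esub> h)) \<otimes> (\<Oplus>i\<in>?J. V (g k) i \<otimes> V (int i + h k) j)"
        using c(3)[OF e0(2) g h] V_add[of j "g k" "h k"] e0 by (simp add: c'm gh)
      also have "\<dots> = (\<Oplus>e'\<in>E. (c e' g \<otimes> c e0 (e' \<otimes>\<^bsub>?G\<^esub> h)) \<otimes> (\<Oplus>i\<in>?J. V (g k) i \<otimes> V (int i + h k) j))"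
        using cl E(1) by (intro R.finsum_ldistr) auto
      also have "\<dots> = (\<Oplus>e'\<in>E. \<Oplus>i\<in>?J. c' (m (e', i)) g \<otimes> c' e (m (e', i) \<otimes>\<^bsub>?G\<^esub> h))"
      proof (intro R.finsum_cong' refl Pi_I)
        fix e' assume e': "e' \<in> E"
        show "(c e' g \<otimes> c e0 (e' \<otimes>\<^bsub>?G\<^esub> h)) \<otimes> (\<Oplus>i\<in>?J. V (g k) i \<otimes> V (int i + h k) j)
            = (\<Oplus>i\<in>?J. c' (m (e', i)) g \<otimes> c' e (m (e', i) \<otimes>\<^bsub>?G\<^esub> h))"
          unfolding tm[OF e'] by (rule R.finsum_rdistr) (simp_all add: cl e')
        show "(\<Oplus>i\<in>?J. c' (m (e', i)) g \<otimes> c' e (m (e', i) \<otimes>\<^bsub>?G\<^esub> h)) \<in> carrier R"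
          unfolding tm[OF e'] by (intro R.finsum_closed Pi_I) (simp_all add: cl e')
      qed
      also have "\<dots> = (\<Oplus>x\<in>E \<times> ?J. c' (m x) g \<otimes> c' e (m x \<otimes>\<^bsub>?G\<^esub> h))"
        by (rule R.finsum_Times[symmetric]) (simp_all add: E(1) tm cl)
      also have "\<dots> = (\<Oplus>e'\<in>m ` (E \<times> ?J). c' e' g \<otimes> c' e (e' \<otimes>\<^bsub>?G\<^esub> h))"
        by (rule R.finsum_reindex[symmetric, OF _ inj]) (auto simp: tm cl)
      finally show "c' e (g \<otimes>\<^bsub>?G\<^esub> h) = (\<Oplus>e'\<in>m ` (E \<times> ?J). c' e' g \<otimes> c' e (e' \<otimes>\<^bsub>?G\<^esub> h))" .
    next
      fix x g assume x: "x \<in> carrier M" and g: "g \<in> carrier ?G"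
      have \<alpha>M: "\<alpha> h y \<in> carrier M" if "h \<in> carrier ?G" "y \<in> carrier M" for h y
        using linear_mapsD(1)[OF lin] that by blast
      have \<sigma>M: "\<sigma> z x \<in> carrier M" for z unfolding \<sigma>_def by (rule \<alpha>M[OF ax x])
      have tm: "c e g \<odot>\<^bsub>M\<^esub> \<alpha> e (V (g k) j \<odot>\<^bsub>M\<^esub> \<sigma> (int j) x) = c' (m (e, j)) g \<odot>\<^bsub>M\<^esub> \<alpha> (m (e, j)) x"
        if e: "e \<in> E" for e j
      proof -
        have eG: "e \<in> carrier ?G" using e E(2) by auto
        have "\<alpha> e (V (g k) j \<odot>\<^bsub>M\<^esub> \<sigma> (int j) x) = V (g k) j \<odot>\<^bsub>M\<^esub> \<alpha> (m (e, j)) x"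
          using linear_mapsD(3)[OF lin[OF eG] V_closed \<sigma>M] mult[OF eG ax x] by (simp add: \<sigma>_def m_def)
        then show ?thesis
          using c(1)[OF e g] \<alpha>M[OF mC[OF e] x] by (simp add: c'm[OF e] smult_assoc1)
      qed
      have tcl: "c' (m (e, j)) g \<odot>\<^bsub>M\<^esub> \<alpha> (m (e, j)) x \<in> carrier M" if "e \<in> E" for e j
        using that c(1) g \<alpha>M[OF mC x] by (simp add: c'm)
      \<comment> \<open>Variable \<open>k\<close> acts first; the induction hypothesis expands the
        action of the remaining ones on the result, and the power of variable \<open>k\<close> is
        expanded afterwards.\<close>
      have "\<alpha> (?tr (Suc k) g) x = \<alpha> (?tr k g) (\<sigma> (g k) x)"
        unfolding trSuc \<sigma>_def by (rule mult[OF tr ax x])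
      also have "\<dots> = (\<Oplus>\<^bsub>M\<^esub>e\<in>E. c e g \<odot>\<^bsub>M\<^esub> \<alpha> e (\<sigma> (g k) x))"
        by (rule c\<alpha>[OF \<sigma>M g])
      also have "\<dots> = (\<Oplus>\<^bsub>M\<^esub>e\<in>E. \<Oplus>\<^bsub>M\<^esub>j\<in>?J. c' (m (e, j)) g \<odot>\<^bsub>M\<^esub> \<alpha> (m (e, j)) x)"
      proof (intro M.finsum_cong' refl Pi_I)
        fix e assume e: "e \<in> E"
        then have eG: "e \<in> carrier ?G" using E(2) by auto
        have cl: "V (g k) j \<odot>\<^bsub>M\<^esub> \<sigma> (int j) x \<in> carrier M" for j using \<sigma>M by simp
        have "\<alpha> e (\<sigma> (g k) x) = (\<Oplus>\<^bsub>M\<^esub>j\<in>?J. \<alpha> e (V (g k) j \<odot>\<^bsub>M\<^esub> \<sigma> (int j) x))"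
          by (subst expand[OF _ x]) (assumption,
              rule linear_maps_finsum[OF module_axioms module_axioms lin[OF eG]], use cl in auto)
        then have "c e g \<odot>\<^bsub>M\<^esub> \<alpha> e (\<sigma> (g k) x) =
            (\<Oplus>\<^bsub>M\<^esub>j\<in>?J. c e g \<odot>\<^bsub>M\<^esub> \<alpha> e (V (g k) j \<odot>\<^bsub>M\<^esub> \<sigma> (int j) x))"
          using finsum_smult_ldistr[of ?J "c e g"] c(1)[OF e g] \<alpha>M[OF eG cl] by simp
        then show "c e g \<odot>\<^bsub>M\<^esub> \<alpha> e (\<sigma> (g k) x) = (\<Oplus>\<^bsub>M\<^esub>j\<in>?J. c' (m (e, j)) g \<odot>\<^bsub>M\<^esub> \<alpha> (m (e, j)) x)"
          unfolding tm[OF e] .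
        show "(\<Oplus>\<^bsub>M\<^esub>j\<in>?J. c' (m (e, j)) g \<odot>\<^bsub>M\<^esub> \<alpha> (m (e, j)) x) \<in> carrier M"
          using tcl[OF e] by (intro M.finsum_closed Pi_I)
      qed
      also have "\<dots> = (\<Oplus>\<^bsub>M\<^esub>y\<in>E \<times> ?J. c' (m y) g \<odot>\<^bsub>M\<^esub> \<alpha> (m y) x)"
        by (rule M.finsum_Times[symmetric]) (simp_all add: E(1) tcl)
      also have "\<dots> = (\<Oplus>\<^bsub>M\<^esub>e\<in>m ` (E \<times> ?J). c' e g \<odot>\<^bsub>M\<^esub> \<alpha> e x)"
        by (rule M.finsum_reindex[symmetric, OF _ inj]) (auto intro: tcl)
      finally show "\<alpha> (?tr (Suc k) g) x = (\<Oplus>\<^bsub>M\<^esub>e\<in>m ` (E \<times> ?J). c' e g \<odot>\<^bsub>M\<^esub> \<alpha> e x)" .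
    qed
  qed
  \<comment> \<open>At \<open>k = n\<close> truncation is the identity of the group.\<close>
  from this[OF order_refl] obtain E where "\<exists>c. ?Q n E c" by (rule exE)
  then obtain c where Q: "?Q n E c" by (rule exE)
  have "shift_coeffs R ?G E c" unfolding shift_coeffs_def using Q by blast
  moreover have "\<forall>x\<in>carrier M. \<forall>g\<in>carrier ?G. \<alpha> g x = (\<Oplus>\<^bsub>M\<^esub>e\<in>E. c e g \<odot>\<^bsub>M\<^esub> \<alpha> e x)"
    using Q trn by simp
  ultimately show ?thesis by blast
qed

section \<open>Cofinite left ideals\<close>

definition quotient_map :: "('b, 'm) ring_scheme \<Rightarrow> 'b set \<Rightarrow> ('b \<Rightarrow> 'b) \<Rightarrow> 'b set \<Rightarrow> 'b set"
  where "quotient_map M N f B = (\<Union>x\<in>B. N +>\<^bsub>M\<^esub> f x)"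

context module
begin

lemma coset_const:
  assumes N: "submodule N R M" and x: "x \<in> carrier M"
    and f: "\<And>y. y \<in> carrier M \<Longrightarrow> y \<ominus>\<^bsub>M\<^esub> x \<in> N \<Longrightarrow> f y = f x"
  shows "y \<in> N +>\<^bsub>M\<^esub> x \<Longrightarrow> f y = f x"
proof -
  interpret N: abelian_subgroup N M by (rule submodule_abelian_subgroup[OF N])
  assume y: "y \<in> N +>\<^bsub>M\<^esub> x"
  then have "y \<in> carrier M" using M.a_r_coset_subset_G[OF N.a_subset x] by auto
  with y show "f y = f x" using N.a_rcos_module x by (intro f) (simp_all add: a_minus_def)
qed

lemma coset_self: "submodule N R M \<Longrightarrow> x \<in> carrier M \<Longrightarrow> x \<in> N +>\<^bsub>M\<^esub> x"
  using abelian_subgroup.a_rcos_self[OF submodule_abelian_subgroup] .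

lemma quotient_map_coset:
  assumes N: "submodule N R M" and f: "f \<in> linear_maps R M M" and fN: "f ` N \<subseteq> N" and x: "x \<in> carrier M"
  shows "quotient_map M N f (N +>\<^bsub>M\<^esub> x) = N +>\<^bsub>M\<^esub> f x"
proof -
  have "N +>\<^bsub>M\<^esub> f y = N +>\<^bsub>M\<^esub> f x" if "y \<in> N +>\<^bsub>M\<^esub> x" for y
  proof (rule coset_const[OF N x _ that])
    fix y assume y: "y \<in> carrier M" "y \<ominus>\<^bsub>M\<^esub> x \<in> N"
    then have "f y \<ominus>\<^bsub>M\<^esub> f x \<in> N"
      using fN linear_maps_diff[OF module_axioms module_axioms f y(1) x] by force
    then show "N +>\<^bsub>M\<^esub> f y = N +>\<^bsub>M\<^esub> f x"
      using coset_eq_iff[OF N] linear_mapsD(1)[OF f] x y by simp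
  qed
  then have "quotient_map M N f (N +>\<^bsub>M\<^esub> x) = (\<Union>y\<in>N +>\<^bsub>M\<^esub> x. N +>\<^bsub>M\<^esub> f x)"
    by (simp add: quotient_map_def)
  also have "\<dots> = N +>\<^bsub>M\<^esub> f x" using coset_self[OF N x] by auto
  finally show ?thesis .
qed

lemma quotient_map_linear:
  assumes N: "submodule N R M" and f: "f \<in> linear_maps R M M" and fN: "f ` N \<subseteq> N"
  shows "quotient_map M N f \<in> linear_maps R (quotient_module M N) (quotient_module M N)"
  using linear_mapsD[OF f]
  by (intro linear_mapsI)
    (auto simp: quotient_module_carrier quotient_module_add[OF N] quotient_module_smult[OF N]
      quotient_map_coset[OF N f fN])

text \<open>A map that kills \<open>N\<close> is constant on cosets, so the representative picked by
  \<open>SOME\<close> does no harm and the map factors through the quotient.\<close>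

lemma quotient_lift_coset:
  assumes "module R P" and N: "submodule N R M" and f: "f \<in> linear_maps R M P"
    and fN: "\<And>x. x \<in> N \<Longrightarrow> f x = \<zero>\<^bsub>P\<^esub>" and x: "x \<in> carrier M"
  shows "f (SOME y. y \<in> N +>\<^bsub>M\<^esub> x) = f x"
proof (rule coset_const[OF N x])
  interpret P: module R P by fact
  show "(SOME y. y \<in> N +>\<^bsub>M\<^esub> x) \<in> N +>\<^bsub>M\<^esub> x"
    by (rule someI[of "\<lambda>y. y \<in> N +>\<^bsub>M\<^esub> x", OF coset_self[OF N x]])
  fix y assume y: "y \<in> carrier M" "y \<ominus>\<^bsub>M\<^esub> x \<in> N"
  then have "\<zero>\<^bsub>P\<^esub> = f y \<oplus>\<^bsub>P\<^esub> \<ominus>\<^bsub>P\<^esub> f x"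
    using fN[OF y(2)] linear_maps_diff[OF module_axioms assms(1) f y(1) x] by (simp add: a_minus_def)
  then show "f y = f x"
    using P.M.add.inv_solve_right[OF P.M.zero_closed] linear_mapsD(1)[OF f] x y(1) by simp
qed

lemma quotient_lift_linear:
  assumes "module R P" and N: "submodule N R M" and f: "f \<in> linear_maps R M P"
    and fN: "\<And>x. x \<in> N \<Longrightarrow> f x = \<zero>\<^bsub>P\<^esub>"
  shows "(\<lambda>B. f (SOME y. y \<in> B)) \<in> linear_maps R (quotient_module M N) P"
  using linear_mapsD[OF f]
  by (intro linear_mapsI)
    (auto simp: quotient_module_carrier quotient_module_add[OF N] quotient_module_smult[OF N]
      quotient_lift_coset[OF assms])

text \<open>Serves to extend memberships by linearity: the elements that a linear map sends into a
  submodule form a submodule, which is everything once it contains generators.\<close>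

lemma submodule_vimage:
  assumes "module R P" and N: "submodule N R P" and f: "f \<in> linear_maps R M P"
  shows "submodule {x \<in> carrier M. f x \<in> N} R M"
proof -
  interpret P: module R P by fact
  note E = P.submoduleE[OF N] and D = linear_mapsD[OF f]
  show ?thesis
  proof (rule submoduleI)
    show "\<zero>\<^bsub>M\<^esub> \<in> {x \<in> carrier M. f x \<in> N}"
      using linear_maps_zero[OF module_axioms assms(1) f] P.submodule_zero[OF N] by simp
    show "\<ominus>\<^bsub>M\<^esub> x \<in> {x \<in> carrier M. f x \<in> N}" if "x \<in> {x \<in> carrier M. f x \<in> N}" for x
      using that E(3) linear_maps_neg[OF module_axioms assms(1) f] by simp
  qed (use D E in auto)
qed

end

context assoc_algebra
begin

text \<open>A scalar \<open>r\<close> acts as multiplication from the left by \<open>r\<close> times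
  the unit, and a left ideal absorbs that.\<close>

lemma left_ideal_submodule: "left_ideal I M \<Longrightarrow> submodule I R M"
proof -
  assume I: "left_ideal I M"
  then interpret I: additive_subgroup I M by (simp add: left_ideal_def)
  show ?thesis
  proof (rule submoduleI[OF I.a_subset])
    fix r x assume r: "r \<in> carrier R" and x: "x \<in> I"
    then have "x \<in> carrier M" using I.a_subset by auto
    then have "r \<odot>\<^bsub>M\<^esub> x = (r \<odot>\<^bsub>M\<^esub> \<one>\<^bsub>M\<^esub>) \<otimes>\<^bsub>M\<^esub> x" using r by (simp add: smult_assoc2)
    then show "r \<odot>\<^bsub>M\<^esub> x \<in> I" using I r x by (simp add: left_ideal_def)
  qed simp_all
qed

lemma left_idealI:
  assumes "submodule I R M" and "\<And>a x. a \<in> carrier M \<Longrightarrow> x \<in> I \<Longrightarrow> a \<otimes>\<^bsub>M\<^esub> x \<in> I"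
  shows "left_ideal I M"
  using assms by (simp add: left_ideal_def additive_subgroup.intro submodule.axioms(1))

end

section \<open>Coordinates on the group algebra with coefficients in \<open>A\<close>\<close>

locale tensor_group_ring = group_ring R G + A: assoc_algebra R A for R :: "('a, 'r) ring_scheme" (structure) and G :: "('g, 'k) monoid_scheme"
    and A :: "('a, 'x, 'm) module_scheme"
begin

sublocale TA: tensor_algebra R A H
  by (intro tensor_algebra.intro A.assoc_algebra_axioms H_algebra)

abbreviation "T \<equiv> tensor R A H"
abbreviation "pt \<equiv> pure_tensor R A H"

lemma pt_closed: "a \<in> carrier A \<Longrightarrow> g \<in> carrier G \<Longrightarrow> pt a (\<delta> g) \<in> carrier T"
  by (intro TA.pure_closed \<delta>_closed)

text \<open>The tensors of an element of \<open>A\<close> with a group element generate the tensor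
  product over \<open>R\<close>.\<close>

lemma T_submodule_eq:
  assumes S: "submodule S R T" and "\<And>a g. a \<in> carrier A \<Longrightarrow> g \<in> carrier G \<Longrightarrow> pt a (\<delta> g) \<in> S"
    and t: "t \<in> carrier T"
  shows "t \<in> S"
  using t
proof (induction rule: TA.tensor_induct)
  case zero
  show ?case by (rule TA.T.submodule_zero[OF S])
next
  case (pure a f)
  note lin = bilinear_mapsD(1)[OF TA.pure_bilinear pure(1)]
  from pure(2) have "f \<in> carrier FM" by (simp add: H_fields)
  then show ?case
  proof (induction rule: R.free_module_induct)
    case zero
    show ?case
      using linear_maps_zero[OF H_module TA.tensor_module lin] TA.T.submodule_zero[OF S] by (simp add: H_fields)
  next
    case (unit r x)
    have "pt a (r \<odot>\<^bsub>FM\<^esub> \<delta> x) = r \<odot>\<^bsub>T\<^esub> pt a (\<delta> x)"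
      using linear_mapsD(3)[OF lin unit(1) \<delta>_closed[OF unit(2)]] by (simp add: H_fields)
    then show ?case using TA.T.submoduleE(4)[OF S unit(1)] assms(2) pure(1) unit(2) by simp
  next
    case (add f g)
    then have "pt a (f \<oplus>\<^bsub>FM\<^esub> g) = pt a f \<oplus>\<^bsub>T\<^esub> pt a g"
      using linear_mapsD(2)[OF lin, of f g] by (simp add: H_fields)
    then show ?case using TA.T.submoduleE(5)[OF S] add by simp
  qed
next
  case (add s t)
  then show ?case by (intro TA.T.submoduleE(5)[OF S])
qed

lemma T_linear_eq:
  assumes "module R P" and f: "f \<in> linear_maps R T P" and g: "g \<in> linear_maps R T P"
    and eq: "\<And>a x. a \<in> carrier A \<Longrightarrow> x \<in> carrier G \<Longrightarrow> f (pt a (\<delta> x)) = g (pt a (\<delta> x))"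
    and t: "t \<in> carrier T"
  shows "f t = g t"
proof (rule TA.tensor_linear_eq[OF assms(1) f g _ t])
  fix a h assume a: "a \<in> carrier A" and h: "h \<in> carrier H"
  note lin = bilinear_mapsD(1)[OF TA.pure_bilinear a]
  show "f (pt a h) = g (pt a h)"
    by (rule H_linear_eq[OF assms(1) linear_maps_comp[OF lin f] linear_maps_comp[OF lin g] eq[OF a] h])
qed

end

locale tensor_shift = tensor_group_ring R G A for R :: "('a, 'r) ring_scheme" (structure) and G :: "('g, 'k) monoid_scheme"
    and A :: "('a, 'x, 'm) module_scheme" +
  fixes E and c
  assumes sc: "shift_coeffs R G E c"
begin

lemma E: "finite E" "E \<subseteq> carrier G" "e \<in> E \<Longrightarrow> e \<in> carrier G"
  using sc by (auto simp: shift_coeffs_def)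

lemma c_closed: "e \<in> E \<Longrightarrow> g \<in> carrier G \<Longrightarrow> c e g \<in> carrier R"
  using sc by (auto simp: shift_coeffs_def)

lemma c_mult:
  "e \<in> E \<Longrightarrow> g \<in> carrier G \<Longrightarrow> h \<in> carrier G \<Longrightarrow>
    c e (g \<otimes>\<^bsub>G\<^esub> h) = (\<Oplus>e'\<in>E. c e' g \<otimes> c e (e' \<otimes>\<^bsub>G\<^esub> h))"
  using sc by (auto simp: shift_coeffs_def)

text \<open>The coordinate at \<open>e\<close>: the function \<open>c e\<close> extended linearly to
  the group algebra and then with coefficients in \<open>A\<close>.\<close>

definition \<Phi> where "\<Phi> e = tensor_lift A (\<lambda>a f. free_lift R (carrier G) (regular_module R) (c e) f \<odot>\<^bsub>A\<^esub> a)"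

lemma \<Phi>_bilinear:
  assumes e: "e \<in> E"
  shows "(\<lambda>a f. free_lift R (carrier G) (regular_module R) (c e) f \<odot>\<^bsub>A\<^esub> a) \<in> bilinear_maps R A H A"
proof -
  have "c e \<in> carrier G \<rightarrow> carrier (regular_module R)" using c_closed[OF e] by simp
  from module.free_lift_linear[OF R.regular_module this]
  have l: "free_lift R (carrier G) (regular_module R) (c e) \<in> linear_maps R H (regular_module R)"
    by (simp add: H_linear)
  show ?thesis
    by (intro bilinear_mapsI A.linear_maps_smult_point[OF l] A.linear_maps_smult linear_maps_id)
      (use linear_mapsD(1)[OF l] in auto)
qed

lemma \<Phi>_linear: "e \<in> E \<Longrightarrow> \<Phi> e \<in> linear_maps R T A"
  unfolding \<Phi>_def by (rule TA.tensor_lift_linear[OF A.module_axioms \<Phi>_bilinear])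

lemma \<Phi>_pt: "e \<in> E \<Longrightarrow> a \<in> carrier A \<Longrightarrow> g \<in> carrier G \<Longrightarrow> \<Phi> e (pt a (\<delta> g)) = c e g \<odot>\<^bsub>A\<^esub> a"
  unfolding \<Phi>_def
  using TA.tensor_lift_pure'[OF A.module_axioms \<Phi>_bilinear, of e a "\<delta> g"]
    module.free_lift_unit[OF R.regular_module, of "c e" "carrier G" g] c_closed
  by (simp add: \<delta>_closed)

text \<open>The functional equation of \<open>c\<close>, carried over to coefficients in
  \<open>A\<close>. The coordinates of a product are combinations of left multiples of the
  coordinates of \<open>t\<close>, which makes \<open>J\<close> a left ideal. The group element
  multiplies from the left here and from the right in \<open>c_mult\<close>; commutativity of
  \<open>G\<close> reconciles the two.\<close>

lemma \<Phi>_mult: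
  assumes e: "e \<in> E" and a: "a \<in> carrier A" and h: "h \<in> carrier G" and t: "t \<in> carrier T"
  shows "\<Phi> e (pt a (\<delta> h) \<otimes>\<^bsub>T\<^esub> t) = (\<Oplus>\<^bsub>A\<^esub>e'\<in>E. c e (e' \<otimes>\<^bsub>G\<^esub> h) \<odot>\<^bsub>A\<^esub> (a \<otimes>\<^bsub>A\<^esub> \<Phi> e' t))"
proof (rule T_linear_eq[OF A.module_axioms _ _ _ t])
  have ceh: "c e (e' \<otimes>\<^bsub>G\<^esub> h) \<in> carrier R" if "e' \<in> E" for e'
    using that E(3) h by (intro c_closed[OF e]) auto
  show "(\<lambda>t. \<Phi> e (pt a (\<delta> h) \<otimes>\<^bsub>T\<^esub> t)) \<in> linear_maps R T A"
    by (rule linear_maps_comp[OF TA.tensor_mult_left_linear[OF pt_closed[OF a h]] \<Phi>_linear[OF e]])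
  show "(\<lambda>t. \<Oplus>\<^bsub>A\<^esub>e'\<in>E. c e (e' \<otimes>\<^bsub>G\<^esub> h) \<odot>\<^bsub>A\<^esub> (a \<otimes>\<^bsub>A\<^esub> \<Phi> e' t)) \<in> linear_maps R T A"
    by (intro A.linear_maps_sum E(1) A.linear_maps_smult ceh
        linear_maps_comp[OF \<Phi>_linear A.mult_left_linear[OF a]])
  fix b g assume b: "b \<in> carrier A" and g: "g \<in> carrier G"
  have "\<Phi> e (pt a (\<delta> h) \<otimes>\<^bsub>T\<^esub> pt b (\<delta> g)) = c e (g \<otimes>\<^bsub>G\<^esub> h) \<odot>\<^bsub>A\<^esub> (a \<otimes>\<^bsub>A\<^esub> b)"
    using a b g h e by (simp add: TA.tensor_mult_pure \<delta>_closed \<delta>_mult_\<delta> \<Phi>_pt G.m_comm)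
  also have "\<dots> = (\<Oplus>e'\<in>E. c e' g \<otimes> c e (e' \<otimes>\<^bsub>G\<^esub> h)) \<odot>\<^bsub>A\<^esub> (a \<otimes>\<^bsub>A\<^esub> b)"
    by (simp add: c_mult[OF e g h])
  also have "\<dots> = (\<Oplus>\<^bsub>A\<^esub>e'\<in>E. (c e' g \<otimes> c e (e' \<otimes>\<^bsub>G\<^esub> h)) \<odot>\<^bsub>A\<^esub> (a \<otimes>\<^bsub>A\<^esub> b))"
    using linear_maps_finsum[OF R.regular_module A.module_axioms
        bilinear_mapsD(2)[OF A.bilinear_smult A.m_closed[OF a b]], of "\<lambda>e'. c e' g \<otimes> c e (e' \<otimes>\<^bsub>G\<^esub> h)" E]
      c_closed g ceh by simp
  also have "\<dots> = (\<Oplus>\<^bsub>A\<^esub>e'\<in>E. c e (e' \<otimes>\<^bsub>G\<^esub> h) \<odot>\<^bsub>A\<^esub> (a \<otimes>\<^bsub>A\<^esub> \<Phi> e' (pt b (\<delta> g))))"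
    using a b g c_closed ceh
    by (intro A.finsum_cong' refl Pi_I)
      (simp_all add: \<Phi>_pt A.smult_assoc1[symmetric] A.smult_assoc3 R.m_comm)
  finally show "\<Phi> e (pt a (\<delta> h) \<otimes>\<^bsub>T\<^esub> pt b (\<delta> g)) =
      (\<Oplus>\<^bsub>A\<^esub>e'\<in>E. c e (e' \<otimes>\<^bsub>G\<^esub> h) \<odot>\<^bsub>A\<^esub> (a \<otimes>\<^bsub>A\<^esub> \<Phi> e' (pt b (\<delta> g))))" .
qed

text \<open>The case of the unit in \<open>\<Phi>_mult\<close>. It says that \<open>t\<close> and
  the sum of the tensors of \<open>\<Phi> e' t\<close> with \<open>e'\<close> have the same
  coordinates, which stands in for a duality between \<open>c\<close> and \<open>E\<close>.\<close>

lemma \<Phi>_expand: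
  assumes e: "e \<in> E" and t: "t \<in> carrier T"
  shows "\<Phi> e t = (\<Oplus>\<^bsub>A\<^esub>e'\<in>E. c e e' \<odot>\<^bsub>A\<^esub> \<Phi> e' t)"
proof -
  have "\<Phi> e (\<one>\<^bsub>T\<^esub> \<otimes>\<^bsub>T\<^esub> t) = (\<Oplus>\<^bsub>A\<^esub>e'\<in>E. c e (e' \<otimes>\<^bsub>G\<^esub> \<one>\<^bsub>G\<^esub>) \<odot>\<^bsub>A\<^esub> (\<one>\<^bsub>A\<^esub> \<otimes>\<^bsub>A\<^esub> \<Phi> e' t))"
    unfolding TA.tensor_one H_one by (rule \<Phi>_mult[OF e _ _ t]) simp_all
  then show ?thesis
    using E(3) linear_mapsD(1)[OF \<Phi>_linear t] c_closed[OF e] t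
    by (simp add: TA.tensor_one_mult cong: A.finsum_cong)
qed

definition J where "J I\<^sub>0 = {t \<in> carrier T. \<forall>e\<in>E. \<Phi> e t \<in> I\<^sub>0}"

lemma J_left_ideal:
  assumes I0: "left_ideal I\<^sub>0 A"
  shows "left_ideal (J I\<^sub>0) T"
proof -
  note sub = A.left_ideal_submodule[OF I0]
  note E0 = A.submoduleE[OF sub]
  interpret T: assoc_algebra R T by (rule TA.tensor_assoc_algebra)
  have subJ: "submodule (J I\<^sub>0) R T"
    unfolding J_def
    using linear_mapsD[OF \<Phi>_linear] linear_maps_zero[OF TA.tensor_module A.module_axioms \<Phi>_linear]
      linear_maps_neg[OF TA.tensor_module A.module_axioms \<Phi>_linear] E0 A.submodule_zero[OF sub]
    by (intro TA.T.submoduleI) auto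
  show ?thesis
  proof (rule T.left_idealI[OF subJ])
    fix s t assume s: "s \<in> carrier T" and t: "t \<in> J I\<^sub>0"
    have tT: "t \<in> carrier T" using t by (simp add: J_def)
    \<comment> \<open>For fixed \<open>t\<close> the admissible left factors form a submodule, so it
      is enough to treat the generators \<open>pt a (\<delta> h)\<close>.\<close>
    have "s \<in> {s \<in> carrier TA.T. s \<otimes>\<^bsub>T\<^esub> t \<in> J I\<^sub>0}"
    proof (rule T_submodule_eq[OF TA.T.submodule_vimage[OF TA.tensor_module subJ TA.tensor_mult_right_linear[OF tT]] _ s])
      fix a h assume a: "a \<in> carrier A" and h: "h \<in> carrier G"
      have "\<Phi> e (pt a (\<delta> h) \<otimes>\<^bsub>T\<^esub> t) \<in> I\<^sub>0" if e: "e \<in> E" for e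
        unfolding \<Phi>_mult[OF e a h tT]
      proof (intro A.submodule_finsum[OF sub] Pi_I E0(4))
        fix e' assume e': "e' \<in> E"
        show "c e (e' \<otimes>\<^bsub>G\<^esub> h) \<in> carrier R" using c_closed[OF e] E(3)[OF e'] h by simp
        show "a \<otimes>\<^bsub>A\<^esub> \<Phi> e' t \<in> I\<^sub>0" using I0 a t e' by (simp add: left_ideal_def J_def)
      qed
      then show "pt a (\<delta> h) \<in> {s \<in> carrier TA.T. s \<otimes>\<^bsub>T\<^esub> t \<in> J I\<^sub>0}"
        using pt_closed[OF a h] tT by (simp add: J_def TA.tensor_mult_closed)
    qed
    then show "s \<otimes>\<^bsub>T\<^esub> t \<in> J I\<^sub>0" by simp
  qed
qed

text \<open>By \<open>\<Phi>_expand\<close>, \<open>t\<close> has the same coordinates as the sum of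
  the tensors of \<open>\<Phi> e t\<close> with \<open>e\<close>. Expanding each
  \<open>\<Phi> e t\<close> in the dual basis of the quotient of \<open>A\<close> changes it by
  elements of \<open>I\<^sub>0\<close> only, hence changes the tensor by an element of
  \<open>J\<close>. The resulting expansion is a dual basis indexed by \<open>E\<close> and
  \<open>X\<close>.\<close>

lemma J_fg_projective:
  assumes I0: "left_ideal I\<^sub>0 A"
    and fg: "fg_module R (quotient_module A I\<^sub>0)" and proj: "projective_module R (quotient_module A I\<^sub>0)"
  shows "fg_module R (quotient_module T (J I\<^sub>0))" "projective_module R (quotient_module T (J I\<^sub>0))"
proof -
  note sub = A.left_ideal_submodule[OF I0]
  note E0 = A.submoduleE[OF sub]
  interpret T: assoc_algebra R T by (rule TA.tensor_assoc_algebra)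
  note subJ = T.left_ideal_submodule[OF J_left_ideal[OF I0]]
  let ?Q = "quotient_module A I\<^sub>0" and ?P = "quotient_module T (J I\<^sub>0)"
  let ?\<pi> = "\<lambda>a. I\<^sub>0 +>\<^bsub>A\<^esub> a" and ?\<kappa> = "\<lambda>t. J I\<^sub>0 +>\<^bsub>T\<^esub> t"
  interpret Q: module R ?Q by (rule A.quotient_module_module[OF sub])
  interpret P: module R ?P by (rule TA.T.quotient_module_module[OF subJ])
  note \<pi> = A.quotient_proj_linear[OF sub] and \<kappa> = TA.T.quotient_proj_linear[OF subJ]
  obtain X :: "'x set set" and b \<phi> where X: "finite X" "b \<in> X \<rightarrow> carrier ?Q"
    and \<phi>: "\<And>i. i \<in> X \<Longrightarrow> \<phi> i \<in> linear_maps R ?Q (regular_module R)"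
    and exp: "\<And>x. x \<in> carrier ?Q \<Longrightarrow> x = (\<Oplus>\<^bsub>?Q\<^esub>i\<in>X. \<phi> i x \<odot>\<^bsub>?Q\<^esub> b i)"
    by (rule Q.dual_basis_exists[OF fg proj]) (rule that)
  have "\<forall>i\<in>X. \<exists>a\<in>carrier A. b i = ?\<pi> a" using X(2) by (auto simp: A.quotient_module_carrier)
  then obtain b' where b': "\<And>i. i \<in> X \<Longrightarrow> b' i \<in> carrier A" "\<And>i. i \<in> X \<Longrightarrow> b i = ?\<pi> (b' i)" by metis
  define \<psi> where "\<psi> i a = \<phi> i (?\<pi> a)" for i a
  have \<psi>: "\<psi> i \<in> linear_maps R A (regular_module R)" if "i \<in> X" for i
    unfolding \<psi>_def by (rule linear_maps_comp[OF \<pi> \<phi>[OF that]])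
  have \<psi>c: "\<psi> i a \<in> carrier R" if "i \<in> X" "a \<in> carrier A" for i a
    using linear_mapsD(1)[OF \<psi> that(2)] that by simp
  have \<psi>0: "\<psi> i a = \<zero>" if "i \<in> X" "a \<in> I\<^sub>0" for i a
  proof -
    have "a \<in> carrier A" using that E0(1) by auto
    then have "?\<pi> a = \<zero>\<^bsub>?Q\<^esub>" using A.coset_eq_zero_iff[OF sub] that by (simp add: quotient_module_def)
    then show ?thesis
      using linear_maps_zero[OF Q.module_axioms R.regular_module \<phi>[OF that(1)]] by (simp add: \<psi>_def)
  qed
  let ?y = "\<lambda>a. \<Oplus>\<^bsub>A\<^esub>i\<in>X. \<psi> i a \<odot>\<^bsub>A\<^esub> b' i"
  have yA: "?y a \<in> carrier A" if "a \<in> carrier A" for a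
    using \<psi>c b'(1) that by (intro A.finsum_closed Pi_I A.smult_closed)
  \<comment> \<open>The dual basis expansion in the quotient, read on representatives in
    \<open>A\<close>.\<close>
  have approx: "a \<ominus>\<^bsub>A\<^esub> ?y a \<in> I\<^sub>0" if a: "a \<in> carrier A" for a
  proof -
    have "?\<pi> (?y a) = (\<Oplus>\<^bsub>?Q\<^esub>i\<in>X. ?\<pi> (\<psi> i a \<odot>\<^bsub>A\<^esub> b' i))"
      using \<psi>c b'(1) a by (intro linear_maps_finsum[OF A.module_axioms Q.module_axioms \<pi>] Pi_I A.smult_closed)
    also have "\<dots> = (\<Oplus>\<^bsub>?Q\<^esub>i\<in>X. \<phi> i (?\<pi> a) \<odot>\<^bsub>?Q\<^esub> b i)"
      using linear_mapsD(3)[OF \<pi>] linear_mapsD(1)[OF \<pi>] \<psi>c b' a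
      by (intro Q.finsum_cong' refl Pi_I) (simp_all add: \<psi>_def)
    also have "\<dots> = ?\<pi> a" using exp linear_mapsD(1)[OF \<pi> a] by simp
    finally show ?thesis using A.coset_eq_iff[OF sub a yA[OF a]] by simp
  qed
  let ?I = "E \<times> X"
  \<comment> \<open>The new basis vectors, and below them their functionals \<open>\<theta>\<close>.
    The latter vanish on \<open>J\<close>, where all coordinates lie in \<open>I\<^sub>0\<close>,
    and therefore descend to the quotient.\<close>
  define \<beta> where "\<beta> = (\<lambda>(e, i). ?\<kappa> (pt (b' i) (\<delta> e)))"
  define \<theta> where "\<theta> = (\<lambda>(e, i) t. \<psi> i (\<Phi> e t))"
  have \<Phi>A: "\<Phi> e t \<in> carrier A" if "e \<in> E" "t \<in> carrier T" for e t
    using linear_mapsD(1)[OF \<Phi>_linear] that by blast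
  have \<theta>: "\<theta> k \<in> linear_maps R T (regular_module R)" if "k \<in> ?I" for k
    using that linear_maps_comp[OF \<Phi>_linear \<psi>] by (auto simp: \<theta>_def)
  have \<theta>0: "\<theta> k t = \<zero>\<^bsub>regular_module R\<^esub>" if "k \<in> ?I" "t \<in> J I\<^sub>0" for k t
    using that \<psi>0 by (auto simp: \<theta>_def J_def)
  have pb: "pt (b' i) (\<delta> e) \<in> carrier T" if "i \<in> X" "e \<in> E" for i e
    using pt_closed b'(1) E(3) that by simp
  have fin: "finite ?I" using X(1) E(1) by simp
  have \<beta>: "\<beta> \<in> ?I \<rightarrow> carrier ?P"
    using linear_mapsD(1)[OF \<kappa> pb] by (auto simp: \<beta>_def)
  note \<theta>lift = TA.T.quotient_lift_linear[OF R.regular_module subJ \<theta> \<theta>0]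
  have expand: "x = (\<Oplus>\<^bsub>?P\<^esub>k\<in>?I. \<theta> k (SOME y. y \<in> x) \<odot>\<^bsub>?P\<^esub> \<beta> k)" if x: "x \<in> carrier ?P" for x
  proof -
    obtain t where t: "t \<in> carrier T" "x = ?\<kappa> t" using x by (auto simp: TA.T.quotient_module_carrier)
    let ?term = "\<lambda>(e, i). \<psi> i (\<Phi> e t) \<odot>\<^bsub>T\<^esub> pt (b' i) (\<delta> e)"
    have termT: "?term k \<in> carrier T" if "k \<in> ?I" for k
      using that \<psi>c \<Phi>A t(1) pb by (auto intro!: TA.T.smult_closed)
    \<comment> \<open>The representative of the dual basis expansion of \<open>t\<close>; it remains
      to show that it differs from \<open>t\<close> by an element of \<open>J\<close>.\<close>
    let ?\<Omega> = "\<Oplus>\<^bsub>T\<^esub>k\<in>?I. ?term k"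
    have \<Omega>T: "?\<Omega> \<in> carrier T" using termT by (intro TA.T.finsum_closed Pi_I)
    have \<Omega>: "?\<Omega> = (\<Oplus>\<^bsub>T\<^esub>e\<in>E. pt (?y (\<Phi> e t)) (\<delta> e))"
    proof -
      have "?\<Omega> = (\<Oplus>\<^bsub>T\<^esub>e\<in>E. \<Oplus>\<^bsub>T\<^esub>i\<in>X. ?term (e, i))"
        by (rule TA.T.finsum_Times[OF E(1) X(1)]) (rule termT, simp)
      also have "\<dots> = (\<Oplus>\<^bsub>T\<^esub>e\<in>E. pt (?y (\<Phi> e t)) (\<delta> e))"
      proof (intro TA.T.finsum_cong' refl Pi_I)
        fix e assume e: "e \<in> E"
        note ea = \<Phi>A[OF e t(1)]
        show "pt (?y (\<Phi> e t)) (\<delta> e) \<in> carrier T" by (rule pt_closed[OF yA[OF ea] E(3)[OF e]])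
        have "pt (?y (\<Phi> e t)) (\<delta> e) = (\<Oplus>\<^bsub>T\<^esub>i\<in>X. pt (\<psi> i (\<Phi> e t) \<odot>\<^bsub>A\<^esub> b' i) (\<delta> e))"
          using \<psi>c b'(1) ea
          by (intro linear_maps_finsum[OF A.module_axioms TA.tensor_module
                bilinear_mapsD(2)[OF TA.pure_bilinear \<delta>_closed[OF E(3)[OF e]]]] Pi_I A.smult_closed)
        also have "\<dots> = (\<Oplus>\<^bsub>T\<^esub>i\<in>X. ?term (e, i))"
          using \<psi>c b'(1) ea pb e \<delta>_closed[OF E(3)[OF e]]
          by (intro TA.T.finsum_cong' refl Pi_I) (simp_all add: TA.tensor_smult_pure[symmetric])
        finally show "(\<Oplus>\<^bsub>T\<^esub>i\<in>X. ?term (e, i)) = pt (?y (\<Phi> e t)) (\<delta> e)" by simp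
      qed
      finally show ?thesis .
    qed
    \<comment> \<open>With \<open>\<Phi>_expand\<close> for \<open>t\<close> and
      \<open>\<Phi>_pt\<close> for \<open>?\<Omega>\<close>, this coordinate is a combination of the
      errors bounded by \<open>approx\<close>.\<close>
    have "\<Phi> e' (t \<ominus>\<^bsub>T\<^esub> ?\<Omega>) \<in> I\<^sub>0" if e': "e' \<in> E" for e'
    proof -
      have cl: "c e' e \<odot>\<^bsub>A\<^esub> \<Phi> e t \<in> carrier A" "c e' e \<odot>\<^bsub>A\<^esub> ?y (\<Phi> e t) \<in> carrier A" if "e \<in> E" for e
        using c_closed[OF e' E(3)[OF that]] \<Phi>A[OF that t(1)] yA by auto
      have "\<Phi> e' ?\<Omega> = (\<Oplus>\<^bsub>A\<^esub>e\<in>E. \<Phi> e' (pt (?y (\<Phi> e t)) (\<delta> e)))"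
        unfolding \<Omega> using pt_closed[OF yA[OF \<Phi>A[OF _ t(1)]] E(3)]
        by (intro linear_maps_finsum[OF TA.tensor_module A.module_axioms \<Phi>_linear[OF e']] Pi_I)
      also have "\<dots> = (\<Oplus>\<^bsub>A\<^esub>e\<in>E. c e' e \<odot>\<^bsub>A\<^esub> ?y (\<Phi> e t))"
        using cl \<Phi>_pt[OF e' yA[OF \<Phi>A[OF _ t(1)]] E(3)] by (intro A.finsum_cong' refl Pi_I) simp_all
      finally have "\<Phi> e' (t \<ominus>\<^bsub>T\<^esub> ?\<Omega>) = (\<Oplus>\<^bsub>A\<^esub>e\<in>E. c e' e \<odot>\<^bsub>A\<^esub> \<Phi> e t) \<ominus>\<^bsub>A\<^esub> (\<Oplus>\<^bsub>A\<^esub>e\<in>E. c e' e \<odot>\<^bsub>A\<^esub> ?y (\<Phi> e t))"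
        using linear_maps_diff[OF TA.tensor_module A.module_axioms \<Phi>_linear[OF e'] t(1) \<Omega>T]
          \<Phi>_expand[OF e' t(1)] by simp
      moreover have "(\<Oplus>\<^bsub>A\<^esub>e\<in>E. c e' e \<odot>\<^bsub>A\<^esub> (\<Phi> e t \<ominus>\<^bsub>A\<^esub> ?y (\<Phi> e t))) \<oplus>\<^bsub>A\<^esub> (\<Oplus>\<^bsub>A\<^esub>e\<in>E. c e' e \<odot>\<^bsub>A\<^esub> ?y (\<Phi> e t))
          = (\<Oplus>\<^bsub>A\<^esub>e\<in>E. c e' e \<odot>\<^bsub>A\<^esub> \<Phi> e t)"
      proof -
        have "c e' e \<odot>\<^bsub>A\<^esub> (\<Phi> e t \<ominus>\<^bsub>A\<^esub> ?y (\<Phi> e t)) \<oplus>\<^bsub>A\<^esub> c e' e \<odot>\<^bsub>A\<^esub> ?y (\<Phi> e t) = c e' e \<odot>\<^bsub>A\<^esub> \<Phi> e t"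
          if e: "e \<in> E" for e
          using c_closed[OF e' E(3)[OF e]] \<Phi>A[OF e t(1)] yA[OF \<Phi>A[OF e t(1)]]
          by (simp add: A.smult_r_distr[symmetric] a_minus_def A.add.m_assoc A.l_neg)
        then show ?thesis
          using cl c_closed[OF e' E(3)] \<Phi>A[OF _ t(1)] yA[OF \<Phi>A[OF _ t(1)]]
          by (subst A.finsum_addf[symmetric]) (auto intro!: A.finsum_cong' simp del: A.finsum_addf A.add.finprod_multf)
      qed
      ultimately have "\<Phi> e' (t \<ominus>\<^bsub>T\<^esub> ?\<Omega>) = (\<Oplus>\<^bsub>A\<^esub>e\<in>E. c e' e \<odot>\<^bsub>A\<^esub> (\<Phi> e t \<ominus>\<^bsub>A\<^esub> ?y (\<Phi> e t)))"
      proof -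
        let ?u = "\<Oplus>\<^bsub>A\<^esub>e\<in>E. c e' e \<odot>\<^bsub>A\<^esub> (\<Phi> e t \<ominus>\<^bsub>A\<^esub> ?y (\<Phi> e t))"
          and ?v = "\<Oplus>\<^bsub>A\<^esub>e\<in>E. c e' e \<odot>\<^bsub>A\<^esub> ?y (\<Phi> e t)" and ?w = "\<Oplus>\<^bsub>A\<^esub>e\<in>E. c e' e \<odot>\<^bsub>A\<^esub> \<Phi> e t"
        assume 1: "\<Phi> e' (t \<ominus>\<^bsub>T\<^esub> ?\<Omega>) = ?w \<ominus>\<^bsub>A\<^esub> ?v" and 2: "?u \<oplus>\<^bsub>A\<^esub> ?v = ?w"
        have "?u \<in> carrier A" "?v \<in> carrier A" "?w \<in> carrier A"
          using cl c_closed[OF e' E(3)] \<Phi>A[OF _ t(1)] yA[OF \<Phi>A[OF _ t(1)]]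
          by (auto intro!: A.finsum_closed A.smult_closed A.minus_closed)
        then show ?thesis using 1 2 A.add.inv_solve_right[of ?u ?w ?v] by (simp add: a_minus_def)
      qed
      also have "\<dots> \<in> I\<^sub>0"
        using approx[OF \<Phi>A[OF _ t(1)]] c_closed[OF e' E(3)]
        by (intro A.submodule_finsum[OF sub] Pi_I E0(4))
      finally show ?thesis .
    qed
    then have "t \<ominus>\<^bsub>T\<^esub> ?\<Omega> \<in> J I\<^sub>0" using t(1) \<Omega>T by (simp add: J_def)
    then have "?\<kappa> t = ?\<kappa> ?\<Omega>" using TA.T.coset_eq_iff[OF subJ t(1) \<Omega>T] by simp
    also have "\<dots> = (\<Oplus>\<^bsub>?P\<^esub>k\<in>?I. ?\<kappa> (?term k))"
      using termT by (intro linear_maps_finsum[OF TA.tensor_module P.module_axioms \<kappa>] Pi_I)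
    also have "\<dots> = (\<Oplus>\<^bsub>?P\<^esub>k\<in>?I. \<theta> k (SOME y. y \<in> x) \<odot>\<^bsub>?P\<^esub> \<beta> k)"
    proof (intro P.finsum_cong' refl Pi_I)
      fix k assume k: "k \<in> ?I"
      then obtain e i where ei: "k = (e, i)" "e \<in> E" "i \<in> X" by auto
      have eq: "\<theta> k (SOME y. y \<in> x) = \<theta> k t"
        unfolding t(2) by (rule TA.T.quotient_lift_coset[OF R.regular_module subJ \<theta>[OF k] \<theta>0[OF k] t(1)])
      show "?\<kappa> (?term k) = \<theta> k (SOME y. y \<in> x) \<odot>\<^bsub>?P\<^esub> \<beta> k"
        unfolding eq using linear_mapsD(3)[OF \<kappa> \<psi>c[OF ei(3) \<Phi>A[OF ei(2) t(1)]] pb[OF ei(3,2)]]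
        by (simp add: ei \<theta>_def \<beta>_def)
      have "\<theta> k t \<in> carrier R" using linear_mapsD(1)[OF \<theta>[OF k] t(1)] by simp
      then show "\<theta> k (SOME y. y \<in> x) \<odot>\<^bsub>?P\<^esub> \<beta> k \<in> carrier ?P"
        unfolding eq using \<beta> k by (intro P.smult_closed) auto
    qed
    finally show ?thesis unfolding t(2) .
  qed
  show "fg_module R ?P" "projective_module R ?P"
    using P.dual_basis_fg_projective[OF fin \<beta> \<theta>lift expand] by blast+
qed

end

context tensor_shift
begin

lemma J_subset:
  assumes I: "left_ideal I T" and I0: "\<And>a. a \<in> I\<^sub>0 \<Longrightarrow> a \<in> carrier A \<and> pt a \<one>\<^bsub>H\<^esub> \<in> I"
    and red: "\<And>a g. a \<in> carrier A \<Longrightarrow> g \<in> carrier G \<Longrightarrow>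
      pt a (\<delta> g) \<ominus>\<^bsub>T\<^esub> (\<Oplus>\<^bsub>T\<^esub>e\<in>E. c e g \<odot>\<^bsub>T\<^esub> pt a (\<delta> e)) \<in> I"
  shows "J I\<^sub>0 \<subseteq> I"
proof
  interpret T: assoc_algebra R T by (rule TA.tensor_assoc_algebra)
  note sub = T.left_ideal_submodule[OF I]
  note IE = TA.T.submoduleE[OF sub]
  define \<Psi> where "\<Psi> t = (\<Oplus>\<^bsub>T\<^esub>e\<in>E. pt (\<Phi> e t) (\<delta> e))" for t
  have \<Psi>: "\<Psi> \<in> linear_maps R T T"
    unfolding \<Psi>_def
    by (intro TA.T.linear_maps_sum E(1) linear_maps_comp[OF \<Phi>_linear bilinear_mapsD(2)[OF TA.pure_bilinear]] \<delta>_closed E(3))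
  \<comment> \<open>The difference of \<open>t\<close> and \<open>\<Psi> t\<close>, written with the
    scalar \<open>-1\<close> so that linearity follows from the rules for sums and
    multiples.\<close>
  have lin: "(\<lambda>t. t \<oplus>\<^bsub>T\<^esub> (\<ominus> \<one>) \<odot>\<^bsub>T\<^esub> \<Psi> t) \<in> linear_maps R T T"
    by (intro TA.T.linear_maps_add TA.T.linear_maps_smult linear_maps_id \<Psi>) simp
  fix t assume t: "t \<in> J I\<^sub>0"
  then have tT: "t \<in> carrier T" by (simp add: J_def)
  have "t \<in> {t \<in> carrier T. t \<oplus>\<^bsub>T\<^esub> (\<ominus> \<one>) \<odot>\<^bsub>T\<^esub> \<Psi> t \<in> I}"
  proof (rule T_submodule_eq[OF TA.T.submodule_vimage[OF TA.tensor_module sub lin] _ tT])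
    fix a g assume a: "a \<in> carrier A" and g: "g \<in> carrier G"
    have pc: "c e g \<odot>\<^bsub>T\<^esub> pt a (\<delta> e) \<in> carrier T" if "e \<in> E" for e
      using c_closed pt_closed a g E(3) that by simp
    have "\<Psi> (pt a (\<delta> g)) = (\<Oplus>\<^bsub>T\<^esub>e\<in>E. c e g \<odot>\<^bsub>T\<^esub> pt a (\<delta> e))"
      unfolding \<Psi>_def using pc
      by (intro TA.T.finsum_cong' refl Pi_I)
        (simp_all add: \<Phi>_pt a g c_closed E(3) \<delta>_closed TA.tensor_smult_pure)
    moreover have "(\<Oplus>\<^bsub>T\<^esub>e\<in>E. c e g \<odot>\<^bsub>T\<^esub> pt a (\<delta> e)) \<in> carrier T"
      using pc by (intro TA.T.finsum_closed Pi_I)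
    ultimately show "pt a (\<delta> g) \<in> {t \<in> carrier T. t \<oplus>\<^bsub>T\<^esub> (\<ominus> \<one>) \<odot>\<^bsub>T\<^esub> \<Psi> t \<in> I}"
      using red[OF a g] pt_closed[OF a g] by (simp add: TA.T.smult_neg_one a_minus_def)
  qed
  then have 1: "t \<oplus>\<^bsub>T\<^esub> \<ominus>\<^bsub>T\<^esub> \<Psi> t \<in> I"
    using linear_mapsD(1)[OF \<Psi> tT] by (simp add: TA.T.smult_neg_one)
  have 2: "\<Psi> t \<in> I"
    unfolding \<Psi>_def
  proof (intro TA.T.submodule_finsum[OF sub] Pi_I)
    fix e assume e: "e \<in> E"
    then have a: "\<Phi> e t \<in> carrier A" "pt (\<Phi> e t) \<one>\<^bsub>H\<^esub> \<in> I" using t I0 by (auto simp: J_def)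
    have "pt \<one>\<^bsub>A\<^esub> (\<delta> e) \<otimes>\<^bsub>T\<^esub> pt (\<Phi> e t) \<one>\<^bsub>H\<^esub> = pt (\<Phi> e t) (\<delta> e)"
      using a(1) E(3)[OF e] by (simp add: TA.tensor_mult_pure \<delta>_closed)
    then show "pt (\<Phi> e t) (\<delta> e) \<in> I"
      using I a(2) pt_closed[OF A.one_closed E(3)[OF e]] by (metis left_ideal_def)
  qed
  have "t = (t \<oplus>\<^bsub>T\<^esub> \<ominus>\<^bsub>T\<^esub> \<Psi> t) \<oplus>\<^bsub>T\<^esub> \<Psi> t"
    using tT linear_mapsD(1)[OF \<Psi> tT] by (simp add: TA.T.a_assoc TA.T.l_neg)
  then show "t \<in> I" using IE(5)[OF 1 2] by simp
qed

end

section \<open>Property P for Laurent polynomial algebras\<close>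

lemma laurent_over_P_left:
  fixes R :: "('a, 'r) ring_scheme" and A :: "('a, 'b, 'm) module_scheme"
  assumes "cring R" and noeth: "noetherian_ring R" and "algebra_with_P_left R A"
  shows "algebra_with_P_left R (laurent_over R A n)"
proof -
  interpret R: cring R by fact
  interpret A: algebra_with_P_left R A by fact
  let ?G = "free_abelian_rank n"
  interpret G: comm_group ?G by (rule comm_group_free_abelian_rank)
  interpret X: tensor_group_ring R ?G A
    by (intro tensor_group_ring.intro group_ring.intro R.is_cring G.comm_group_axioms A.assoc_algebra_axioms)
  have T: "laurent_over R A n = X.T" by (simp add: laurent_over_def laurent_def)
  interpret T: assoc_algebra R X.T by (rule X.TA.tensor_assoc_algebra)
  show ?thesis
    unfolding T
  proof (intro algebra_with_P_left.intro T.assoc_algebra_axioms algebra_with_P_left_axioms.intro)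
    fix I assume I: "left_ideal I X.T" and fg: "fg_module R (quotient_module X.T I)"
    note sub = T.left_ideal_submodule[OF I]
    let ?Q = "quotient_module X.T I" and ?\<pi> = "\<lambda>t. I +>\<^bsub>X.T\<^esub> t"
    interpret Q: module R ?Q by (rule X.TA.T.quotient_module_module[OF sub])
    note \<pi> = X.TA.T.quotient_proj_linear[OF sub]
    \<comment> \<open>The group element \<open>g\<close> inside the algebra. As \<open>I\<close> is
      a left ideal, multiplication by it from the left descends to the quotient and gives the action
      to which the expansion is applied.\<close>
    define u where "u g = X.pt \<one>\<^bsub>A\<^esub> (X.\<delta> g)" for g
    have u: "u g \<in> carrier X.T" if "g \<in> carrier ?G" for g
      using X.pt_closed that by (simp add: u_def)
    define \<alpha> where "\<alpha> g = quotient_map X.T I (\<lambda>t. u g \<otimes>\<^bsub>X.T\<^esub> t)" for g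
    note L = X.TA.tensor_mult_left_linear[OF u]
    have uI: "(\<lambda>t. u g \<otimes>\<^bsub>X.T\<^esub> t) ` I \<subseteq> I" if "g \<in> carrier ?G" for g
      using I u[OF that] by (auto simp: left_ideal_def)
    have \<alpha>: "\<alpha> g (?\<pi> t) = ?\<pi> (u g \<otimes>\<^bsub>X.T\<^esub> t)" if "g \<in> carrier ?G" "t \<in> carrier X.T" for g t
      unfolding \<alpha>_def by (rule X.TA.T.quotient_map_coset[OF sub L[OF that(1)] uI[OF that(1)] that(2)])
    have act: "lin_action R ?G ?Q \<alpha>"
      unfolding lin_action_def
    proof (intro conjI ballI)
      show "\<alpha> g \<in> linear_maps R ?Q ?Q" if "g \<in> carrier ?G" for g
        unfolding \<alpha>_def by (rule X.TA.T.quotient_map_linear[OF sub L[OF that] uI[OF that]])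
      fix x assume "x \<in> carrier ?Q"
      then obtain t where t: "t \<in> carrier X.T" "x = ?\<pi> t" by (auto simp: X.TA.T.quotient_module_carrier)
      show "\<alpha> (g \<otimes>\<^bsub>?G\<^esub> h) x = \<alpha> g (\<alpha> h x)" if gh: "g \<in> carrier ?G" "h \<in> carrier ?G" for g h
      proof -
        have "u (g \<otimes>\<^bsub>?G\<^esub> h) = u g \<otimes>\<^bsub>X.T\<^esub> u h"
          using gh by (simp add: u_def X.TA.tensor_mult_pure X.\<delta>_closed X.\<delta>_mult_\<delta>)
        then show ?thesis
          using gh t u by (simp add: \<alpha> X.TA.tensor_mult_closed X.TA.tensor_mult_assoc)
      qed
      have "u \<one>\<^bsub>?G\<^esub> = \<one>\<^bsub>X.T\<^esub>" by (simp add: u_def X.TA.tensor_one X.H_one)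
      then show "\<alpha> \<one>\<^bsub>?G\<^esub> x = x" using t by (simp add: \<alpha> X.TA.tensor_one_mult)
    qed
    obtain E c where sc: "shift_coeffs R ?G E c"
      and exp: "\<And>x g. x \<in> carrier ?Q \<Longrightarrow> g \<in> carrier ?G \<Longrightarrow> \<alpha> g x = (\<Oplus>\<^bsub>?Q\<^esub>e\<in>E. c e g \<odot>\<^bsub>?Q\<^esub> \<alpha> e x)"
      using Q.free_abelian_action_expansion[OF noeth fg act] by (elim exE conjE) (rule that, assumption, blast)
    interpret S: tensor_shift R ?G A E c
      by (intro tensor_shift.intro X.tensor_group_ring_axioms tensor_shift_axioms.intro sc)
    have oneH: "\<one>\<^bsub>X.H\<^esub> \<in> carrier X.H" by simp
    have pa: "X.pt a \<one>\<^bsub>X.H\<^esub> \<in> carrier X.T" if "a \<in> carrier A" for a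
      using X.TA.pure_closed[OF that oneH] .
    have u_pa: "u g \<otimes>\<^bsub>X.T\<^esub> X.pt a \<one>\<^bsub>X.H\<^esub> = X.pt a (X.\<delta> g)" if "a \<in> carrier A" "g \<in> carrier ?G" for a g
      using that by (simp add: u_def X.TA.tensor_mult_pure X.\<delta>_closed)
    have red: "X.pt a (X.\<delta> g) \<ominus>\<^bsub>X.T\<^esub> (\<Oplus>\<^bsub>X.T\<^esub>e\<in>E. c e g \<odot>\<^bsub>X.T\<^esub> X.pt a (X.\<delta> e)) \<in> I"
      if a: "a \<in> carrier A" and g: "g \<in> carrier ?G" for a g
    proof -
      have pc: "c e g \<odot>\<^bsub>X.T\<^esub> X.pt a (X.\<delta> e) \<in> carrier X.T" if "e \<in> E" for e
        using S.c_closed X.pt_closed a g S.E(3) that by simp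
      have "?\<pi> (X.pt a (X.\<delta> g)) = \<alpha> g (?\<pi> (X.pt a \<one>\<^bsub>X.H\<^esub>))"
        using \<alpha>[OF g pa[OF a]] u_pa[OF a g] by simp
      also have "\<dots> = (\<Oplus>\<^bsub>?Q\<^esub>e\<in>E. c e g \<odot>\<^bsub>?Q\<^esub> \<alpha> e (?\<pi> (X.pt a \<one>\<^bsub>X.H\<^esub>)))"
        by (rule exp[OF linear_mapsD(1)[OF \<pi> pa[OF a]] g])
      also have "\<dots> = (\<Oplus>\<^bsub>?Q\<^esub>e\<in>E. ?\<pi> (c e g \<odot>\<^bsub>X.T\<^esub> X.pt a (X.\<delta> e)))"
      proof (intro Q.finsum_cong' refl Pi_I)
        fix e assume e: "e \<in> E"
        show "?\<pi> (c e g \<odot>\<^bsub>X.T\<^esub> X.pt a (X.\<delta> e)) \<in> carrier ?Q" by (rule linear_mapsD(1)[OF \<pi> pc[OF e]])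
        show "c e g \<odot>\<^bsub>?Q\<^esub> \<alpha> e (?\<pi> (X.pt a \<one>\<^bsub>X.H\<^esub>)) = ?\<pi> (c e g \<odot>\<^bsub>X.T\<^esub> X.pt a (X.\<delta> e))"
          using \<alpha>[OF S.E(3)[OF e] pa[OF a]] u_pa[OF a S.E(3)[OF e]]
            linear_mapsD(3)[OF \<pi> S.c_closed[OF e g] X.pt_closed[OF a S.E(3)[OF e]]] by simp
      qed
      also have "\<dots> = ?\<pi> (\<Oplus>\<^bsub>X.T\<^esub>e\<in>E. c e g \<odot>\<^bsub>X.T\<^esub> X.pt a (X.\<delta> e))"
        using pc by (intro linear_maps_finsum[OF X.TA.tensor_module Q.module_axioms \<pi>, symmetric] Pi_I)
      finally show ?thesis
        using X.TA.T.coset_eq_iff[OF sub X.pt_closed[OF a g]] pc X.TA.T.finsum_closed by (simp add: Pi_iff)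
    qed
    \<comment> \<open>The intersection of \<open>I\<close> with \<open>A\<close>, to which the
      hypothesis on \<open>A\<close> will be applied.\<close>
    let ?I' = "{a \<in> carrier A. X.pt a \<one>\<^bsub>X.H\<^esub> \<in> I}"
    note pl = bilinear_mapsD(2)[OF X.TA.pure_bilinear oneH]
    have I': "left_ideal ?I' A"
    proof (rule A.left_idealI[OF A.submodule_vimage[OF X.TA.tensor_module sub pl]])
      fix a x assume a: "a \<in> carrier A" and x: "x \<in> ?I'"
      have "X.pt (a \<otimes>\<^bsub>A\<^esub> x) \<one>\<^bsub>X.H\<^esub> = X.pt a \<one>\<^bsub>X.H\<^esub> \<otimes>\<^bsub>X.T\<^esub> X.pt x \<one>\<^bsub>X.H\<^esub>"
        using a x by (simp add: X.TA.tensor_mult_pure)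
      then show "a \<otimes>\<^bsub>A\<^esub> x \<in> ?I'" using a x pa I by (simp add: left_ideal_def)
    qed
    note sub' = A.left_ideal_submodule[OF I']
    \<comment> \<open>Its kernel is \<open>?I'\<close>. The image is a submodule of a finitely
      generated module over a Noetherian ring, hence finitely generated, and its generators are
      lifted to \<open>A\<close>.\<close>
    define j where "j a = ?\<pi> (X.pt a \<one>\<^bsub>X.H\<^esub>)" for a
    have j: "j \<in> linear_maps R A ?Q" unfolding j_def by (rule linear_maps_comp[OF pl \<pi>])
    obtain B where B: "finite B" "B \<subseteq> carrier ?Q" "carrier ?Q \<subseteq> lspan R ?Q B"
      using fg unfolding Q.fg_module_iff by (elim exE conjE) (rule that)
    have "submodule (lspan R ?Q (j ` carrier A)) R ?Q"
      using linear_mapsD(1)[OF j] by (intro Q.lspan_submodule) auto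
    moreover have "lspan R ?Q (j ` carrier A) = j ` carrier A"
      using A.lspan_linear_image[OF Q.module_axioms j order_refl]
        A.lspan_closed[OF order_refl] A.lspan_base[OF order_refl] by (metis subset_antisym subsetI)
    moreover have "j ` carrier A \<subseteq> lspan R ?Q B" using B(3) linear_mapsD(1)[OF j] by auto
    ultimately obtain C where C: "finite C" "C \<subseteq> j ` carrier A" "j ` carrier A \<subseteq> lspan R ?Q C"
      using Q.noetherian_submodule[OF noeth B(1,2), of "j ` carrier A"] by auto
    obtain C0 where C0: "C0 \<subseteq> carrier A" "finite C0" "C = j ` C0"
      using finite_subset_image[OF C(1,2)] by auto
    have fg': "fg_module R (quotient_module A ?I')"
      unfolding A.quotient_fg_iff[OF sub']
    proof (intro exI[of _ C0] conjI C0 ballI)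
      fix a assume a: "a \<in> carrier A"
      have "j a \<in> j ` lspan R A C0"
        unfolding A.lspan_linear_image[OF Q.module_axioms j C0(1)] using C(3) a C0(3) by auto
      then obtain s where s: "s \<in> lspan R A C0" "j a = j s" by auto
      have sA: "s \<in> carrier A" by (rule A.lspan_closed[OF C0(1) s(1)])
      have "X.pt a \<one>\<^bsub>X.H\<^esub> \<ominus>\<^bsub>X.T\<^esub> X.pt s \<one>\<^bsub>X.H\<^esub> \<in> I"
        using s(2) X.TA.T.coset_eq_iff[OF sub pa[OF a] pa[OF sA]] by (simp add: j_def)
      then have "a \<ominus>\<^bsub>A\<^esub> s \<in> ?I'"
        using linear_maps_diff[OF A.module_axioms X.TA.tensor_module pl a sA] a sA by simp
      then show "\<exists>s\<in>lspan R A C0. a \<ominus>\<^bsub>A\<^esub> s \<in> ?I'" using s(1) by blast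
    qed
    obtain I0 where I0: "left_ideal I0 A" "I0 \<subseteq> ?I'"
      and fp: "fg_module R (quotient_module A I0)" "projective_module R (quotient_module A I0)"
      using A.P_left[OF I' fg'] by (elim exE conjE) (rule that)
    have "S.J I0 \<subseteq> I" by (rule S.J_subset[OF I _ red]) (use I0(2) in auto)
    then show "\<exists>I\<^sub>0. left_ideal I\<^sub>0 X.T \<and> I\<^sub>0 \<subseteq> I \<and>
        fg_module R (quotient_module X.T I\<^sub>0) \<and> projective_module R (quotient_module X.T I\<^sub>0)"
      using S.J_left_ideal[OF I0(1)] S.J_fg_projective[OF I0(1) fp] by blast
  qed
qed

section \<open>The finite dual of a group algebra\<close>

context module
begin

lemma dual_module_fields:
  "carrier (dual_module R M) = linear_maps R M (regular_module R) \<inter> extensional (carrier M)"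
  "\<zero>\<^bsub>dual_module R M\<^esub> = (\<lambda>k\<in>carrier M. \<zero>)"
  "f \<oplus>\<^bsub>dual_module R M\<^esub> g = (\<lambda>k\<in>carrier M. f k \<oplus> g k)"
  "r \<odot>\<^bsub>dual_module R M\<^esub> f = (\<lambda>k\<in>carrier M. r \<otimes> f k)"
  by (simp_all add: dual_module_def)

lemma dual_memI:
  assumes "f \<in> linear_maps R M (regular_module R)"
  shows "(\<lambda>k\<in>carrier M. f k) \<in> carrier (dual_module R M)"
  using linear_maps_cong[OF module_axioms assms, of "\<lambda>k\<in>carrier M. f k"] by (simp add: dual_module_fields)

lemma dual_linear: "f \<in> carrier (dual_module R M) \<Longrightarrow> f \<in> linear_maps R M (regular_module R)"
  by (simp add: dual_module_fields)

lemma dual_apply_closed: "f \<in> carrier (dual_module R M) \<Longrightarrow> k \<in> carrier M \<Longrightarrow> f k \<in> carrier R"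
  using linear_mapsD(1)[OF dual_linear] by simp

lemma dual_ext:
  "f \<in> carrier (dual_module R M) \<Longrightarrow> g \<in> carrier (dual_module R M) \<Longrightarrow> (\<And>k. k \<in> carrier M \<Longrightarrow> f k = g k) \<Longrightarrow> f = g"
  by (auto simp: dual_module_fields intro: extensionalityI)

lemma dual_module_module: "module R (dual_module R M)"
proof -
  let ?D = "dual_module R M"
  interpret Rm: module R "regular_module R" by (rule R.regular_module)
  note mem = dual_apply_closed
  have add_cl: "f \<oplus>\<^bsub>?D\<^esub> g \<in> carrier ?D" if "f \<in> carrier ?D" "g \<in> carrier ?D" for f g
    unfolding dual_module_fields(3)
    by (rule dual_memI) (use Rm.linear_maps_add[OF dual_linear[OF that(1)] dual_linear[OF that(2)]] in simp)
  have smult_cl: "r \<odot>\<^bsub>?D\<^esub> f \<in> carrier ?D" if "r \<in> carrier R" "f \<in> carrier ?D" for r f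
    unfolding dual_module_fields(4)
    by (rule dual_memI) (use Rm.linear_maps_smult[OF dual_linear[OF that(2)] that(1)] in simp)
  have zero_cl: "\<zero>\<^bsub>?D\<^esub> \<in> carrier ?D"
    unfolding dual_module_fields(2)
    by (rule dual_memI) (use Rm.linear_maps_const_zero in simp)
  have ab: "abelian_group ?D"
  proof (rule abelian_groupI)
    fix f assume f: "f \<in> carrier ?D"
    show "\<exists>g\<in>carrier ?D. g \<oplus>\<^bsub>?D\<^esub> f = \<zero>\<^bsub>?D\<^esub>"
    proof (rule bexI[of _ "(\<ominus> \<one>) \<odot>\<^bsub>?D\<^esub> f"])
      show n: "(\<ominus> \<one>) \<odot>\<^bsub>?D\<^esub> f \<in> carrier ?D" by (rule smult_cl[OF _ f]) simp
      show "(\<ominus> \<one>) \<odot>\<^bsub>?D\<^esub> f \<oplus>\<^bsub>?D\<^esub> f = \<zero>\<^bsub>?D\<^esub>"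
        by (rule dual_ext[OF add_cl[OF n f] zero_cl]) (simp add: dual_module_fields mem[OF f] R.l_minus R.l_neg)
    qed
    show "\<zero>\<^bsub>?D\<^esub> \<oplus>\<^bsub>?D\<^esub> f = f"
      by (rule dual_ext[OF add_cl[OF zero_cl f] f]) (simp add: dual_module_fields mem[OF f])
    fix g assume g: "g \<in> carrier ?D"
    show "f \<oplus>\<^bsub>?D\<^esub> g = g \<oplus>\<^bsub>?D\<^esub> f"
      by (rule dual_ext[OF add_cl[OF f g] add_cl[OF g f]]) (simp add: dual_module_fields mem[OF f] mem[OF g] R.a_comm)
    fix h assume h: "h \<in> carrier ?D"
    show "f \<oplus>\<^bsub>?D\<^esub> g \<oplus>\<^bsub>?D\<^esub> h = f \<oplus>\<^bsub>?D\<^esub> (g \<oplus>\<^bsub>?D\<^esub> h)"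
      by (rule dual_ext[OF add_cl[OF add_cl[OF f g] h] add_cl[OF f add_cl[OF g h]]])
        (simp add: dual_module_fields mem[OF f] mem[OF g] mem[OF h] R.a_assoc)
  qed (rule add_cl, assumption+, rule zero_cl)
  show ?thesis
  proof (rule moduleI[OF R.is_cring ab])
    fix r f assume r: "r \<in> carrier R" and f: "f \<in> carrier ?D"
    show "r \<odot>\<^bsub>?D\<^esub> f \<in> carrier ?D" by (rule smult_cl[OF r f])
    fix s assume s: "s \<in> carrier R"
    show "(r \<oplus> s) \<odot>\<^bsub>?D\<^esub> f = r \<odot>\<^bsub>?D\<^esub> f \<oplus>\<^bsub>?D\<^esub> s \<odot>\<^bsub>?D\<^esub> f"
      by (rule dual_ext[OF smult_cl[OF R.a_closed[OF r s] f] add_cl[OF smult_cl[OF r f] smult_cl[OF s f]]])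
        (simp add: dual_module_fields mem[OF f] r s R.l_distr)
    show "(r \<otimes> s) \<odot>\<^bsub>?D\<^esub> f = r \<odot>\<^bsub>?D\<^esub> (s \<odot>\<^bsub>?D\<^esub> f)"
      by (rule dual_ext[OF smult_cl[OF R.m_closed[OF r s] f] smult_cl[OF r smult_cl[OF s f]]])
        (simp add: dual_module_fields mem[OF f] r s R.m_assoc)
  next
    fix r f g assume r: "r \<in> carrier R" and f: "f \<in> carrier ?D" and g: "g \<in> carrier ?D"
    show "r \<odot>\<^bsub>?D\<^esub> (f \<oplus>\<^bsub>?D\<^esub> g) = r \<odot>\<^bsub>?D\<^esub> f \<oplus>\<^bsub>?D\<^esub> r \<odot>\<^bsub>?D\<^esub> g"
      by (rule dual_ext[OF smult_cl[OF r add_cl[OF f g]] add_cl[OF smult_cl[OF r f] smult_cl[OF r g]]])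
        (simp add: dual_module_fields mem[OF f] mem[OF g] r R.r_distr)
  next
    fix f assume f: "f \<in> carrier ?D"
    show "\<one> \<odot>\<^bsub>?D\<^esub> f = f"
      by (rule dual_ext[OF smult_cl[OF R.one_closed f] f]) (simp add: dual_module_fields mem[OF f])
  qed
qed

lemma dual_eval_linear:
  "k \<in> carrier M \<Longrightarrow> (\<lambda>f. f k) \<in> linear_maps R (dual_module R M) (regular_module R)"
  by (rule linear_mapsI) (simp_all add: dual_apply_closed, simp_all add: dual_module_fields)

text \<open>Applied to convolution, it bounds all translates of a product by finitely many products.
  Linearity is used in one argument at a time, through preimages of the span.\<close>

lemma bilinear_lspan:
  assumes "module R N" and "module R P" and \<beta>: "\<beta> \<in> bilinear_maps R M N P"
    and B: "B \<subseteq> carrier M" and C: "C \<subseteq> carrier N" and x: "x \<in> lspan R M B" and y: "y \<in> lspan R N C"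
  shows "\<beta> x y \<in> lspan R P ((\<lambda>(b, c). \<beta> b c) ` (B \<times> C))"
proof -
  interpret N: module R N by fact
  interpret P: module R P by fact
  let ?S = "(\<lambda>(b, c). \<beta> b c) ` (B \<times> C)"
  have S: "?S \<subseteq> carrier P" using bilinear_maps_closed[OF \<beta>] B C by auto
  note sub = P.lspan_submodule[OF S]
  have "\<beta> b y \<in> lspan R P ?S" if b: "b \<in> B" for b
  proof -
    have bM: "b \<in> carrier M" using b B by auto
    have "C \<subseteq> {y \<in> carrier N. \<beta> b y \<in> lspan R P ?S}"
      using C b by (auto intro!: P.lspan_base[OF S])
    from N.lspan_minimal[OF N.submodule_vimage[OF P.module_axioms sub bilinear_mapsD(1)[OF \<beta> bM]] this] y
    show ?thesis by blast
  qed
  then have "B \<subseteq> {x \<in> carrier M. \<beta> x y \<in> lspan R P ?S}" using B by auto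
  from lspan_minimal[OF submodule_vimage[OF P.module_axioms sub bilinear_mapsD(2)[OF \<beta> N.lspan_closed[OF C y]]] this] x
  show ?thesis by blast
qed

end

section \<open>Translates of functionals and the finite dual\<close>

context group_ring
begin

abbreviation "D \<equiv> dual_module R H"
abbreviation "Fd \<equiv> carrier (finite_dual_module R H)"
abbreviation "act \<equiv> dual_action H"

sublocale D: module R D
  by (rule H.dual_module_module)

lemma H_submodule_eq:
  assumes S: "submodule S R H" and "\<And>g. g \<in> carrier G \<Longrightarrow> \<delta> g \<in> S" and h: "h \<in> carrier H"
  shows "h \<in> S"
proof -
  have "h \<in> carrier FM" using h by (simp add: H_fields)
  then show ?thesis
  proof (induction rule: R.free_module_induct)
    case zero
    then show ?case using H.submodule_zero[OF S] by (simp add: H_fields)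
  next
    case (unit r x)
    then show ?case using H.submoduleE(4)[OF S unit(1)] assms(2) by (simp add: H_fields)
  next
    case (add f g)
    then show ?case using H.submoduleE(5)[OF S] by (simp add: H_fields)
  qed
qed

lemma D_ext:
  assumes "f \<in> carrier D" and "g \<in> carrier D" and "\<And>x. x \<in> carrier G \<Longrightarrow> f (\<delta> x) = g (\<delta> x)"
  shows "f = g"
proof (rule H.dual_ext[OF assms(1,2)])
  fix k assume k: "k \<in> carrier H"
  show "f k = g k"
    by (rule H_linear_eq[OF R.regular_module H.dual_linear[OF assms(1)] H.dual_linear[OF assms(2)] assms(3) k])
qed

lemma eval_linear: "x \<in> carrier G \<Longrightarrow> (\<lambda>f. f (\<delta> x)) \<in> linear_maps R D (regular_module R)"
  by (rule H.dual_eval_linear[OF \<delta>_closed])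

lemma D_closed: "f \<in> carrier D \<Longrightarrow> x \<in> carrier G \<Longrightarrow> f (\<delta> x) \<in> carrier R"
  by (rule H.dual_apply_closed[OF _ \<delta>_closed])

lemma D_apply:
  "x \<in> carrier G \<Longrightarrow> (f \<oplus>\<^bsub>D\<^esub> g) (\<delta> x) = f (\<delta> x) \<oplus> g (\<delta> x)"
  "x \<in> carrier G \<Longrightarrow> (r \<odot>\<^bsub>D\<^esub> f) (\<delta> x) = r \<otimes> f (\<delta> x)"
  "x \<in> carrier G \<Longrightarrow> \<zero>\<^bsub>D\<^esub> (\<delta> x) = \<zero>"
  by (simp_all add: H.dual_module_fields \<delta>_closed)

lemma D_finsum_apply:
  assumes "x \<in> carrier G" and "h \<in> I \<rightarrow> carrier D"
  shows "(\<Oplus>\<^bsub>D\<^esub>i\<in>I. h i) (\<delta> x) = (\<Oplus>i\<in>I. h i (\<delta> x))"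
  using linear_maps_finsum[OF D.module_axioms R.regular_module eval_linear[OF assms(1)] assms(2)] by simp

definition D_of :: "('c \<Rightarrow> 'a) \<Rightarrow> ('c \<Rightarrow> 'a) \<Rightarrow> 'a"
  where "D_of u = (\<lambda>h\<in>carrier H. free_lift R (carrier G) (regular_module R) u h)"

lemma D_of:
  assumes "\<And>x. x \<in> carrier G \<Longrightarrow> u x \<in> carrier R"
  shows "D_of u \<in> carrier D" and "x \<in> carrier G \<Longrightarrow> D_of u (\<delta> x) = u x"
proof -
  have u: "u \<in> carrier G \<rightarrow> carrier (regular_module R)" using assms by simp
  show "D_of u \<in> carrier D"
    unfolding D_of_def using module.free_lift_linear[OF R.regular_module u]
    by (intro H.dual_memI) (simp add: H_linear)
  show "D_of u (\<delta> x) = u x" if "x \<in> carrier G"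
    using module.free_lift_unit[OF R.regular_module u that] that by (simp add: D_of_def \<delta>_closed)
qed

lemma act_closed: "h \<in> carrier H \<Longrightarrow> f \<in> carrier D \<Longrightarrow> act h f \<in> carrier D"
  unfolding dual_action_def
  by (intro H.dual_memI linear_maps_comp[OF H.mult_right_linear H.dual_linear])

lemma act_linear: "h \<in> carrier H \<Longrightarrow> act h \<in> linear_maps R D D"
  by (rule linear_mapsI[OF act_closed])
    (auto simp: dual_action_def H.dual_module_fields(3,4) H_mult_closed intro!: restrict_ext)

lemma act_linear_left: "f \<in> carrier D \<Longrightarrow> (\<lambda>h. act h f) \<in> linear_maps R H D"
proof (rule linear_mapsI)
  assume f: "f \<in> carrier D"
  note lin = H.dual_linear[OF f]
  show "act h f \<in> carrier D" if "h \<in> carrier H" for h by (rule act_closed[OF that f])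
  show "act (h \<oplus>\<^bsub>H\<^esub> h') f = act h f \<oplus>\<^bsub>D\<^esub> act h' f" if "h \<in> carrier H" "h' \<in> carrier H" for h h'
    using that linear_mapsD(2)[OF lin]
    by (auto simp: dual_action_def H.dual_module_fields(3) H_mult_closed H.r_distr intro!: restrict_ext)
  show "act (r \<odot>\<^bsub>H\<^esub> h) f = r \<odot>\<^bsub>D\<^esub> act h f" if "r \<in> carrier R" "h \<in> carrier H" for r h
    using that linear_mapsD(3)[OF lin]
    by (auto simp: dual_action_def H.dual_module_fields(4) H_mult_closed H.smult_assoc3 intro!: restrict_ext)
qed

lemma act_act:
  "h \<in> carrier H \<Longrightarrow> h' \<in> carrier H \<Longrightarrow> act h (act h' f) = act (h \<otimes>\<^bsub>H\<^esub> h') f"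
  by (auto simp: dual_action_def H_mult_closed H_mult_assoc intro!: restrict_ext)

lemma act_\<delta>: "x \<in> carrier G \<Longrightarrow> y \<in> carrier G \<Longrightarrow> act (\<delta> x) f (\<delta> y) = f (\<delta> (y \<otimes>\<^bsub>G\<^esub> x))"
  by (simp add: dual_action_def \<delta>_closed \<delta>_mult_\<delta>)

lemma act_one: "f \<in> carrier D \<Longrightarrow> act (\<delta> \<one>\<^bsub>G\<^esub>) f = f"
  by (rule D_ext) (simp_all add: act_closed \<delta>_closed act_\<delta>)

abbreviation "orbit f \<equiv> (\<lambda>h. act h f) ` carrier H"

text \<open>The orbit is the image of the linear map that sends \<open>h\<close> to the translate of
  \<open>f\<close> by \<open>h\<close>, so it is its own span; it contains \<open>f\<close> as the
  translate by the unit.\<close>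

lemma orbit_span:
  assumes f: "f \<in> carrier D"
  shows "submodule (orbit f) R D" and "f \<in> orbit f"
proof -
  have "orbit f = lspan R D (orbit f)"
    using H.lspan_linear_image[OF D.module_axioms act_linear_left[OF f] order_refl]
      H.lspan_closed[OF order_refl] H.lspan_base[OF order_refl] by (metis subset_antisym subsetI)
  moreover have "submodule (lspan R D (orbit f)) R D"
    using act_closed f by (intro D.lspan_submodule) auto
  ultimately show "submodule (orbit f) R D" by simp
  show "f \<in> orbit f" using act_one[OF f] \<delta>_closed[OF G.one_closed] by force
qed

lemma Fd_orbit:
  assumes "f \<in> Fd"
  obtains B where "finite B" and "B \<subseteq> orbit f" and "orbit f \<subseteq> lspan R D B"
proof -
  have f: "f \<in> carrier D" "fg_module R (D\<lparr>carrier := orbit f\<rparr>)"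
    using assms by (simp_all add: finite_dual_module_def)
  from f(2) show ?thesis
    unfolding D.fg_submodule_iff[OF orbit_span(1)[OF f(1)]] using that by blast
qed

lemma Fd_D: "f \<in> Fd \<Longrightarrow> f \<in> carrier D"
  by (simp add: finite_dual_module_def)

text \<open>Over a Noetherian ring it suffices to enclose the orbit in a finitely generated
  submodule, whose generators may be arbitrary functionals. Since the translate depends linearly on
  \<open>h\<close>, only group elements need to be tested.\<close>

lemma Fd_I:
  assumes noeth: "noetherian_ring R" and f: "f \<in> carrier D" and B: "finite B" "B \<subseteq> carrier D"
    and act: "\<And>g. g \<in> carrier G \<Longrightarrow> act (\<delta> g) f \<in> lspan R D B"
  shows "f \<in> Fd"
proof -
  have "act h f \<in> lspan R D B" if h: "h \<in> carrier H" for h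
    using H_submodule_eq[OF H.submodule_vimage[OF D.module_axioms D.lspan_submodule[OF B(2)] act_linear_left[OF f]] _ h]
      act \<delta>_closed by simp
  then have "orbit f \<subseteq> lspan R D B" by auto
  from D.fg_submodule_noetherian[OF noeth orbit_span(1)[OF f] B this] f
  show ?thesis by (simp add: finite_dual_module_def)
qed

lemma Fd_act_span:
  assumes "f \<in> Fd"
  obtains B where "finite B" and "B \<subseteq> carrier D" and "\<And>h. h \<in> carrier H \<Longrightarrow> act h f \<in> lspan R D B"
proof (rule Fd_orbit[OF assms])
  fix B assume B: "finite B" "B \<subseteq> orbit f" "orbit f \<subseteq> lspan R D B"
  then have "B \<subseteq> carrier D" using act_closed[OF _ Fd_D[OF assms]] by auto
  with B show ?thesis using that by blast
qed

lemma Fd_submodule: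
  assumes noeth: "noetherian_ring R"
  shows "submodule Fd R D"
proof (rule D.submoduleI)
  show "Fd \<subseteq> carrier D" using Fd_D by auto
  have smult: "r \<odot>\<^bsub>D\<^esub> f \<in> Fd" if r: "r \<in> carrier R" and f: "f \<in> Fd" for r f
  proof (rule Fd_act_span[OF f])
    fix B assume B: "finite B" "B \<subseteq> carrier D" "\<And>h. h \<in> carrier H \<Longrightarrow> act h f \<in> lspan R D B"
    show ?thesis
      using linear_mapsD(3)[OF act_linear[OF \<delta>_closed] r Fd_D[OF f]] B(3)[OF \<delta>_closed] r f
      by (intro Fd_I[OF noeth _ B(1,2)]) (simp_all add: Fd_D D.lspan_smult[OF B(2)])
  qed
  then show "r \<odot>\<^bsub>D\<^esub> f \<in> Fd" if "r \<in> carrier R" "f \<in> Fd" for r f using that .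
  show "\<ominus>\<^bsub>D\<^esub> f \<in> Fd" if f: "f \<in> Fd" for f
    using smult[OF _ f, of "\<ominus> \<one>"] by (simp add: D.smult_neg_one Fd_D f)
  show "\<zero>\<^bsub>D\<^esub> \<in> Fd"
    using linear_maps_zero[OF D.module_axioms D.module_axioms act_linear[OF \<delta>_closed]]
    by (intro Fd_I[OF noeth, of _ "{}"]) (simp_all add: lspan.zero)
  fix f g assume f: "f \<in> Fd" and g: "g \<in> Fd"
  show "f \<oplus>\<^bsub>D\<^esub> g \<in> Fd"
  proof (rule Fd_act_span[OF f], rule Fd_act_span[OF g])
    fix B C assume B: "finite B" "B \<subseteq> carrier D" "\<And>h. h \<in> carrier H \<Longrightarrow> act h f \<in> lspan R D B"
      and C: "finite C" "C \<subseteq> carrier D" "\<And>h. h \<in> carrier H \<Longrightarrow> act h g \<in> lspan R D C"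
    have BC: "finite (B \<union> C)" "B \<union> C \<subseteq> carrier D" using B C by auto
    have "act h f \<in> lspan R D (B \<union> C)" "act h g \<in> lspan R D (B \<union> C)" if "h \<in> carrier H" for h
      using B(3)[OF that] C(3)[OF that] lspan_mono[of B "B \<union> C" R D] lspan_mono[of C "B \<union> C" R D] by auto
    then show ?thesis
      using linear_mapsD(2)[OF act_linear[OF \<delta>_closed] Fd_D[OF f] Fd_D[OF g]] Fd_D[OF f] Fd_D[OF g] \<delta>_closed
      by (intro Fd_I[OF noeth _ BC]) (simp_all add: D.lspan_add[OF BC(2)])
  qed
qed

text \<open>Every finite set of elements of \<open>H\<degree>\<close> is recovered from its values on a finite set of group
  elements; this local dual basis makes \<open>H\<degree> \<otimes> N\<close> embed into the functions from \<open>G\<close> to \<open>N\<close>.\<close>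

definition reproducing :: "(('c \<Rightarrow> 'a) \<Rightarrow> 'a) set \<Rightarrow> 'c set \<Rightarrow> ('c \<Rightarrow> ('c \<Rightarrow> 'a) \<Rightarrow> 'a) \<Rightarrow> bool"
  where "reproducing X E \<chi> \<longleftrightarrow> finite E \<and> E \<subseteq> carrier G \<and> (\<forall>e\<in>E. \<chi> e \<in> Fd) \<and>
    (\<forall>f\<in>X. f = (\<Oplus>\<^bsub>D\<^esub>e\<in>E. f (\<delta> e) \<odot>\<^bsub>D\<^esub> \<chi> e))"

lemma reproducing_mono: "X \<subseteq> Y \<Longrightarrow> reproducing Y E \<chi> \<Longrightarrow> reproducing X E \<chi>"
  by (auto simp: reproducing_def)

text \<open>Both sides of the reproducing formula are linear in \<open>f\<close>.\<close>

lemma reproducing_lspan: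
  assumes X: "X \<subseteq> carrier D" and rep: "reproducing X E \<chi>"
  shows "reproducing (lspan R D X) E \<chi>"
proof -
  have E: "finite E" "E \<subseteq> carrier G" "\<And>e. e \<in> E \<Longrightarrow> \<chi> e \<in> Fd"
    and eq: "\<And>f. f \<in> X \<Longrightarrow> f = (\<Oplus>\<^bsub>D\<^esub>e\<in>E. f (\<delta> e) \<odot>\<^bsub>D\<^esub> \<chi> e)"
    using rep by (auto simp: reproducing_def)
  have lin: "(\<lambda>f. \<Oplus>\<^bsub>D\<^esub>e\<in>E. f (\<delta> e) \<odot>\<^bsub>D\<^esub> \<chi> e) \<in> linear_maps R D D"
    using E(2) by (intro D.linear_maps_sum E(1) D.linear_maps_smult_point eval_linear Fd_D E(3)) auto
  have "f = (\<Oplus>\<^bsub>D\<^esub>e\<in>E. f (\<delta> e) \<odot>\<^bsub>D\<^esub> \<chi> e)" if "f \<in> lspan R D X" for f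
    by (rule D.lspan_linear_eq[OF D.module_axioms linear_maps_id lin X eq that])
  then show ?thesis using E by (simp add: reproducing_def)
qed

text \<open>The functional equation expresses every translate of a coordinate function by the
  coordinate functions themselves, so these belong to the finite dual. The hypothesis
  \<open>rel\<close> is the reproducing formula evaluated at group elements, and values there
  determine a functional.\<close>

lemma reproducing_of_action:
  assumes noeth: "noetherian_ring R" and sc: "shift_coeffs R G E c" and X: "X \<subseteq> carrier D"
    and rel: "\<And>f g. f \<in> X \<Longrightarrow> g \<in> carrier G \<Longrightarrow> f (\<delta> g) = (\<Oplus>e\<in>E. c e g \<otimes> f (\<delta> e))"
  shows "reproducing X E (\<lambda>e. D_of (c e))"
proof -
  have E: "finite E" "E \<subseteq> carrier G" and c: "\<And>e g. e \<in> E \<Longrightarrow> g \<in> carrier G \<Longrightarrow> c e g \<in> carrier R"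
    and c_mult: "\<And>e g h. e \<in> E \<Longrightarrow> g \<in> carrier G \<Longrightarrow> h \<in> carrier G \<Longrightarrow>
      c e (g \<otimes>\<^bsub>G\<^esub> h) = (\<Oplus>e'\<in>E. c e' g \<otimes> c e (e' \<otimes>\<^bsub>G\<^esub> h))"
    using sc by (auto simp: shift_coeffs_def)
  have eG: "e \<in> carrier G" if "e \<in> E" for e using that E(2) by auto
  let ?\<chi> = "\<lambda>e. D_of (c e)"
  have \<chi>: "?\<chi> e \<in> carrier D" "x \<in> carrier G \<Longrightarrow> ?\<chi> e (\<delta> x) = c e x" if "e \<in> E" for e x
    using D_of[of "c e"] c[OF that] by auto
  have \<chi>S: "?\<chi> ` E \<subseteq> carrier D" using \<chi>(1) by auto
  have "?\<chi> e \<in> Fd" if e: "e \<in> E" for e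
  proof (rule Fd_I[OF noeth \<chi>(1)[OF e] _ \<chi>S])
    show "finite (?\<chi> ` E)" using E(1) by simp
    fix h assume h: "h \<in> carrier G"
    have cl: "c e (e' \<otimes>\<^bsub>G\<^esub> h) \<odot>\<^bsub>D\<^esub> ?\<chi> e' \<in> carrier D" if "e' \<in> E" for e'
      using c[OF e] eG[OF that] h \<chi>(1)[OF that] by simp
    \<comment> \<open>\<open>c_mult\<close>, read as an identity of functionals.\<close>
    have "act (\<delta> h) (?\<chi> e) = (\<Oplus>\<^bsub>D\<^esub>e'\<in>E. c e (e' \<otimes>\<^bsub>G\<^esub> h) \<odot>\<^bsub>D\<^esub> ?\<chi> e')"
    proof (rule D_ext)
      show "act (\<delta> h) (?\<chi> e) \<in> carrier D" by (rule act_closed[OF \<delta>_closed[OF h] \<chi>(1)[OF e]])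
      show "(\<Oplus>\<^bsub>D\<^esub>e'\<in>E. c e (e' \<otimes>\<^bsub>G\<^esub> h) \<odot>\<^bsub>D\<^esub> ?\<chi> e') \<in> carrier D"
        using cl by (intro D.finsum_closed Pi_I)
      fix x assume x: "x \<in> carrier G"
      have "(\<Oplus>\<^bsub>D\<^esub>e'\<in>E. c e (e' \<otimes>\<^bsub>G\<^esub> h) \<odot>\<^bsub>D\<^esub> ?\<chi> e') (\<delta> x) = (\<Oplus>e'\<in>E. (c e (e' \<otimes>\<^bsub>G\<^esub> h) \<odot>\<^bsub>D\<^esub> ?\<chi> e') (\<delta> x))"
        using cl by (intro D_finsum_apply[OF x] Pi_I)
      also have "\<dots> = (\<Oplus>e'\<in>E. c e' x \<otimes> c e (e' \<otimes>\<^bsub>G\<^esub> h))"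
        using c eG h x e by (intro R.finsum_cong' refl Pi_I) (simp_all add: D_apply \<chi> R.m_comm)
      finally show "act (\<delta> h) (?\<chi> e) (\<delta> x) = (\<Oplus>\<^bsub>D\<^esub>e'\<in>E. c e (e' \<otimes>\<^bsub>G\<^esub> h) \<odot>\<^bsub>D\<^esub> ?\<chi> e') (\<delta> x)"
        using x h e by (simp add: act_\<delta> \<chi> c_mult)
    qed
    also have "\<dots> \<in> lspan R D (?\<chi> ` E)"
      using c[OF e] eG h by (intro D.lspan_finsum_closed[OF \<chi>S] Pi_I D.lspan_smult[OF \<chi>S] D.lspan_base[OF \<chi>S]) auto
    finally show "act (\<delta> h) (?\<chi> e) \<in> lspan R D (?\<chi> ` E)" .
  qed
  moreover have "f = (\<Oplus>\<^bsub>D\<^esub>e\<in>E. f (\<delta> e) \<odot>\<^bsub>D\<^esub> ?\<chi> e)" if f: "f \<in> X" for f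
  proof (rule D_ext)
    show fD: "f \<in> carrier D" using f X by auto
    have cl: "f (\<delta> e) \<odot>\<^bsub>D\<^esub> ?\<chi> e \<in> carrier D" if "e \<in> E" for e
      using D_closed[OF fD eG[OF that]] \<chi>(1)[OF that] by simp
    then show "(\<Oplus>\<^bsub>D\<^esub>e\<in>E. f (\<delta> e) \<odot>\<^bsub>D\<^esub> ?\<chi> e) \<in> carrier D" by (intro D.finsum_closed Pi_I)
    fix x assume x: "x \<in> carrier G"
    have "(\<Oplus>\<^bsub>D\<^esub>e\<in>E. f (\<delta> e) \<odot>\<^bsub>D\<^esub> ?\<chi> e) (\<delta> x) = (\<Oplus>e\<in>E. (f (\<delta> e) \<odot>\<^bsub>D\<^esub> ?\<chi> e) (\<delta> x))"
      using cl by (intro D_finsum_apply[OF x] Pi_I)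
    also have "\<dots> = (\<Oplus>e\<in>E. c e x \<otimes> f (\<delta> e))"
      using c eG x D_closed[OF fD] by (intro R.finsum_cong' refl Pi_I) (simp_all add: D_apply \<chi> R.m_comm)
    finally show "f (\<delta> x) = (\<Oplus>\<^bsub>D\<^esub>e\<in>E. f (\<delta> e) \<odot>\<^bsub>D\<^esub> ?\<chi> e) (\<delta> x)" using rel[OF f x] by simp
  qed
  ultimately show ?thesis using E by (simp add: reproducing_def)
qed

end

text \<open>The orbits of the members of \<open>X\<close> span a finitely generated module on which
  the group acts by translation. Expand this action in coordinates and evaluate at the identity,
  where the translate of \<open>f\<close> by \<open>g\<close> takes the value of \<open>f\<close> at
  \<open>g\<close>.\<close>

lemma free_abelian_reproducing:
  assumes "cring R" and noeth: "noetherian_ring R" and fin: "finite X"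
    and X: "X \<subseteq> carrier (finite_dual_module R (group_hopf_algebra R (free_abelian_rank n)))"
  shows "\<exists>E \<chi>. group_ring.reproducing R (free_abelian_rank n) X E \<chi>"
proof -
  let ?G = "free_abelian_rank n"
  interpret R: cring R by fact
  interpret G: comm_group ?G by (rule comm_group_free_abelian_rank)
  interpret group_ring R ?G by (intro group_ring.intro R.is_cring G.comm_group_axioms)
  \<comment> \<open>Whole orbits are taken in order that the span be stable under translation;
    finitely many members of each already generate it.\<close>
  define S where "S = (\<Union>f\<in>X. orbit f)"
  have SD: "S \<subseteq> carrier D" using X act_closed Fd_D by (auto simp: S_def)
  let ?N = "lspan R D S"
  note subN = D.lspan_submodule[OF SD]
  have "\<forall>f\<in>X. \<exists>B. finite B \<and> B \<subseteq> orbit f \<and> orbit f \<subseteq> lspan R D B"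
  proof
    fix f assume "f \<in> X"
    then have "f \<in> Fd" using X by auto
    then show "\<exists>B. finite B \<and> B \<subseteq> orbit f \<and> orbit f \<subseteq> lspan R D B"
      by (rule Fd_orbit) blast
  qed
  then obtain B where B: "\<And>f. f \<in> X \<Longrightarrow> finite (B f) \<and> B f \<subseteq> orbit f \<and> orbit f \<subseteq> lspan R D (B f)" by metis
  let ?B = "\<Union>f\<in>X. B f"
  have BS: "?B \<subseteq> S" unfolding S_def using B by (intro UN_mono) auto
  have BN: "?B \<subseteq> ?N" using BS D.lspan_base[OF SD] by blast
  have "S \<subseteq> lspan R D ?B"
  proof
    fix s assume "s \<in> S"
    then obtain f where f: "f \<in> X" "s \<in> orbit f" by (auto simp: S_def)
    then have "s \<in> lspan R D (B f)" using B by blast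
    then show "s \<in> lspan R D ?B" using lspan_mono[of "B f" ?B R D] f(1) by blast
  qed
  then have "?N \<subseteq> lspan R D ?B"
    using BS SD by (intro D.lspan_minimal D.lspan_submodule) auto
  then have fg: "fg_module R (D\<lparr>carrier := ?N\<rparr>)"
    unfolding D.fg_submodule_iff[OF subN] using BN fin B by (intro exI[of _ ?B]) auto
  interpret N: module R "D\<lparr>carrier := ?N\<rparr>" by (rule submodule.submodule_is_module[OF subN D.module_axioms])
  have ND: "f \<in> carrier D" if "f \<in> ?N" for f by (rule D.lspan_closed[OF SD that])
  have stable: "act (\<delta> g) f \<in> ?N" if g: "g \<in> carrier ?G" and f: "f \<in> ?N" for g f
  proof -
    have "act (\<delta> g) s \<in> S" if s: "s \<in> S" for s
    proof -
      obtain f h where f: "f \<in> X" "h \<in> carrier H" "s = act h f" using s by (auto simp: S_def)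
      then have "act (\<delta> g) s \<in> orbit f"
        using act_act[OF \<delta>_closed[OF g] f(2), of f]
          imageI[OF H_mult_closed[OF \<delta>_closed[OF g] f(2)], of "\<lambda>h. act h f"] by simp
      then show ?thesis using f(1) by (auto simp only: S_def)
    qed
    then have "act (\<delta> g) ` S \<subseteq> S" by auto
    then have "lspan R D (act (\<delta> g) ` S) \<subseteq> ?N" by (rule lspan_mono)
    then show ?thesis
      using f D.lspan_linear_image[OF D.module_axioms act_linear[OF \<delta>_closed[OF g]] SD] by blast
  qed
  have actN: "lin_action R ?G (D\<lparr>carrier := ?N\<rparr>) (\<lambda>g. act (\<delta> g))"
    unfolding lin_action_def
  proof (intro conjI ballI)
    show "act (\<delta> g) \<in> linear_maps R (D\<lparr>carrier := ?N\<rparr>) (D\<lparr>carrier := ?N\<rparr>)" if g: "g \<in> carrier ?G" for g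
      using stable[OF g] ND linear_mapsD(2,3)[OF act_linear[OF \<delta>_closed[OF g]]] by (intro linear_mapsI) auto
    fix f assume "f \<in> carrier (D\<lparr>carrier := ?N\<rparr>)"
    then have f: "f \<in> ?N" by simp
    show "act (\<delta> (g \<otimes>\<^bsub>?G\<^esub> h)) f = act (\<delta> g) (act (\<delta> h) f)" if "g \<in> carrier ?G" "h \<in> carrier ?G" for g h
      using that by (simp add: act_act \<delta>_closed \<delta>_mult_\<delta>)
    show "act (\<delta> \<one>\<^bsub>?G\<^esub>) f = f" by (rule act_one[OF ND[OF f]])
  qed
  obtain E c where sc: "shift_coeffs R ?G E c"
    and exp: "\<And>f g. f \<in> carrier (D\<lparr>carrier := ?N\<rparr>) \<Longrightarrow> g \<in> carrier ?G \<Longrightarrow>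
      act (\<delta> g) f = (\<Oplus>\<^bsub>D\<lparr>carrier := ?N\<rparr>\<^esub>e\<in>E. c e g \<odot>\<^bsub>D\<lparr>carrier := ?N\<rparr>\<^esub> act (\<delta> e) f)"
    using N.free_abelian_action_expansion[OF noeth fg actN] by (elim exE conjE) (rule that, assumption, blast)
  have E: "finite E" "\<And>e. e \<in> E \<Longrightarrow> e \<in> carrier ?G"
    and c: "\<And>e g. e \<in> E \<Longrightarrow> g \<in> carrier ?G \<Longrightarrow> c e g \<in> carrier R"
    using sc by (auto simp: shift_coeffs_def)
  have "reproducing X E (\<lambda>e. D_of (c e))"
  proof (rule reproducing_of_action[OF noeth sc])
    show "X \<subseteq> carrier D" using X Fd_D by auto
    fix f g assume f: "f \<in> X" and g: "g \<in> carrier ?G"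
    have fD: "f \<in> carrier D" using f X Fd_D by auto
    have fN: "f \<in> ?N" using orbit_span(2)[OF fD] f by (intro D.lspan_base[OF SD]) (auto simp: S_def)
    let ?one = "\<delta> \<one>\<^bsub>?G\<^esub>"
    \<comment> \<open>Evaluation at the identity is applied to the expansion of the translate by
      \<open>g\<close>; a sum formed in the submodule thereby becomes a sum in
      \<open>R\<close>.\<close>
    have ev: "(\<lambda>f. f ?one) \<in> linear_maps R (D\<lparr>carrier := ?N\<rparr>) (regular_module R)"
      using linear_mapsD[OF eval_linear[OF G.one_closed]] ND by (intro linear_mapsI) auto
    have at_one: "act (\<delta> h) f ?one = f (\<delta> h)" if "h \<in> carrier ?G" for h
      using that by (simp add: act_\<delta>)
    have cl: "c e g \<odot>\<^bsub>D\<lparr>carrier := ?N\<rparr>\<^esub> act (\<delta> e) f \<in> carrier (D\<lparr>carrier := ?N\<rparr>)" if "e \<in> E" for e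
      using c[OF that g] stable[OF E(2)[OF that] fN] N.smult_closed by simp
    have "f (\<delta> g) = act (\<delta> g) f ?one" using at_one[OF g] by simp
    also have "\<dots> = (\<Oplus>\<^bsub>D\<lparr>carrier := ?N\<rparr>\<^esub>e\<in>E. c e g \<odot>\<^bsub>D\<lparr>carrier := ?N\<rparr>\<^esub> act (\<delta> e) f) ?one"
      using exp[OF _ g, of f] fN by simp
    also have "\<dots> = (\<Oplus>\<^bsub>R\<^esub>e\<in>E. (c e g \<odot>\<^bsub>D\<lparr>carrier := ?N\<rparr>\<^esub> act (\<delta> e) f) ?one)"
      using linear_maps_finsum[OF N.module_axioms R.regular_module ev, of "\<lambda>e. c e g \<odot>\<^bsub>D\<lparr>carrier := ?N\<rparr>\<^esub> act (\<delta> e) f" E] cl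
      by (simp add: Pi_iff)
    also have "\<dots> = (\<Oplus>\<^bsub>R\<^esub>e\<in>E. c e g \<otimes>\<^bsub>R\<^esub> f (\<delta> e))"
      using c g E(2) D_closed[OF fD] by (intro R.finsum_cong' refl Pi_I) (simp_all add: D_apply at_one)
    finally show "f (\<delta> g) = (\<Oplus>\<^bsub>R\<^esub>e\<in>E. c e g \<otimes>\<^bsub>R\<^esub> f (\<delta> e))" .
  qed
  then show ?thesis by blast
qed

section \<open>The Hopf structure of the finite dual\<close>

text \<open>Isolates the input to the Hopf structure: a Noetherian base ring and reproducing
  families for finite sets of functionals. For the free abelian groups the latter come from
  \<open>free_abelian_reproducing\<close>.\<close>

locale finite_dual_hopf = group_ring R G for R :: "('a, 'r) ring_scheme" (structure)
    and G :: "('g, 'k) monoid_scheme" +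
  assumes noeth: "noetherian_ring R"
    and rep_ex: "\<And>X. finite X \<Longrightarrow> X \<subseteq> Fd \<Longrightarrow> \<exists>E \<chi>. reproducing X E \<chi>"
begin

abbreviation "C \<equiv> finite_dual R H"

lemma C_fields:
  "carrier C = Fd" "add C = add D" "ring.zero C = ring.zero D" "smult C = smult D"
  by (simp_all add: finite_dual_def module.extend_def hopf.fields_def finite_dual_module_def)

lemma C_ops:
  "f \<otimes>\<^bsub>C\<^esub> g = (\<lambda>h\<in>carrier H. tensor_lift R (\<lambda>a b. f a \<otimes> g b) (comult H h))"
  "\<one>\<^bsub>C\<^esub> = (\<lambda>h\<in>carrier H. counit H h)"
  "comult C f = (THE t. is_dual_comult R H f t)"
  "counit C f = f \<one>\<^bsub>H\<^esub>"
  "antipode C f = (\<lambda>h\<in>carrier H. f (antipode H h))"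
  by (simp_all add: finite_dual_def module.extend_def hopf.fields_def)

lemma C_module: "module R C"
  by (rule module_cong[OF submodule.submodule_is_module[OF Fd_submodule[OF noeth] D.module_axioms]])
    (simp_all add: C_fields)

sublocale C: module R C
  by (rule C_module)

sublocale Rm: module R "regular_module R"
  by (rule R.regular_module)

lemma C_D: "f \<in> carrier C \<Longrightarrow> f \<in> carrier D"
  by (simp add: C_fields Fd_D)

lemma C_ext:
  "f \<in> carrier C \<Longrightarrow> g \<in> carrier C \<Longrightarrow> (\<And>x. x \<in> carrier G \<Longrightarrow> f (\<delta> x) = g (\<delta> x)) \<Longrightarrow> f = g"
  by (rule D_ext[OF C_D C_D])

lemma C_eval: "k \<in> carrier H \<Longrightarrow> (\<lambda>f. f k) \<in> linear_maps R C (regular_module R)"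
  using linear_mapsD[OF H.dual_eval_linear] C_D by (intro linear_mapsI) (simp_all add: C_fields)

lemma C_closed: "f \<in> carrier C \<Longrightarrow> x \<in> carrier G \<Longrightarrow> f (\<delta> x) \<in> carrier R"
  by (rule D_closed[OF C_D])

lemma C_apply:
  "x \<in> carrier G \<Longrightarrow> (f \<oplus>\<^bsub>C\<^esub> g) (\<delta> x) = f (\<delta> x) \<oplus> g (\<delta> x)"
  "x \<in> carrier G \<Longrightarrow> (r \<odot>\<^bsub>C\<^esub> f) (\<delta> x) = r \<otimes> f (\<delta> x)"
  "x \<in> carrier G \<Longrightarrow> \<zero>\<^bsub>C\<^esub> (\<delta> x) = \<zero>"
  by (simp_all add: C_fields D_apply)

section \<open>The convolution algebra\<close>

lemma mult_R_bilinear: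
  assumes "f \<in> linear_maps R M (regular_module R)" and "g \<in> linear_maps R N (regular_module R)"
  shows "(\<lambda>a b. f a \<otimes> g b) \<in> bilinear_maps R M N (regular_module R)"
  using linear_mapsD[OF assms(1)] linear_mapsD[OF assms(2)]
  by (intro bilinear_mapsI linear_mapsI)
    (simp_all add: R.l_distr R.r_distr R.m_assoc R.m_lcomm)

lemma tensor_lift_R_linear:
  assumes "tensor_product R M N" and \<beta>: "\<beta> \<in> bilinear_maps R M N (regular_module R)"
  shows "tensor_lift R \<beta> \<in> linear_maps R (tensor R M N) (regular_module R)"
    and "m \<in> carrier M \<Longrightarrow> n \<in> carrier N \<Longrightarrow> tensor_lift R \<beta> (pure_tensor R M N m n) = \<beta> m n"
  using tensor_product.tensor_lift_linear[OF assms(1) Rm.module_axioms \<beta>]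
    tensor_product.tensor_lift_pure'[OF assms(1) Rm.module_axioms \<beta>] by simp_all

lemma HH_tensor: "tensor_product R H H"
  by unfold_locales

text \<open>The product of \<open>finite_dual\<close>, considered on the whole linear dual, so that
  its bilinearity is available before the finite dual is known to be closed under it.\<close>

definition conv where "conv f g = (\<lambda>h\<in>carrier H. tensor_lift R (\<lambda>a b. f a \<otimes> g b) (comult H h))"

lemma conv:
  assumes f: "f \<in> carrier D" and g: "g \<in> carrier D"
  shows "conv f g \<in> carrier D" and "x \<in> carrier G \<Longrightarrow> conv f g (\<delta> x) = f (\<delta> x) \<otimes> g (\<delta> x)"
proof -
  note \<beta> = mult_R_bilinear[OF H.dual_linear[OF f] H.dual_linear[OF g]]
  note l = tensor_lift_R_linear[OF HH_tensor \<beta>]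
  show "conv f g \<in> carrier D"
    unfolding conv_def by (rule H.dual_memI[OF linear_maps_comp[OF comult_linear l(1)]])
  show "conv f g (\<delta> x) = f (\<delta> x) \<otimes> g (\<delta> x)" if "x \<in> carrier G"
    using that l(2)[OF \<delta>_closed \<delta>_closed] by (simp add: conv_def \<delta>_closed comult_\<delta>)
qed

lemma conv_bilinear: "conv \<in> bilinear_maps R D D D"
proof (intro bilinear_mapsI linear_mapsI)
  fix f g assume f: "f \<in> carrier D" and g: "g \<in> carrier D"
  show "conv f g \<in> carrier D" "conv f g \<in> carrier D" using conv(1)[OF f g] by simp_all
  show "conv f (g \<oplus>\<^bsub>D\<^esub> h) = conv f g \<oplus>\<^bsub>D\<^esub> conv f h" "conv (f \<oplus>\<^bsub>D\<^esub> h) g = conv f g \<oplus>\<^bsub>D\<^esub> conv h g"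
    if h: "h \<in> carrier D" for h
    by (rule D_ext; simp add: f g h conv D_apply D_closed R.r_distr R.l_distr)+
  show "conv f (r \<odot>\<^bsub>D\<^esub> g) = r \<odot>\<^bsub>D\<^esub> conv f g" "conv (r \<odot>\<^bsub>D\<^esub> f) g = r \<odot>\<^bsub>D\<^esub> conv f g"
    if r: "r \<in> carrier R" for r
    by (rule D_ext; simp add: f g r conv D_apply D_closed R.m_assoc R.m_lcomm)+
qed

text \<open>Group elements are group-like, so translation by one of them respects convolution, which
  is the pointwise product of values on the group.\<close>

lemma act_conv:
  assumes f: "f \<in> carrier D" and g: "g \<in> carrier D" and x: "x \<in> carrier G"
  shows "act (\<delta> x) (conv f g) = conv (act (\<delta> x) f) (act (\<delta> x) g)"
proof -
  note cl = act_closed[OF \<delta>_closed[OF x] f] act_closed[OF \<delta>_closed[OF x] g]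
  show ?thesis
    by (rule D_ext[OF act_closed[OF \<delta>_closed[OF x] conv(1)[OF f g]] conv(1)[OF cl]])
      (simp add: f g x cl conv act_\<delta>)
qed

lemma conv_Fd:
  assumes f: "f \<in> Fd" and g: "g \<in> Fd"
  shows "conv f g \<in> Fd"
proof (rule Fd_act_span[OF f], rule Fd_act_span[OF g])
  fix B B' assume B: "finite B" "B \<subseteq> carrier D" "\<And>h. h \<in> carrier H \<Longrightarrow> act h f \<in> lspan R D B"
    and B': "finite B'" "B' \<subseteq> carrier D" "\<And>h. h \<in> carrier H \<Longrightarrow> act h g \<in> lspan R D B'"
  let ?S = "(\<lambda>(b, c). conv b c) ` (B \<times> B')"
  have "?S \<subseteq> carrier D" using conv(1) B(2) B'(2) by auto
  then show ?thesis
  proof (rule Fd_I[OF noeth conv(1)[OF Fd_D[OF f] Fd_D[OF g]], rotated])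
    show "finite ?S" using B B' by simp
    fix x assume x: "x \<in> carrier G"
    show "act (\<delta> x) (conv f g) \<in> lspan R D ?S"
      unfolding act_conv[OF Fd_D[OF f] Fd_D[OF g] x]
      by (rule D.bilinear_lspan[OF D.module_axioms D.module_axioms conv_bilinear B(2) B'(2)
            B(3)[OF \<delta>_closed[OF x]] B'(3)[OF \<delta>_closed[OF x]]])
  qed
qed

lemma C_mult: "f \<otimes>\<^bsub>C\<^esub> g = conv f g"
  by (simp add: C_ops conv_def)

lemma C_mult_closed: "f \<in> carrier C \<Longrightarrow> g \<in> carrier C \<Longrightarrow> f \<otimes>\<^bsub>C\<^esub> g \<in> carrier C"
  by (simp add: C_fields C_mult conv_Fd)

lemma C_mult_apply:
  "f \<in> carrier C \<Longrightarrow> g \<in> carrier C \<Longrightarrow> x \<in> carrier G \<Longrightarrow> (f \<otimes>\<^bsub>C\<^esub> g) (\<delta> x) = f (\<delta> x) \<otimes> g (\<delta> x)"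
  by (simp add: C_mult conv C_D)

lemma C_one_apply: "x \<in> carrier G \<Longrightarrow> \<one>\<^bsub>C\<^esub> (\<delta> x) = \<one>"
  by (simp add: C_ops \<delta>_closed counit_\<delta>)

lemma C_one_closed: "\<one>\<^bsub>C\<^esub> \<in> carrier C"
proof -
  have D: "\<one>\<^bsub>C\<^esub> \<in> carrier D" unfolding C_ops by (rule H.dual_memI[OF counit_linear])
  then have S: "{\<one>\<^bsub>C\<^esub>} \<subseteq> carrier D" by simp
  \<comment> \<open>The counit is invariant under translation, so its orbit is spanned by the counit
    alone.\<close>
  have "act (\<delta> x) \<one>\<^bsub>C\<^esub> = \<one>\<^bsub>C\<^esub>" if "x \<in> carrier G" for x
    by (rule D_ext[OF act_closed[OF \<delta>_closed[OF that] D] D]) (simp add: that act_\<delta> C_one_apply)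
  then show ?thesis
    using D.lspan_base[OF S] by (simp add: C_fields(1)) (rule Fd_I[OF noeth D _ S], simp_all)
qed

lemma C_algebra: "assoc_algebra R C"
proof -
  note cl = C_mult_closed C_one_closed C_mult_apply C_one_apply C_apply C_closed
  have "ring C"
  proof (rule ringI[OF C.M.abelian_group_axioms monoidI])
    fix f g h assume [simp]: "f \<in> carrier C" "g \<in> carrier C" "h \<in> carrier C"
    show "f \<otimes>\<^bsub>C\<^esub> g \<otimes>\<^bsub>C\<^esub> h = f \<otimes>\<^bsub>C\<^esub> (g \<otimes>\<^bsub>C\<^esub> h)" by (rule C_ext) (simp_all add: cl R.m_assoc)
    show "(f \<oplus>\<^bsub>C\<^esub> g) \<otimes>\<^bsub>C\<^esub> h = f \<otimes>\<^bsub>C\<^esub> h \<oplus>\<^bsub>C\<^esub> g \<otimes>\<^bsub>C\<^esub> h"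
      by (rule C_ext) (simp_all add: cl R.l_distr)
    show "h \<otimes>\<^bsub>C\<^esub> (f \<oplus>\<^bsub>C\<^esub> g) = h \<otimes>\<^bsub>C\<^esub> f \<oplus>\<^bsub>C\<^esub> h \<otimes>\<^bsub>C\<^esub> g"
      by (rule C_ext) (simp_all add: cl R.r_distr)
    show "\<one>\<^bsub>C\<^esub> \<otimes>\<^bsub>C\<^esub> f = f" by (rule C_ext) (simp_all add: cl)
    show "f \<otimes>\<^bsub>C\<^esub> \<one>\<^bsub>C\<^esub> = f" by (rule C_ext) (simp_all add: cl)
    show "f \<otimes>\<^bsub>C\<^esub> g \<in> carrier C" by (simp add: cl)
  qed (rule C_one_closed)
  then show ?thesis
  proof (intro assoc_algebra.intro C_module assoc_algebra_axioms.intro)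
    fix r f g assume [simp]: "r \<in> carrier R" "f \<in> carrier C" "g \<in> carrier C"
    show "(r \<odot>\<^bsub>C\<^esub> f) \<otimes>\<^bsub>C\<^esub> g = r \<odot>\<^bsub>C\<^esub> (f \<otimes>\<^bsub>C\<^esub> g)" by (rule C_ext) (simp_all add: cl R.m_assoc)
    show "f \<otimes>\<^bsub>C\<^esub> (r \<odot>\<^bsub>C\<^esub> g) = r \<odot>\<^bsub>C\<^esub> (f \<otimes>\<^bsub>C\<^esub> g)" by (rule C_ext) (simp_all add: cl R.m_lcomm)
  qed
qed

sublocale C: assoc_algebra R C
  by (rule C_algebra)

sublocale CC: tensor_algebra R C C
  by (intro tensor_algebra.intro C_algebra)

section \<open>Evaluations that separate tensors over the finite dual\<close>

abbreviation "TC \<equiv> tensor R C C"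

text \<open>Evaluation of the first tensor factor at the group element \<open>x\<close>, with values
  in the second factor.\<close>

definition slice where "slice N x = tensor_lift N (\<lambda>f n. f (\<delta> x) \<odot>\<^bsub>N\<^esub> n)"

lemma slice_bilinear:
  assumes "module R N" and x: "x \<in> carrier G"
  shows "(\<lambda>f n. f (\<delta> x) \<odot>\<^bsub>N\<^esub> n) \<in> bilinear_maps R C N N"
proof -
  interpret N: module R N by fact
  show ?thesis
    using bilinear_maps_precomp[OF N.bilinear_smult C_eval[OF \<delta>_closed[OF x]] linear_maps_id] .
qed

lemma slice:
  assumes N: "module R N" and x: "x \<in> carrier G"
  shows "slice N x \<in> linear_maps R (tensor R C N) N"
    and "f \<in> carrier C \<Longrightarrow> n \<in> carrier N \<Longrightarrow> slice N x (pure_tensor R C N f n) = f (\<delta> x) \<odot>\<^bsub>N\<^esub> n"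
proof -
  interpret CN: tensor_product R C N by (intro tensor_product.intro C_module N)
  show "slice N x \<in> linear_maps R (tensor R C N) N"
    unfolding slice_def by (rule CN.tensor_lift_linear[OF N slice_bilinear[OF N x]])
  show "slice N x (pure_tensor R C N f n) = f (\<delta> x) \<odot>\<^bsub>N\<^esub> n" if "f \<in> carrier C" "n \<in> carrier N"
    unfolding slice_def by (rule CN.tensor_lift_pure'[OF N slice_bilinear[OF N x] that])
qed

text \<open>For a pure tensor, replace \<open>f\<close> by its reproducing expansion and move the
  scalar \<open>f (\<delta> e)\<close> to the other factor. The set \<open>X\<close> collects the
  functionals that occur in \<open>t\<close>, and the formula is claimed for every family that
  reproduces \<open>X\<close>: this lets the induction join two summands, and later lets two tensors
  be compared through one family.\<close>

lemma tensor_slice_expansion: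
  assumes N: "module R N" and t: "t \<in> carrier (tensor R C N)"
  shows "\<exists>X. finite X \<and> X \<subseteq> Fd \<and> (\<forall>E \<chi>. reproducing X E \<chi> \<longrightarrow>
    t = (\<Oplus>\<^bsub>tensor R C N\<^esub>e\<in>E. pure_tensor R C N (\<chi> e) (slice N e t)))"
proof -
  interpret CN: tensor_product R C N by (intro tensor_product.intro C_module N)
  have E: "finite E" "\<And>e. e \<in> E \<Longrightarrow> e \<in> carrier G" "\<And>e. e \<in> E \<Longrightarrow> \<chi> e \<in> carrier C"
    if "reproducing X E \<chi>" for X E \<chi>
    using that by (auto simp: reproducing_def C_fields)
  have lin: "(\<lambda>t. \<Oplus>\<^bsub>CN.T\<^esub>e\<in>E. CN.pure (\<chi> e) (slice N e t)) \<in> linear_maps R CN.T CN.T"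
    if "reproducing X E \<chi>" for X E \<chi>
    using E[OF that]
    by (intro CN.T.linear_maps_sum linear_maps_comp[OF slice(1)[OF N] bilinear_mapsD(1)[OF CN.pure_bilinear]])
  show ?thesis
    using t
  proof (induction rule: CN.tensor_induct)
    case zero
    have "\<zero>\<^bsub>CN.T\<^esub> = (\<Oplus>\<^bsub>CN.T\<^esub>e\<in>E. CN.pure (\<chi> e) (slice N e \<zero>\<^bsub>CN.T\<^esub>))" if "reproducing {} E \<chi>" for E \<chi>
      using linear_maps_zero[OF CN.tensor_module CN.tensor_module lin[OF that]] by simp
    then show ?case by (intro exI[of _ "{}"]) simp
  next
    case (pure f n)
    have "CN.pure f n = (\<Oplus>\<^bsub>CN.T\<^esub>e\<in>E. CN.pure (\<chi> e) (slice N e (CN.pure f n)))"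
      if rep: "reproducing {f} E \<chi>" for E \<chi>
    proof -
      \<comment> \<open>The reproducing formula is a sum in the linear dual; the inclusion of the
        finite dual is linear and carries sums over.\<close>
      have "f = (\<Oplus>\<^bsub>C\<^esub>e\<in>E. f (\<delta> e) \<odot>\<^bsub>C\<^esub> \<chi> e)"
      proof -
        have feq: "f = (\<Oplus>\<^bsub>D\<^esub>e\<in>E. f (\<delta> e) \<odot>\<^bsub>D\<^esub> \<chi> e)" using rep by (simp add: reproducing_def)
        have "(\<lambda>g. g) \<in> linear_maps R C D"
          by (rule linear_mapsI) (simp_all add: C_fields Fd_D)
        from linear_maps_finsum[OF C_module D.module_axioms this, of "\<lambda>e. f (\<delta> e) \<odot>\<^bsub>C\<^esub> \<chi> e" E]
        moreover have "(\<lambda>e. f (\<delta> e) \<odot>\<^bsub>C\<^esub> \<chi> e) \<in> E \<rightarrow> carrier C"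
          by (intro Pi_I C.smult_closed C_closed[OF pure(1)] E(2,3)[OF rep])
        ultimately have "(\<Oplus>\<^bsub>C\<^esub>e\<in>E. f (\<delta> e) \<odot>\<^bsub>C\<^esub> \<chi> e) = (\<Oplus>\<^bsub>D\<^esub>e\<in>E. f (\<delta> e) \<odot>\<^bsub>C\<^esub> \<chi> e)"
          by blast
        then show ?thesis using feq by (simp add: C_fields(4))
      qed
      then have "CN.pure f n = CN.pure (\<Oplus>\<^bsub>C\<^esub>e\<in>E. f (\<delta> e) \<odot>\<^bsub>C\<^esub> \<chi> e) n" by simp
      also have "\<dots> = (\<Oplus>\<^bsub>CN.T\<^esub>e\<in>E. CN.pure (f (\<delta> e) \<odot>\<^bsub>C\<^esub> \<chi> e) n)"
        by (intro linear_maps_finsum[OF C_module CN.tensor_module bilinear_mapsD(2)[OF CN.pure_bilinear pure(2)]]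
            Pi_I C.smult_closed C_closed[OF pure(1)] E(2,3)[OF rep])
      also have "\<dots> = (\<Oplus>\<^bsub>CN.T\<^esub>e\<in>E. CN.pure (\<chi> e) (slice N e (CN.pure f n)))"
        using C_closed[OF pure(1)] E[OF rep] pure
        by (intro CN.T.finsum_cong' refl Pi_I) (simp_all add: slice[OF N] CN.pure_balanced CN.pure_closed)
      finally show ?thesis .
    qed
    then show ?case using pure(1) by (intro exI[of _ "{f}"]) (simp add: C_fields)
  next
    case (add s t)
    then obtain X where X: "finite X" "X \<subseteq> Fd"
      "\<And>E \<chi>. reproducing X E \<chi> \<Longrightarrow> s = (\<Oplus>\<^bsub>CN.T\<^esub>e\<in>E. CN.pure (\<chi> e) (slice N e s))" by blast
    from add obtain Y where Y: "finite Y" "Y \<subseteq> Fd"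
      "\<And>E \<chi>. reproducing Y E \<chi> \<Longrightarrow> t = (\<Oplus>\<^bsub>CN.T\<^esub>e\<in>E. CN.pure (\<chi> e) (slice N e t))" by blast
    have "s \<oplus>\<^bsub>CN.T\<^esub> t = (\<Oplus>\<^bsub>CN.T\<^esub>e\<in>E. CN.pure (\<chi> e) (slice N e (s \<oplus>\<^bsub>CN.T\<^esub> t)))"
      if rep: "reproducing (X \<union> Y) E \<chi>" for E \<chi>
      using linear_mapsD(2)[OF lin[OF rep] add(1,2)]
        X(3)[OF reproducing_mono[OF Un_upper1 rep]] Y(3)[OF reproducing_mono[OF Un_upper2 rep]] by simp
    then show ?case using X Y by (intro exI[of _ "X \<union> Y"]) simp
  qed
qed

text \<open>A family that reproduces the functionals of both tensors at once expands both, with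
  coefficients in \<open>N\<close> given by the slices. This is the embedding of the tensor product
  into functions on the group with values in \<open>N\<close>.\<close>

lemma slice_eqI:
  assumes N: "module R N" and s: "s \<in> carrier (tensor R C N)" and t: "t \<in> carrier (tensor R C N)"
    and eq: "\<And>x. x \<in> carrier G \<Longrightarrow> slice N x s = slice N x t"
  shows "s = t"
proof -
  obtain X where X: "finite X" "X \<subseteq> Fd" "\<And>E \<chi>. reproducing X E \<chi> \<Longrightarrow>
      s = (\<Oplus>\<^bsub>tensor R C N\<^esub>e\<in>E. pure_tensor R C N (\<chi> e) (slice N e s))"
    using tensor_slice_expansion[OF N s] by blast
  obtain Y where Y: "finite Y" "Y \<subseteq> Fd" "\<And>E \<chi>. reproducing Y E \<chi> \<Longrightarrow>
      t = (\<Oplus>\<^bsub>tensor R C N\<^esub>e\<in>E. pure_tensor R C N (\<chi> e) (slice N e t))"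
    using tensor_slice_expansion[OF N t] by blast
  obtain E \<chi> where rep: "reproducing (X \<union> Y) E \<chi>"
    using rep_ex[of "X \<union> Y"] X Y by auto
  interpret CN: tensor_product R C N by (intro tensor_product.intro C_module N)
  interpret N: module R N by fact
  have "s = (\<Oplus>\<^bsub>CN.T\<^esub>e\<in>E. CN.pure (\<chi> e) (slice N e s))" by (rule X(3)[OF reproducing_mono[OF Un_upper1 rep]])
  also have "\<dots> = (\<Oplus>\<^bsub>CN.T\<^esub>e\<in>E. CN.pure (\<chi> e) (slice N e t))"
    using rep linear_mapsD(1)[OF slice(1)[OF N] t] eq
    by (intro CN.T.finsum_cong' refl Pi_I CN.pure_closed) (auto simp: reproducing_def C_fields)
  also have "\<dots> = t" by (rule Y(3)[OF reproducing_mono[OF Un_upper2 rep], symmetric])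
  finally show ?thesis .
qed

definition ev where "ev h k = tensor_lift R (\<lambda>f g. f h \<otimes> g k)"

lemma ev:
  assumes "h \<in> carrier H" and "k \<in> carrier H"
  shows "ev h k \<in> linear_maps R TC (regular_module R)"
    and "f \<in> carrier C \<Longrightarrow> g \<in> carrier C \<Longrightarrow> ev h k (CC.pure f g) = f h \<otimes> g k"
  unfolding ev_def
  by (rule tensor_lift_R_linear[OF CC.tensor_product_axioms mult_R_bilinear[OF C_eval[OF assms(1)] C_eval[OF assms(2)]]])
    (rule tensor_lift_R_linear(2)[OF CC.tensor_product_axioms mult_R_bilinear[OF C_eval[OF assms(1)] C_eval[OF assms(2)]]])

lemma ev_slice:
  assumes x: "x \<in> carrier G" and y: "y \<in> carrier G" and t: "t \<in> carrier TC"
  shows "ev (\<delta> x) (\<delta> y) t = slice C x t (\<delta> y)"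
  by (rule CC.tensor_linear_eq[OF Rm.module_axioms ev(1)[OF \<delta>_closed[OF x] \<delta>_closed[OF y]]
        linear_maps_comp[OF slice(1)[OF C_module x] C_eval[OF \<delta>_closed[OF y]]] _ t])
    (simp add: ev(2) \<delta>_closed x y slice(2)[OF C_module] C_apply)

text \<open>A slice of such a tensor is again a functional, determined by its values, so values at
  pairs of group elements separate the tensor square.\<close>

lemma ev_eqI:
  assumes s: "s \<in> carrier TC" and t: "t \<in> carrier TC"
    and eq: "\<And>x y. x \<in> carrier G \<Longrightarrow> y \<in> carrier G \<Longrightarrow> ev (\<delta> x) (\<delta> y) s = ev (\<delta> x) (\<delta> y) t"
  shows "s = t"
  using linear_mapsD(1)[OF slice(1)[OF C_module]] s t eq
  by (intro slice_eqI[OF C_module s t] C_ext) (simp_all add: ev_slice[symmetric])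

lemma finite_dual_module_fields:
  "carrier (finite_dual_module R H) = carrier C" "add (finite_dual_module R H) = add C"
  "smult (finite_dual_module R H) = smult C"
  by (simp_all add: C_fields) (simp_all add: finite_dual_module_def)

lemma is_dual_comult_iff:
  "is_dual_comult R H f t \<longleftrightarrow> t \<in> carrier TC \<and>
    (\<forall>h\<in>carrier H. \<forall>k\<in>carrier H. f (h \<otimes>\<^bsub>H\<^esub> k) = ev h k t)"
  using tensor_cong_fields(1)[OF finite_dual_module_fields finite_dual_module_fields, of R]
  by (simp add: is_dual_comult_def ev_def)

section \<open>The comultiplication of the finite dual\<close>

lemma act_C: 
  assumes f: "f \<in> carrier C" and g: "g \<in> carrier G"
  shows "act (\<delta> g) f \<in> carrier C"
proof -
  have fF: "f \<in> Fd" using f by (simp add: C_fields)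
  show ?thesis
  proof (rule Fd_act_span[OF fF])
    fix B assume B: "finite B" "B \<subseteq> carrier D" "\<And>h. h \<in> carrier H \<Longrightarrow> act h f \<in> lspan R D B"
    have "act (\<delta> g) f \<in> Fd"
      using B(3) H_mult_closed \<delta>_closed g
      by (intro Fd_I[OF noeth act_closed[OF \<delta>_closed[OF g] C_D[OF f]] B(1,2)]) (simp add: act_act)
    then show ?thesis by (simp add: C_fields)
  qed
qed

lemma dual_comult_ex:
  assumes f: "f \<in> carrier C"
  shows "\<exists>t. is_dual_comult R H f t"
proof -
  have fF: "f \<in> Fd" using f by (simp add: C_fields)
  obtain B where B: "finite B" "B \<subseteq> orbit f" "orbit f \<subseteq> lspan R D B" using Fd_orbit[OF fF] .
  have orbF: "orbit f \<subseteq> Fd"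
  proof -
    have "h \<in> {h \<in> carrier H. act h f \<in> Fd}" if h: "h \<in> carrier H" for h
      using act_C[OF f] \<delta>_closed
      by (intro H_submodule_eq[OF H.submodule_vimage[OF D.module_axioms Fd_submodule[OF noeth] act_linear_left[OF C_D[OF f]]] _ h])
        (simp add: C_fields)
    then show ?thesis by auto
  qed
  obtain E \<chi> where rep: "reproducing B E \<chi>" using rep_ex[OF B(1)] B(2) orbF by blast
  have BD: "B \<subseteq> carrier D" using B(2) orbF Fd_D by blast
  have rep': "reproducing (orbit f) E \<chi>"
    by (rule reproducing_mono[OF B(3) reproducing_lspan[OF BD rep]])
  have E: "finite E" "\<And>e. e \<in> E \<Longrightarrow> e \<in> carrier G" "\<And>e. e \<in> E \<Longrightarrow> \<chi> e \<in> carrier C"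
    and eq: "\<And>k. k \<in> carrier H \<Longrightarrow> act k f = (\<Oplus>\<^bsub>D\<^esub>e\<in>E. act k f (\<delta> e) \<odot>\<^bsub>D\<^esub> \<chi> e)"
    using rep' by (auto simp: reproducing_def C_fields)
  let ?t = "\<Oplus>\<^bsub>TC\<^esub>e\<in>E. CC.pure (\<chi> e) (act (\<delta> e) f)"
  have p: "CC.pure (\<chi> e) (act (\<delta> e) f) \<in> carrier TC" if "e \<in> E" for e
    using that E act_C[OF f] by (intro CC.pure_closed) auto
  have "f (h \<otimes>\<^bsub>H\<^esub> k) = ev h k ?t" if h: "h \<in> carrier H" and k: "k \<in> carrier H" for h k
  proof -
    \<comment> \<open>Commutativity of \<open>H\<close> exchanges the roles of \<open>k\<close> and
      \<open>e\<close>, so the coefficient becomes a translate of \<open>f\<close> evaluated at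
      \<open>k\<close>.\<close>
    have \<delta>k: "act k f (\<delta> e) = act (\<delta> e) f k" if "e \<in> E" for e
      using that E(2) k H_mult_comm[OF \<delta>_closed k] by (simp add: dual_action_def \<delta>_closed)
    have cl: "act k f (\<delta> e) \<odot>\<^bsub>D\<^esub> \<chi> e \<in> carrier D" if "e \<in> E" for e
      using that E D_closed[OF act_closed[OF k C_D[OF f]]] C_D by simp
    have "f (h \<otimes>\<^bsub>H\<^esub> k) = act k f h" using h by (simp add: dual_action_def)
    also have "\<dots> = (\<Oplus>\<^bsub>D\<^esub>e\<in>E. act k f (\<delta> e) \<odot>\<^bsub>D\<^esub> \<chi> e) h" using eq[OF k] by simp
    also have "\<dots> = (\<Oplus>e\<in>E. (act k f (\<delta> e) \<odot>\<^bsub>D\<^esub> \<chi> e) h)"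
      using linear_maps_finsum[OF D.module_axioms Rm.module_axioms H.dual_eval_linear[OF h],
          of "\<lambda>e. act k f (\<delta> e) \<odot>\<^bsub>D\<^esub> \<chi> e" E] cl by (simp add: Pi_iff)
    also have "\<dots> = (\<Oplus>e\<in>E. ev h k (CC.pure (\<chi> e) (act (\<delta> e) f)))"
      using E act_C[OF f] h k H.dual_apply_closed[OF C_D]
      by (intro R.finsum_cong' refl Pi_I)
        (simp_all add: ev(2) \<delta>k H.dual_module_fields(4) R.m_comm)
    also have "\<dots> = ev h k ?t"
      using linear_maps_finsum[OF CC.tensor_module Rm.module_axioms ev(1)[OF h k],
          of "\<lambda>e. CC.pure (\<chi> e) (act (\<delta> e) f)" E] p by (simp add: Pi_iff)
    finally show ?thesis .
  qed
  moreover have "?t \<in> carrier TC" using p by (intro CC.T.finsum_closed Pi_I)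
  ultimately show ?thesis unfolding is_dual_comult_iff by blast
qed

text \<open>Both tensors take the same values at pairs of group elements, and such values
  separate.\<close>

lemma dual_comult_unique:
  assumes "is_dual_comult R H f s" and "is_dual_comult R H f t"
  shows "s = t"
  using assms unfolding is_dual_comult_iff by (intro ev_eqI) (metis \<delta>_closed)+

lemma dual_comult_ex1: "f \<in> carrier C \<Longrightarrow> \<exists>!t. is_dual_comult R H f t"
  using dual_comult_ex dual_comult_unique by blast

lemma comult_C:
  assumes f: "f \<in> carrier C"
  shows "comult C f \<in> carrier TC"
    and "x \<in> carrier G \<Longrightarrow> y \<in> carrier G \<Longrightarrow> ev (\<delta> x) (\<delta> y) (comult C f) = f (\<delta> (x \<otimes>\<^bsub>G\<^esub> y))"
proof -
  have "is_dual_comult R H f (comult C f)"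
    unfolding C_ops(3) by (rule theI'[OF dual_comult_ex1[OF f]])
  then show "comult C f \<in> carrier TC"
    "x \<in> carrier G \<Longrightarrow> y \<in> carrier G \<Longrightarrow> ev (\<delta> x) (\<delta> y) (comult C f) = f (\<delta> (x \<otimes>\<^bsub>G\<^esub> y))"
    unfolding is_dual_comult_iff by (simp_all add: \<delta>_closed \<delta>_mult_\<delta>[symmetric])
qed

lemmas ev_lin = ev(1)[OF \<delta>_closed \<delta>_closed]
lemmas ev_pure = ev(2)[OF \<delta>_closed \<delta>_closed]

lemma comult_C_linear: "comult C \<in> linear_maps R C TC"
proof (rule linear_mapsI)
  note ce = comult_C
  fix f assume f: "f \<in> carrier C"
  show "comult C f \<in> carrier TC" by (rule ce(1)[OF f])
  show "comult C (f \<oplus>\<^bsub>C\<^esub> g) = comult C f \<oplus>\<^bsub>TC\<^esub> comult C g" if g: "g \<in> carrier C" for g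
    by (rule ev_eqI) (simp_all add: f g ce linear_mapsD(2)[OF ev_lin] C_apply)
  show "comult C (r \<odot>\<^bsub>C\<^esub> f) = r \<odot>\<^bsub>TC\<^esub> comult C f" if r: "r \<in> carrier R" for r
    by (rule ev_eqI) (simp_all add: f r ce linear_mapsD(3)[OF ev_lin] C_apply)
qed

section \<open>The coalgebra laws\<close>

lemma counit_C_linear: "counit C \<in> linear_maps R C (regular_module R)"
  by (rule linear_maps_cong[OF C_module C_eval[OF H.one_closed]]) (simp add: C_ops)

lemma counit_C: "counit C f = f (\<delta> \<one>\<^bsub>G\<^esub>)"
  by (simp add: C_ops H_one)

text \<open>Reduces each axiom with one comultiplication to an evaluation at one pair. The counit
  axioms use the pairs of the identity and \<open>g\<close> in both orders, the antipode axioms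
  those of \<open>g\<close> and its inverse.\<close>

lemma lift_C_apply:
  assumes \<beta>: "\<beta> \<in> bilinear_maps R C C C" and g: "g \<in> carrier G" and x: "x \<in> carrier G" and y: "y \<in> carrier G"
    and eq: "\<And>a b. a \<in> carrier C \<Longrightarrow> b \<in> carrier C \<Longrightarrow> \<beta> a b (\<delta> g) = a (\<delta> x) \<otimes> b (\<delta> y)"
    and t: "t \<in> carrier TC"
  shows "tensor_lift C \<beta> t (\<delta> g) = ev (\<delta> x) (\<delta> y) t"
  by (rule CC.tensor_linear_eq[OF Rm.module_axioms
        linear_maps_comp[OF CC.tensor_lift_linear[OF C_module \<beta>] C_eval[OF \<delta>_closed[OF g]]] ev_lin[OF x y] _ t])
    (simp add: CC.tensor_lift_pure'[OF C_module \<beta>] ev_pure x y eq)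

sublocale C_CC: tensor_product R C TC
  by (intro tensor_product.intro C_module CC.tensor_module)

sublocale CC_C: tensor_product R TC C
  by (intro tensor_product.intro C_module CC.tensor_module)

abbreviation "T3 \<equiv> tensor R C TC"

text \<open>Values at triples of group elements separate the triple tensor product: slice in the
  first factor, then evaluate the remaining two.\<close>

lemma ev3_eqI:
  assumes s: "s \<in> carrier T3" and t: "t \<in> carrier T3"
    and eq: "\<And>x y z. x \<in> carrier G \<Longrightarrow> y \<in> carrier G \<Longrightarrow> z \<in> carrier G \<Longrightarrow>
      ev (\<delta> y) (\<delta> z) (slice TC x s) = ev (\<delta> y) (\<delta> z) (slice TC x t)"
  shows "s = t"
  using linear_mapsD(1)[OF slice(1)[OF CC.tensor_module]] s t
  by (intro slice_eqI[OF CC.tensor_module s t] ev_eqI) (simp_all add: eq)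

lemma assoc_inner_bilinear:
  assumes n: "n \<in> carrier C"
  shows "(\<lambda>l m. C_CC.pure l (CC.pure m n)) \<in> bilinear_maps R C C T3"
  by (rule bilinear_maps_precomp[OF C_CC.pure_bilinear linear_maps_id bilinear_mapsD(2)[OF CC.pure_bilinear n]])

text \<open>The inner lift of \<open>tensor_assoc\<close>, with the last factor held fixed; the
  outer lift needs it to be bilinear.\<close>

definition reassoc where
  "reassoc t n = tensor_lift T3 (\<lambda>l m. C_CC.pure l (CC.pure m n)) t"

lemma reassoc_pure:
  "l \<in> carrier C \<Longrightarrow> m \<in> carrier C \<Longrightarrow> n \<in> carrier C \<Longrightarrow> reassoc (CC.pure l m) n = C_CC.pure l (CC.pure m n)"
  unfolding reassoc_def
  by (rule CC.tensor_lift_pure'[OF C_CC.tensor_module assoc_inner_bilinear])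

lemma reassoc_linear: "n \<in> carrier C \<Longrightarrow> (\<lambda>t. reassoc t n) \<in> linear_maps R TC T3"
  unfolding reassoc_def
  by (rule CC.tensor_lift_linear[OF C_CC.tensor_module assoc_inner_bilinear])

lemma reassoc_bilinear: "reassoc \<in> bilinear_maps R TC C T3"
proof (intro bilinear_mapsI reassoc_linear linear_mapsI)
  fix t n assume t: "t \<in> carrier TC" and n: "n \<in> carrier C"
  note eq = CC.tensor_linear_eq[OF C_CC.tensor_module reassoc_linear _ _ t]
  show "reassoc t n \<in> carrier T3" by (rule linear_mapsD(1)[OF reassoc_linear[OF n] t])
  show "reassoc t (n \<oplus>\<^bsub>C\<^esub> n') = reassoc t n \<oplus>\<^bsub>T3\<^esub> reassoc t n'" if n': "n' \<in> carrier C" for n'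
    by (rule eq[OF _ C_CC.T.linear_maps_add[OF reassoc_linear[OF n] reassoc_linear[OF n']]])
      (simp_all add: n n' reassoc_pure CC.pure_add_right C_CC.pure_add_right CC.pure_closed)
  show "reassoc t (r \<odot>\<^bsub>C\<^esub> n) = r \<odot>\<^bsub>T3\<^esub> reassoc t n" if r: "r \<in> carrier R" for r
    by (rule eq[OF _ C_CC.T.linear_maps_smult[OF reassoc_linear[OF n] r]])
      (simp_all add: n r reassoc_pure CC.pure_balanced[symmetric] C_CC.pure_balanced CC.tensor_smult_pure[symmetric]
        C_CC.tensor_smult_pure CC.pure_closed)
qed

lemma ev_reassoc:
  assumes x: "x \<in> carrier G" and y: "y \<in> carrier G" and z: "z \<in> carrier G"
    and t: "t \<in> carrier TC" and n: "n \<in> carrier C"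
  shows "ev (\<delta> y) (\<delta> z) (slice TC x (reassoc t n)) = ev (\<delta> x) (\<delta> y) t \<otimes> n (\<delta> z)"
proof (rule CC.tensor_linear_eq[OF Rm.module_axioms _ _ _ t])
  show "(\<lambda>t. ev (\<delta> y) (\<delta> z) (slice TC x (reassoc t n))) \<in> linear_maps R TC (regular_module R)"
    by (rule linear_maps_comp[OF reassoc_linear[OF n]
          linear_maps_comp[OF slice(1)[OF CC.tensor_module x] ev_lin[OF y z]]])
  show "(\<lambda>t. ev (\<delta> x) (\<delta> y) t \<otimes> n (\<delta> z)) \<in> linear_maps R TC (regular_module R)"
    using linear_mapsD[OF ev_lin[OF x y]] C_closed[OF n z]
    by (intro linear_mapsI) (simp_all add: R.l_distr R.m_assoc)
  fix l m assume l: "l \<in> carrier C" and m: "m \<in> carrier C"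
  show "ev (\<delta> y) (\<delta> z) (slice TC x (reassoc (CC.pure l m) n)) = ev (\<delta> x) (\<delta> y) (CC.pure l m) \<otimes> n (\<delta> z)"
    using x y z l m n C_closed
    by (simp add: reassoc_pure slice(2)[OF CC.tensor_module] CC.pure_closed linear_mapsD(3)[OF ev_lin] ev_pure R.m_assoc)
qed

text \<open>Evaluated at a triple of group elements, the two sides are the values of
  \<open>f\<close> at the two bracketings of the triple product. Each side is first reduced to a
  value of \<open>comult C f\<close>, by comparing linear maps on pure tensors.\<close>

lemma coassoc_C:
  assumes f: "f \<in> carrier C"
  shows "tensor_assoc R C C C (tensor_map R TC C (comult C) id (comult C f)) =
    tensor_map R C TC id (comult C) (comult C f)"
proof -
  note t = comult_C(1)[OF f]
  have id: "id \<in> linear_maps R C C" using linear_maps_id by (simp add: id_def)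
  note b1 = bilinear_maps_precomp[OF CC_C.pure_bilinear comult_C_linear id]
  note b2 = bilinear_maps_precomp[OF C_CC.pure_bilinear id comult_C_linear]
  let ?m1 = "tensor_map R TC C (comult C) id" and ?m2 = "tensor_map R C TC id (comult C)"
  let ?as = "tensor_assoc R C C C"
  have m1: "?m1 \<in> linear_maps R TC (tensor R TC C)"
    "\<And>a b. a \<in> carrier C \<Longrightarrow> b \<in> carrier C \<Longrightarrow> ?m1 (CC.pure a b) = CC_C.pure (comult C a) b"
    using CC.tensor_lift_linear[OF CC_C.tensor_module b1] CC.tensor_lift_pure'[OF CC_C.tensor_module b1]
    by (simp_all add: tensor_map_def)
  have m2: "?m2 \<in> linear_maps R TC T3"
    "\<And>a b. a \<in> carrier C \<Longrightarrow> b \<in> carrier C \<Longrightarrow> ?m2 (CC.pure a b) = C_CC.pure a (comult C b)"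
    using CC.tensor_lift_linear[OF C_CC.tensor_module b2] CC.tensor_lift_pure'[OF C_CC.tensor_module b2]
    by (simp_all add: tensor_map_def)
  have as_eq: "?as = tensor_lift T3 reassoc"
    by (simp add: tensor_assoc_def reassoc_def[abs_def])
  have as: "?as \<in> linear_maps R (tensor R TC C) T3"
    "\<And>t n. t \<in> carrier TC \<Longrightarrow> n \<in> carrier C \<Longrightarrow> ?as (CC_C.pure t n) = reassoc t n"
    unfolding as_eq
    using CC_C.tensor_lift_linear[OF C_CC.tensor_module reassoc_bilinear]
      CC_C.tensor_lift_pure'[OF C_CC.tensor_module reassoc_bilinear] by simp_all
  note am = linear_maps_comp[OF m1(1) as(1)]
  show ?thesis
  proof (rule ev3_eqI)
    show "?as (?m1 (comult C f)) \<in> carrier T3" by (rule linear_mapsD(1)[OF am t])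
    show "?m2 (comult C f) \<in> carrier T3" by (rule linear_mapsD(1)[OF m2(1) t])
    fix x y z assume x: "x \<in> carrier G" and y: "y \<in> carrier G" and z: "z \<in> carrier G"
    note sl = linear_maps_comp[OF slice(1)[OF CC.tensor_module x] ev_lin[OF y z]]
    have xy: "x \<otimes>\<^bsub>G\<^esub> y \<in> carrier G" and yz: "y \<otimes>\<^bsub>G\<^esub> z \<in> carrier G" using x y z by auto
    have "ev (\<delta> y) (\<delta> z) (slice TC x (?as (?m1 (comult C f)))) = ev (\<delta> (x \<otimes>\<^bsub>G\<^esub> y)) (\<delta> z) (comult C f)"
      by (rule CC.tensor_linear_eq[OF Rm.module_axioms linear_maps_comp[OF am sl] ev_lin[OF xy z] _ t])
        (simp add: m1 as comult_C ev_reassoc x y z ev_pure)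
    also have "\<dots> = ev (\<delta> x) (\<delta> (y \<otimes>\<^bsub>G\<^esub> z)) (comult C f)"
      using comult_C(2)[OF f] x y z by (simp add: G.m_assoc)
    also have "\<dots> = ev (\<delta> y) (\<delta> z) (slice TC x (?m2 (comult C f)))"
      by (rule CC.tensor_linear_eq[OF Rm.module_axioms ev_lin[OF x yz] linear_maps_comp[OF m2(1) sl] _ t])
        (simp add: m2 comult_C slice(2)[OF CC.tensor_module] linear_mapsD(3)[OF ev_lin] x y z ev_pure C_closed)
    finally show "ev (\<delta> y) (\<delta> z) (slice TC x (?as (?m1 (comult C f)))) = ev (\<delta> y) (\<delta> z) (slice TC x (?m2 (comult C f)))" .
  qed
qed

lemma C_coalgebra: "coalgebra R C"
proof (intro coalgebra.intro C_module coalgebra_axioms.intro comult_C_linear counit_C_linear coassoc_C)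
  fix f assume f: "f \<in> carrier C"
  note t = comult_C(1)[OF f]
  have b1: "(\<lambda>a b. counit C a \<odot>\<^bsub>C\<^esub> b) \<in> bilinear_maps R C C C"
    by (rule bilinear_maps_precomp[OF C.bilinear_smult counit_C_linear linear_maps_id])
  have b2: "(\<lambda>a b. counit C b \<odot>\<^bsub>C\<^esub> a) \<in> bilinear_maps R C C C"
    using bilinear_mapsD[OF b1] by (intro bilinear_mapsI) auto
  show "tensor_lift C (\<lambda>a b. counit C a \<odot>\<^bsub>C\<^esub> b) (comult C f) = f"
    using lift_C_apply[OF b1 _ G.one_closed _ _ t] linear_mapsD(1)[OF CC.tensor_lift_linear[OF C_module b1] t] f
    by (intro C_ext) (simp_all add: counit_C C_apply comult_C)
  show "tensor_lift C (\<lambda>a b. counit C b \<odot>\<^bsub>C\<^esub> a) (comult C f) = f"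
    using lift_C_apply[OF b2 _ _ G.one_closed _ t] linear_mapsD(1)[OF CC.tensor_lift_linear[OF C_module b2] t] f C_closed
    by (intro C_ext) (simp_all add: counit_C C_apply comult_C R.m_comm)
qed

text \<open>On the group the product of functionals is pointwise, so evaluation at a pair is
  multiplicative. With \<open>ev_eqI\<close>, multiplicativity of the comultiplication becomes an
  identity between values.\<close>

lemma ev_mult:
  assumes x: "x \<in> carrier G" and y: "y \<in> carrier G" and s: "s \<in> carrier TC" and t: "t \<in> carrier TC"
  shows "ev (\<delta> x) (\<delta> y) (s \<otimes>\<^bsub>TC\<^esub> t) = ev (\<delta> x) (\<delta> y) s \<otimes> ev (\<delta> x) (\<delta> y) t"
proof (rule CC.tensor_linear_eq[OF Rm.module_axioms _ _ _ s])
  note e = ev_lin[OF x y]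
  show "(\<lambda>s. ev (\<delta> x) (\<delta> y) (s \<otimes>\<^bsub>TC\<^esub> t)) \<in> linear_maps R TC (regular_module R)"
    by (rule linear_maps_comp[OF CC.tensor_mult_right_linear[OF t] e])
  show "(\<lambda>s. ev (\<delta> x) (\<delta> y) s \<otimes> ev (\<delta> x) (\<delta> y) t) \<in> linear_maps R TC (regular_module R)"
    using bilinear_mapsD(2)[OF mult_R_bilinear[OF e e] t] .
  fix a b assume a: "a \<in> carrier C" and b: "b \<in> carrier C"
  show "ev (\<delta> x) (\<delta> y) (CC.pure a b \<otimes>\<^bsub>TC\<^esub> t) = ev (\<delta> x) (\<delta> y) (CC.pure a b) \<otimes> ev (\<delta> x) (\<delta> y) t"
  proof (rule CC.tensor_linear_eq[OF Rm.module_axioms _ _ _ t])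
    show "(\<lambda>t. ev (\<delta> x) (\<delta> y) (CC.pure a b \<otimes>\<^bsub>TC\<^esub> t)) \<in> linear_maps R TC (regular_module R)"
      by (rule linear_maps_comp[OF CC.tensor_mult_left_linear[OF CC.pure_closed[OF a b]] e])
    show "(\<lambda>t. ev (\<delta> x) (\<delta> y) (CC.pure a b) \<otimes> ev (\<delta> x) (\<delta> y) t) \<in> linear_maps R TC (regular_module R)"
      using bilinear_mapsD(1)[OF mult_R_bilinear[OF e e] CC.pure_closed[OF a b]] .
    fix a' b' assume "a' \<in> carrier C" "b' \<in> carrier C"
    then show "ev (\<delta> x) (\<delta> y) (CC.pure a b \<otimes>\<^bsub>TC\<^esub> CC.pure a' b') =
        ev (\<delta> x) (\<delta> y) (CC.pure a b) \<otimes> ev (\<delta> x) (\<delta> y) (CC.pure a' b')"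
      using a b x y C_closed by (simp add: CC.tensor_mult_pure ev_pure C_mult_closed C_mult_apply R.m_ac)
  qed
qed

lemma C_bialgebra: "bialgebra R C"
proof (intro bialgebra.intro C_algebra C_coalgebra bialgebra_axioms.intro)
  note cl = comult_C C_mult_closed C_one_closed
  show "comult C \<in> ring_hom C TC"
  proof (rule ring_hom_memI)
    fix f g assume f: "f \<in> carrier C" and g: "g \<in> carrier C"
    show "comult C f \<in> carrier TC" by (rule comult_C(1)[OF f])
    show "comult C (f \<otimes>\<^bsub>C\<^esub> g) = comult C f \<otimes>\<^bsub>TC\<^esub> comult C g"
      by (rule ev_eqI) (simp_all add: f g cl CC.tensor_mult_closed ev_mult C_mult_apply)
    show "comult C (f \<oplus>\<^bsub>C\<^esub> g) = comult C f \<oplus>\<^bsub>TC\<^esub> comult C g"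
      by (rule linear_mapsD(2)[OF comult_C_linear f g])
  next
    show "comult C \<one>\<^bsub>C\<^esub> = \<one>\<^bsub>TC\<^esub>"
      unfolding CC.tensor_one
      by (rule ev_eqI) (simp_all add: cl CC.pure_closed ev_pure C_one_apply)
  qed
  show "counit C \<in> ring_hom C R"
    by (rule ring_hom_memI) (simp_all add: counit_C C_closed C_mult_apply C_apply C_one_apply)
qed

section \<open>The antipode\<close>

lemma antipode_C_apply: "x \<in> carrier G \<Longrightarrow> antipode C f (\<delta> x) = f (\<delta> (inv\<^bsub>G\<^esub> x))"
  by (simp add: C_ops \<delta>_closed antipode_\<delta>)

text \<open>Linearity is pointwise; the point is that the antipode preserves the finite dual. Since
  \<open>G\<close> is abelian, translating by \<open>g\<close> after the antipode is the antipode
  after translating by the inverse of \<open>g\<close>, so generators for the translates of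
  \<open>f\<close> are carried to generators for those of its antipode.\<close>

lemma antipode_C_linear: "antipode C \<in> linear_maps R C C"
proof -
  have D: "antipode C f \<in> carrier D" if "f \<in> carrier D" for f
    unfolding C_ops by (rule H.dual_memI[OF linear_maps_comp[OF antipode_linear H.dual_linear[OF that]]])
  have lin: "antipode C \<in> linear_maps R D D"
  proof (rule linear_mapsI[OF D])
    show "antipode C (f \<oplus>\<^bsub>D\<^esub> g) = antipode C f \<oplus>\<^bsub>D\<^esub> antipode C g" if "f \<in> carrier D" "g \<in> carrier D" for f g
      using that by (intro D_ext) (simp_all add: D antipode_C_apply D_apply)
    show "antipode C (r \<odot>\<^bsub>D\<^esub> f) = r \<odot>\<^bsub>D\<^esub> antipode C f" if "r \<in> carrier R" "f \<in> carrier D" for r f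
      using that by (intro D_ext) (simp_all add: D antipode_C_apply D_apply)
  qed
  have F: "antipode C f \<in> Fd" if f: "f \<in> Fd" for f
  proof (rule Fd_act_span[OF f])
    fix B assume B: "finite B" "B \<subseteq> carrier D" "\<And>h. h \<in> carrier H \<Longrightarrow> act h f \<in> lspan R D B"
    have im: "finite (antipode C ` B)" "antipode C ` B \<subseteq> carrier D" using B D by auto
    show ?thesis
    proof (rule Fd_I[OF noeth D[OF Fd_D[OF f]] im])
      fix g assume g: "g \<in> carrier G"
      have ig: "inv\<^bsub>G\<^esub> g \<in> carrier G" using g by simp
      have "act (\<delta> g) (antipode C f) = antipode C (act (\<delta> (inv\<^bsub>G\<^esub> g)) f)"
      proof (rule D_ext)
        show "act (\<delta> g) (antipode C f) \<in> carrier D" by (rule act_closed[OF \<delta>_closed[OF g] D[OF Fd_D[OF f]]])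
        show "antipode C (act (\<delta> (inv\<^bsub>G\<^esub> g)) f) \<in> carrier D" by (rule D[OF act_closed[OF \<delta>_closed[OF ig] Fd_D[OF f]]])
        show "act (\<delta> g) (antipode C f) (\<delta> x) = antipode C (act (\<delta> (inv\<^bsub>G\<^esub> g)) f) (\<delta> x)" if "x \<in> carrier G" for x
          using that g by (simp add: act_\<delta> antipode_C_apply G.inv_mult)
      qed
      also have "\<dots> \<in> antipode C ` lspan R D B" using B(3)[OF \<delta>_closed[OF ig]] by blast
      also have "\<dots> = lspan R D (antipode C ` B)" by (rule D.lspan_linear_image[OF D.module_axioms lin B(2)])
      finally show "act (\<delta> g) (antipode C f) \<in> lspan R D (antipode C ` B)" .
    qed
  qed
  show ?thesis
    using F linear_mapsD(2,3)[OF lin] C_D by (intro linear_mapsI) (simp_all add: C_fields Fd_D)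
qed

text \<open>At a group element \<open>x\<close>, each antipode law says that \<open>f\<close> takes
  at \<open>x\<close> times its inverse the same value as at the identity.\<close>

lemma C_hopf: "hopf_algebra R C"
proof (intro hopf_algebra.intro C_bialgebra hopf_algebra_axioms.intro antipode_C_linear)
  fix f assume f: "f \<in> carrier C"
  note t = comult_C(1)[OF f]
  note ac = linear_mapsD(1)[OF antipode_C_linear]
  have b1: "(\<lambda>a b. antipode C a \<otimes>\<^bsub>C\<^esub> b) \<in> bilinear_maps R C C C"
    by (rule bilinear_maps_precomp[OF C.mult_bilinear antipode_C_linear linear_maps_id])
  have b2: "(\<lambda>a b. a \<otimes>\<^bsub>C\<^esub> antipode C b) \<in> bilinear_maps R C C C"
    by (rule bilinear_maps_precomp[OF C.mult_bilinear linear_maps_id antipode_C_linear])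
  have r: "counit C f \<odot>\<^bsub>C\<^esub> \<one>\<^bsub>C\<^esub> \<in> carrier C"
    using C_closed[OF f G.one_closed] C_one_closed by (simp add: counit_C)
  show "tensor_lift C (\<lambda>a b. antipode C a \<otimes>\<^bsub>C\<^esub> b) (comult C f) = counit C f \<odot>\<^bsub>C\<^esub> \<one>\<^bsub>C\<^esub>"
  proof (rule C_ext[OF _ r])
    show "tensor_lift C (\<lambda>a b. antipode C a \<otimes>\<^bsub>C\<^esub> b) (comult C f) \<in> carrier C"
      by (rule linear_mapsD(1)[OF CC.tensor_lift_linear[OF C_module b1] t])
    fix x assume x: "x \<in> carrier G"
    have "tensor_lift C (\<lambda>a b. antipode C a \<otimes>\<^bsub>C\<^esub> b) (comult C f) (\<delta> x) = ev (\<delta> (inv\<^bsub>G\<^esub> x)) (\<delta> x) (comult C f)"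
      by (rule lift_C_apply[OF b1 x _ x _ t]) (simp_all add: x ac C_mult_apply antipode_C_apply)
    then show "tensor_lift C (\<lambda>a b. antipode C a \<otimes>\<^bsub>C\<^esub> b) (comult C f) (\<delta> x) = (counit C f \<odot>\<^bsub>C\<^esub> \<one>\<^bsub>C\<^esub>) (\<delta> x)"
      using x C_closed[OF f] by (simp add: comult_C[OF f] C_apply C_one_apply counit_C)
  qed
  show "tensor_lift C (\<lambda>a b. a \<otimes>\<^bsub>C\<^esub> antipode C b) (comult C f) = counit C f \<odot>\<^bsub>C\<^esub> \<one>\<^bsub>C\<^esub>"
  proof (rule C_ext[OF _ r])
    show "tensor_lift C (\<lambda>a b. a \<otimes>\<^bsub>C\<^esub> antipode C b) (comult C f) \<in> carrier C"
      by (rule linear_mapsD(1)[OF CC.tensor_lift_linear[OF C_module b2] t])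
    fix x assume x: "x \<in> carrier G"
    have "tensor_lift C (\<lambda>a b. a \<otimes>\<^bsub>C\<^esub> antipode C b) (comult C f) (\<delta> x) = ev (\<delta> x) (\<delta> (inv\<^bsub>G\<^esub> x)) (comult C f)"
      by (rule lift_C_apply[OF b2 x x _ _ t]) (simp_all add: x ac C_mult_apply antipode_C_apply)
    then show "tensor_lift C (\<lambda>a b. a \<otimes>\<^bsub>C\<^esub> antipode C b) (comult C f) (\<delta> x) = (counit C f \<odot>\<^bsub>C\<^esub> \<one>\<^bsub>C\<^esub>) (\<delta> x)"
      using x C_closed[OF f] by (simp add: comult_C[OF f] C_apply C_one_apply counit_C)
  qed
qed

end

lemma laurent_finite_dual_hopf:
  assumes "cring R" and "noetherian_ring R"
  shows "finite_dual_hopf R (free_abelian_rank n)"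
  by (intro finite_dual_hopf.intro finite_dual_hopf_axioms.intro group_ring.intro assms
      comm_group_free_abelian_rank free_abelian_reproducing)

text \<open>The comultiplication of \<open>finite_dual\<close> is a definite description; the second
  conjunct guarantees that it denotes, so that the Hopf algebra of the third conjunct carries the
  canonical comultiplication.\<close>

theorem theorem4p14:
  fixes R :: "('a, 'r) ring_scheme" and A :: "('a, 'b, 'm) module_scheme" and n :: nat
  assumes "cring R" and "noetherian_ring R" and "algebra_with_P_left R A"
  shows "algebra_with_P_left R (laurent_over R A n) \<and>
    (\<forall>f\<in>carrier (finite_dual R (laurent R n)). \<exists>!t. is_dual_comult R (laurent R n) f t) \<and>
    hopf_algebra R (finite_dual R (laurent R n))"
proof -
  interpret finite_dual_hopf R "free_abelian_rank n"
    by (rule laurent_finite_dual_hopf[OF assms(1,2)])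
  show ?thesis
    using laurent_over_P_left[OF assms] dual_comult_ex1 C_hopf by (simp add: laurent_def)
qed

end
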